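(* Let $\ell\ge 2$ and let $d$ be an integer with $d>d_{4\ell}=(8\ell)^{16\ell}$. Let $\mu$ be a finite Borel measure on $[0,1]$ with Fourier transform $\widehat{\mu}(\xi)=\int_0^1 e(-\xi\alpha)\,d\mu(\alpha)$ such that for every $0<s<1$, $$|\widehat{\mu}(0)|^2+\sum_{u\in\mathbb{Z}\setminus\{0\}}|\widehat{\mu}(u)|^2|u|^{s-1}<\infty.$$ Then for $\mu$-almost every $\alpha\in[0,1]$, the sequence $\mathcal{X}_\alpha^d$ has Poissonian $\ell$-point correlation.
   Context: $e(x)=e^{2\pi i x}$. For an integer $d>1$ and real $\alpha$, let $x(n)=\alpha n^d \bmod 1$ and $\mathcal{X}_\alpha^d=\{x(n)\}_{n>0}$; $d_k:=(2k)^{4k}$. Write $[N]=\{1,\dots,N\}$. For $f\in C_c^\infty(\mathbb{R}^{\ell-1})$ define $$R_\ell^N(\mathcal{X}_\alpha^d,f)=\frac1N\sum^{*}_{\mathbf{n}\in[N]^\ell}\sum_{\mathbf{k}\in\mathbb{Z}^{\ell-1}} f\big(N(x(n_1)-x(n_2)+k_1),\dots,N(x(n_{\ell-1})-x(n_\ell)+k_{\ell-1})\big),$$ where $\sum^*$ means the coordinates of $\mathbf{n}$ are pairwise distinct. The sequence has Poissonian $\ell$-point correlation if for every $f\in C_c^\infty(\mathbb{R}^{\ell-1})$ the limit $\lim_{N\to\infty}R_\ell^N(\mathcal{X}_\alpha^d,f)$ exists and equals $\int_{\mathbb{R}^{\ell-1}}f(\mathbf{x})\,d\mathbf{x}$.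 *)

theory Defs
  imports "HOL-Analysis.Analysis" "HOL-Probability.Probability"
begin

definition ee :: "real \<Rightarrow> complex" where
  "ee x = cis (2 * pi * x)"

definition xseq :: "nat \<Rightarrow> real \<Rightarrow> nat \<Rightarrow> real" where
  "xseq d \<alpha> n = frac (\<alpha> * real n ^ d)"

fun Ck :: "nat \<Rightarrow> ('a::euclidean_space \<Rightarrow> real) \<Rightarrow> bool" where
  "Ck 0 f \<longleftrightarrow> continuous_on UNIV f"
| "Ck (Suc k) f \<longleftrightarrow> (\<forall>x. f differentiable (at x)) \<and>
      (\<forall>v. Ck k (\<lambda>x. frechet_derivative f (at x) v))"

definition smooth_fun :: "('a::euclidean_space \<Rightarrow> real) \<Rightarrow> bool" where
  "smooth_fun f \<longleftrightarrow> (\<forall>k. Ck k f)"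

definition Cc_infty :: "('a::euclidean_space \<Rightarrow> real) \<Rightarrow> bool" where
  "Cc_infty f \<longleftrightarrow> smooth_fun f \<and> compact (closure {x. f x \<noteq> 0})"

text \<open>A fixed enumeration of the coordinate type 'n by {0..<CARD('n)};
  coordinate j of R^(l-1) (l = CARD('n)+1) corresponds to index idx j.\<close>
definition idx :: "'n::finite \<Rightarrow> nat" where
  "idx = (SOME g. bij_betw g (UNIV :: 'n set) {..<CARD('n)})"

definition distinct_tuples :: "nat \<Rightarrow> nat \<Rightarrow> (nat \<Rightarrow> nat) set" where
  "distinct_tuples l N = {n. (\<forall>i<l. n i \<in> {1..N}) \<and> (\<forall>i\<ge>l. n i = 0) \<and> inj_on n {..<l}}"

definition corr :: "nat \<Rightarrow> real \<Rightarrow> nat \<Rightarrow> (real^'n::finite \<Rightarrow> real) \<Rightarrow> real" where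
  "corr d \<alpha> N f = (1 / real N) *
     (\<Sum>n\<in>distinct_tuples (CARD('n) + 1) N.
        (\<Sum>\<^sub>\<infinity>k::int^'n.
           f (\<chi> j. real N * (xseq d \<alpha> (n (idx j)) - xseq d \<alpha> (n (idx j + 1)) + of_int (k $ j)))))"

definition poissonian_corr :: "nat \<Rightarrow> real \<Rightarrow> 'n::finite itself \<Rightarrow> bool" where
  "poissonian_corr d \<alpha> _ \<longleftrightarrow>
     (\<forall>f :: real^'n \<Rightarrow> real. Cc_infty f \<longrightarrow>
        (\<lambda>N. corr d \<alpha> N f) \<longlonglongrightarrow> integral UNIV f)"

definition fourier_meas :: "real measure \<Rightarrow> real \<Rightarrow> complex" where
  "fourier_meas M \<xi> = (LINT a:{0..1}|M. ee (- \<xi> * a))"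

end

theory Submission
  imports Defs "HOL-Number_Theory.Cong" "HOL-Computational_Algebra.Squarefree"
begin

text \<open>
  Test functions. Write \<open>F\<^sub>P\<close> for the Fejer kernel normalised by \<open>F\<^sub>P(0) = 1\<close>. Its translates by multiples of
  \<open>1/P\<close> sum to 1, so for \<open>P = M N\<close> and large \<open>M\<close> the function \<open>\<delta> \<mapsto> f(N \<delta>)\<close> is the combination
  of the products \<open>\<Prod>\<^sub>j F\<^sub>P(\<delta>\<^sub>j - a\<^sub>j/P)\<close> with weights \<open>f(a/M)\<close>, up to a small multiple of a fixed
  positive trigonometric polynomial. It is therefore enough to treat countably many trigonometric polynomials of
  degree \<open>O(N)\<close>, and for those only the subsequence \<open>N = i^16\<close>: the remaining \<open>N\<close> follow by
  monotonicity for nonnegative \<open>f\<close>.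

  Variance. Expanding the square and applying Cauchy-Schwarz with the energy hypothesis (\<open>s\<close> close to 1), the second
  moment of the non-constant part is bounded by the number of solutions of
  \<open>h\<^sub>1 n\<^sub>1^d + \<dots> + h\<^sub>4\<^sub>l n\<^sub>4\<^sub>l^d = 0\<close> in four groups, where in each group
  the \<open>h\<close> sum to zero without all vanishing and the \<open>n\<close> are distinct. The trivial solutions number
  \<open>M^(4l-2)\<close> and the bound \<open>M^(4l-3/10)\<close> suffices.

  Counting. This is a determinant-method argument in the spirit of Bombieri and Pila. On a residue class modulo \<open>q\<close>
  avoiding the zeros of a Jacobian all coordinates are, modulo \<open>q^T\<close>, polynomials in \<open>t\<close> free
  coordinates (Hensel), so few residue patterns occur and the pigeonhole principle produces low-degree polynomials
  vanishing on the points. Derivatives of such a polynomial along the variety either lower \<open>t\<close>, or give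
  derivations of low height. Applying these repeatedly to the equation, which is homogeneous of huge degree in each
  \<open>n\<close>, eliminates its terms one at a time until the ratios of the \<open>n\<close> take few values.
\<close>


section \<open>Hensel lifting\<close>

text \<open>The obstacle is height. Each drop in dimension replaces the derivations by 2 by 2
  minors, so their coefficients become powers of the scale with exponents that depend on the level,
  whereas \<open>d\<close> is fixed in advance and must beat the coefficients met in the
  elimination. Hence at every level the derivations are rebuilt by implicit differentiation of
  auxiliary polynomials whose degrees and height exponents depend on \<open>l\<close> alone; at each
  point they agree with the old ones up to a nonzero factor. All sizes are powers of one scale
  \<open>G\<close>, with \<open>M = G ^ k0\<close>. A splitting costs a power of \<open>G\<close>
  with exponent free of \<open>k0\<close>, and there are \<open>8 * l - 4\<close> levels, so a large
  \<open>k0\<close> keeps the total loss below \<open>M powr (17 / 10)\<close>, on top of the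
  \<open>4 * l - 2\<close> parameters that remain at the end. This is the exponent
  \<open>4 * l - 3 / 10\<close>. Cauchy-Schwarz halves the saving to
  \<open>N powr (- 3 / 20)\<close>, the energy factor takes away \<open>N powr (1 / 40)\<close>, and
  what is left, \<open>N powr (- 1 / 8)\<close>, is summable along 16th powers.\<close>

datatype pexp = Con int | Var nat | Add pexp pexp | Mul pexp pexp

primrec ev :: "pexp \<Rightarrow> (nat \<Rightarrow> int) \<Rightarrow> int" where
  "ev (Con c) x = c"
| "ev (Var j) x = x j"
| "ev (Add A B) x = ev A x + ev B x"
| "ev (Mul A B) x = ev A x * ev B x"

primrec dv :: "pexp \<Rightarrow> (nat \<Rightarrow> int) \<Rightarrow> (nat \<Rightarrow> int) \<Rightarrow> int" where
  "dv (Con c) x w = 0"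
| "dv (Var j) x w = w j"
| "dv (Add A B) x w = dv A x w + dv B x w"
| "dv (Mul A B) x w = dv A x w * ev B x + ev A x * dv B x w"

primrec sub :: "(nat \<Rightarrow> pexp) \<Rightarrow> pexp \<Rightarrow> pexp" where
  "sub \<sigma> (Con c) = Con c"
| "sub \<sigma> (Var j) = \<sigma> j"
| "sub \<sigma> (Add A B) = Add (sub \<sigma> A) (sub \<sigma> B)"
| "sub \<sigma> (Mul A B) = Mul (sub \<sigma> A) (sub \<sigma> B)"

text \<open>The derivation with prescribed values on the variables. Its result is again an
  expression, so derivations can be iterated and the results bounded by recursion on the
  syntax.\<close>

primrec der :: "(nat \<Rightarrow> pexp) \<Rightarrow> pexp \<Rightarrow> pexp" where
  "der \<Theta> (Con c) = Con 0"
| "der \<Theta> (Var j) = \<Theta> j"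
| "der \<Theta> (Add A B) = Add (der \<Theta> A) (der \<Theta> B)"
| "der \<Theta> (Mul A B) = Add (Mul (der \<Theta> A) B) (Mul A (der \<Theta> B))"

primrec vars :: "pexp \<Rightarrow> nat set" where
  "vars (Con c) = {}"
| "vars (Var j) = {j}"
| "vars (Add A B) = vars A \<union> vars B"
| "vars (Mul A B) = vars A \<union> vars B"

text \<open>A majorant of the values on the box of side \<open>M\<close>: coefficients are replaced
  by their absolute values and variables by \<open>M\<close>. It is read off the expression, so it
  passes through sums, products and derivations without a normal form for polynomials.\<close>

primrec bd :: "int \<Rightarrow> pexp \<Rightarrow> int" where
  "bd M (Con c) = \<bar>c\<bar>"
| "bd M (Var j) = M"
| "bd M (Add A B) = bd M A + bd M B"
| "bd M (Mul A B) = bd M A * bd M B"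

primrec dg :: "pexp \<Rightarrow> nat" where
  "dg (Con c) = 0"
| "dg (Var j) = 1"
| "dg (Add A B) = max (dg A) (dg B)"
| "dg (Mul A B) = dg A + dg B"

definition unit :: "nat \<Rightarrow> nat \<Rightarrow> int" where
  "unit k = (\<lambda>i. if i = k then 1 else 0)"

text \<open>
  Near every point of \<open>S\<close> where \<open>\<Delta>\<close> is a unit modulo \<open>q\<close>, the coordinates in \<open>V\<close> are local parameters:
  \<open>\<phi>\<close> expresses the coordinate \<open>j\<close> through them to any precision, and the derivation \<open>\<Theta> k\<close> is
  \<open>\<Delta>\<close> times the partial derivative in the parameter \<open>k\<close>.
\<close>

definition hens :: "(nat \<Rightarrow> int) set \<Rightarrow> nat set \<Rightarrow> (nat \<Rightarrow> nat \<Rightarrow> pexp) \<Rightarrow> pexp \<Rightarrow> bool" where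
  "hens S V \<Theta> \<Delta> \<longleftrightarrow> (\<forall>x0\<in>S. \<forall>q>0. coprime (ev \<Delta> x0) q \<longrightarrow> (\<forall>T j. \<exists>\<phi>. vars \<phi> \<subseteq> V \<and>
     (\<forall>x\<in>S. (\<forall>i. [x i = x0 i] (mod q)) \<longrightarrow> [x j = ev \<phi> x] (mod q ^ T)) \<and>
     (\<forall>k\<in>V. [ev \<Delta> x0 * dv \<phi> x0 (unit k) = ev (\<Theta> k j) x0] (mod q))))"

lemma hens_subset: "hens S V \<Theta> \<Delta> \<Longrightarrow> S' \<subseteq> S \<Longrightarrow> hens S' V \<Theta> \<Delta>"
  unfolding hens_def
proof (intro ballI allI impI, goal_cases)
  case (1 x0 q T j)
  then have "x0 \<in> S" by blast
  with 1 obtain \<phi> where "vars \<phi> \<subseteq> V"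
    "\<forall>x\<in>S. (\<forall>i. [x i = x0 i] (mod q)) \<longrightarrow> [x j = ev \<phi> x] (mod q ^ T)"
    "\<forall>k\<in>V. [ev \<Delta> x0 * dv \<phi> x0 (unit k) = ev (\<Theta> k j) x0] (mod q)" by (metis (no_types, lifting))
  then show ?case using 1(2) by (intro exI[of _ \<phi>]) blast
qed

lemma ev_der: "ev (der \<Theta> E) x = dv E x (\<lambda>j. ev (\<Theta> j) x)"
  by (induction E) auto

lemma ev_sub: "ev (sub \<sigma> E) x = ev E (\<lambda>j. ev (\<sigma> j) x)"
  by (induction E) auto

lemma dv_sub: "dv (sub \<sigma> E) x w = dv E (\<lambda>j. ev (\<sigma> j) x) (\<lambda>j. dv (\<sigma> j) x w)"
  by (induction E) (auto simp: ev_sub)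

lemma vars_sub: "vars (sub \<sigma> E) = (\<Union>j\<in>vars E. vars (\<sigma> j))"
  by (induction E) auto

lemma dv_scale: "dv E x (\<lambda>j. c * w j) = c * dv E x w"
  by (induction E) (auto simp: algebra_simps)

lemma dv_add: "dv E x (\<lambda>j. v j + w j) = dv E x v + dv E x w"
  by (induction E) (auto simp: algebra_simps)

lemma ev_vars: "(\<And>j. j \<in> vars E \<Longrightarrow> x j = y j) \<Longrightarrow> ev E x = ev E y"
  by (induction E) auto

lemma ev_cong_mod: "(\<And>j. [x j = y j] (mod m)) \<Longrightarrow> [ev E x = ev E y] (mod m)"
  by (induction E) (auto intro: cong_add cong_mult)

lemma dv_cong_mod: "(\<And>j. [x j = y j] (mod m)) \<Longrightarrow> (\<And>j. [v j = w j] (mod m)) \<Longrightarrow>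
    [dv E x v = dv E y w] (mod m)"
  by (induction E) (auto intro!: cong_add cong_mult ev_cong_mod)

lemma dv_dvd: "(\<And>j. m dvd w j) \<Longrightarrow> m dvd dv E x w"
  by (induction E) auto

text \<open>The terms of second order in \<open>y\<close> are divisible by
  \<open>q ^ (2 * s + 2)\<close>, hence by \<open>q ^ (s + 2)\<close>; only the product case
  produces such terms.\<close>

lemma ev_taylor:
  fixes q :: int
  assumes "\<And>j. q ^ Suc s dvd y j"
  shows "[ev E (\<lambda>j. x j + y j) = ev E x + dv E x y] (mod q ^ Suc (Suc s))"
proof (induction E)
  case (Mul A B)
  have "[ev (Mul A B) (\<lambda>j. x j + y j) = (ev A x + dv A x y) * (ev B x + dv B x y)] (mod q ^ Suc (Suc s))"
    using Mul by (auto intro: cong_mult)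
  moreover have "q ^ Suc (Suc s) dvd dv A x y * dv B x y"
  proof -
    have "q ^ Suc s * q ^ Suc s dvd dv A x y * dv B x y"
      using assms by (intro mult_dvd_mono dv_dvd) auto
    moreover have "q ^ Suc (Suc s) dvd q ^ Suc s * q ^ Suc s"
      by (subst power_add[symmetric]) (rule le_imp_power_dvd, simp)
    ultimately show ?thesis by (rule dvd_trans[rotated])
  qed
  then have "[(ev A x + dv A x y) * (ev B x + dv B x y) = ev (Mul A B) x + dv (Mul A B) x y] (mod q ^ Suc (Suc s))"
    unfolding cong_iff_dvd_diff by (simp add: algebra_simps)
  ultimately show ?case using cong_trans by blast
next
  case (Add A B)
  then show ?case using cong_add[OF Add] by (auto simp: algebra_simps)
qed auto

lemma cong_power_le: "[a = b] (mod q ^ n) \<Longrightarrow> m \<le> n \<Longrightarrow> [a = b] (mod (q::int) ^ m)"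
  by (meson cong_dvd_modulus le_imp_power_dvd)

lemma upd_unit: "(\<lambda>j. dv (if j = i then \<psi> else Var j) x (unit k)) = (\<lambda>j. unit k j + dv \<psi> x (unit k) * unit i j)" if "k \<noteq> i"
  using that by (auto simp: unit_def fun_eq_iff)

lemma ev_upd: "(\<lambda>j. ev (if j = i then \<psi> else Var j) x) = x(i := ev \<psi> x)"
  by (auto simp: fun_eq_iff)

text \<open>The implicit function theorem modulo powers of \<open>q\<close>: where \<open>E\<close>
  vanishes and its derivative in direction \<open>i\<close> is a unit, coordinate \<open>i\<close>
  is a function of the other parameters. The new derivations are the combinations of
  \<open>\<Theta> k\<close> and \<open>\<Theta> i\<close> that annihilate \<open>E\<close>, and the
  quantity that has to be a unit acquires the factor \<open>der (\<Theta> i) E\<close>.\<close>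

lemma hens_step:
  assumes H: "hens S V \<Theta> \<Delta>" and i: "i \<in> V" and E: "\<And>x. x \<in> S \<Longrightarrow> ev E x = 0"
  shows "hens S (V - {i}) (\<lambda>k j. Add (Mul (der (\<Theta> i) E) (\<Theta> k j)) (Mul (Con (-1)) (Mul (der (\<Theta> k) E) (\<Theta> i j))))
     (Mul \<Delta> (der (\<Theta> i) E))"
  unfolding hens_def
proof (intro ballI allI impI)
  fix x0 q T j
  assume x0: "x0 \<in> S" and q: "q > 0" and cop: "coprime (ev (Mul \<Delta> (der (\<Theta> i) E)) x0) q"
  \<comment> \<open>The constant starting value of the iteration below has the wrong derivative, so
    one step is made even for \<open>T = 0\<close>. The iterate with index \<open>Suc T\<close> is
    accurate modulo \<open>q ^ (T + 2)\<close>, provided \<open>\<phi>\<close> is.\<close>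
  define T' where "T' = Suc (Suc T)"
  define cl where "cl x \<longleftrightarrow> x \<in> S \<and> (\<forall>i. [x i = x0 i] (mod q))" for x
  have cl0: "cl x0" using x0 by (simp add: cl_def)
  define D0 where "D0 = ev \<Delta> x0"
  define U where "U k = ev (der (\<Theta> k) E) x0" for k
  have copD: "coprime D0 q" and copU: "coprime (U i) q" using cop by (auto simp: D0_def U_def)
  have "\<forall>j. \<exists>\<phi>. vars \<phi> \<subseteq> V \<and> (\<forall>x. cl x \<longrightarrow> [x j = ev \<phi> x] (mod q ^ T')) \<and>
     (\<forall>k\<in>V. [D0 * dv \<phi> x0 (unit k) = ev (\<Theta> k j) x0] (mod q))"
    using H x0 q copD unfolding hens_def cl_def D0_def by blast
  then obtain \<phi> where vphi: "\<And>j. vars (\<phi> j) \<subseteq> V"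
    and phi: "\<And>j x. cl x \<Longrightarrow> [x j = ev (\<phi> j) x] (mod q ^ T')"
    and dphi: "\<And>j k. k \<in> V \<Longrightarrow> [D0 * dv (\<phi> j) x0 (unit k) = ev (\<Theta> k j) x0] (mod q)"
    by metis
  have phiq: "[ev (\<phi> j) x = x j] (mod q)" if "cl x" for j x
    using cong_power_le[OF phi[OF that, of j], of 1] by (simp add: T'_def cong_sym_eq)
  define e where "e = sub \<phi> E"
  have ve: "vars e \<subseteq> V" using vphi by (auto simp: e_def vars_sub)
  have e0: "[ev e x = 0] (mod q ^ T')" if "cl x" for x
  proof -
    have "[ev E (\<lambda>j. ev (\<phi> j) x) = ev E x] (mod q ^ T')"
      by (rule ev_cong_mod) (use phi[OF that] in \<open>auto simp: cong_sym_eq\<close>)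
    then show ?thesis using E that by (auto simp: e_def ev_sub cl_def)
  qed
  define \<epsilon> where "\<epsilon> k = dv e x0 (unit k)" for k
  have eps: "[D0 * \<epsilon> k = U k] (mod q)" if "k \<in> V" for k
  proof -
    have "[dv E (\<lambda>j. ev (\<phi> j) x0) (\<lambda>j. D0 * dv (\<phi> j) x0 (unit k)) = dv E x0 (\<lambda>j. ev (\<Theta> k j) x0)] (mod q)"
      by (rule dv_cong_mod) (use phiq[OF cl0] dphi[OF that] in auto)
    then show ?thesis by (simp add: dv_scale \<epsilon>_def e_def dv_sub U_def ev_der)
  qed
  have "coprime (D0 * \<epsilon> i) q" using eps[OF i] copU by (metis cong_imp_coprime cong_sym)
  then have "coprime (\<epsilon> i) q" by simp
  then obtain b where b: "[\<epsilon> i * b = 1] (mod q)" using cong_solve_coprime_int by blast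
  \<comment> \<open>Newton iteration with a frozen inverse \<open>b\<close> of the derivative at
    \<open>x0\<close>. Convergence is only linear, one power of \<open>q\<close> per step, but no
    division occurs and the iterates stay expressions in the remaining parameters.\<close>
  define \<psi> where "\<psi> = rec_nat (Con (x0 i)) (\<lambda>s p. Add p (Mul (Con (-b)) (sub (Var(i := p)) e)))"
  have psi0: "\<psi> 0 = Con (x0 i)" and psiS: "\<psi> (Suc s) = Add (\<psi> s) (Mul (Con (-b)) (sub (Var(i := \<psi> s)) e))" for s
    by (simp_all add: \<psi>_def)
  have vpsi: "vars (\<psi> s) \<subseteq> V - {i}" for s
    by (induction s) (use ve in \<open>auto simp: psi0 psiS vars_sub split: if_splits\<close>)
  have psi: "[x i = ev (\<psi> s) x] (mod q ^ Suc s)" if x: "cl x" and "Suc s \<le> T'" for x s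
    using that(2)
  proof (induction s)
    case 0
    then show ?case using x by (auto simp: psi0 cl_def)
  next
    case (Suc s)
    define y where "y = x i - ev (\<psi> s) x"
    define X where "X = x(i := ev (\<psi> s) x)"
    have dy: "q ^ Suc s dvd y" using Suc by (auto simp: y_def cong_iff_dvd_diff)
    have Xx: "x = (\<lambda>j. X j + y * unit i j)" by (auto simp: X_def y_def unit_def fun_eq_iff)
    have "[ev e (\<lambda>j. X j + y * unit i j) = ev e X + dv e X (\<lambda>j. y * unit i j)] (mod q ^ Suc (Suc s))"
      by (rule ev_taylor) (use dy in auto)
    then have t1: "[ev e x = ev e X + y * dv e X (unit i)] (mod q ^ Suc (Suc s))"
      unfolding Xx[symmetric] dv_scale .
    have "q dvd y" using dy by (metis dvd_mult_left power_Suc)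
    then have "[x i = ev (\<psi> s) x] (mod q)" by (simp add: y_def cong_iff_dvd_diff)
    then have "[X j = x0 j] (mod q)" for j
      using x by (auto simp: X_def cl_def) (metis cong_sym cong_trans)
    then have "[dv e X (unit i) = \<epsilon> i] (mod q)" unfolding \<epsilon>_def by (intro dv_cong_mod) auto
    then have "q ^ Suc s * q dvd y * (dv e X (unit i) - \<epsilon> i)"
      using dy by (intro mult_dvd_mono) (auto simp: cong_iff_dvd_diff)
    then have t2: "q ^ Suc (Suc s) dvd y * (dv e X (unit i) - \<epsilon> i)" by (simp add: mult.commute)
    have t3: "q ^ Suc (Suc s) dvd ev e x" using cong_power_le[OF e0[OF x] Suc.prems] by (simp add: cong_0_iff)
    have "q ^ Suc s * q dvd y * (\<epsilon> i * b - 1)"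
      using dy b by (intro mult_dvd_mono) (auto simp: cong_iff_dvd_diff)
    then have t4: "q ^ Suc (Suc s) dvd y * (\<epsilon> i * b - 1)" by (simp add: mult.commute)
    have t1': "q ^ Suc (Suc s) dvd ev e x - (ev e X + y * dv e X (unit i))" using t1 by (simp add: cong_iff_dvd_diff)
    have "x i - ev (\<psi> (Suc s)) x = y + b * ev e X"
      by (simp add: psiS ev_sub ev_upd y_def X_def)
    \<comment> \<open>The new error is split into four quantities divisible by
      \<open>q ^ (s + 2)\<close>: the value of \<open>e\<close> at \<open>x\<close>, the Taylor
      remainder, the variation of the derivative over the class, and the defect of the inverse
      \<open>b\<close>.\<close>
    also have "\<dots> = b * ev e x - b * (ev e x - (ev e X + y * dv e X (unit i)))
        - b * (y * (dv e X (unit i) - \<epsilon> i)) - y * (\<epsilon> i * b - 1)"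
      by (simp add: algebra_simps)
    also have "q ^ Suc (Suc s) dvd \<dots>"
      by (rule dvd_diff[OF dvd_diff[OF dvd_diff[OF dvd_mult[OF t3] dvd_mult[OF t1']] dvd_mult[OF t2]] t4])
    finally show ?case by (simp add: cong_iff_dvd_diff)
  qed
  have X0: "[(x0(i := ev (\<psi> s) x0)) j = x0 j] (mod q)" if "Suc s \<le> T'" for s j
    using cong_power_le[OF psi[OF cl0 that], of 1] by (auto simp: cong_sym_eq)
  \<comment> \<open>One step already yields the derivative of the implicit function modulo
    \<open>q\<close>: the derivative \<open>z\<close> of the previous iterate cancels because
    \<open>\<epsilon> i * b\<close> is 1 modulo \<open>q\<close>.\<close>
  have dpsi: "[dv (\<psi> (Suc s)) x0 (unit k) = - b * \<epsilon> k] (mod q)" if "Suc s \<le> T'" "k \<noteq> i" for s k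
  proof -
    define z where "z = dv (\<psi> s) x0 (unit k)"
    define X where "X = x0(i := ev (\<psi> s) x0)"
    have "[dv e X (unit k) = \<epsilon> k] (mod q)" "[dv e X (unit i) = \<epsilon> i] (mod q)"
      unfolding \<epsilon>_def X_def by (intro dv_cong_mod X0 that cong_refl)+
    then have c: "[z - b * (dv e X (unit k) + z * dv e X (unit i)) = z - b * (\<epsilon> k + z * \<epsilon> i)] (mod q)"
      by (intro cong_diff cong_mult cong_add cong_refl)
    have "dv (\<psi> (Suc s)) x0 (unit k) = z - b * (dv e X (unit k) + z * dv e X (unit i))"
      by (simp add: psiS dv_sub ev_upd upd_unit[OF that(2)] dv_add dv_scale z_def X_def)
    moreover have "z - b * (\<epsilon> k + z * \<epsilon> i) - (- b * \<epsilon> k) = - z * (\<epsilon> i * b - 1)" by (simp add: algebra_simps)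
    then have "[z - b * (\<epsilon> k + z * \<epsilon> i) = - b * \<epsilon> k] (mod q)"
      using b by (simp add: cong_iff_dvd_diff)
    ultimately show ?thesis using c by (metis cong_trans)
  qed
  define p where "p = \<psi> (Suc T)"
  define \<omega> where "\<omega> = sub (Var(i := p)) (\<phi> j)"
  have "vars \<omega> \<subseteq> V - {i}" using vphi[of j] vpsi[of "Suc T"] by (auto simp: \<omega>_def p_def vars_sub split: if_splits)
  moreover have "[x j = ev \<omega> x] (mod q ^ T)" if "cl x" for x
  proof -
    have "[ev (\<phi> j) x = ev (\<phi> j) (x(i := ev p x))] (mod q ^ T)"
      using cong_power_le[OF psi[OF that, of "Suc T"], of T] by (intro ev_cong_mod) (auto simp: p_def T'_def)
    then show ?thesis using cong_power_le[OF phi[OF that, of j], of T]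
      by (auto simp: \<omega>_def ev_sub ev_upd T'_def intro: cong_trans)
  qed
  moreover have "[D0 * U i * dv \<omega> x0 (unit k) = U i * ev (\<Theta> k j) x0 - U k * ev (\<Theta> i j) x0] (mod q)" if k: "k \<in> V - {i}" for k
  proof -
    have ki: "k \<noteq> i" "k \<in> V" using k by auto
    define P where "P k = dv (\<phi> j) x0 (unit k)" for k
    have "dv \<omega> x0 (unit k) = dv (\<phi> j) (x0(i := ev p x0)) (unit k) + dv p x0 (unit k) * dv (\<phi> j) (x0(i := ev p x0)) (unit i)"
      by (simp add: \<omega>_def dv_sub ev_upd upd_unit[OF ki(1)] dv_add dv_scale)
    also have "[\<dots> = P k + (- b * \<epsilon> k) * P i] (mod q)"
      unfolding P_def p_def
      by (intro cong_add cong_mult dv_cong_mod X0 dpsi cong_refl) (auto simp: T'_def ki)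
    finally have 1: "[D0 * U i * dv \<omega> x0 (unit k) = D0 * U i * (P k + (- b * \<epsilon> k) * P i)] (mod q)"
      by (intro cong_mult cong_refl)
    have d1: "q dvd D0 * \<epsilon> i - U i" "q dvd D0 * \<epsilon> k - U k" "q dvd \<epsilon> i * b - 1" "q dvd D0 * P k - ev (\<Theta> k j) x0"
      "q dvd D0 * P i - ev (\<Theta> i j) x0"
      using eps[OF i] eps[OF ki(2)] b dphi[OF ki(2), of j] dphi[OF i, of j] by (auto simp: cong_iff_dvd_diff P_def)
    have "D0 * U i * (P k + (- b * \<epsilon> k) * P i) - (U i * ev (\<Theta> k j) x0 - U k * ev (\<Theta> i j) x0)
      = U i * (D0 * P k - ev (\<Theta> k j) x0) + (D0 * \<epsilon> i - U i) * (D0 * b * \<epsilon> k * P i)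
        - (\<epsilon> i * b - 1) * (D0 * D0 * \<epsilon> k * P i) - (D0 * \<epsilon> k - U k) * (D0 * P i) - U k * (D0 * P i - ev (\<Theta> i j) x0)"
      by (simp add: algebra_simps)
    also have "q dvd \<dots>"
      by (rule dvd_diff[OF dvd_diff[OF dvd_diff[OF dvd_add[OF dvd_mult[OF d1(4)] dvd_mult2[OF d1(1)]]
            dvd_mult2[OF d1(3)]] dvd_mult2[OF d1(2)]] dvd_mult[OF d1(5)]])
    finally have "[D0 * U i * (P k + (- b * \<epsilon> k) * P i) = U i * ev (\<Theta> k j) x0 - U k * ev (\<Theta> i j) x0] (mod q)"
      by (simp add: cong_iff_dvd_diff)
    with 1 show ?thesis by (rule cong_trans)
  qed
  ultimately show "\<exists>\<phi>. vars \<phi> \<subseteq> V - {i} \<and> (\<forall>x\<in>S. (\<forall>i. [x i = x0 i] (mod q)) \<longrightarrow> [x j = ev \<phi> x] (mod q ^ T)) \<and>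
     (\<forall>k\<in>V - {i}. [ev (Mul \<Delta> (der (\<Theta> i) E)) x0 * dv \<phi> x0 (unit k)
        = ev (Add (Mul (der (\<Theta> i) E) (\<Theta> k j)) (Mul (Con (-1)) (Mul (der (\<Theta> k) E) (\<Theta> i j)))) x0] (mod q))"
    by (intro exI[of _ \<omega>]) (auto simp: cl_def D0_def U_def)
qed

text \<open>On the parameters themselves the derivations are exactly \<open>\<Delta>\<close> times
  the coordinate ones, as integers at every point of \<open>S\<close> and not merely modulo
  \<open>q\<close>. Therefore deriving a polynomial in the parameters gives \<open>\<Delta>\<close>
  times its partial derivative.\<close>

definition tang :: "(nat \<Rightarrow> int) set \<Rightarrow> nat set \<Rightarrow> (nat \<Rightarrow> nat \<Rightarrow> pexp) \<Rightarrow> pexp \<Rightarrow> bool" where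
  "tang S V \<Theta> \<Delta> \<longleftrightarrow> (\<forall>x\<in>S. \<forall>k\<in>V. \<forall>k'\<in>V. ev (\<Theta> k k') x = (if k = k' then ev \<Delta> x else 0))"

lemma tang_step:
  "tang S V \<Theta> \<Delta> \<Longrightarrow> i \<in> V \<Longrightarrow> tang S (V - {i}) (\<lambda>k j. Add (Mul (der (\<Theta> i) E) (\<Theta> k j))
     (Mul (Con (-1)) (Mul (der (\<Theta> k) E) (\<Theta> i j)))) (Mul \<Delta> (der (\<Theta> i) E))"
  by (auto simp: tang_def)

section \<open>Counting residue patterns\<close>

primrec psum :: "('a \<Rightarrow> pexp) \<Rightarrow> 'a list \<Rightarrow> pexp" where
  "psum f [] = Con 0"
| "psum f (a # as) = Add (f a) (psum f as)"

primrec pprod :: "('a \<Rightarrow> pexp) \<Rightarrow> 'a list \<Rightarrow> pexp" where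
  "pprod f [] = Con 1"
| "pprod f (a # as) = Mul (f a) (pprod f as)"

lemma ev_psum: "ev (psum f as) x = (\<Sum>a\<leftarrow>as. ev (f a) x)"
  by (induction as) auto

lemma dv_psum: "dv (psum f as) x w = (\<Sum>a\<leftarrow>as. dv (f a) x w)"
  by (induction as) auto

lemma ev_pprod: "ev (pprod f as) x = (\<Prod>a\<leftarrow>as. ev (f a) x)"
  by (induction as) auto

lemma vars_psum: "vars (psum f as) = (\<Union>a\<in>set as. vars (f a))"
  by (induction as) auto

text \<open>
  Since \<open>q\<close> divides \<open>x v - x0 v\<close> on the class of \<open>x0\<close>, the coefficient of a term of total order \<open>k\<close> matters
  only modulo \<open>q^(T-k)\<close>; hence the exponent \<open>T - k\<close>.
\<close>

fun Rp :: "int \<Rightarrow> (nat \<Rightarrow> int) \<Rightarrow> nat list \<Rightarrow> nat \<Rightarrow> ((nat \<Rightarrow> int) \<Rightarrow> int) set" where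
  "Rp q x0 [] T = (\<lambda>c _. c) ` {0..<q ^ T}"
| "Rp q x0 (v # vs) T = (\<lambda>g x. \<Sum>k<T. (x v - x0 v) ^ k * g k x) ` (PiE {..<T} (\<lambda>k. Rp q x0 vs (T - k)))"

lemma Rp_finite: "finite (Rp q x0 vs T)"
  by (induction vs arbitrary: T) (auto intro!: finite_PiE)

lemma choose_sum: "(\<Sum>k<T. (T - k + t) choose Suc t) = (T + Suc t) choose Suc (Suc t)"
proof -
  have "(\<Sum>k<T. (T - k + t) choose Suc t) = (\<Sum>k<T. (Suc k + t) choose Suc t)"
    by (rule sum.reindex_bij_witness[of _ "\<lambda>k. T - Suc k" "\<lambda>k. T - Suc k"])
      (auto simp del: binomial_Suc_Suc simp: Suc_diff_Suc)
  also have "\<dots> = (T + Suc t) choose Suc (Suc t)"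
    by (induction T) (auto simp: add_ac)
  finally show ?thesis .
qed

text \<open>A monomial of order \<open>k\<close> contributes \<open>T - k\<close> digits in base
  \<open>q\<close>. Summing over the monomials of order below \<open>T\<close> in \<open>t\<close>
  variables gives \<open>(T + t) choose Suc t\<close>.\<close>

lemma Rp_card: "q > 0 \<Longrightarrow> card (Rp q x0 vs T) \<le> nat q ^ ((T + length vs) choose Suc (length vs))"
proof (induction vs arbitrary: T)
  case Nil
  have "card (Rp q x0 [] T) \<le> card {0..<q ^ T}" unfolding Rp.simps by (rule card_image_le) simp
  then show ?case using Nil by (simp del: Rp.simps add: nat_power_eq)
next
  case (Cons v vs)
  have "card (Rp q x0 (v # vs) T) \<le> card (PiE {..<T} (\<lambda>k. Rp q x0 vs (T - k)))"
    by (auto intro!: card_image_le finite_PiE Rp_finite)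
  also have "\<dots> = (\<Prod>k<T. card (Rp q x0 vs (T - k)))" by (simp add: card_PiE)
  also have "\<dots> \<le> (\<Prod>k<T. nat q ^ ((T - k + length vs) choose Suc (length vs)))"
    by (intro prod_mono conjI Cons.IH Cons.prems) auto
  also have "\<dots> = nat q ^ (\<Sum>k<T. (T - k + length vs) choose Suc (length vs))" by (simp add: power_sum)
  also have "\<dots> = nat q ^ ((T + length (v # vs)) choose Suc (length (v # vs)))" by (simp only: choose_sum length_Cons)
  finally show ?case .
qed

lemma pexp_expand:
  assumes "vars \<phi> \<subseteq> insert v W"
  shows "\<exists>m \<omega>. (\<forall>k. vars (\<omega> k) \<subseteq> W) \<and> (\<forall>k>m. \<omega> k = Con 0) \<and>
     (\<forall>x. ev \<phi> x = (\<Sum>k\<le>(m::nat). ev (\<omega> k) x * (x v - c) ^ k))"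
  using assms
proof (induction \<phi>)
  case (Con b)
  show ?case by (rule exI[of _ 0], rule exI[of _ "\<lambda>k. if k = 0 then Con b else Con 0"]) auto
next
  case (Var j)
  show ?case
  proof (cases "j = v")
    case True
    then show ?thesis
      by (intro exI[of _ 1] exI[of _ "\<lambda>k. if k = 0 then Con c else if k = 1 then Con 1 else Con 0"]) auto
  next
    case False
    then show ?thesis using Var
      by (intro exI[of _ 0] exI[of _ "\<lambda>k. if k = 0 then Var j else Con 0"]) auto
  qed
next
  case (Add A B)
  obtain m1 \<omega>1 where 1: "\<forall>k. vars (\<omega>1 k) \<subseteq> W" "\<forall>k>m1. \<omega>1 k = Con 0"
     "\<forall>x. ev A x = (\<Sum>k\<le>m1. ev (\<omega>1 k) x * (x v - c) ^ k)" using Add.IH(1) Add.prems by auto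
  obtain m2 \<omega>2 where 2: "\<forall>k. vars (\<omega>2 k) \<subseteq> W" "\<forall>k>m2. \<omega>2 k = Con 0"
     "\<forall>x. ev B x = (\<Sum>k\<le>m2. ev (\<omega>2 k) x * (x v - c) ^ k)" using Add.IH(2) Add.prems by auto
  define m where "m = max m1 m2"
  have "ev A x = (\<Sum>k\<le>m. ev (\<omega>1 k) x * (x v - c) ^ k)" for x
    unfolding 1(3)[rule_format] by (rule sum.mono_neutral_left) (use 1(2) in \<open>auto simp: m_def\<close>)
  moreover have "ev B x = (\<Sum>k\<le>m. ev (\<omega>2 k) x * (x v - c) ^ k)" for x
    unfolding 2(3)[rule_format] by (rule sum.mono_neutral_left) (use 2(2) in \<open>auto simp: m_def\<close>)
  ultimately show ?case
    by (intro exI[of _ m] exI[of _ "\<lambda>k. if k \<le> m then Add (\<omega>1 k) (\<omega>2 k) else Con 0"])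
       (use 1(1) 2(1) in \<open>auto simp: sum.distrib[symmetric] distrib_right\<close>)
next
  case (Mul A B)
  obtain m1 \<omega>1 where 1: "\<forall>k. vars (\<omega>1 k) \<subseteq> W" "\<forall>k>m1. \<omega>1 k = Con 0"
     "\<forall>x. ev A x = (\<Sum>k\<le>m1. ev (\<omega>1 k) x * (x v - c) ^ k)" using Mul.IH(1) Mul.prems by auto
  obtain m2 \<omega>2 where 2: "\<forall>k. vars (\<omega>2 k) \<subseteq> W" "\<forall>k>m2. \<omega>2 k = Con 0"
     "\<forall>x. ev B x = (\<Sum>k\<le>m2. ev (\<omega>2 k) x * (x v - c) ^ k)" using Mul.IH(2) Mul.prems by auto
  define \<omega> where "\<omega> r = (if r \<le> m1 + m2 then psum (\<lambda>k. Mul (\<omega>1 k) (\<omega>2 (r - k))) [0..<Suc r] else Con 0)" for r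
  have "ev (Mul A B) x = (\<Sum>r\<le>m1+m2. ev (\<omega> r) x * (x v - c) ^ r)" for x
  proof -
    have "(\<Sum>k\<le>m1. ev (\<omega>1 k) x * (x v - c) ^ k) * (\<Sum>k\<le>m2. ev (\<omega>2 k) x * (x v - c) ^ k)
      = (\<Sum>r\<le>m1+m2. (\<Sum>k\<le>r. ev (\<omega>1 k) x * ev (\<omega>2 (r - k)) x) * (x v - c) ^ r)"
      by (rule polynomial_product) (use 1(2) 2(2) in auto)
    also have "\<dots> = (\<Sum>r\<le>m1+m2. ev (\<omega> r) x * (x v - c) ^ r)"
      by (intro sum.cong refl) (auto simp: \<omega>_def ev_psum sum_list_sum_nth interv_sum_list_conv_sum_set_nat
          atLeast0LessThan lessThan_Suc_atMost simp del: upt_Suc)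
    finally show ?thesis using 1(3) 2(3) by simp
  qed
  moreover have "vars (\<omega> k) \<subseteq> W" for k
    using 1(1) 2(1) unfolding \<omega>_def by (auto simp: vars_psum simp del: upt_Suc)
  ultimately show ?case by (intro exI[of _ "m1 + m2"] exI[of _ \<omega>]) (auto simp: \<omega>_def)
qed

lemma Rp_represents:
  assumes "vars \<phi> \<subseteq> set vs" "q > 0"
  shows "\<exists>r\<in>Rp q x0 vs T. \<forall>x. (\<forall>i. [x i = x0 i] (mod q)) \<longrightarrow> [ev \<phi> x = r x] (mod q ^ T)"
  using assms
proof (induction vs arbitrary: T \<phi>)
  case Nil
  have "ev \<phi> x mod q ^ T = ev \<phi> x0 mod q ^ T" for x
    by (rule arg_cong[of _ _ "\<lambda>y. y mod q ^ T"], rule ev_vars) (use Nil in auto)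
  moreover have "(\<lambda>_. ev \<phi> x0 mod q ^ T) \<in> Rp q x0 [] T" using Nil by auto
  ultimately have "[ev \<phi> x = (\<lambda>_. ev \<phi> x0 mod q ^ T) x] (mod q ^ T)" for x by (simp add: cong_def)
  then show ?case using \<open>(\<lambda>_. ev \<phi> x0 mod q ^ T) \<in> Rp q x0 [] T\<close>
    by (intro bexI[of _ "\<lambda>_. ev \<phi> x0 mod q ^ T"] allI impI)
next
  case (Cons v vs)
  then obtain m \<omega> where \<omega>: "\<forall>k. vars (\<omega> k) \<subseteq> set vs" "\<forall>k>m. \<omega> k = Con 0"
     "\<forall>x. ev \<phi> x = (\<Sum>k\<le>m. ev (\<omega> k) x * (x v - x0 v) ^ k)"
    using pexp_expand[of \<phi> v "set vs" "x0 v"] by auto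
  have "\<forall>k. \<exists>r. r \<in> Rp q x0 vs (T - k) \<and> (\<forall>x. (\<forall>i. [x i = x0 i] (mod q)) \<longrightarrow> [ev (\<omega> k) x = r x] (mod q ^ (T - k)))"
    using Cons.IH[of "\<omega> _"] \<omega>(1) Cons.prems by blast
  then obtain r where r: "\<And>k. r k \<in> Rp q x0 vs (T - k)"
    "\<And>k x. (\<forall>i. [x i = x0 i] (mod q)) \<Longrightarrow> [ev (\<omega> k) x = r k x] (mod q ^ (T - k))" by metis
  define R where "R x = (\<Sum>k<T. (x v - x0 v) ^ k * r k x)" for x
  have "R \<in> Rp q x0 (v # vs) T"
    unfolding Rp.simps
    by (rule image_eqI[of _ _ "restrict r {..<T}"]) (use r(1) in \<open>auto simp: R_def fun_eq_iff\<close>)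
  moreover have "[ev \<phi> x = R x] (mod q ^ T)" if x: "\<forall>i. [x i = x0 i] (mod q)" for x
  proof -
    have dk: "q ^ k dvd (x v - x0 v) ^ k" for k
      using x by (intro dvd_power_same) (auto simp: cong_iff_dvd_diff)
    have "ev \<phi> x = (\<Sum>k\<le>m + T. ev (\<omega> k) x * (x v - x0 v) ^ k)"
      unfolding \<omega>(3)[rule_format] by (rule sum.mono_neutral_left) (use \<omega>(2) in auto)
    also have "\<dots> = (\<Sum>k<T. ev (\<omega> k) x * (x v - x0 v) ^ k) + (\<Sum>k=T..m+T. ev (\<omega> k) x * (x v - x0 v) ^ k)"
      by (subst sum.union_disjoint[symmetric]) (auto intro!: sum.cong)
    also have "[\<dots> = R x + 0] (mod q ^ T)"
    proof (rule cong_add)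
      show "[(\<Sum>k = T..m + T. ev (\<omega> k) x * (x v - x0 v) ^ k) = 0] (mod q ^ T)"
        unfolding cong_0_iff by (intro dvd_sum dvd_mult) (meson dk dvd_trans le_imp_power_dvd atLeastAtMost_iff)
      show "[(\<Sum>k<T. ev (\<omega> k) x * (x v - x0 v) ^ k) = R x] (mod q ^ T)"
        unfolding R_def
      proof (intro cong_sum)
        fix k assume k: "k \<in> {..<T}"
        have "q ^ (T - k) * q ^ k dvd (ev (\<omega> k) x - r k x) * (x v - x0 v) ^ k"
          using r(2)[OF x, of k] dk by (intro mult_dvd_mono) (auto simp: cong_iff_dvd_diff)
        then show "[ev (\<omega> k) x * (x v - x0 v) ^ k = (x v - x0 v) ^ k * r k x] (mod q ^ T)"
          using k by (simp add: power_add[symmetric] cong_iff_dvd_diff algebra_simps)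
      qed
    qed
    finally show ?thesis by simp
  qed
  ultimately show ?case by blast
qed

text \<open>There are more coefficient vectors than residue patterns, so two combinations agree
  modulo \<open>q ^ T\<close> on all of \<open>S\<close>. Their difference is smaller than
  \<open>q ^ T\<close> in absolute value and is therefore 0. One vector serves the whole class,
  however many points it has, because the patterns are functions on the class.\<close>

lemma siegel:
  fixes q B M :: int and f :: "'a \<Rightarrow> (nat \<Rightarrow> int) \<Rightarrow> int"
  assumes fin: "finite \<Gamma>" "finite V" and q: "q > 0" and B: "B \<ge> 1"
    and cls: "\<And>x i. x \<in> S \<Longrightarrow> [x i = x0 i] (mod q)"
    and rep: "\<And>\<gamma>. \<gamma> \<in> \<Gamma> \<Longrightarrow> \<exists>\<phi>. vars \<phi> \<subseteq> V \<and> (\<forall>x\<in>S. [f \<gamma> x = ev \<phi> x] (mod q ^ T))"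
    and size: "\<And>x \<gamma>. x \<in> S \<Longrightarrow> \<gamma> \<in> \<Gamma> \<Longrightarrow> \<bar>f \<gamma> x\<bar> \<le> M"
    and many: "q ^ ((T + card V) choose Suc (card V)) < B ^ card \<Gamma>"
    and small: "int (card \<Gamma>) * (B * M) < q ^ T"
  shows "\<exists>c. (\<exists>\<gamma>\<in>\<Gamma>. c \<gamma> \<noteq> 0) \<and> (\<forall>\<gamma>. \<bar>c \<gamma>\<bar> \<le> B) \<and> (\<forall>\<gamma>. \<gamma> \<notin> \<Gamma> \<longrightarrow> c \<gamma> = 0) \<and>
     (\<forall>x\<in>S. (\<Sum>\<gamma>\<in>\<Gamma>. c \<gamma> * f \<gamma> x) = 0)"
proof -
  obtain vs where vs: "set vs = V" "distinct vs" using fin finite_distinct_list by blast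
  obtain gs where gs: "set gs = \<Gamma>" "distinct gs" using fin finite_distinct_list by blast
  obtain \<phi> where \<phi>: "\<And>\<gamma>. \<gamma> \<in> \<Gamma> \<Longrightarrow> vars (\<phi> \<gamma>) \<subseteq> V" "\<And>\<gamma> x. \<gamma> \<in> \<Gamma> \<Longrightarrow> x \<in> S \<Longrightarrow> [f \<gamma> x = ev (\<phi> \<gamma>) x] (mod q ^ T)"
    using rep by metis
  define X where "X = PiE \<Gamma> (\<lambda>_. {0..<B})"
  have "\<exists>r\<in>Rp q x0 vs T. \<forall>x\<in>S. [(\<Sum>\<gamma>\<in>\<Gamma>. c \<gamma> * f \<gamma> x) = r x] (mod q ^ T)" for c
  proof -
    define P where "P = psum (\<lambda>\<gamma>. Mul (Con (c \<gamma>)) (\<phi> \<gamma>)) gs"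
    have "vars P \<subseteq> set vs" using \<phi>(1) gs vs by (auto simp: P_def vars_psum)
    then obtain r where r: "r \<in> Rp q x0 vs T" "\<And>x. (\<forall>i. [x i = x0 i] (mod q)) \<Longrightarrow> [ev P x = r x] (mod q ^ T)"
      using Rp_represents[OF _ q] by metis
    have "[(\<Sum>\<gamma>\<in>\<Gamma>. c \<gamma> * f \<gamma> x) = r x] (mod q ^ T)" if x: "x \<in> S" for x
    proof -
      have "[(\<Sum>\<gamma>\<in>\<Gamma>. c \<gamma> * f \<gamma> x) = (\<Sum>\<gamma>\<in>\<Gamma>. c \<gamma> * ev (\<phi> \<gamma>) x)] (mod q ^ T)"
        by (intro cong_sum cong_mult cong_refl \<phi>(2) x)
      also have "(\<Sum>\<gamma>\<in>\<Gamma>. c \<gamma> * ev (\<phi> \<gamma>) x) = ev P x"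
        using gs by (simp add: P_def ev_psum sum_list_distinct_conv_sum_set)
      also have "[\<dots> = r x] (mod q ^ T)" using r(2) cls[OF x] by blast
      finally show ?thesis .
    qed
    with r(1) show ?thesis by blast
  qed
  then obtain r where r: "\<And>c. r c \<in> Rp q x0 vs T" "\<And>c x. x \<in> S \<Longrightarrow> [(\<Sum>\<gamma>\<in>\<Gamma>. c \<gamma> * f \<gamma> x) = r c x] (mod q ^ T)"
    by metis
  have "card (Rp q x0 vs T) \<le> nat q ^ ((T + card V) choose Suc (card V))"
    using Rp_card[OF q, of x0 vs T] vs distinct_card[of vs] by simp
  also have "\<dots> < nat B ^ card \<Gamma>"
    using many q B by (simp flip: nat_power_eq add: nat_mono_iff nat_less_eq_zless)
  also have "\<dots> = card X" using B fin by (simp add: X_def card_PiE)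
  finally have "\<not> inj_on r X" using r(1) card_inj_on_le[of r X "Rp q x0 vs T"] Rp_finite by force
  then obtain c1 c2 where c: "c1 \<in> X" "c2 \<in> X" "c1 \<noteq> c2" "r c1 = r c2" unfolding inj_on_def by blast
  define c where "c \<gamma> = (if \<gamma> \<in> \<Gamma> then c1 \<gamma> - c2 \<gamma> else 0)" for \<gamma>
  have cB: "\<bar>c \<gamma>\<bar> \<le> B" for \<gamma>
    using c(1,2) B by (auto simp: c_def X_def dest!: PiE_mem[of _ _ _ \<gamma>])
  have nz: "\<exists>\<gamma>\<in>\<Gamma>. c \<gamma> \<noteq> 0"
    using c(1-3) by (auto simp: c_def X_def fun_eq_iff PiE_iff extensional_def) metis
  have "(\<Sum>\<gamma>\<in>\<Gamma>. c \<gamma> * f \<gamma> x) = 0" if x: "x \<in> S" for x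
  proof -
    have "(\<Sum>\<gamma>\<in>\<Gamma>. c \<gamma> * f \<gamma> x) = (\<Sum>\<gamma>\<in>\<Gamma>. c1 \<gamma> * f \<gamma> x) - (\<Sum>\<gamma>\<in>\<Gamma>. c2 \<gamma> * f \<gamma> x)"
      by (simp add: sum_subtractf[symmetric] c_def algebra_simps)
    then have "[(\<Sum>\<gamma>\<in>\<Gamma>. c \<gamma> * f \<gamma> x) = 0] (mod q ^ T)"
      using cong_diff[OF r(2)[OF x, of c1] r(2)[OF x, of c2]] c(4) by simp
    moreover have "\<bar>\<Sum>\<gamma>\<in>\<Gamma>. c \<gamma> * f \<gamma> x\<bar> \<le> (\<Sum>\<gamma>\<in>\<Gamma>. B * M)"
      by (rule order_trans[OF sum_abs sum_mono], unfold abs_mult, rule mult_mono) (use cB B size[OF x] in auto)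
    then have "\<bar>\<Sum>\<gamma>\<in>\<Gamma>. c \<gamma> * f \<gamma> x\<bar> < q ^ T" using small by simp
    ultimately show ?thesis by (simp add: cong_0_iff) (metis abs_dvd_iff dvd_abs_iff zdvd_not_zless zero_less_abs_iff abs_of_nonneg)
  qed
  then show ?thesis using nz cB by (intro exI[of _ c]) (auto simp: c_def)
qed

section \<open>Polynomials of bounded degree\<close>

primrec ppow :: "pexp \<Rightarrow> nat \<Rightarrow> pexp" where
  "ppow A 0 = Con 1"
| "ppow A (Suc n) = Mul A (ppow A n)"

lemma ev_ppow [simp]: "ev (ppow A n) x = ev A x ^ n"
  by (induction n) auto

lemma dv_ppow: "dv (ppow A n) x w = int n * ev A x ^ (n - 1) * dv A x w"
proof (induction n)
  case (Suc n)
  then show ?case by (cases n) (auto simp: algebra_simps)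
qed auto

lemma bd_ppow: "bd M (ppow A n) = bd M A ^ n"
  by (induction n) auto

lemma dg_ppow: "dg (ppow A n) = n * dg A"
  by (induction n) auto

lemma bd_psum: "bd M (psum f as) = (\<Sum>a\<leftarrow>as. bd M (f a))"
  by (induction as) auto

lemma bd_pprod: "bd M (pprod f as) = (\<Prod>a\<leftarrow>as. bd M (f a))"
  by (induction as) auto

lemma dg_psum: "(\<And>a. a \<in> set as \<Longrightarrow> dg (f a) \<le> n) \<Longrightarrow> dg (psum f as) \<le> n"
  by (induction as) auto

lemma dg_pprod: "dg (pprod f as) = (\<Sum>a\<leftarrow>as. dg (f a))"
  by (induction as) auto

lemma dv_pprod: "distinct as \<Longrightarrow> dv (pprod f as) x w = (\<Sum>a\<in>set as. dv (f a) x w * (\<Prod>b\<in>set as - {a}. ev (f b) x))"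
proof (induction as)
  case (Cons a as)
  have "(\<Sum>c\<in>set as. dv (f c) x w * (\<Prod>b\<in>set (a # as) - {c}. ev (f b) x))
      = (\<Sum>c\<in>set as. ev (f a) x * (dv (f c) x w * (\<Prod>b\<in>set as - {c}. ev (f b) x)))"
  proof (intro sum.cong refl)
    fix c assume "c \<in> set as"
    then have "set (a # as) - {c} = insert a (set as - {c})" "a \<notin> set as - {c}" using Cons by auto
    then show "dv (f c) x w * (\<Prod>b\<in>set (a # as) - {c}. ev (f b) x)
      = ev (f a) x * (dv (f c) x w * (\<Prod>b\<in>set as - {c}. ev (f b) x))" by simp
  qed
  moreover have "set (a # as) - {a} = set as" using Cons by auto
  ultimately show ?case using Cons
    by (simp add: ev_pprod sum_distrib_left prod.distinct_set_conv_list)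
qed auto

definition lst :: "'a set \<Rightarrow> 'a list" where
  "lst A = (SOME xs. set xs = A \<and> distinct xs)"

lemma lst: "finite A \<Longrightarrow> set (lst A) = A \<and> distinct (lst A)"
  unfolding lst_def by (rule someI_ex) (rule finite_distinct_list)

definition Gam :: "nat set \<Rightarrow> nat \<Rightarrow> (nat \<Rightarrow> nat) set" where
  "Gam W D = {\<gamma>. (\<forall>i. i \<notin> W \<longrightarrow> \<gamma> i = 0) \<and> sum \<gamma> W \<le> D}"

definition mval :: "nat set \<Rightarrow> (nat \<Rightarrow> int) \<Rightarrow> (nat \<Rightarrow> nat) \<Rightarrow> int" where
  "mval W x \<gamma> = (\<Prod>i\<in>W. x i ^ \<gamma> i)"

definition pv :: "nat set \<Rightarrow> nat \<Rightarrow> ((nat \<Rightarrow> nat) \<Rightarrow> int) \<Rightarrow> (nat \<Rightarrow> int) \<Rightarrow> int" where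
  "pv W D c x = (\<Sum>\<gamma>\<in>Gam W D. c \<gamma> * mval W x \<gamma>)"

text \<open>The coefficients of the formal partial derivative in variable \<open>i\<close>.
  Polynomials are kept as coefficient functions because the descents below run on nonvanishing of
  coefficients, not of values.\<close>

definition pdc :: "nat \<Rightarrow> ((nat \<Rightarrow> nat) \<Rightarrow> int) \<Rightarrow> (nat \<Rightarrow> nat) \<Rightarrow> int" where
  "pdc i c = (\<lambda>\<gamma>. int (Suc (\<gamma> i)) * c (\<gamma>(i := Suc (\<gamma> i))))"

definition pexp_mono :: "nat set \<Rightarrow> (nat \<Rightarrow> nat) \<Rightarrow> pexp" where
  "pexp_mono W \<gamma> = pprod (\<lambda>i. ppow (Var i) (\<gamma> i)) (lst W)"

definition PE :: "nat set \<Rightarrow> nat \<Rightarrow> ((nat \<Rightarrow> nat) \<Rightarrow> int) \<Rightarrow> pexp" where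
  "PE W D c = psum (\<lambda>\<gamma>. Mul (Con (c \<gamma>)) (pexp_mono W \<gamma>)) (lst (Gam W D))"

definition sup_in :: "nat set \<Rightarrow> nat \<Rightarrow> ((nat \<Rightarrow> nat) \<Rightarrow> int) \<Rightarrow> bool" where
  "sup_in W D c \<longleftrightarrow> (\<forall>\<gamma>. \<gamma> \<notin> Gam W D \<longrightarrow> c \<gamma> = 0)"

lemma Gam_empty: "Gam {} D = {\<lambda>_. 0}" by (auto simp: Gam_def)

lemma Gam_insert:
  assumes "finite W" "w \<notin> W"
  shows "Gam (insert w W) D = (\<Union>k\<le>D. (\<lambda>\<gamma>. \<gamma>(w := k)) ` Gam W (D - k))"
proof (intro equalityI subsetI)
  fix \<gamma> assume g: "\<gamma> \<in> Gam (insert w W) D"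
  define \<gamma>' where "\<gamma>' = \<gamma>(w := 0)"
  have "sum \<gamma>' W = sum \<gamma> W" using assms by (auto simp: \<gamma>'_def intro!: sum.cong)
  then have "\<gamma>' \<in> Gam W (D - \<gamma> w)" "\<gamma> w \<le> D" using g assms by (auto simp: Gam_def \<gamma>'_def)
  moreover have "\<gamma> = \<gamma>'(w := \<gamma> w)" by (auto simp: \<gamma>'_def)
  ultimately show "\<gamma> \<in> (\<Union>k\<le>D. (\<lambda>\<gamma>. \<gamma>(w := k)) ` Gam W (D - k))" by blast
next
  fix \<gamma> assume "\<gamma> \<in> (\<Union>k\<le>D. (\<lambda>\<gamma>. \<gamma>(w := k)) ` Gam W (D - k))"
  then obtain k \<gamma>' where k: "k \<le> D" "\<gamma>' \<in> Gam W (D - k)" "\<gamma> = \<gamma>'(w := k)" by blast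
  have "sum \<gamma> W = sum \<gamma>' W" unfolding k(3) using assms by (auto intro!: sum.cong)
  then show "\<gamma> \<in> Gam (insert w W) D" using k assms by (auto simp: Gam_def)
qed

lemma Gam_finite: "finite W \<Longrightarrow> finite (Gam W D)"
  by (induction W arbitrary: D rule: finite_induct) (auto simp: Gam_empty Gam_insert)

lemma Gam_card: "finite W \<Longrightarrow> card (Gam W D) = (D + card W) choose card W"
proof (induction W arbitrary: D rule: finite_induct)
  case (insert w W)
  have "card (Gam (insert w W) D) = (\<Sum>k\<le>D. card ((\<lambda>\<gamma>. \<gamma>(w := k)) ` Gam W (D - k)))"
    unfolding Gam_insert[OF insert(1,2)]
    by (rule card_UN_disjoint) (auto simp: Gam_finite insert(1) fun_eq_iff, metis fun_upd_same)
  also have "\<dots> = (\<Sum>k\<le>D. card (Gam W (D - k)))"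
  proof (intro sum.cong refl card_image inj_onI)
    fix k \<gamma> \<gamma>' assume "\<gamma> \<in> Gam W (D - k)" "\<gamma>' \<in> Gam W (D - k)" and e: "\<gamma>(w := k) = \<gamma>'(w := k)"
    then have "\<gamma> w = \<gamma>' w" using insert(2) by (auto simp: Gam_def)
    with e show "\<gamma> = \<gamma>'" by (metis fun_upd_triv fun_upd_upd)
  qed
  also have "\<dots> = (\<Sum>k\<le>D. (D - k + card W) choose card W)" using insert by simp
  also have "\<dots> = (\<Sum>k\<le>D. (k + card W) choose card W)"
    by (rule sum.reindex_bij_witness[of _ "\<lambda>k. D - k" "\<lambda>k. D - k"]) auto
  also have "\<dots> = (D + Suc (card W)) choose Suc (card W)"
    by (induction D) (auto simp: add_ac)
  finally show ?case using insert by simp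
qed (auto simp: Gam_empty)

lemma choose_fact_ge: "D ^ n \<le> fact n * ((D + n) choose n)"
proof (induction n)
  case (Suc n)
  have "fact (Suc n) * ((D + Suc n) choose Suc n) = fact n * (Suc n * (Suc (D + n) choose Suc n))"
    by (simp add: algebra_simps del: binomial_Suc_Suc)
  also have "\<dots> = fact n * ((D + n) choose n) * Suc (D + n)"
    by (simp only: Suc_times_binomial_eq ac_simps)
  also have "\<dots> \<ge> D ^ n * D" by (intro mult_mono Suc) auto
  finally show ?case by (simp add: mult.commute)
qed auto

lemma ev_pexp_mono: "finite W \<Longrightarrow> ev (pexp_mono W \<gamma>) x = mval W x \<gamma>"
  using lst[of W] by (simp add: pexp_mono_def mval_def ev_pprod prod.distinct_set_conv_list[symmetric])

lemma ev_PE: "finite W \<Longrightarrow> ev (PE W D c) x = pv W D c x"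
  using lst[OF Gam_finite[of W D]] by (simp add: PE_def pv_def ev_psum ev_pexp_mono sum_list_distinct_conv_sum_set)

lemma mono_shift:
  assumes W: "finite W" and sc: "sup_in W D c" and i: "i \<in> W"
  shows "(\<Sum>\<gamma>\<in>Gam W D. c \<gamma> * (int (\<gamma> i) * x i ^ (\<gamma> i - 1) * (\<Prod>b\<in>W - {i}. x b ^ \<gamma> b))) = pv W D (pdc i c) x"
proof -
  define A where "A = {\<gamma> \<in> Gam W D. \<gamma> i \<noteq> 0}"
  define B where "B = {\<gamma> \<in> Gam W D. \<gamma>(i := Suc (\<gamma> i)) \<in> Gam W D}"
  let ?s = "\<lambda>\<gamma>. \<gamma>(i := Suc (\<gamma> i))"
  let ?f = "\<lambda>\<gamma>. c \<gamma> * (int (\<gamma> i) * x i ^ (\<gamma> i - 1) * (\<Prod>b\<in>W - {i}. x b ^ \<gamma> b))"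
  have sumi: "sum \<gamma> W = \<gamma> i + sum \<gamma> (W - {i})" for \<gamma> :: "nat \<Rightarrow> nat" using W i by (simp add: sum.remove)
  have "(\<Sum>\<gamma>\<in>Gam W D. ?f \<gamma>) = (\<Sum>\<gamma>\<in>A. ?f \<gamma>)"
    by (rule sum.mono_neutral_right) (auto simp: A_def Gam_finite W)
  also have "\<dots> = (\<Sum>\<gamma>\<in>B. ?f (?s \<gamma>))"
  proof (rule sum.reindex_bij_witness[of _ ?s "\<lambda>\<gamma>. \<gamma>(i := \<gamma> i - 1)"])
    fix \<gamma> assume "\<gamma> \<in> A"
    then have g: "\<gamma> \<in> Gam W D" "\<gamma> i \<noteq> 0" by (auto simp: A_def)
    show "?s (\<gamma>(i := \<gamma> i - 1)) = \<gamma>" using g by auto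
    then show "\<gamma>(i := \<gamma> i - 1) \<in> B" using g i
      by (auto simp: B_def Gam_def sumi)
    show "?f (?s (\<gamma>(i := \<gamma> i - 1))) = ?f \<gamma>" using \<open>?s (\<gamma>(i := \<gamma> i - 1)) = \<gamma>\<close> by simp
  qed (auto simp: A_def B_def)
  also have "\<dots> = (\<Sum>\<gamma>\<in>B. pdc i c \<gamma> * mval W x \<gamma>)"
  proof (intro sum.cong refl)
    fix \<gamma> assume "\<gamma> \<in> B"
    have "mval W x \<gamma> = x i ^ \<gamma> i * (\<Prod>b\<in>W - {i}. x b ^ \<gamma> b)"
      using W i by (simp add: mval_def prod.remove)
    moreover have "(\<Prod>b\<in>W - {i}. x b ^ ?s \<gamma> b) = (\<Prod>b\<in>W - {i}. x b ^ \<gamma> b)" by (intro prod.cong) auto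
    ultimately show "?f (?s \<gamma>) = pdc i c \<gamma> * mval W x \<gamma>" by (simp add: pdc_def)
  qed
  also have "\<dots> = pv W D (pdc i c) x"
    unfolding pv_def by (rule sum.mono_neutral_left) (use sc in \<open>auto simp: B_def Gam_finite W pdc_def sup_in_def\<close>)
  finally show ?thesis .
qed

lemma dv_PE:
  assumes W: "finite W" and sc: "sup_in W D c"
  shows "dv (PE W D c) x w = (\<Sum>i\<in>W. pv W D (pdc i c) x * w i)"
proof -
  have m: "dv (pexp_mono W \<gamma>) x w = (\<Sum>i\<in>W. int (\<gamma> i) * x i ^ (\<gamma> i - 1) * (\<Prod>b\<in>W - {i}. x b ^ \<gamma> b) * w i)" for \<gamma>
    using lst[OF W] by (simp add: pexp_mono_def dv_pprod dv_ppow algebra_simps)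
  have "dv (PE W D c) x w = (\<Sum>\<gamma>\<in>Gam W D. c \<gamma> * dv (pexp_mono W \<gamma>) x w)"
    using lst[OF Gam_finite[OF W, of D]] by (simp add: PE_def dv_psum sum_list_distinct_conv_sum_set)
  also have "\<dots> = (\<Sum>\<gamma>\<in>Gam W D. \<Sum>i\<in>W. c \<gamma> * (int (\<gamma> i) * x i ^ (\<gamma> i - 1) * (\<Prod>b\<in>W - {i}. x b ^ \<gamma> b)) * w i)"
    unfolding m by (simp add: sum_distrib_left mult.assoc)
  also have "\<dots> = (\<Sum>i\<in>W. \<Sum>\<gamma>\<in>Gam W D. c \<gamma> * (int (\<gamma> i) * x i ^ (\<gamma> i - 1) * (\<Prod>b\<in>W - {i}. x b ^ \<gamma> b)) * w i)"
    by (rule sum.swap)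
  also have "\<dots> = (\<Sum>i\<in>W. pv W D (pdc i c) x * w i)"
    by (intro sum.cong refl) (simp only: sum_distrib_right[symmetric] mono_shift[OF W sc])
  finally show ?thesis .
qed

lemma Gam_mono: "D \<le> D' \<Longrightarrow> Gam W D \<subseteq> Gam W D'" by (auto simp: Gam_def)

lemma sup_in_mono: "sup_in W D c \<Longrightarrow> D \<le> D' \<Longrightarrow> sup_in W D' c"
  using Gam_mono[of D D' W] by (auto simp: sup_in_def)

lemma sup_in_pdc:
  assumes "finite W" "sup_in W D c" "i \<in> W" shows "sup_in W (D - 1) (pdc i c)"
  unfolding sup_in_def
proof (intro allI impI)
  fix \<gamma> assume g: "\<gamma> \<notin> Gam W (D - 1)"
  have s: "sum (\<gamma>(i := Suc (\<gamma> i))) W = Suc (sum \<gamma> W)"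
    using assms by (simp add: sum.remove[of W i])
  have "\<gamma>(i := Suc (\<gamma> i)) \<notin> Gam W D" using g s assms(3) by (auto simp: Gam_def split: if_splits)
  then show "pdc i c \<gamma> = 0" using assms by (auto simp: pdc_def sup_in_def)
qed

primrec itd :: "nat list \<Rightarrow> ((nat \<Rightarrow> nat) \<Rightarrow> int) \<Rightarrow> (nat \<Rightarrow> nat) \<Rightarrow> int" where
  "itd [] c = c"
| "itd (i # us) c = itd us (pdc i c)"

lemma sup_in_itd: "finite W \<Longrightarrow> sup_in W D c \<Longrightarrow> set us \<subseteq> W \<Longrightarrow> sup_in W D (itd us c)"
proof (induction us arbitrary: c)
  case (Cons i us)
  have "sup_in W D (pdc i c)" by (rule sup_in_mono[OF sup_in_pdc]) (use Cons.prems in auto)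
  then show ?case using Cons by auto
qed auto

lemma itd_snoc: "itd (us @ [i]) c = pdc i (itd us c)"
  by (induction us arbitrary: c) auto

lemma pdc_bound: "sup_in W D c \<Longrightarrow> finite W \<Longrightarrow> i \<in> W \<Longrightarrow> (\<And>\<gamma>. \<bar>c \<gamma>\<bar> \<le> B) \<Longrightarrow> \<bar>pdc i c \<gamma>\<bar> \<le> int D * B"
proof -
  assume a: "sup_in W D c" "finite W" "i \<in> W" "\<And>\<gamma>. \<bar>c \<gamma>\<bar> \<le> B"
  have B: "B \<ge> 0" using a(4)[of undefined] by linarith
  show ?thesis
  proof (cases "\<gamma>(i := Suc (\<gamma> i)) \<in> Gam W D")
    case True
    then have "Suc (\<gamma> i) \<le> D" using a(2,3) by (auto simp: Gam_def sum.remove[of W i])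
    then have "int (Suc (\<gamma> i)) \<le> int D" by linarith
    then show ?thesis using a(4) B unfolding pdc_def abs_mult by (intro mult_mono) auto
  next
    case False
    then show ?thesis using a B by (auto simp: pdc_def sup_in_def)
  qed
qed

lemma itd_bound: "sup_in W D c \<Longrightarrow> finite W \<Longrightarrow> set us \<subseteq> W \<Longrightarrow> (\<And>\<gamma>. \<bar>c \<gamma>\<bar> \<le> B) \<Longrightarrow> \<bar>itd us c \<gamma>\<bar> \<le> int D ^ length us * B"
proof (induction us arbitrary: c B)
  case (Cons i us)
  have "\<bar>itd us (pdc i c) \<gamma>\<bar> \<le> int D ^ length us * (int D * B)"
    by (rule Cons.IH) (use Cons.prems in \<open>auto intro!: sup_in_mono[OF sup_in_pdc[of W D]] pdc_bound\<close>)
  then show ?case by (simp add: ac_simps)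
qed auto

lemma pv_sup0: "finite W \<Longrightarrow> sup_in W 0 c \<Longrightarrow> pv W D c x = c (\<lambda>_. 0)"
proof -
  assume a: "finite W" "sup_in W 0 c"
  have "c \<gamma> = 0" if "\<gamma> \<noteq> (\<lambda>_. 0)" for \<gamma>
    using a that by (auto simp: sup_in_def Gam_def fun_eq_iff)
  then have "pv W D c x = (\<Sum>\<gamma>\<in>{\<lambda>_. 0}. c \<gamma> * mval W x \<gamma>)"
    unfolding pv_def by (intro sum.mono_neutral_right) (auto simp: Gam_finite a, auto simp: Gam_def)
  then show ?thesis by (simp add: mval_def)
qed

lemma pick_var:
  assumes "finite W" "\<not> sup_in W 0 c" "sup_in W D c"
  shows "\<exists>i\<in>W. \<exists>\<gamma>. pdc i c \<gamma> \<noteq> 0"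
proof -
  obtain \<gamma> where g: "c \<gamma> \<noteq> 0" "\<gamma> \<notin> Gam W 0" using assms(2) by (auto simp: sup_in_def)
  then have "\<gamma> \<in> Gam W D" using assms(3) by (auto simp: sup_in_def)
  then obtain i where i: "i \<in> W" "\<gamma> i \<noteq> 0" using g(2) assms(1) by (auto simp: Gam_def)
  then have "pdc i c (\<gamma>(i := \<gamma> i - 1)) \<noteq> 0" using g by (auto simp: pdc_def)
  with i show ?thesis by blast
qed

text \<open>A chain of nonzero partial derivatives ends in a nonzero constant. The value at
  \<open>x\<close> starts at 0, so some link of the chain leads from a zero to a nonzero
  value.\<close>

lemma descent:
  assumes "finite W" "sup_in W D' c" "\<exists>\<gamma>. c \<gamma> \<noteq> 0" "pv W D c x = 0"
  shows "\<exists>us i. set us \<subseteq> W \<and> length us \<le> D' \<and> i \<in> W \<and> pv W D (itd us c) x = 0 \<and> pv W D (itd (us @ [i]) c) x \<noteq> 0"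
  using assms(2-)
proof (induction D' arbitrary: c)
  case 0
  then obtain \<gamma> where g: "c \<gamma> \<noteq> 0" by blast
  then have "\<gamma> \<in> Gam W 0" using 0 by (auto simp: sup_in_def)
  then have "\<gamma> = (\<lambda>_. 0)" using assms(1) by (auto simp: Gam_def fun_eq_iff)
  with g 0 assms(1) show ?case by (simp add: pv_sup0)
next
  case (Suc D')
  show ?case
  proof (cases "sup_in W 0 c")
    case True
    then obtain us i where "set us \<subseteq> W \<and> length us \<le> D' \<and> i \<in> W \<and> pv W D (itd us c) x = 0 \<and> pv W D (itd (us @ [i]) c) x \<noteq> 0"
      using Suc.IH[of c] Suc.prems sup_in_mono by blast
    then show ?thesis using le_SucI by blast
  next
    case False
    then obtain i where i: "i \<in> W" "\<exists>\<gamma>. pdc i c \<gamma> \<noteq> 0" using pick_var assms(1) Suc.prems by blast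
    show ?thesis
    proof (cases "pv W D (pdc i c) x = 0")
      case True
      then obtain us j where "set us \<subseteq> W \<and> length us \<le> D' \<and> j \<in> W \<and> pv W D (itd us (pdc i c)) x = 0
          \<and> pv W D (itd (us @ [j]) (pdc i c)) x \<noteq> 0"
        using Suc.IH[of "pdc i c"] i sup_in_pdc[OF assms(1) Suc.prems(1) i(1)] by auto
      then show ?thesis using i by (intro exI[of _ "i # us"] exI[of _ j]) auto
    next
      case False
      then show ?thesis using i Suc.prems by (intro exI[of _ "[]"] exI[of _ i]) auto
    qed
  qed
qed

text \<open>One word of derivatives must serve the whole family. While some member is not constant,
  a variable is chosen in which that member has a nonzero derivative; all degrees fall together, and
  a nonzero member survives until all are constant.\<close>

lemma descent_family:
  assumes "finite W" "\<forall>k. sup_in W D (c k)" "\<exists>k \<gamma>. c k \<gamma> \<noteq> 0"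
  shows "\<exists>us. set us \<subseteq> W \<and> length us \<le> D \<and> (\<forall>k. sup_in W 0 (itd us (c k))) \<and> (\<exists>k. itd us (c k) (\<lambda>_. 0) \<noteq> 0)"
  using assms(2-)
proof (induction D arbitrary: c)
  case 0
  then obtain k \<gamma> where g: "c k \<gamma> \<noteq> 0" by blast
  then have "\<gamma> \<in> Gam W 0" using 0 by (auto simp: sup_in_def)
  then have "\<gamma> = (\<lambda>_. 0)" using assms(1) by (auto simp: Gam_def fun_eq_iff)
  with g 0 show ?case by (intro exI[of _ "[]"]) auto
next
  case (Suc D)
  show ?case
  proof (cases "\<forall>k. sup_in W 0 (c k)")
    case True
    then obtain us where "set us \<subseteq> W \<and> length us \<le> D \<and> (\<forall>k. sup_in W 0 (itd us (c k))) \<and> (\<exists>k. itd us (c k) (\<lambda>_. 0) \<noteq> 0)"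
      using Suc.IH[of c] Suc.prems sup_in_mono[of W 0 _ D] by blast
    then show ?thesis using le_SucI by blast
  next
    case False
    then obtain k i where i: "i \<in> W" "\<exists>\<gamma>. pdc i (c k) \<gamma> \<noteq> 0" using pick_var assms(1) Suc.prems by blast
    have "\<forall>k. sup_in W D (pdc i (c k))" using sup_in_pdc[OF assms(1) _ i(1)] Suc.prems by fastforce
    then obtain us where "set us \<subseteq> W \<and> length us \<le> D \<and> (\<forall>k. sup_in W 0 (itd us (pdc i (c k)))) \<and> (\<exists>k. itd us (pdc i (c k)) (\<lambda>_. 0) \<noteq> 0)"
      using Suc.IH[of "\<lambda>k. pdc i (c k)"] i by blast
    then show ?thesis using i by (intro exI[of _ "i # us"]) auto
  qed
qed

lemma bd_nonneg: "M \<ge> 0 \<Longrightarrow> bd M E \<ge> 0"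
  by (induction E) auto

lemma ev_bd: "(\<And>j. \<bar>x j\<bar> \<le> M) \<Longrightarrow> \<bar>ev E x\<bar> \<le> bd M E"
proof (induction E)
  case (Mul A B)
  have "M \<ge> 0" using Mul.prems[of 0] by linarith
  then show ?case using Mul by (auto simp: abs_mult intro!: mult_mono bd_nonneg)
qed (auto intro: order_trans[OF abs_triangle_ineq] add_mono)

lemma bd_der:
  assumes M: "M \<ge> 1" and L: "L \<ge> 0" "\<And>j. bd M (\<Theta> j) \<le> L"
  shows "bd M (der \<Theta> E) \<le> int (dg E) * bd M E * L"
proof (induction E)
  case (Var j)
  have "L \<le> M * L" using M L(1) by (simp add: mult_le_cancel_right1)
  then show ?case using L(2)[of j] by auto
next
  case (Add A B)
  have "bd M (der \<Theta> (Add A B)) \<le> int (dg A) * bd M A * L + int (dg B) * bd M B * L" using Add by auto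
  also have "\<dots> \<le> int (dg (Add A B)) * bd M A * L + int (dg (Add A B)) * bd M B * L"
    using M L(1) by (intro add_mono mult_right_mono bd_nonneg) auto
  finally show ?case by (simp add: algebra_simps)
next
  case (Mul A B)
  have "bd M (der \<Theta> (Mul A B)) \<le> (int (dg A) * bd M A * L) * bd M B + bd M A * (int (dg B) * bd M B * L)"
    using Mul M by (auto intro!: add_mono mult_right_mono mult_left_mono bd_nonneg)
  then show ?case by (simp add: algebra_simps)
qed auto

lemma dg_der: "(\<And>j. dg (\<Theta> j) \<le> n) \<Longrightarrow> dg (der \<Theta> E) \<le> dg E + n"
proof (induction E)
  case (Add A B)
  then have "dg (der \<Theta> A) \<le> dg A + n" "dg (der \<Theta> B) \<le> dg B + n" by auto
  then show ?case by simp linarith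
next
  case (Mul A B)
  then show ?case by (simp add: algebra_simps)
next
  case (Var j)
  then show ?case by (auto intro: le_SucI)
qed auto

lemma bd_PE:
  assumes W: "finite W" and M: "M \<ge> 1" and c: "\<And>\<gamma>. \<bar>c \<gamma>\<bar> \<le> B"
  shows "bd M (PE W D c) \<le> int (card (Gam W D)) * (B * M ^ D)" and "dg (PE W D c) \<le> D"
proof -
  have B: "B \<ge> 0" using c[of undefined] by linarith
  have m: "bd M (pexp_mono W \<gamma>) = M ^ sum \<gamma> W" "dg (pexp_mono W \<gamma>) = sum \<gamma> W" for \<gamma>
    using lst[OF W] by (simp_all add: pexp_mono_def bd_pprod bd_ppow dg_pprod dg_ppow power_sum
        prod.distinct_set_conv_list[symmetric] sum_list_distinct_conv_sum_set)
  have "bd M (PE W D c) = (\<Sum>\<gamma>\<in>Gam W D. \<bar>c \<gamma>\<bar> * M ^ sum \<gamma> W)"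
    using lst[OF Gam_finite[OF W, of D]] by (simp add: PE_def bd_psum sum_list_distinct_conv_sum_set m)
  also have "\<dots> \<le> (\<Sum>\<gamma>\<in>Gam W D. B * M ^ D)"
    using B M by (intro sum_mono mult_mono c power_increasing) (auto simp: Gam_def)
  finally show "bd M (PE W D c) \<le> int (card (Gam W D)) * (B * M ^ D)" by simp
  show "dg (PE W D c) \<le> D" unfolding PE_def
    by (rule dg_psum) (use lst[OF Gam_finite[OF W, of D]] in \<open>auto simp: m Gam_def\<close>)
qed

section \<open>Auxiliary moduli and elimination\<close>

lemma fact_le_prod: "finite A \<Longrightarrow> 0 \<notin> A \<Longrightarrow> fact (card A) \<le> \<Prod>(A :: nat set)"
proof (induction "card A" arbitrary: A)
  case (Suc n)
  then have ne: "A \<noteq> {}" by auto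
  have A: "A \<subseteq> {1..Max A}" using Suc by (auto simp: Suc_le_eq intro: Max_ge) (metis gr0I)
  then have "card A \<le> Max A" using card_mono[of "{1..Max A}" A] by simp
  moreover have "fact (card (A - {Max A})) \<le> \<Prod>(A - {Max A})"
    using Suc ne by (intro Suc.hyps(1)) (auto simp: card_Diff_singleton)
  ultimately have "fact (card (A - {Max A})) * card A \<le> \<Prod>(A - {Max A}) * Max A" by (intro mult_mono) auto
  moreover have "\<Prod>A = \<Prod>(A - {Max A}) * Max A" using Suc ne by (simp add: prod.remove[of A "Max A"] mult.commute)
  moreover have "fact (card A) = fact (card (A - {Max A})) * card A"
    using Suc ne by (simp add: card_Diff_singleton flip: Suc.hyps(2))
  ultimately show ?case by simp
qed auto

lemma squarefree_eq_prod_primes: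
  assumes "squarefree (n::nat)" shows "n = \<Prod>(prime_factors n)"
proof -
  have n: "n \<noteq> 0" using assms by (metis not_squarefree_0)
  have "(\<Prod>p\<in>prime_factors n. p ^ multiplicity p n) = n" using prod_prime_factors[OF n] by simp
  moreover have "(\<Prod>p\<in>prime_factors n. p ^ multiplicity p n) = (\<Prod>p\<in>prime_factors n. p)"
  proof (intro prod.cong refl)
    fix p assume p: "p \<in> prime_factors n"
    then have "multiplicity p n \<le> 1" using assms n by (auto simp: squarefree_factorial_semiring'')
    moreover have "multiplicity p n > 0" using p n by (simp add: prime_factors_multiplicity)
    ultimately have "multiplicity p n = 1" by linarith
    then show "p ^ multiplicity p n = p" by simp
  qed
  ultimately show ?thesis by simp
qed

text \<open>Erdos' count: every number up to Y is a square times a product of distinct primes.\<close>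

lemma le_four_power_primes: "Y \<le> 4 ^ card {p::nat. prime p \<and> p \<le> Y}"
proof (cases "Y = 0")
  case False
  define A where "A = {p::nat. prime p \<and> p \<le> Y}"
  have finA: "finite A" by (rule finite_subset[of _ "{..Y}"]) (auto simp: A_def)
  define s where "s = Max {k. k ^ 2 \<le> Y}"
  have fin: "finite {k. k\<^sup>2 \<le> Y}" by (rule finite_subset[of _ "{..Y}"]) (auto dest: power2_nat_le_imp_le)
  have "0 \<in> {k. k\<^sup>2 \<le> Y}" by simp
  then have s: "s ^ 2 \<le> Y" using Max_in[OF fin] unfolding s_def by blast
  let ?f = "\<lambda>n::nat. (prime_factors (squarefree_part n), square_part n)"
  have "inj_on ?f {1..Y}"
  proof (rule inj_onI)
    fix a b assume "?f a = ?f b"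
    then have pf: "prime_factors (squarefree_part a) = prime_factors (squarefree_part b)"
      and sq: "square_part a = square_part b" by auto
    have "squarefree_part a = \<Prod>(prime_factors (squarefree_part a))"
      by (rule squarefree_eq_prod_primes) (rule squarefree_squarefree_part)
    also have "\<dots> = squarefree_part b"
      unfolding pf by (rule squarefree_eq_prod_primes[symmetric]) (rule squarefree_squarefree_part)
    finally have sf: "squarefree_part a = squarefree_part b" .
    have "a = squarefree_part a * square_part a ^ 2" by (rule squarefree_decompose)
    also have "\<dots> = b" unfolding sf sq by (rule squarefree_decompose[symmetric])
    finally show "a = b" .
  qed
  moreover have "?f ` {1..Y} \<subseteq> Pow A \<times> {1..s}"
  proof
    fix z assume "z \<in> ?f ` {1..Y}"
    then obtain n where n: "n \<in> {1..Y}" "z = ?f n" by blast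
    have "squarefree_part n dvd squarefree_part n * square_part n ^ 2" by simp
    then have "squarefree_part n dvd n" unfolding squarefree_decompose[symmetric] .
    then have "p \<le> Y" if "p dvd squarefree_part n" for p
      using that n by (meson atLeastAtMost_iff dvd_imp_le dvd_trans le_trans less_le_trans zero_less_one)
    moreover have "square_part n ^ 2 \<le> Y" using n dvd_imp_le[OF square_part_square_dvd, of n] by auto
    then have "square_part n \<le> s" unfolding s_def by (intro Max_ge fin) simp
    moreover have "1 \<le> square_part n" using n square_part_0_iff[of n] by (cases "square_part n") auto
    ultimately show "z \<in> Pow A \<times> {1..s}" using n by (auto simp: A_def)
  qed
  ultimately have "card {1..Y} \<le> card (Pow A \<times> {1..s})" by (intro card_inj_on_le) (auto simp: finA)
  then have "Y \<le> 2 ^ card A * s" by (simp add: card_Pow card_cartesian_product finA)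
  then have "Y * Y \<le> (2 ^ card A * s) * (2 ^ card A * s)" by (intro mult_mono) auto
  also have "\<dots> = 4 ^ card A * s ^ 2" by (simp add: power2_eq_square power_mult_distrib[symmetric])
  also have "\<dots> \<le> 4 ^ card A * Y" using s by simp
  finally show ?thesis using False by (simp add: A_def)
qed auto

lemma fact_dominates: "\<exists>R. \<forall>r\<ge>R. K * b ^ r < (fact r :: nat)"
proof -
  have "(\<lambda>n. real b ^ n /\<^sub>R fact n) \<longlonglongrightarrow> 0" by (rule summable_LIMSEQ_zero[OF summable_exp_generic])
  then have "(\<lambda>n. real b ^ n / fact n) \<longlonglongrightarrow> 0" by (simp add: divide_inverse mult.commute scaleR_conv_of_real)
  then have "eventually (\<lambda>n. real b ^ n / fact n < 1 / (real K + 1)) sequentially"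
    by (rule order_tendstoD) auto
  then obtain R where R: "\<And>n. n \<ge> R \<Longrightarrow> real b ^ n / fact n < 1 / (real K + 1)" by (auto simp: eventually_sequentially)
  have "K * b ^ r < fact r" if "r \<ge> R" for r
  proof -
    have "(real K + 1) * real b ^ r < fact r" using R[OF that] by (simp add: field_simps)
    moreover have "real (K * b ^ r) \<le> (real K + 1) * real b ^ r" by (simp add: algebra_simps)
    ultimately have "real (K * b ^ r) < real (fact r)" by (simp only: of_nat_fact)
    then show ?thesis by linarith
  qed
  then show ?thesis by blast
qed

text \<open>If every prime up to \<open>Y = 4 ^ R * G\<close> divided \<open>M\<close>, then so
  would their product, which is at least \<open>fact r\<close> for their number \<open>r\<close>.
  But \<open>Y \<le> 4 ^ r\<close> bounds \<open>M\<close> by \<open>K * (4 ^ K) ^ r\<close>, which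
  is less than \<open>fact r\<close> for \<open>r \<ge> R\<close>; and \<open>4 ^ R \<le> Y\<close>
  forces \<open>r \<ge> R\<close>.\<close>

lemma prime_avoid: "\<exists>C\<ge>1. \<forall>G\<ge>1. \<forall>M::int. M \<noteq> 0 \<longrightarrow> \<bar>M\<bar> \<le> int K * int G ^ K \<longrightarrow>
   (\<exists>p::nat. prime p \<and> \<not> int p dvd M \<and> p \<le> C * G)"
proof -
  obtain R where R: "\<And>r. r \<ge> R \<Longrightarrow> K * (4 ^ K) ^ r < fact r" using fact_dominates by blast
  show ?thesis
  proof (rule exI[of _ "4 ^ R"], intro conjI allI impI)
    fix G :: nat and M :: int
    assume G: "G \<ge> 1" and M: "M \<noteq> 0" "\<bar>M\<bar> \<le> int K * int G ^ K"
    define Y where "Y = 4 ^ R * G"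
    define A where "A = {p::nat. prime p \<and> p \<le> Y}"
    have finA: "finite A" by (rule finite_subset[of _ "{..Y}"]) (auto simp: A_def)
    have Y4: "Y \<le> 4 ^ card A" using le_four_power_primes by (simp add: A_def)
    have "(4::nat) ^ R \<le> 4 ^ card A" using Y4 G by (metis Y_def le_trans mult.right_neutral mult_le_mono2)
    then have rR: "card A \<ge> R" by simp
    show "\<exists>p::nat. prime p \<and> \<not> int p dvd M \<and> p \<le> 4 ^ R * G"
    proof (rule ccontr)
      assume "\<not> ?thesis"
      then have dv: "p dvd nat \<bar>M\<bar>" if "p \<in> A" for p using that by (auto simp: A_def Y_def nat_dvd_iff)
      have "\<Prod>A' dvd nat \<bar>M\<bar>" if "A' \<subseteq> A" for A'
        using finite_subset[OF that finA] that
      proof (induction A' rule: finite_induct)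
        case (insert p A')
        have "coprime p (\<Prod>A')"
          using insert by (intro prod_coprime_right) (auto simp: A_def intro!: primes_coprime)
        moreover have "p dvd nat \<bar>M\<bar>" by (rule dv) (use insert in auto)
        moreover have "\<Prod>A' dvd nat \<bar>M\<bar>" using insert by blast
        ultimately have "p * \<Prod>A' dvd nat \<bar>M\<bar>" by (intro divides_mult)
        then show ?case using insert(1,2) by (simp only: prod.insert not_False_eq_True)
      qed auto
      then have "\<Prod>A \<le> nat \<bar>M\<bar>" using M by (intro dvd_imp_le) auto
      then have "fact (card A) \<le> nat \<bar>M\<bar>" using fact_le_prod[OF finA] by (force simp: A_def)
      also have "nat \<bar>M\<bar> \<le> K * G ^ K" using M(2) by (simp add: nat_le_iff)
      also have "\<dots> \<le> K * Y ^ K" by (intro mult_le_mono2 power_mono) (auto simp: Y_def)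
      also have "\<dots> \<le> K * (4 ^ card A) ^ K" by (intro mult_le_mono2 power_mono Y4) auto
      also have "\<dots> = K * (4 ^ K) ^ card A" by (simp add: power_mult[symmetric] mult.commute)
      finally show False using R[OF rR] by simp
    qed
  qed auto
qed

text \<open>The modulus is a power of the avoided prime with the least sufficient exponent. It
  overshoots \<open>G ^ \<kappa>\<close> by at most one factor \<open>p \<le> C * G\<close>, which
  explains the exponent \<open>Suc \<kappa>\<close>.\<close>

lemma modulus_exists: "\<exists>C\<ge>1. \<forall>G\<ge>1. \<forall>M::int. M \<noteq> 0 \<longrightarrow> \<bar>M\<bar> \<le> int K * int G ^ K \<longrightarrow>
   (\<exists>q::int. int G ^ \<kappa> \<le> q \<and> q \<le> int C * int G ^ Suc \<kappa> \<and> coprime M q)"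
proof -
  obtain C where C: "C \<ge> 1" and p: "\<And>G M. G \<ge> 1 \<Longrightarrow> M \<noteq> 0 \<Longrightarrow> \<bar>M\<bar> \<le> int K * int G ^ K \<Longrightarrow> \<exists>p::nat. prime p \<and> \<not> int p dvd M \<and> p \<le> C * G"
    using prime_avoid[of K] by blast
  show ?thesis
  proof (rule exI[of _ C], intro conjI C allI impI)
    fix G :: nat and M :: int
    assume G: "G \<ge> 1" and M: "M \<noteq> 0" "\<bar>M\<bar> \<le> int K * int G ^ K"
    obtain p where p: "prime p" "\<not> int p dvd M" "p \<le> C * G" using p[OF G M] by blast
    have p2: "p \<ge> 2" using p(1) prime_ge_2_nat by blast
    define e where "e = (LEAST e. G ^ \<kappa> \<le> p ^ e)"
    have "G ^ \<kappa> < 2 ^ (G ^ \<kappa>)" by (rule less_exp)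
    also have "\<dots> \<le> p ^ (G ^ \<kappa>)" using p2 by (intro power_mono) auto
    finally have e: "G ^ \<kappa> \<le> p ^ e"
      unfolding e_def by (intro LeastI[where P = "\<lambda>e. G ^ \<kappa> \<le> p ^ e"] less_imp_le)
    have "p ^ e \<le> C * G ^ Suc \<kappa>"
    proof (cases e)
      case 0
      then show ?thesis using C G by (simp add: Suc_le_eq)
    next
      case (Suc e')
      then have "\<not> G ^ \<kappa> \<le> p ^ e'" unfolding e_def using not_less_Least by (metis lessI)
      then have "p * p ^ e' \<le> (C * G) * G ^ \<kappa>" using p(3) by (intro mult_mono) auto
      then show ?thesis using Suc by (simp add: ac_simps)
    qed
    moreover have "coprime M (int p ^ e)"
      using p by (metis coprime_commute coprime_power_right_iff prime_imp_coprime prime_nat_int_transfer)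
    ultimately show "\<exists>q::int. int G ^ \<kappa> \<le> q \<and> q \<le> int C * int G ^ Suc \<kappa> \<and> coprime M q"
      using e by (intro exI[of _ "int p ^ e"]) (simp add: of_nat_power[symmetric] of_nat_mult[symmetric] del: of_nat_power of_nat_mult power_Suc)
  qed
qed

text \<open>
  The coefficients obtained from \<open>\<Sum>\<^sub>s a\<^sub>s n\<^sub>s^e = 0\<close>, where \<open>n\<^sub>s\<close> is the variable \<open>m + s\<close>, by applying \<open>\<Lambda> k\<close>
  and eliminating the term \<open>r\<close>; every step lowers \<open>e\<close> by one.
\<close>

fun ac :: "nat \<Rightarrow> nat \<Rightarrow> (nat \<Rightarrow> nat \<Rightarrow> pexp) \<Rightarrow> (nat \<times> nat) list \<Rightarrow> nat \<Rightarrow> pexp" where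
  "ac m d \<Lambda> [] s = Var s"
| "ac m d \<Lambda> ((k, r) # ps) s =
    Add (Mul (Mul (ac m d \<Lambda> ps r) (Var (m + r))) (Add (Mul (Var (m + s)) (der (\<Lambda> k) (ac m d \<Lambda> ps s)))
          (Mul (Con (int (d - length ps))) (Mul (ac m d \<Lambda> ps s) (\<Lambda> k (m + s))))))
        (Mul (Con (-1)) (Mul (Mul (ac m d \<Lambda> ps s) (Var (m + s))) (Add (Mul (Var (m + r)) (der (\<Lambda> k) (ac m d \<Lambda> ps r)))
          (Mul (Con (int (d - length ps))) (Mul (ac m d \<Lambda> ps r) (\<Lambda> k (m + r)))))))"

definition gc :: "nat \<Rightarrow> nat \<Rightarrow> (nat \<Rightarrow> nat \<Rightarrow> pexp) \<Rightarrow> (nat \<times> nat) list \<Rightarrow> nat \<Rightarrow> pexp" where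
  "gc m d \<Lambda> ps s = Mul (ac m d \<Lambda> ps s) (ppow (Var (m + s)) (d - length ps))"

definition RR :: "nat \<Rightarrow> nat \<Rightarrow> (nat \<Rightarrow> nat \<Rightarrow> pexp) \<Rightarrow> (nat \<times> nat) list \<Rightarrow> pexp" where
  "RR m d \<Lambda> ps = psum (gc m d \<Lambda> ps) [0..<m]"

lemma ev_RR: "ev (RR m d \<Lambda> ps) x = (\<Sum>s<m. ev (gc m d \<Lambda> ps s) x)"
  by (simp add: RR_def ev_psum interv_sum_list_conv_sum_set_nat atLeast0LessThan)

lemma ev_der_RR: "ev (der \<Theta> (RR m d \<Lambda> ps)) x = (\<Sum>s<m. ev (der \<Theta> (gc m d \<Lambda> ps s)) x)"
  by (simp add: ev_der RR_def dv_psum interv_sum_list_conv_sum_set_nat atLeast0LessThan)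

text \<open>Let \<open>g t\<close> denote the terms. After a surviving term \<open>t\<close> is
  eliminated, the induction hypothesis says that the class sum \<open>G\<close> satisfies
  \<open>g t * DG = Dg t * G\<close>, so a nonzero \<open>G\<close> would have the logarithmic
  derivative of every surviving term. By \<open>nobeta\<close>, surviving terms of different classes
  have different ones, hence \<open>G = 0\<close>. The assumptions \<open>clA\<close> and
  \<open>clR\<close> say that quantities vanishing at \<open>x\<close> have vanishing derivatives
  there: dead coefficients stay dead, and the relation can be differentiated. The bound on
  \<open>length ps\<close> keeps the exponent of the \<open>n\<close> positive.\<close>

lemma elimination:
  fixes x :: "nat \<Rightarrow> int" and cls :: "nat \<Rightarrow> 'c"
  assumes md: "m \<le> d" and nz: "\<And>s. s < m \<Longrightarrow> x (m + s) \<noteq> 0"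
    and clA: "\<And>ps s k. set ps \<subseteq> V \<times> {..<m} \<Longrightarrow> length ps \<le> m \<Longrightarrow> s < m \<Longrightarrow> k \<in> V \<Longrightarrow>
       ev (ac m d \<Lambda> ps s) x = 0 \<Longrightarrow> ev (der (\<Lambda> k) (ac m d \<Lambda> ps s)) x = 0"
    and clR: "\<And>ps k. set ps \<subseteq> V \<times> {..<m} \<Longrightarrow> length ps \<le> m \<Longrightarrow> k \<in> V \<Longrightarrow>
       ev (RR m d \<Lambda> ps) x = 0 \<Longrightarrow> ev (der (\<Lambda> k) (RR m d \<Lambda> ps)) x = 0"
    and nobeta: "\<And>ps r r'. set ps \<subseteq> V \<times> {..<m} \<Longrightarrow> length ps \<le> m \<Longrightarrow> r < m \<Longrightarrow> r' < m \<Longrightarrow> cls r \<noteq> cls r' \<Longrightarrow>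
       ev (ac m d \<Lambda> ps r) x \<noteq> 0 \<Longrightarrow> ev (ac m d \<Lambda> ps r') x \<noteq> 0 \<Longrightarrow>
       \<exists>k\<in>V. ev (gc m d \<Lambda> ps r') x * ev (der (\<Lambda> k) (gc m d \<Lambda> ps r)) x \<noteq>
              ev (gc m d \<Lambda> ps r) x * ev (der (\<Lambda> k) (gc m d \<Lambda> ps r')) x"
    and ps: "set ps \<subseteq> V \<times> {..<m}" "length ps + card {s. s < m \<and> ev (ac m d \<Lambda> ps s) x \<noteq> 0} \<le> m"
    and R0: "ev (RR m d \<Lambda> ps) x = 0"
  shows "(\<Sum>s | s < m \<and> cls s = c. ev (gc m d \<Lambda> ps s) x) = 0"
  using ps R0
proof (induction "card {s. s < m \<and> ev (ac m d \<Lambda> ps s) x \<noteq> 0}" arbitrary: ps c rule: less_induct)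
  case less
  define a where "a s = ev (ac m d \<Lambda> ps s) x" for s
  define n where "n s = x (m + s)" for s
  define e where "e = d - length ps"
  define supp where "supp = {s. s < m \<and> a s \<noteq> 0}"
  define Da where "Da k s = ev (der (\<Lambda> k) (ac m d \<Lambda> ps s)) x" for k s
  define Dn where "Dn k s = ev (\<Lambda> k (m + s)) x" for k s
  have fin: "finite supp" by (auto simp: supp_def)
  have g: "ev (gc m d \<Lambda> ps s) x = a s * n s ^ e" for s by (simp add: gc_def a_def n_def e_def)
  show ?case
  proof (cases "\<exists>r\<in>supp. \<exists>r'\<in>supp. cls r \<noteq> cls r'")
    case False
    show ?thesis
    proof (cases "\<exists>r\<in>supp. cls r = c")
      case True
      then have "a s = 0" if "s < m" "cls s \<noteq> c" for s using False that by (auto simp: supp_def)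
      then have "(\<Sum>s | s < m \<and> cls s = c. ev (gc m d \<Lambda> ps s) x) = (\<Sum>s<m. ev (gc m d \<Lambda> ps s) x)"
        by (intro sum.mono_neutral_left) (auto simp: g)
      then show ?thesis using less.prems(3) by (simp add: ev_RR)
    next
      case False
      then show ?thesis by (intro sum.neutral) (auto simp: g supp_def)
    qed
  next
    case True
    then obtain r r' where r: "r \<in> supp" "r' \<in> supp" "cls r \<noteq> cls r'" by blast
    have "card {r, r'} \<le> card supp" using r fin by (intro card_mono) auto
    moreover have "r \<noteq> r'" using r by auto
    ultimately have c2: "card supp \<ge> 2" by simp
    then have len: "length ps < m" using less.prems(2) by (auto simp: supp_def a_def)
    then have pw: "n s ^ e = n s * n s ^ (e - 1)" for s using md by (simp add: e_def power_eq_if)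
    have dgc: "ev (der (\<Lambda> k) (gc m d \<Lambda> ps s)) x = Da k s * n s ^ e + a s * (int e * n s ^ (e - 1) * Dn k s)" for k s
      by (simp add: gc_def ev_der dv_ppow Da_def a_def n_def e_def Dn_def)
    define G where "G = (\<Sum>s | s < m \<and> cls s = c. a s * n s ^ e)"
    define DG where "DG k = (\<Sum>s | s < m \<and> cls s = c. Da k s * n s ^ e + a s * (int e * n s ^ (e - 1) * Dn k s))" for k
    \<comment> \<open>This is \<open>g t * DG = Dg t * G\<close> with the common factor
      \<open>n t ^ (e - 1)\<close> removed, in line with the coefficients \<open>ac\<close>, which
      lower the exponent by one only.\<close>
    have key: "a t * n t * DG k = (n t * Da k t + int e * (a t * Dn k t)) * G" if t: "t \<in> supp" and k: "k \<in> V" for t k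
    proof -
      define qs where "qs = (k, t) # ps"
      have a': "ev (ac m d \<Lambda> qs s) x = a t * n t * (n s * Da k s + int e * (a s * Dn k s)) - a s * n s * (n t * Da k t + int e * (a t * Dn k t))" for s
        by (simp add: qs_def a_def n_def Da_def Dn_def e_def)
      have tm: "t < m" using t by (auto simp: supp_def)
      have "{s. s < m \<and> ev (ac m d \<Lambda> qs s) x \<noteq> 0} \<subseteq> supp - {t}"
      proof
        fix s assume s: "s \<in> {s. s < m \<and> ev (ac m d \<Lambda> qs s) x \<noteq> 0}"
        have "a s \<noteq> 0"
        proof
          assume "a s = 0"
          then have "Da k s = 0" using clA[of ps s k] less.prems(1) len s k by (simp add: a_def Da_def)
          then show False using s a'[of s] \<open>a s = 0\<close> by simp
        qed
        moreover have "s \<noteq> t" using s a'[of t] by auto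
        ultimately show "s \<in> supp - {t}" using s by (auto simp: supp_def)
      qed
      then have "card {s. s < m \<and> ev (ac m d \<Lambda> qs s) x \<noteq> 0} \<le> card (supp - {t})" using fin by (intro card_mono) auto
      then have cd: "card {s. s < m \<and> ev (ac m d \<Lambda> qs s) x \<noteq> 0} < card supp" using t fin c2 by (simp add: card_Diff_singleton)
      have len': "length qs = Suc (length ps)" by (simp add: qs_def)
      have exp: "d - length qs = e - 1" by (simp add: qs_def e_def)
      have gq: "ev (gc m d \<Lambda> qs s) x = a t * n t * (Da k s * n s ^ e + a s * (int e * n s ^ (e - 1) * Dn k s))
          - (n t * Da k t + int e * (a t * Dn k t)) * (a s * n s ^ e)" for s
      proof -
        have "ev (gc m d \<Lambda> qs s) x = ev (ac m d \<Lambda> qs s) x * n s ^ (e - 1)" by (simp add: gc_def exp n_def)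
        then show ?thesis unfolding a' pw by (simp add: algebra_simps)
      qed
      have "ev (RR m d \<Lambda> qs) x = a t * n t * ev (der (\<Lambda> k) (RR m d \<Lambda> ps)) x - (n t * Da k t + int e * (a t * Dn k t)) * ev (RR m d \<Lambda> ps) x"
        by (simp only: ev_RR ev_der_RR gq g dgc sum_subtractf sum_distrib_left)
      also have "\<dots> = 0" using less.prems clR[of ps k] len k by simp
      finally have RRq: "ev (RR m d \<Lambda> qs) x = 0" .
      have "(\<Sum>s | s < m \<and> cls s = c. ev (gc m d \<Lambda> qs s) x) = 0"
      proof (rule less.hyps)
        show "card {s. s < m \<and> ev (ac m d \<Lambda> qs s) x \<noteq> 0} < card {s. s < m \<and> ev (ac m d \<Lambda> ps s) x \<noteq> 0}"
          using cd unfolding supp_def a_def .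
        then show "length qs + card {s. s < m \<and> ev (ac m d \<Lambda> qs s) x \<noteq> 0} \<le> m" using less.prems(2) len' by linarith
        show "set qs \<subseteq> V \<times> {..<m}" using less.prems(1) k tm by (auto simp: qs_def)
      qed (rule RRq)
      then show ?thesis
        by (simp add: gq sum_subtractf sum_distrib_left[symmetric] G_def DG_def)
    qed
    have "G = 0"
    proof (rule ccontr)
      assume G: "G \<noteq> 0"
      obtain k where k: "k \<in> V" and W: "ev (gc m d \<Lambda> ps r') x * ev (der (\<Lambda> k) (gc m d \<Lambda> ps r)) x \<noteq>
              ev (gc m d \<Lambda> ps r) x * ev (der (\<Lambda> k) (gc m d \<Lambda> ps r')) x"
        using nobeta[of ps r r'] less.prems(1) len r by (auto simp: supp_def a_def)
      have dg': "ev (der (\<Lambda> k) (gc m d \<Lambda> ps s)) x = n s ^ (e - 1) * (n s * Da k s + int e * (a s * Dn k s))" for s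
      proof -
        show ?thesis unfolding dgc pw by (simp add: algebra_simps)
      qed
      have gs: "ev (gc m d \<Lambda> ps s) x = n s ^ (e - 1) * (a s * n s)" for s
        unfolding g pw by simp
      have "ev (gc m d \<Lambda> ps r') x * ev (der (\<Lambda> k) (gc m d \<Lambda> ps r)) x * G
        = n r' ^ (e - 1) * (a r' * n r') * n r ^ (e - 1) * ((n r * Da k r + int e * (a r * Dn k r)) * G)"
        by (simp add: gs dg' algebra_simps)
      also have "\<dots> = n r' ^ (e - 1) * n r ^ (e - 1) * (a r * n r) * (a r' * n r' * DG k)"
        unfolding key[OF r(1) k, symmetric] by (simp add: algebra_simps)
      also have "\<dots> = ev (gc m d \<Lambda> ps r) x * ev (der (\<Lambda> k) (gc m d \<Lambda> ps r')) x * G"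
        unfolding key[OF r(2) k] by (simp add: gs dg' algebra_simps)
      finally show False using W G by simp
    qed
    then show ?thesis by (simp add: G_def g)
  qed
qed

section \<open>The solution set\<close>

text \<open>
  The coordinates \<open>s\<close> and \<open>4l + s\<close> of \<open>x\<close> are \<open>h\<^sub>s\<close> and \<open>n\<^sub>s\<close>, for \<open>s < 4l\<close>; the group of \<open>s\<close> is \<open>s div l\<close>.
\<close>

definition SB :: "nat \<Rightarrow> nat \<Rightarrow> int \<Rightarrow> (nat \<Rightarrow> int) set" where
  "SB l d M = {x. (\<forall>j\<ge>8 * l. x j = 0) \<and> (\<forall>s<4 * l. \<bar>x s\<bar> \<le> M \<and> 1 \<le> x (4 * l + s) \<and> x (4 * l + s) \<le> M) \<and>
     (\<forall>s<4 * l. \<forall>s'<4 * l. s \<noteq> s' \<longrightarrow> s div l = s' div l \<longrightarrow> x (4 * l + s) \<noteq> x (4 * l + s')) \<and>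
     (\<forall>g<4. (\<exists>s<4 * l. s div l = g \<and> x s \<noteq> 0) \<and> (\<Sum>s | s < 4 * l \<and> s div l = g. x s) = 0) \<and>
     (\<Sum>s<4 * l. x s * x (4 * l + s) ^ d) = 0}"

lemma SB_D:
  assumes "x \<in> SB l d M"
  shows "\<And>j. j \<ge> 8 * l \<Longrightarrow> x j = 0" "\<And>s. s < 4 * l \<Longrightarrow> 1 \<le> x (4 * l + s)" "\<And>s. s < 4 * l \<Longrightarrow> x (4 * l + s) \<le> M"
    "\<And>s s'. s < 4 * l \<Longrightarrow> s' < 4 * l \<Longrightarrow> s \<noteq> s' \<Longrightarrow> s div l = s' div l \<Longrightarrow> x (4 * l + s) \<noteq> x (4 * l + s')"
    "\<And>g. g < 4 \<Longrightarrow> \<exists>s<4 * l. s div l = g \<and> x s \<noteq> 0" "\<And>g. g < 4 \<Longrightarrow> (\<Sum>s | s < 4 * l \<and> s div l = g. x s) = 0"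
    "(\<Sum>s<4 * l. x s * x (4 * l + s) ^ d) = 0"
  proof -
  note h = assms[unfolded SB_def mem_Collect_eq]
  note h2 = conjunct2[OF h] note h3 = conjunct2[OF h2] note h4 = conjunct2[OF h3]
  show "\<And>j. j \<ge> 8 * l \<Longrightarrow> x j = 0" by (rule conjunct1[OF h, rule_format])
  show "\<And>s. s < 4 * l \<Longrightarrow> 1 \<le> x (4 * l + s)" "\<And>s. s < 4 * l \<Longrightarrow> x (4 * l + s) \<le> M"
    using conjunct1[OF h2] by simp_all
  show "\<And>s s'. s < 4 * l \<Longrightarrow> s' < 4 * l \<Longrightarrow> s \<noteq> s' \<Longrightarrow> s div l = s' div l \<Longrightarrow> x (4 * l + s) \<noteq> x (4 * l + s')"
    by (rule conjunct1[OF h3, rule_format])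
  show "\<And>g. g < 4 \<Longrightarrow> \<exists>s<4 * l. s div l = g \<and> x s \<noteq> 0" "\<And>g. g < 4 \<Longrightarrow> (\<Sum>s | s < 4 * l \<and> s div l = g. x s) = 0"
    using conjunct1[OF h4] by simp_all
  show "(\<Sum>s<4 * l. x s * x (4 * l + s) ^ d) = 0" by (rule conjunct2[OF h4])
qed

lemma SB_bound: assumes "x \<in> SB l d M" "M \<ge> 0" shows "\<bar>x j\<bar> \<le> M"
proof (cases "j < 4 * l")
  case True
  then show ?thesis using assms by (auto simp: SB_def)
next
  case False
  show ?thesis
  proof (cases "j < 8 * l")
    case True
    then obtain s where s: "j = 4 * l + s" "s < 4 * l" using False by (metis add_diff_inverse_nat less_diff_conv2 mult_2 not_less add.commute add_less_cancel_left distrib_right numeral_Bit0)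
    then show ?thesis using SB_D(2,3)[OF assms(1), of s] by auto
  next
    case False
    then show ?thesis using SB_D(1)[OF assms(1)] assms by auto
  qed
qed

lemma card_le_coords:
  fixes M :: int
  assumes "finite I" "M \<ge> 0" "\<And>x j. x \<in> S \<Longrightarrow> \<bar>x j\<bar> \<le> M"
    and "\<And>x y. x \<in> S \<Longrightarrow> y \<in> S \<Longrightarrow> (\<And>i. i \<in> I \<Longrightarrow> x i = (y i :: int)) \<Longrightarrow> x = y"
  shows "finite S" "card S \<le> nat (2 * M + 1) ^ card I"
proof -
  have inj: "inj_on (\<lambda>x. restrict x I) S"
    by (rule inj_onI, rule assms(4)) (auto simp: restrict_def fun_eq_iff, metis)
  have sub: "(\<lambda>x. restrict x I) ` S \<subseteq> PiE I (\<lambda>_. {-M..M})"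
    using assms(3) by (auto simp: abs_le_iff) (metis abs_le_D2 minus_le_iff)
  have fin: "finite (PiE I (\<lambda>_. {-M..M}))" using assms(1) by (intro finite_PiE) auto
  then show "finite S" using inj sub by (meson finite_imageD finite_subset)
  have "card S \<le> card (PiE I (\<lambda>_. {-M..M}))" using inj sub fin by (rule card_inj_on_le)
  also have "\<dots> = nat (2 * M + 1) ^ card I" using assms(1) by (simp add: card_PiE algebra_simps)
  finally show "card S \<le> nat (2 * M + 1) ^ card I" .
qed

lemma SB_finite: assumes "M \<ge> 0" shows "finite (SB l d M)" "card (SB l d M) \<le> nat (2 * M + 1) ^ (8 * l)"
proof -
  have *: "x = y" if "x \<in> SB l d M" "y \<in> SB l d M" "\<And>i. i \<in> {..<8 * l} \<Longrightarrow> x i = y i" for x y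
  proof
    fix j show "x j = y j" using that SB_D(1)[OF that(1), of j] SB_D(1)[OF that(2), of j] by (cases "j < 8 * l") auto
  qed
  show "finite (SB l d M)" "card (SB l d M) \<le> nat (2 * M + 1) ^ (8 * l)"
    using card_le_coords[of "{..<8 * l}" M "SB l d M"] SB_bound * assms by auto
qed

text \<open>A count of parameters. In each class the \<open>n\<close> at one pivot determines all
  others, and the class sum determines the \<open>h\<close> at the pivot; one \<open>n\<close> per
  class and the \<open>h\<close> off the pivots make \<open>4 * l\<close> parameters. The group sums
  impose linear conditions on the latter, and two of these are independent, since an index and its
  pivot meet at most two of the four groups.\<close>

lemma terminal_count:
  fixes cls :: "nat \<Rightarrow> nat" and M :: int
  assumes l: "l \<ge> 1" and d: "d \<ge> 1" and M: "M \<ge> 1" and S: "S \<subseteq> SB l d M"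
    and ratio: "\<And>x y s s'. x \<in> S \<Longrightarrow> y \<in> S \<Longrightarrow> s < 4 * l \<Longrightarrow> s' < 4 * l \<Longrightarrow> cls s = cls s' \<Longrightarrow>
        x (4 * l + s) * y (4 * l + s') = x (4 * l + s') * y (4 * l + s)"
    and csum: "\<And>x c. x \<in> S \<Longrightarrow> (\<Sum>s | s < 4 * l \<and> cls s = c. x s * x (4 * l + s) ^ d) = 0"
  shows "card S \<le> nat (2 * M + 1) ^ (4 * l - 2)"
proof (cases "S = {}")
  case False
  then obtain y where y: "y \<in> S" by blast
  note yB = SB_D[OF subsetD[OF S y]]
  let ?m = "4 * l"
  define w where "w s = (of_int (y (?m + s)) :: rat) ^ d" for s
  have ypos: "y (?m + s) > 0" if "s < ?m" for s using yB(2)[OF that] by simp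
  have wpos: "w s > 0" if "s < ?m" for s using ypos[OF that] by (simp add: w_def)
  define pv where "pv s = (LEAST t. t < ?m \<and> cls t = cls s)" for s
  have pv: "pv s < ?m" "cls (pv s) = cls s" if "s < ?m" for s
    using LeastI[of "\<lambda>t. t < ?m \<and> cls t = cls s" s] that by (auto simp: pv_def)
  have pv_eq: "pv s = pv t" if "cls s = cls t" for s t using that by (simp add: pv_def)
  have pvpv: "pv (pv s) = pv s" if "s < ?m" for s using pv[OF that] by (intro pv_eq) auto
  define NP where "NP = {s. s < ?m \<and> pv s \<noteq> s}"
  \<comment> \<open>The coefficient of the \<open>h\<close> at \<open>i\<close> in the sum over
    group \<open>g\<close> once the \<open>h\<close> at the pivots are eliminated: \<open>i\<close>
    enters directly and through its pivot. The weights come from the reference point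
    \<open>y\<close>, because within a class the \<open>n\<close> are proportional over all of
    \<open>S\<close>.\<close>
  define cf where "cf i g = (if i div l = g then 1 else 0) - (if pv i div l = g then w i / w (pv i) else (0::rat))" for i g
  have wsum: "(\<Sum>s | s < ?m \<and> cls s = c. of_int (x s) * w s) = 0" if x: "x \<in> S" for x c
  proof (cases "\<exists>p<?m. cls p = c")
    case True
    then obtain p where p: "p < ?m" "cls p = c" by blast
    have "(\<Sum>s | s < ?m \<and> cls s = c. x s * (x (?m + s) ^ d * y (?m + p) ^ d)) = 0"
      using csum[OF x, of c] by (simp add: sum_distrib_right[symmetric] mult.assoc[symmetric])
    also have "(\<Sum>s | s < ?m \<and> cls s = c. x s * (x (?m + s) ^ d * y (?m + p) ^ d))
      = (\<Sum>s | s < ?m \<and> cls s = c. x s * (x (?m + p) ^ d * y (?m + s) ^ d))"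
      using ratio[OF x y _ p(1)] p(2) by (intro sum.cong refl) (auto simp: power_mult_distrib[symmetric])
    also have "\<dots> = x (?m + p) ^ d * (\<Sum>s | s < ?m \<and> cls s = c. x s * y (?m + s) ^ d)"
      by (simp add: sum_distrib_left algebra_simps)
    finally have "(\<Sum>s | s < ?m \<and> cls s = c. x s * y (?m + s) ^ d) = 0"
      using SB_D(2)[OF subsetD[OF S x] p(1)] by auto
    then have "(of_int (\<Sum>s | s < ?m \<and> cls s = c. x s * y (?m + s) ^ d) :: rat) = 0" by (simp only: of_int_0)
    then show ?thesis by (simp add: w_def)
  next
    case False
    then have "{s. s < ?m \<and> cls s = c} = {}" by blast
    then show ?thesis by (simp only: sum.empty)
  qed
  have wdist: "w s \<noteq> w t" if "s < ?m" "t < ?m" "s \<noteq> t" "s div l = t div l" for s t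
  proof
    assume "w s = w t"
    then have "y (?m + s) ^ d = y (?m + t) ^ d" unfolding w_def by (metis of_int_eq_iff of_int_power)
    then have "y (?m + s) = y (?m + t)" using ypos[OF that(1)] ypos[OF that(2)] d
      by (metis less_imp_le power_eq_imp_eq_base zero_less_one less_le_trans)
    then show False using yB(4)[OF that(1,2,3,4)] by simp
  qed
  \<comment> \<open>A nonzero \<open>h\<close> in the group cannot be alone in its class, as the
    class sum vanishes. The coefficient found is 1, a negative weight quotient, or 1 minus such a
    quotient; the last is nonzero because the \<open>n\<close> within a group are distinct.\<close>
  have cov: "\<exists>i\<in>NP. cf i g \<noteq> 0" if g: "g < 4" for g
  proof -
    obtain s where s: "s < ?m" "s div l = g" "y s \<noteq> 0" using yB(5)[OF g] by blast
    have "\<exists>i. i < ?m \<and> i \<noteq> s \<and> cls i = cls s"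
    proof (rule ccontr)
      assume "\<not> ?thesis"
      then have "{t. t < ?m \<and> cls t = cls s} = {s}" using s by auto
      then have "of_int (y s) * w s = 0" using wsum[OF y, of "cls s"] by simp
      then show False using s wpos[OF s(1)] by simp
    qed
    then obtain i where i: "i < ?m" "i \<noteq> s" "cls i = cls s" by blast
    show ?thesis
    proof (cases "pv s = s")
      case True
      then have "pv i = s" using pv_eq i by metis
      moreover have "w i / w s \<noteq> 1" if "i div l = g" using wdist[OF i(1) s(1) i(2)] that s wpos[OF s(1)] by auto
      moreover have "w i / w s \<noteq> 0" using wpos[OF s(1)] wpos[OF i(1)] by auto
      ultimately show ?thesis using i s by (intro bexI[of _ i]) (auto simp: cf_def NP_def)
    next
      case False
      then have "w s / w (pv s) \<noteq> 1" if "pv s div l = g" using wdist[OF s(1) pv(1)[OF s(1)]] that s wpos[OF pv(1)[OF s(1)]] by auto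
      then show ?thesis using False s by (intro bexI[of _ s]) (auto simp: cf_def NP_def)
    qed
  qed
  obtain i1 where i1: "i1 \<in> NP" "cf i1 0 \<noteq> 0" using cov[of 0] by auto
  \<comment> \<open>In a group containing neither \<open>i1\<close> nor its pivot, \<open>i1\<close>
    has coefficient 0, so the system for \<open>i1\<close> and \<open>i2\<close> is
    triangular.\<close>
  have "\<exists>g. g < 4 \<and> g \<noteq> i1 div l \<and> g \<noteq> pv i1 div l"
  proof -
    have "card ({..<4::nat} - {i1 div l, pv i1 div l}) \<ge> card {..<4::nat} - card {i1 div l, pv i1 div l}"
      by (intro diff_card_le_card_Diff) auto
    moreover have "card {i1 div l, pv i1 div l} \<le> 2" by (simp add: card_insert_if)
    ultimately have "{..<4::nat} - {i1 div l, pv i1 div l} \<noteq> {}" by (metis card.empty card_lessThan diff_is_0_eq le_zero_eq numeral_le_iff order_trans semiring_norm(69) semiring_norm(71) semiring_norm(72) zero_less_numeral not_le)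
    then show ?thesis by auto
  qed
  then obtain g2 where g2: "g2 < 4" "g2 \<noteq> i1 div l" "g2 \<noteq> pv i1 div l" by blast
  then have cf12: "cf i1 g2 = 0" by (simp add: cf_def)
  obtain i2 where i2: "i2 \<in> NP" "cf i2 g2 \<noteq> 0" using cov[OF g2(1)] by blast
  have i12: "i1 \<noteq> i2" using cf12 i2 by auto
  define P where "P = {s. s < ?m \<and> pv s = s}"
  define I where "I = (\<lambda>s. ?m + s) ` P \<union> (NP - {i1, i2})"
  have finP: "finite P" "finite NP" by (auto simp: P_def NP_def)
  have "card I \<le> card P + (card NP - 2)"
    unfolding I_def using card_image_le[OF finP(1), of "\<lambda>s. ?m + s"] i1 i2 i12 finP
    by (intro order_trans[OF card_Un_le]) (auto simp: card_Diff_subset)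
  moreover have "card P + card NP = ?m"
  proof -
    have "card P + card NP = card (P \<union> NP)" by (rule card_Un_disjoint[symmetric]) (auto simp: P_def NP_def)
    also have "P \<union> NP = {..<?m}" by (auto simp: P_def NP_def)
    finally show ?thesis by simp
  qed
  moreover have "card NP \<ge> 2" using card_mono[of NP "{i1, i2}"] finP i1 i2 i12 by auto
  ultimately have cI: "card I \<le> ?m - 2" by linarith
  have finI: "finite I" using finP by (auto simp: I_def)
  have determined: "x = x'" if x: "x \<in> S" and x': "x' \<in> S" and eq: "\<And>i. i \<in> I \<Longrightarrow> x i = x' i" for x x'
  proof -
    define \<delta> where "\<delta> s = (of_int (x s - x' s) :: rat)" for s
    have \<delta>0: "\<delta> i = 0" if "i \<in> NP" "i \<noteq> i1" "i \<noteq> i2" for i using eq[of i] that by (auto simp: \<delta>_def I_def)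
    have \<delta>w: "(\<Sum>s | s < ?m \<and> cls s = c. \<delta> s * w s) = 0" for c
      using wsum[OF x, of c] wsum[OF x', of c] by (simp add: \<delta>_def left_diff_distrib sum_subtractf)
    have dpv: "\<delta> p = - (\<Sum>i | i \<in> NP \<and> pv i = p. \<delta> i * (w i / w p))" if p: "p \<in> P" for p
    proof -
      have pm: "p < ?m" "pv p = p" using p by (auto simp: P_def)
      have "{s. s < ?m \<and> cls s = cls p} = insert p {i. i \<in> NP \<and> pv i = p}"
      proof (intro equalityI subsetI)
        fix s assume "s \<in> {s. s < ?m \<and> cls s = cls p}"
        then have "s < ?m" "pv s = p" using pv_eq[of s p] pm by auto
        then show "s \<in> insert p {i. i \<in> NP \<and> pv i = p}" by (auto simp: NP_def)
      next
        fix s assume "s \<in> insert p {i. i \<in> NP \<and> pv i = p}"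
        then have "s = p \<or> s < ?m \<and> pv s = p" by (auto simp: NP_def)
        then show "s \<in> {s. s < ?m \<and> cls s = cls p}" using pm pv(2)[of s] by auto
      qed
      moreover have "p \<notin> {i. i \<in> NP \<and> pv i = p}" using p by (auto simp: P_def NP_def)
      ultimately have "\<delta> p * w p + (\<Sum>i | i \<in> NP \<and> pv i = p. \<delta> i * w i) = 0"
        using \<delta>w[of "cls p"] finP by simp
      then have "\<delta> p = - (\<Sum>i | i \<in> NP \<and> pv i = p. \<delta> i * w i) / w p"
        using wpos[OF pm(1)] by (simp add: field_simps eq_neg_iff_add_eq_0)
      then show ?thesis by (simp add: sum_divide_distrib)
    qed
    have K: "(\<Sum>i\<in>NP. \<delta> i * cf i g) = 0" if g: "g < 4" for g
    proof -
      have "(of_int ((\<Sum>s | s < ?m \<and> s div l = g. x s) - (\<Sum>s | s < ?m \<and> s div l = g. x' s)) :: rat) = 0"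
        using SB_D(6)[OF subsetD[OF S x] g] SB_D(6)[OF subsetD[OF S x'] g] by simp
      then have "(\<Sum>s | s < ?m \<and> s div l = g. \<delta> s) = 0" by (simp add: \<delta>_def sum_subtractf)
      also have "{s. s < ?m \<and> s div l = g} = {s \<in> NP. s div l = g} \<union> {s \<in> P. s div l = g}" by (auto simp: P_def NP_def)
      also have "(\<Sum>s\<in>\<dots>. \<delta> s) = (\<Sum>s\<in>{s \<in> NP. s div l = g}. \<delta> s) + (\<Sum>s\<in>{s \<in> P. s div l = g}. \<delta> s)"
        by (rule sum.union_disjoint) (auto simp: P_def NP_def)
      also have "(\<Sum>s\<in>{s \<in> NP. s div l = g}. \<delta> s) = (\<Sum>s\<in>NP. if s div l = g then \<delta> s else 0)"
        using finP by (simp add: sum.inter_filter)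
      also have "(\<Sum>s\<in>{s \<in> P. s div l = g}. \<delta> s) = (\<Sum>s\<in>P. if s div l = g then \<delta> s else 0)"
        using finP by (simp add: sum.inter_filter)
      also have "\<dots> = (\<Sum>p\<in>P. \<Sum>i | i \<in> NP \<and> pv i = p. - (if pv i div l = g then \<delta> i * (w i / w (pv i)) else 0))"
        by (intro sum.cong refl) (auto simp: dpv sum_negf)
      also have "\<dots> = (\<Sum>i\<in>NP. - (if pv i div l = g then \<delta> i * (w i / w (pv i)) else 0))"
        using sum.group[of NP P pv "\<lambda>i. - (if pv i div l = g then \<delta> i * (w i / w (pv i)) else 0)"] finP pv pvpv
        by (force simp: P_def NP_def)
      also have "(\<Sum>s\<in>NP. if s div l = g then \<delta> s else 0) + \<dots> = (\<Sum>i\<in>NP. \<delta> i * cf i g)"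
        by (simp only: sum.distrib[symmetric]) (intro sum.cong refl, auto simp: cf_def algebra_simps)
      finally show ?thesis .
    qed
    have two: "(\<Sum>i\<in>NP. \<delta> i * cf i g) = \<delta> i1 * cf i1 g + \<delta> i2 * cf i2 g" for g
    proof -
      have "(\<Sum>i\<in>NP. \<delta> i * cf i g) = (\<Sum>i\<in>{i1, i2}. \<delta> i * cf i g)"
        by (rule sum.mono_neutral_right) (use finP i1 i2 \<delta>0 in auto)
      then show ?thesis using i12 by simp
    qed
    have "\<delta> i2 = 0" using K[OF g2(1)] two[of g2] cf12 i2 by simp
    moreover from this have "\<delta> i1 = 0" using K[of 0] two[of 0] i1 by simp
    ultimately have NP0: "\<delta> i = 0" if "i \<in> NP" for i using \<delta>0 that by (cases "i = i1 \<or> i = i2") auto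
    then have P0: "\<delta> p = 0" if "p \<in> P" for p using dpv[OF that] by (simp add: sum.neutral)
    have h: "x s = x' s" if "s < ?m" for s
    proof -
      have "\<delta> s = 0" using that NP0 P0 by (cases "pv s = s") (auto simp: NP_def P_def)
      then show ?thesis by (simp add: \<delta>_def)
    qed
    have n: "x (?m + s) = x' (?m + s)" if s: "s < ?m" for s
    proof -
      define p where "p = pv s"
      have p: "p \<in> P" "p < ?m" "cls p = cls s" using pv[OF s] pvpv[OF s] by (auto simp: p_def P_def)
      then have "x (?m + p) = x' (?m + p)" using eq[of "?m + p"] by (auto simp: I_def)
      moreover have "x (?m + s) * x' (?m + p) = x (?m + p) * x' (?m + s)" using ratio[OF x x' s p(2)] p(3) by simp
      ultimately show ?thesis using SB_D(2)[OF subsetD[OF S x] p(2)] by auto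
    qed
    show "x = x'"
    proof
      fix j
      consider "j < ?m" | "?m \<le> j" "j - ?m < ?m" | "8 * l \<le> j" by linarith
      then show "x j = x' j"
      proof cases
        case 2 then show ?thesis using n[of "j - ?m"] by simp
      next
        case 3 then show ?thesis using SB_D(1)[OF subsetD[OF S x], of j] SB_D(1)[OF subsetD[OF S x'], of j] by simp
      qed (use h in auto)
    qed
  qed
  have "card S \<le> nat (2 * M + 1) ^ card I"
  proof (rule card_le_coords(2)[OF finI])
    show "\<bar>x j\<bar> \<le> M" if "x \<in> S" for x j using SB_bound[OF subsetD[OF S that]] M by simp
  qed (use M determined in auto)
  also have "\<dots> \<le> nat (2 * M + 1) ^ (?m - 2)" using cI M by (intro power_increasing) auto
  finally show ?thesis .
qed auto

section \<open>Descent on the dimension\<close>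

lemma card_le_labels:
  assumes "finite S" "finite L" "lab ` S \<subseteq> L" "\<And>y. y \<in> L \<Longrightarrow> card {x \<in> S. lab x = y} \<le> c"
  shows "card S \<le> card L * c"
proof -
  have "card S = card (\<Union>y\<in>L. {x \<in> S. lab x = y})" using assms(3) by (intro arg_cong[of _ _ card]) auto
  also have "\<dots> \<le> (\<Sum>y\<in>L. card {x \<in> S. lab x = y})" by (rule card_UN_le[OF assms(2)])
  also have "\<dots> \<le> (\<Sum>y\<in>L. c)" by (intro sum_mono assms(4))
  finally show ?thesis by simp
qed

lemma word_finite: "finite A \<Longrightarrow> finite {us. set us \<subseteq> A \<and> length us \<le> n}"
  by (rule finite_lists_length_le)

text \<open>Coordinates are bounded by \<open>G ^ k0\<close> and moduli are at least
  \<open>G ^ k1\<close>; auxiliary polynomials have degree \<open>D\<close> and coefficients up to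
  \<open>G ^ b\<close>, and congruences are taken modulo the \<open>T0\<close>-th power.
  \<open>many\<close> and \<open>small\<close> are the two inequalities of the pigeonhole argument,
  compared as exponents of \<open>G\<close>, with \<open>Suc k1\<close> because a modulus may exceed
  \<open>G ^ k1\<close> by a factor of order \<open>G\<close>. \<open>weight\<close> makes the
  coefficients of the elimination, squared, smaller than the power of \<open>n\<close> that
  remains.\<close>

locale count =
  fixes l d k0 k1 D b T0 :: nat
  assumes l2: "l \<ge> 2" and k0: "k0 \<ge> 1" and d4: "4 * l < d"
    and many: "\<And>t. t \<le> 8 * l - 5 \<Longrightarrow> Suc k1 * ((T0 + t) choose Suc t) < b * ((D + Suc t) choose Suc t)"
    and small: "b + k0 * D < k1 * T0"
    and weight: "2 * (2 ^ (4 * l) * (3 * k0 + 8 * l * (b + k0 * D))) \<le> d - 4 * l"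
begin

text \<open>Exponents of \<open>G\<close> lost on the way. Merging two classes costs
  \<open>c2\<close>: \<open>8 * l + 1\<close> labels of size about \<open>G ^ 2\<close>, and then
  about \<open>G ^ 2\<close> values of a ratio. One dimension costs \<open>cc\<close>: labels of
  size about \<open>G ^ Suc k1\<close>, and then at most \<open>4 * l\<close> merges.
  \<open>AA\<close> adds this to the terminal count.\<close>

definition c2 :: nat where "c2 = 2 * (8 * l + 1) + 2"
definition cc :: nat where "cc = Suc k1 * (8 * l + 1) + 4 * l * c2"
definition AA :: "nat \<Rightarrow> nat" where "AA t = (4 * l - 2) * k0 + t * cc"

definition bx :: "nat \<Rightarrow> int" where "bx G = int G ^ k0"

text \<open>Height and degree polynomial in the scale. One \<open>K\<close> serves as factor,
  exponent and degree, since only its independence of \<open>G\<close> matters.\<close>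

definition okb :: "nat \<Rightarrow> nat \<Rightarrow> pexp \<Rightarrow> bool" where
  "okb G K E \<longleftrightarrow> bd (bx G) E \<le> int K * int G ^ K \<and> dg E \<le> K"

text \<open>The bound \<open>K\<close> may change from level to level, but not with
  \<open>G\<close>. Because \<open>\<Delta>\<close> is nonzero with controlled height at every
  point, a suitable modulus coprime to it exists and \<open>hens\<close> becomes applicable. The
  last clause makes the derivations vanish on the coordinates that are 0 throughout
  \<open>SB\<close>.\<close>

definition state :: "nat \<Rightarrow> nat \<Rightarrow> (nat \<Rightarrow> int) set \<Rightarrow> nat set \<Rightarrow> (nat \<Rightarrow> nat \<Rightarrow> pexp) \<Rightarrow> pexp \<Rightarrow> bool" where
  "state G K S V \<Theta> \<Delta> \<longleftrightarrow> S \<subseteq> SB l d (bx G) \<and> V \<subseteq> {..<8 * l} \<and> hens S V \<Theta> \<Delta> \<and> tang S V \<Theta> \<Delta> \<and>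
     (\<forall>x\<in>S. ev \<Delta> x \<noteq> 0) \<and> okb G K \<Delta> \<and> (\<forall>k\<in>V. \<forall>j. okb G K (\<Theta> k j)) \<and>
     (\<forall>x\<in>S. \<forall>k\<in>V. \<forall>j\<ge>8 * l. ev (\<Theta> k j) x = 0)"

lemma bx1: "G \<ge> 1 \<Longrightarrow> bx G \<ge> 1" by (simp add: bx_def)

lemma state_subset: "state G K S V \<Theta> \<Delta> \<Longrightarrow> S' \<subseteq> S \<Longrightarrow> state G K S' V \<Theta> \<Delta>"
  unfolding state_def tang_def by (blast intro: hens_subset)

lemma state_finV: "state G K S V \<Theta> \<Delta> \<Longrightarrow> finite V"
  unfolding state_def by (meson finite_lessThan finite_subset)

lemma state_fin: "state G K S V \<Theta> \<Delta> \<Longrightarrow> finite S"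
  unfolding state_def bx_def using finite_subset[OF _ SB_finite(1)[of "int G ^ k0" l d]] by simp

lemma state_bound: "state G K S V \<Theta> \<Delta> \<Longrightarrow> x \<in> S \<Longrightarrow> \<bar>x j\<bar> \<le> bx G"
  unfolding state_def bx_def using SB_bound[of x l d "int G ^ k0" j] by auto

lemma state_ev: "state G K S V \<Theta> \<Delta> \<Longrightarrow> x \<in> S \<Longrightarrow> okb G K' E \<Longrightarrow> \<bar>ev E x\<bar> \<le> int K' * int G ^ K'"
  unfolding okb_def using ev_bd[of x "bx G" E] state_bound by (meson order_trans)

lemma okb_mono: "okb G K E \<Longrightarrow> K \<le> K' \<Longrightarrow> G \<ge> 1 \<Longrightarrow> okb G K' E"
proof -
  assume a: "okb G K E" "K \<le> K'" "G \<ge> 1"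
  have "int K * int G ^ K \<le> int K' * int G ^ K'" using a by (intro mult_mono power_increasing) auto
  then show ?thesis using a by (auto simp: okb_def)
qed

lemma okb_Mul: assumes "okb G K A" "okb G K' B" "G \<ge> 1" shows "okb G (K * K' + K + K') (Mul A B)"
proof -
  have "bd (bx G) A * bd (bx G) B \<le> (int K * int G ^ K) * (int K' * int G ^ K')"
    using assms bd_nonneg[of "bx G"] by (intro mult_mono) (auto simp: okb_def bx_def)
  also have "\<dots> = int (K * K') * int G ^ (K + K')" by (simp add: power_add)
  also have "\<dots> \<le> int (K * K' + K + K') * int G ^ (K * K' + K + K')"
    using assms(3) by (intro mult_mono power_increasing) auto
  finally show ?thesis using assms by (auto simp: okb_def)
qed

lemma okb_Add: assumes "okb G K A" "okb G K' B" "G \<ge> 1" shows "okb G (K + K') (Add A B)"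
proof -
  have "int K * int G ^ K \<le> int K * int G ^ (K + K')" "int K' * int G ^ K' \<le> int K' * int G ^ (K + K')"
    using assms(3) by (auto intro!: mult_left_mono power_increasing)
  then have "bd (bx G) A + bd (bx G) B \<le> int K * int G ^ (K + K') + int K' * int G ^ (K + K')"
    using assms(1,2) unfolding okb_def by linarith
  then show ?thesis using assms by (auto simp: okb_def algebra_simps)
qed

lemma okb_Con: "G \<ge> 1 \<Longrightarrow> \<bar>c\<bar> \<le> int K \<Longrightarrow> okb G K (Con c)"
proof -
  assume a: "G \<ge> 1" "\<bar>c\<bar> \<le> int K"
  have "int K * 1 \<le> int K * int G ^ K" using a by (intro mult_left_mono) auto
  then show ?thesis using a by (simp add: okb_def)
qed

lemma okb_der: assumes "okb G K E" "\<And>j. okb G K' (\<Theta> j)" "G \<ge> 1" shows "okb G (K * K * K' + K + K') (der \<Theta> E)"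
proof -
  have "bd (bx G) (der \<Theta> E) \<le> int (dg E) * bd (bx G) E * (int K' * int G ^ K')"
    by (rule bd_der) (use assms bx1 in \<open>auto simp: okb_def\<close>)
  also have "\<dots> \<le> int K * (int K * int G ^ K) * (int K' * int G ^ K')"
    using assms bd_nonneg[of "bx G"] by (intro mult_mono) (auto simp: okb_def bx_def)
  also have "\<dots> = int (K * K * K') * int G ^ (K + K')" by (simp add: power_add)
  also have "\<dots> \<le> int (K * K * K' + K + K') * int G ^ (K * K * K' + K + K')"
    using assms(3) by (intro mult_mono power_increasing) auto
  finally have 1: "bd (bx G) (der \<Theta> E) \<le> int (K * K * K' + K + K') * int G ^ (K * K * K' + K + K')" .
  have "dg (der \<Theta> E) \<le> dg E + K'" by (rule dg_der) (use assms in \<open>auto simp: okb_def\<close>)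
  then show ?thesis using 1 assms by (auto simp: okb_def)
qed

definition Plev :: "nat \<Rightarrow> bool" where
  "Plev t \<longleftrightarrow> (\<forall>K. \<exists>C. \<forall>G\<ge>2. \<forall>S V \<Theta> \<Delta>. state G K S V \<Theta> \<Delta> \<longrightarrow> card V = t \<longrightarrow> card S \<le> C * G ^ AA (Suc t))"

text \<open>The case of a further equation that is transversal to the variety at every point.
  \<open>dropP (Suc t)\<close> follows from \<open>Plev t\<close> by solving for one parameter; the
  substance is the passage from \<open>dropP t\<close> to \<open>Plev t\<close>.\<close>

definition dropP :: "nat \<Rightarrow> bool" where
  "dropP t \<longleftrightarrow> (\<forall>K. \<exists>C. \<forall>G\<ge>2. \<forall>S V \<Theta> \<Delta> i E. state G K S V \<Theta> \<Delta> \<longrightarrow> card V = t \<longrightarrow> i \<in> V \<longrightarrow> okb G K E \<longrightarrow>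
      (\<forall>x\<in>S. ev E x = 0 \<and> ev (der (\<Theta> i) E) x \<noteq> 0) \<longrightarrow> card S \<le> C * G ^ AA t)"

lemma state_step:
  "\<exists>K'. \<forall>G\<ge>1. \<forall>S V \<Theta> \<Delta> i E. state G K S V \<Theta> \<Delta> \<longrightarrow> i \<in> V \<longrightarrow> okb G K E \<longrightarrow>
     (\<forall>x\<in>S. ev E x = 0 \<and> ev (der (\<Theta> i) E) x \<noteq> 0) \<longrightarrow>
     state G K' S (V - {i}) (\<lambda>k j. Add (Mul (der (\<Theta> i) E) (\<Theta> k j)) (Mul (Con (-1)) (Mul (der (\<Theta> k) E) (\<Theta> i j))))
      (Mul \<Delta> (der (\<Theta> i) E))"
proof -
  define K1 where "K1 = K * K * K + K + K"
  define K2 where "K2 = K1 * K + K1 + K"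
  define K3 where "K3 = K2 + (1 * K2 + 1 + K2)"
  define K' where "K' = K3 + (K * K1 + K + K1)"
  show ?thesis
  proof (rule exI[of _ K'], intro allI impI)
    fix G S V \<Theta> \<Delta> i E
    assume G: "G \<ge> 1" and st: "state G K S V \<Theta> \<Delta>" and i: "i \<in> V" and E: "okb G K E"
      and z: "\<forall>x\<in>S. ev E x = 0 \<and> ev (der (\<Theta> i) E) x \<noteq> 0"
    have th: "okb G K (\<Theta> k j)" if "k \<in> V" for k j using st that by (auto simp: state_def)
    have d1: "okb G K1 (der (\<Theta> k) E)" if "k \<in> V" for k
      unfolding K1_def by (rule okb_der[OF E _ G]) (use th that in auto)
    have m1: "okb G K2 (Mul (der (\<Theta> k) E) (\<Theta> k' j))" if "k \<in> V" "k' \<in> V" for k k' j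
      unfolding K2_def by (rule okb_Mul[OF d1 th G]) (use that in auto)
    have t1: "okb G K3 (Add (Mul (der (\<Theta> i) E) (\<Theta> k j)) (Mul (Con (-1)) (Mul (der (\<Theta> k) E) (\<Theta> i j))))" if "k \<in> V" for k j
      unfolding K3_def by (rule okb_Add[OF m1 okb_Mul[OF okb_Con m1]]) (use i that G in auto)
    have D: "okb G (K * K1 + K + K1) (Mul \<Delta> (der (\<Theta> i) E))"
      by (rule okb_Mul[OF _ d1[OF i] G]) (use st in \<open>auto simp: state_def\<close>)
    show "state G K' S (V - {i}) (\<lambda>k j. Add (Mul (der (\<Theta> i) E) (\<Theta> k j)) (Mul (Con (-1)) (Mul (der (\<Theta> k) E) (\<Theta> i j))))
      (Mul \<Delta> (der (\<Theta> i) E))"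
      unfolding state_def
    proof (intro conjI ballI allI impI)
      show "hens S (V - {i}) (\<lambda>k j. Add (Mul (der (\<Theta> i) E) (\<Theta> k j)) (Mul (Con (-1)) (Mul (der (\<Theta> k) E) (\<Theta> i j))))
        (Mul \<Delta> (der (\<Theta> i) E))"
        by (rule hens_step) (use st i z in \<open>auto simp: state_def\<close>)
      show "tang S (V - {i}) (\<lambda>k j. Add (Mul (der (\<Theta> i) E) (\<Theta> k j)) (Mul (Con (-1)) (Mul (der (\<Theta> k) E) (\<Theta> i j))))
        (Mul \<Delta> (der (\<Theta> i) E))"
        by (rule tang_step) (use st i in \<open>auto simp: state_def\<close>)
      show "okb G K' (Mul \<Delta> (der (\<Theta> i) E))" by (rule okb_mono[OF D _ G]) (simp add: K'_def)
      fix k j assume "k \<in> V - {i}"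
      then show "okb G K' (Add (Mul (der (\<Theta> i) E) (\<Theta> k j)) (Mul (Con (-1)) (Mul (der (\<Theta> k) E) (\<Theta> i j))))"
        by (intro okb_mono[OF t1 _ G]) (auto simp: K'_def)
    qed (use st i z in \<open>auto simp: state_def\<close>)
  qed
qed

text \<open>Vacuous: without parameters there is no direction in which a derivative could be
  nonzero.\<close>

lemma drop_0: "dropP 0"
  unfolding dropP_def using state_finV card_0_eq by (metis empty_iff)

lemma drop_Suc: assumes "Plev t" shows "dropP (Suc t)"
  unfolding dropP_def
proof
  fix K
  obtain K' where K': "\<And>G S V \<Theta> \<Delta> i E. G \<ge> 1 \<Longrightarrow> state G K S V \<Theta> \<Delta> \<Longrightarrow> i \<in> V \<Longrightarrow> okb G K E \<Longrightarrow>
     (\<forall>x\<in>S. ev E x = 0 \<and> ev (der (\<Theta> i) E) x \<noteq> 0) \<Longrightarrow>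
     state G K' S (V - {i}) (\<lambda>k j. Add (Mul (der (\<Theta> i) E) (\<Theta> k j)) (Mul (Con (-1)) (Mul (der (\<Theta> k) E) (\<Theta> i j))))
      (Mul \<Delta> (der (\<Theta> i) E))"
    using state_step[of K] by blast
  obtain C where C: "\<And>G S V \<Theta> \<Delta>. G \<ge> 2 \<Longrightarrow> state G K' S V \<Theta> \<Delta> \<Longrightarrow> card V = t \<Longrightarrow> card S \<le> C * G ^ AA (Suc t)"
    using assms unfolding Plev_def by blast
  show "\<exists>C. \<forall>G\<ge>2. \<forall>S V \<Theta> \<Delta> i E. state G K S V \<Theta> \<Delta> \<longrightarrow> card V = Suc t \<longrightarrow> i \<in> V \<longrightarrow> okb G K E \<longrightarrow>
      (\<forall>x\<in>S. ev E x = 0 \<and> ev (der (\<Theta> i) E) x \<noteq> 0) \<longrightarrow> card S \<le> C * G ^ AA (Suc t)"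
  proof (rule exI[of _ C], intro allI impI)
    fix G S V \<Theta> \<Delta> i E
    assume a: "G \<ge> 2" "state G K S V \<Theta> \<Delta>" "card V = Suc t" "i \<in> V" "okb G K E"
       "\<forall>x\<in>S. ev E x = 0 \<and> ev (der (\<Theta> i) E) x \<noteq> 0"
    show "card S \<le> C * G ^ AA (Suc t)"
      by (rule C[OF a(1) K'[OF _ a(2,4,5,6)]]) (use a state_finV in \<open>auto simp: card_Diff_singleton\<close>)
  qed
qed

text \<open>Points where a member of a bounded family vanishes while one of its derivatives does not
  are negligible. Outside them vanishing is inherited by derivatives, so a relation at a point may
  be differentiated as if it were an identity on the variety.\<close>

lemma closed_count:
  assumes "dropP t"
  shows "\<exists>C. \<forall>G\<ge>2. \<forall>S V \<Theta> \<Delta> \<E>. state G K S V \<Theta> \<Delta> \<longrightarrow> card V = t \<longrightarrow> finite \<E> \<longrightarrow> card \<E> \<le> n \<longrightarrow>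
     (\<forall>E\<in>\<E>. okb G K E) \<longrightarrow> card {x \<in> S. \<exists>E\<in>\<E>. \<exists>k\<in>V. ev E x = 0 \<and> ev (der (\<Theta> k) E) x \<noteq> 0} \<le> C * G ^ AA t"
proof -
  obtain C where "\<forall>G\<ge>2. \<forall>S V \<Theta> \<Delta> i E. state G K S V \<Theta> \<Delta> \<longrightarrow> card V = t \<longrightarrow> i \<in> V \<longrightarrow> okb G K E \<longrightarrow>
      (\<forall>x\<in>S. ev E x = 0 \<and> ev (der (\<Theta> i) E) x \<noteq> 0) \<longrightarrow> card S \<le> C * G ^ AA t"
    using assms unfolding dropP_def by blast
  note C = this[rule_format]
  show ?thesis
  proof (rule exI[of _ "n * t * C"], intro allI impI)
    fix G S V \<Theta> \<Delta> \<E>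
    assume a: "G \<ge> 2" "state G K S V \<Theta> \<Delta>" "card V = t" "finite \<E>" "card \<E> \<le> n" "\<forall>E\<in>\<E>. okb G K E"
    note fV = state_finV[OF a(2)]
    define X where "X = (\<lambda>(E, k). {x \<in> S. ev E x = 0 \<and> ev (der (\<Theta> k) E) x \<noteq> 0})"
    have "card {x \<in> S. \<exists>E\<in>\<E>. \<exists>k\<in>V. ev E x = 0 \<and> ev (der (\<Theta> k) E) x \<noteq> 0} = card (\<Union>p\<in>\<E> \<times> V. X p)"
      by (rule arg_cong[of _ _ card]) (auto simp: X_def)
    also have "\<dots> \<le> (\<Sum>p\<in>\<E> \<times> V. card (X p))" by (rule card_UN_le) (use a fV in auto)
    also have "\<dots> \<le> (\<Sum>p\<in>\<E> \<times> V. C * G ^ AA t)"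
    proof (rule sum_mono)
      fix p assume "p \<in> \<E> \<times> V"
      then obtain E k where p: "p = (E, k)" "E \<in> \<E>" "k \<in> V" by blast
      show "card (X p) \<le> C * G ^ AA t"
        by (rule C[OF a(1) state_subset[OF a(2)] a(3) p(3)]) (use p a in \<open>auto simp: X_def\<close>)
    qed
    also have "\<dots> \<le> (n * t) * (C * G ^ AA t)" using a fV by (auto simp: card_cartesian_product)
    finally show "card {x \<in> S. \<exists>E\<in>\<E>. \<exists>k\<in>V. ev E x = 0 \<and> ev (der (\<Theta> k) E) x \<noteq> 0} \<le> n * t * C * G ^ AA t" by simp
  qed
qed

text \<open>The modulus has to be coprime to \<open>\<Delta>\<close> at the point, so it varies with
  the point and becomes part of the label. Together with \<open>8 * l\<close> residues this gives
  the exponent \<open>Suc (8 * l)\<close>.\<close>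

lemma residue_split:
  "\<exists>C\<ge>1. \<forall>G\<ge>2. \<forall>S V \<Theta> \<Delta> X. state G K S V \<Theta> \<Delta> \<longrightarrow>
     (\<forall>F q x0. F \<subseteq> S \<longrightarrow> x0 \<in> F \<longrightarrow> int G ^ \<kappa> \<le> q \<longrightarrow> q \<le> int C * int G ^ Suc \<kappa> \<longrightarrow> coprime (ev \<Delta> x0) q \<longrightarrow>
        (\<forall>x\<in>F. \<forall>i. [x i = x0 i] (mod q)) \<longrightarrow> card F \<le> X) \<longrightarrow>
     card S \<le> (C * G ^ Suc \<kappa>) ^ Suc (8 * l) * X"
proof -
  obtain C where C: "C \<ge> 1" and q: "\<And>G M. G \<ge> 1 \<Longrightarrow> M \<noteq> 0 \<Longrightarrow> \<bar>M\<bar> \<le> int K * int G ^ K \<Longrightarrow>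
     \<exists>q. int G ^ \<kappa> \<le> q \<and> q \<le> int C * int G ^ Suc \<kappa> \<and> coprime M q"
    using modulus_exists[of K \<kappa>] by blast
  show ?thesis
  proof (rule exI[of _ C], intro conjI C allI impI)
    fix G S V \<Theta> \<Delta> X
    assume G: "G \<ge> 2" and st: "state G K S V \<Theta> \<Delta>"
     and F: "\<forall>F q x0. F \<subseteq> S \<longrightarrow> x0 \<in> F \<longrightarrow> int G ^ \<kappa> \<le> q \<longrightarrow> q \<le> int C * int G ^ Suc \<kappa> \<longrightarrow> coprime (ev \<Delta> x0) q \<longrightarrow>
        (\<forall>x\<in>F. \<forall>i. [x i = x0 i] (mod q)) \<longrightarrow> card F \<le> X"
    define Q where "Q = C * G ^ Suc \<kappa>"
    have "\<forall>x\<in>S. \<exists>q. int G ^ \<kappa> \<le> q \<and> q \<le> int C * int G ^ Suc \<kappa> \<and> coprime (ev \<Delta> x) q"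
      using q state_ev[OF st] st G unfolding state_def by (metis One_nat_def Suc_leD numeral_2_eq_2)
    then obtain q where q: "\<And>x. x \<in> S \<Longrightarrow> int G ^ \<kappa> \<le> q x \<and> q x \<le> int C * int G ^ Suc \<kappa> \<and> coprime (ev \<Delta> x) (q x)"
      by metis
    have q0: "q x > 0" if "x \<in> S" for x using q[OF that] G by (smt (verit) of_nat_0_less_iff zero_less_power numeral_2_eq_2 zero_less_Suc less_le_trans)
    have qQ: "q x \<le> int Q" if "x \<in> S" for x using q[OF that] by (simp add: Q_def)
    define lab where "lab x = (nat (q x), restrict (\<lambda>j. nat (x j mod q x)) {..<8 * l})" for x
    define L where "L = {1..Q} \<times> PiE {..<8 * l} (\<lambda>_. {..<Q})"
    have finL: "finite L" unfolding L_def by (intro finite_cartesian_product finite_PiE) auto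
    have cL: "card L = Q ^ Suc (8 * l)" by (simp add: L_def card_cartesian_product card_PiE)
    have "lab ` S \<subseteq> L"
    proof
      fix y assume "y \<in> lab ` S"
      then obtain x where x: "x \<in> S" "y = lab x" by blast
      have "nat (x j mod q x) < Q" for j
        using q0[OF x(1)] qQ[OF x(1)] pos_mod_bound[of "q x" "x j"] by linarith
      then show "y \<in> L" using x q0[OF x(1)] qQ[OF x(1)] by (auto simp: L_def lab_def)
    qed
    then have "card S \<le> card L * X"
    proof (rule card_le_labels[OF state_fin[OF st] finL])
      fix y
      show "card {x \<in> S. lab x = y} \<le> X"
      proof (cases "{x \<in> S. lab x = y} = {}")
        case False
        then obtain x0 where x0: "x0 \<in> S" "lab x0 = y" by blast
        have "[x i = x0 i] (mod q x0)" if x: "x \<in> S" "lab x = y" for x i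
        proof (cases "i < 8 * l")
          case True
          have e: "lab x = lab x0" using x x0 by simp
          then have "nat (q x) = nat (q x0)" by (simp add: lab_def)
          then have qq: "q x = q x0" using q0[OF x(1)] q0[OF x0(1)] by linarith
          have "restrict (\<lambda>j. nat (x j mod q x)) {..<8 * l} i = restrict (\<lambda>j. nat (x0 j mod q x0)) {..<8 * l} i"
            using e unfolding lab_def by (metis Pair_inject)
          then have "nat (x i mod q x0) = nat (x0 i mod q x0)" using True qq by simp
          then show ?thesis using q0[OF x0(1)] by (simp add: cong_def eq_nat_nat_iff)
        next
          case False
          then have "x i = 0" "x0 i = 0"
            using x(1) x0(1) st SB_D(1)[of x l d "bx G" i] SB_D(1)[of x0 l d "bx G" i] by (auto simp: state_def)
          then show ?thesis by simp
        qed
        then show ?thesis using F x0 q[OF x0(1)] by (intro F[rule_format, of _ x0 "q x0"]) auto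
      next
        case True
        then show ?thesis by (simp only: card.empty)
      qed
    qed
    then show "card S \<le> (C * G ^ Suc \<kappa>) ^ Suc (8 * l) * X" unfolding cL Q_def .
  qed
qed

end

section \<open>Quotients with vanishing derivatives take few values\<close>

context count
begin

lemma state_mono: assumes "state G K S V \<Theta> \<Delta>" "K \<le> K'" "G \<ge> 1" shows "state G K' S V \<Theta> \<Delta>"
proof -
  have "okb G K' E" if "okb G K E" for E using okb_mono[OF that assms(2,3)] .
  then show ?thesis using assms(1) unfolding state_def by blast
qed

text \<open>A form of degree \<open>L\<close> in \<open>g\<close> and \<open>g'\<close> whose
  coefficients are polynomials in the parameters, differentiated along \<open>us\<close>.
  Homogeneity is essential: if the quotient of \<open>g\<close> and \<open>g'\<close> has zero
  derivatives, all products \<open>g ^ k * g' ^ (L - k)\<close> have the same logarithmic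
  derivative.\<close>

definition Qp :: "nat set \<Rightarrow> nat \<Rightarrow> (nat \<Rightarrow> (nat \<Rightarrow> nat) \<Rightarrow> int) \<Rightarrow> pexp \<Rightarrow> pexp \<Rightarrow> nat list \<Rightarrow> pexp" where
  "Qp V L c g g' us = psum (\<lambda>k. Mul (PE V L (itd us (c k))) (Mul (ppow g k) (ppow g' (L - k)))) [0..<Suc L]"

lemma ev_Qp: "finite V \<Longrightarrow> ev (Qp V L c g g' us) x = (\<Sum>k\<le>L. pv V L (itd us (c k)) x * (ev g x ^ k * ev g' x ^ (L - k)))"
  by (simp add: Qp_def ev_psum ev_PE interv_sum_list_conv_sum_set_nat atLeast0LessThan lessThan_Suc_atMost del: upt_Suc)

lemma okb_Qp:
  assumes "G \<ge> 1" "okb G K g" "okb G K g'" "finite V" "card V \<le> n" "set us \<subseteq> V" "length us \<le> L" "K \<ge> 1"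
    "\<And>k. sup_in V L (c k)" "\<And>k \<gamma>. \<bar>c k \<gamma>\<bar> \<le> int G ^ L" "L \<ge> 1"
  defines "Z \<equiv> Suc L * (2 ^ (L + n) * L ^ L * K ^ L) + (L + k0 * L + K * L) + (L + L * K)"
  shows "okb G Z (Qp V L c g g' us)"
proof -
  have G1: "int G \<ge> 1" using assms by simp
  have "((L + card V) choose card V) \<le> 2 ^ (L + card V)" by (rule binomial_le_pow2)
  also have "\<dots> \<le> 2 ^ (L + n)" using assms(5) by (intro power_increasing) auto
  finally have cG: "int (card (Gam V L)) \<le> 2 ^ (L + n)" unfolding Gam_card[OF assms(4)]
    by (metis of_nat_le_iff of_nat_numeral of_nat_power)
  have it: "\<bar>itd us (c k) \<gamma>\<bar> \<le> int L ^ L * int G ^ L" for k \<gamma>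
  proof -
    have "\<bar>itd us (c k) \<gamma>\<bar> \<le> int L ^ length us * int G ^ L"
      by (rule itd_bound[OF assms(9) assms(4) assms(6)]) (use assms in auto)
    also have "\<dots> \<le> int L ^ L * int G ^ L" using assms by (intro mult_right_mono power_increasing) auto
    finally show ?thesis .
  qed
  have P1: "bd (bx G) (PE V L (itd us (c k))) \<le> 2 ^ (L + n) * ((int L ^ L * int G ^ L) * bx G ^ L)" for k
    by (rule order_trans[OF bd_PE(1)[OF assms(4) bx1[OF assms(1)] it]])
       (use cG bx1[OF assms(1)] in \<open>intro mult_right_mono, auto\<close>)
  have P2: "bd (bx G) g ^ k * bd (bx G) g' ^ (L - k) \<le> (int K * int G ^ K) ^ L" if "k \<le> L" for k
  proof -
    have "bd (bx G) g ^ k * bd (bx G) g' ^ (L - k) \<le> (int K * int G ^ K) ^ k * (int K * int G ^ K) ^ (L - k)"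
      using assms bd_nonneg[of "bx G"] bx1[OF assms(1)] by (intro mult_mono power_mono) (auto simp: okb_def)
    then show ?thesis using that by (simp add: power_add[symmetric])
  qed
  have "bd (bx G) (Qp V L c g g' us) = (\<Sum>k\<le>L. bd (bx G) (PE V L (itd us (c k))) * (bd (bx G) g ^ k * bd (bx G) g' ^ (L - k)))"
    by (simp add: Qp_def bd_psum bd_ppow interv_sum_list_conv_sum_set_nat atLeast0LessThan lessThan_Suc_atMost del: upt_Suc)
  also have "\<dots> \<le> (\<Sum>k\<le>L. (2 ^ (L + n) * ((int L ^ L * int G ^ L) * bx G ^ L)) * (int K * int G ^ K) ^ L)"
    using P1 P2 bd_nonneg[of "bx G"] bx1[OF assms(1)] by (intro sum_mono mult_mono) auto
  also have "\<dots> = int (Suc L * (2 ^ (L + n) * L ^ L * K ^ L)) * int G ^ (L + k0 * L + K * L)"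
    by (simp add: bx_def power_mult_distrib power_add power_mult[symmetric] algebra_simps)
  also have "\<dots> \<le> int Z * int G ^ Z"
    using G1 unfolding Z_def by (intro mult_mono power_increasing) auto
  finally have 1: "bd (bx G) (Qp V L c g g' us) \<le> int Z * int G ^ Z" .
  have "dg (Qp V L c g g' us) \<le> L + L * K" unfolding Qp_def
  proof (rule dg_psum)
    fix k assume "k \<in> set [0..<Suc L]"
    then have k: "k \<le> L" by auto
    have "dg (PE V L (itd us (c k))) \<le> L" by (rule bd_PE(2)[OF assms(4) bx1[OF assms(1)] it])
    moreover have "k * dg g + (L - k) * dg g' \<le> k * K + (L - k) * K"
      using assms(2,3) by (intro add_mono mult_le_mono2) (auto simp: okb_def)
    then have "k * dg g + (L - k) * dg g' \<le> L * K" using k by (simp add: add_mult_distrib[symmetric])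
    ultimately show "dg (Mul (PE V L (itd us (c k))) (Mul (ppow g k) (ppow g' (L - k)))) \<le> L + L * K"
      by (simp add: dg_ppow)
  qed
  also have "\<dots> \<le> Z" unfolding Z_def by linarith
  finally show ?thesis using 1 by (simp add: okb_def)
qed

text \<open>The digits of a residue pattern and the coefficients at disposal both number about
  \<open>L ^ Suc t\<close>. Allowing coefficients up to \<open>G ^ L\<close> gives the second side a
  further factor \<open>L\<close>, which wins for large \<open>L\<close>.\<close>

lemma choose_L:
  fixes K t :: nat
  shows "\<exists>L\<ge>1. 3 * ((1 + L * (1 + K) + t) choose Suc t) < L * (((L + t) choose t) * Suc L)"
proof -
  define c where "c = 2 + K + t"
  define L where "L = 3 * c ^ Suc t * fact t + 1"
  have T: "1 + L * (1 + K) + t \<le> c * L"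
    by (simp add: c_def L_def algebra_simps)
  have "fact t * (3 * ((1 + L * (1 + K) + t) choose Suc t)) \<le> fact t * (3 * (1 + L * (1 + K) + t) ^ Suc t)"
    by (intro mult_le_mono2 binomial_le_pow) auto
  also have "\<dots> \<le> fact t * (3 * (c * L) ^ Suc t)" by (intro mult_le_mono2 power_mono T) auto
  also have "\<dots> = (3 * c ^ Suc t * fact t) * L ^ Suc t" by (simp add: power_mult_distrib)
  also have "\<dots> < L * L ^ Suc t" by (intro mult_strict_right_mono) (auto simp: L_def)
  also have "\<dots> = L * (L ^ t * L)" by simp
  also have "\<dots> \<le> L * ((fact t * ((L + t) choose t)) * Suc L)" by (intro mult_le_mono choose_fact_ge) auto
  also have "\<dots> = fact t * (L * (((L + t) choose t) * Suc L))" by (simp only: ac_simps)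
  finally have "3 * ((1 + L * (1 + K) + t) choose Suc t) < L * (((L + t) choose t) * Suc L)"
    by (metis mult_less_cancel1)
  then show ?thesis by (intro exI[of _ L]) (auto simp: L_def)
qed

lemma ratio_values:
  fixes e :: "nat \<Rightarrow> int"
  assumes e: "\<exists>k\<le>L. e k \<noteq> 0" and S: "finite S"
    and z: "\<And>x. x \<in> S \<Longrightarrow> g' x \<noteq> 0" "\<And>x. x \<in> S \<Longrightarrow> (\<Sum>k\<le>L. e k * (g x ^ k * g' x ^ (L - k))) = (0::int)"
    and X: "\<And>S'. S' \<subseteq> S \<Longrightarrow> (\<forall>x\<in>S'. \<forall>y\<in>S'. g x * g' y = g' x * g y) \<Longrightarrow> card S' \<le> X"
  shows "card S \<le> L * X"
proof -
  define R where "R = {z::real. (\<Sum>k\<le>L. real_of_int (e k) * z ^ k) = 0}"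
  obtain k where k: "e k \<noteq> 0" "k \<le> L" using e by blast
  have R: "finite R \<and> card R \<le> L"
    unfolding R_def by (rule Transcendental.polyfun_rootbound[of "\<lambda>k. real_of_int (e k)" k L]) (use k in auto)
  define lab where "lab x = real_of_int (g x) / real_of_int (g' x)" for x
  have "lab ` S \<subseteq> R"
  proof
    fix w assume "w \<in> lab ` S"
    then obtain x where x: "x \<in> S" "w = lab x" by blast
    have "(\<Sum>k\<le>L. real_of_int (e k) * lab x ^ k) * real_of_int (g' x) ^ L
      = (\<Sum>k\<le>L. real_of_int (e k * (g x ^ k * g' x ^ (L - k))))"
      unfolding sum_distrib_right
    proof (intro sum.cong refl)
      fix k assume "k \<in> {..L}"
      then have "real_of_int (g' x) ^ L = real_of_int (g' x) ^ k * real_of_int (g' x) ^ (L - k)"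
        by (simp add: power_add[symmetric])
      then show "real_of_int (e k) * lab x ^ k * real_of_int (g' x) ^ L = real_of_int (e k * (g x ^ k * g' x ^ (L - k)))"
        using z(1)[OF x(1)] by (simp add: lab_def power_divide)
    qed
    also have "\<dots> = real_of_int (\<Sum>k\<le>L. e k * (g x ^ k * g' x ^ (L - k)))" by (simp only: of_int_sum)
    also have "\<dots> = 0" using z(2)[OF x(1)] by simp
    finally show "w \<in> R" using z(1)[OF x(1)] x by (simp add: R_def)
  qed
  then have "card S \<le> card R * X"
  proof (rule card_le_labels[OF S conjunct1[OF R]])
    fix w assume "w \<in> R"
    show "card {x \<in> S. lab x = w} \<le> X"
    proof (rule X)
      show "\<forall>x\<in>{x \<in> S. lab x = w}. \<forall>y\<in>{x \<in> S. lab x = w}. g x * g' y = g' x * g y"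
      proof (intro ballI)
        fix x y assume "x \<in> {x \<in> S. lab x = w}" "y \<in> {x \<in> S. lab x = w}"
        then have xy: "x \<in> S" "y \<in> S" "lab x = lab y" by auto
        then have "real_of_int (g x * g' y) = real_of_int (g' x * g y)"
          using z(1)[OF xy(1)] z(1)[OF xy(2)] by (simp add: lab_def field_simps)
        then show "g x * g' y = g' x * g y" by (simp only: of_int_eq_iff)
      qed
    qed auto
  qed
  also have "\<dots> \<le> L * X" using R by simp
  finally show ?thesis .
qed

text \<open>The quotient of \<open>g\<close> and \<open>g'\<close> is killed by all derivations. The
  pigeonhole principle gives one form in \<open>g\<close> and \<open>g'\<close>, with polynomial
  coefficients in the parameters, that vanishes on the class. Differentiation acts on these
  coefficients alone, so they can be brought down to constants, not all 0; then the quotient is a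
  root of one fixed polynomial of degree at most \<open>L\<close>.\<close>

lemma constants_fiber:
  assumes dr: "dropP t" and K1: "K \<ge> 1"
  shows "\<exists>C. \<forall>G\<ge>2. \<forall>S V \<Theta> \<Delta> g g' X q x0. state G K S V \<Theta> \<Delta> \<longrightarrow> card V = t \<longrightarrow> okb G K g \<longrightarrow> okb G K g' \<longrightarrow>
     (\<forall>x\<in>S. ev g x \<noteq> 0 \<and> ev g' x \<noteq> 0 \<and> (\<forall>k\<in>V. ev g' x * ev (der (\<Theta> k) g) x = ev g x * ev (der (\<Theta> k) g') x)) \<longrightarrow>
     (\<forall>S'. S' \<subseteq> S \<longrightarrow> (\<forall>x\<in>S'. \<forall>y\<in>S'. ev g x * ev g' y = ev g' x * ev g y) \<longrightarrow> card S' \<le> X) \<longrightarrow>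
     x0 \<in> S \<longrightarrow> int G ^ 1 \<le> q \<longrightarrow> q \<le> int C1 * int G ^ Suc 1 \<longrightarrow> coprime (ev \<Delta> x0) q \<longrightarrow> (\<forall>x\<in>S. \<forall>i. [x i = x0 i] (mod q)) \<longrightarrow>
     card S \<le> C * (G ^ AA t + X)"
proof -
  obtain L where L: "L \<ge> 1" "3 * ((1 + L * (1 + (K + k0)) + t) choose Suc t) < L * (((L + t) choose t) * Suc L)"
    using choose_L[where K = "K + k0" and t = t] by blast
  define T where "T = 1 + L * (1 + (K + k0))"
  define N where "N = ((L + t) choose t) * Suc L"
  define Z where "Z = Suc L * (2 ^ (L + t) * L ^ L * K ^ L) + (L + k0 * L + K * L) + (L + L * K)"
  define W where "W = card {us. set us \<subseteq> {..<8 * l} \<and> length us \<le> L}"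
  obtain C where "\<forall>G\<ge>2. \<forall>S V \<Theta> \<Delta> \<E>. state G (K + Z) S V \<Theta> \<Delta> \<longrightarrow> card V = t \<longrightarrow> finite \<E> \<longrightarrow> card \<E> \<le> W \<longrightarrow>
     (\<forall>E\<in>\<E>. okb G (K + Z) E) \<longrightarrow> card {x \<in> S. \<exists>E\<in>\<E>. \<exists>k\<in>V. ev E x = 0 \<and> ev (der (\<Theta> k) E) x \<noteq> 0} \<le> C * G ^ AA t"
    using closed_count[OF dr] by blast
  note C = this[rule_format]
  \<comment> \<open>From \<open>G0\<close> on, one factor \<open>G\<close> absorbs the constants:
    \<open>C1 * G ^ 2 \<le> G ^ 3\<close> and \<open>N * K ^ L < G\<close>. For smaller
    \<open>G\<close> the trivial count \<open>C'\<close> of the whole box is enough.\<close>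
  define G0 where "G0 = C1 + N * K ^ L + 1"
  define C' where "C' = (2 * G0 ^ k0 + 1) ^ (8 * l)"
  show ?thesis
  proof (rule exI[of _ "C + L + C'"], intro allI impI)
    fix G S V \<Theta> \<Delta> g g' X q x0
    assume G: "(2::nat) \<le> G" and st: "state G K S V \<Theta> \<Delta>" and V: "card V = t" and g: "okb G K g" and g': "okb G K g'"
      and w: "\<forall>x\<in>S. ev g x \<noteq> 0 \<and> ev g' x \<noteq> 0 \<and> (\<forall>k\<in>V. ev g' x * ev (der (\<Theta> k) g) x = ev g x * ev (der (\<Theta> k) g') x)"
      and X: "\<forall>S'. S' \<subseteq> S \<longrightarrow> (\<forall>x\<in>S'. \<forall>y\<in>S'. ev g x * ev g' y = ev g' x * ev g y) \<longrightarrow> card S' \<le> X"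
      and x0: "x0 \<in> S" and q1: "int G ^ 1 \<le> q" and q2: "q \<le> int C1 * int G ^ Suc 1" and cop: "coprime (ev \<Delta> x0) q"
      and cl: "\<forall>x\<in>S. \<forall>i. [x i = x0 i] (mod q)"
    note fV = state_finV[OF st]
    have G1: "G \<ge> 1" using G by simp
    have q0: "q > 0" using q1 G by simp
    show "card S \<le> (C + L + C') * (G ^ AA t + X)"
    proof (cases "G \<ge> G0")
      case False
      have "card S \<le> card (SB l d (bx G))" using st SB_finite(1)[of "bx G" l d] bx1[OF G1] by (intro card_mono) (auto simp: state_def)
      also have "\<dots> \<le> nat (2 * bx G + 1) ^ (8 * l)" using SB_finite(2)[of "bx G" l d] bx1[OF G1] by simp
      also have "\<dots> \<le> C'"
      proof -
        have "int G ^ k0 \<le> int G0 ^ k0" using False by (intro power_mono) auto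
        then have "nat (2 * bx G + 1) \<le> 2 * G0 ^ k0 + 1" by (simp add: bx_def nat_le_iff)
        then show ?thesis unfolding C'_def by (intro power_mono) auto
      qed
      also have "C' \<le> (C + L + C') * (G ^ AA t + X)"
      proof -
        have "G ^ AA t \<ge> 1" using G by simp
        then have "C' * 1 \<le> (C + L + C') * (G ^ AA t + X)" by (intro mult_mono) auto
        then show ?thesis by simp
      qed
      finally show ?thesis .
    next
      case True
      have Vsub: "V \<subseteq> {..<8 * l}" using st by (simp add: state_def)
      obtain \<phi> where \<phi>: "\<And>j. vars (\<phi> j) \<subseteq> V" "\<And>j x. x \<in> S \<Longrightarrow> [x j = ev (\<phi> j) x] (mod q ^ T)"
      proof -
        have "\<forall>j. \<exists>\<phi>. vars \<phi> \<subseteq> V \<and> (\<forall>x\<in>S. [x j = ev \<phi> x] (mod q ^ T))"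
        proof
          fix j
          have "hens S V \<Theta> \<Delta>" using st by (simp add: state_def)
          then obtain \<phi> where "vars \<phi> \<subseteq> V" "\<forall>x\<in>S. (\<forall>i. [x i = x0 i] (mod q)) \<longrightarrow> [x j = ev \<phi> x] (mod q ^ T)"
            using x0 q0 cop unfolding hens_def by blast
          then show "\<exists>\<phi>. vars \<phi> \<subseteq> V \<and> (\<forall>x\<in>S. [x j = ev \<phi> x] (mod q ^ T))" using cl by blast
        qed
        then show ?thesis using that by metis
      qed
      define \<Gamma> where "\<Gamma> = Gam V L \<times> {..L}"
      define f where "f = (\<lambda>(\<gamma>, k) x. mval V x \<gamma> * (ev g x ^ k * ev g' x ^ (L - k)))"
      have cG: "card \<Gamma> = N" by (simp add: \<Gamma>_def card_cartesian_product Gam_card[OF fV] V N_def)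
      have "\<exists>c. (\<exists>\<gamma>\<in>\<Gamma>. c \<gamma> \<noteq> 0) \<and> (\<forall>\<gamma>. \<bar>c \<gamma>\<bar> \<le> int G ^ L) \<and> (\<forall>\<gamma>. \<gamma> \<notin> \<Gamma> \<longrightarrow> c \<gamma> = 0) \<and>
         (\<forall>x\<in>S. (\<Sum>\<gamma>\<in>\<Gamma>. c \<gamma> * f \<gamma> x) = 0)"
      proof (rule siegel[of \<Gamma> V q "int G ^ L" S x0 f T "bx G ^ L * (int K * int G ^ K) ^ L"])
        show "finite \<Gamma>" using Gam_finite[OF fV] by (simp add: \<Gamma>_def)
        show "1 \<le> int G ^ L" using G by simp
        show "[x i = x0 i] (mod q)" if "x \<in> S" for x i using cl that by blast
        show "\<exists>\<phi>. vars \<phi> \<subseteq> V \<and> (\<forall>x\<in>S. [f \<gamma> x = ev \<phi> x] (mod q ^ T))" if "\<gamma> \<in> \<Gamma>" for \<gamma>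
        proof -
          obtain \<gamma>1 k where gk: "\<gamma> = (\<gamma>1, k)" by force
          let ?E = "Mul (pexp_mono V \<gamma>1) (Mul (ppow g k) (ppow g' (L - k)))"
          have "f \<gamma> x = ev ?E x" for x by (simp add: f_def gk ev_pexp_mono[OF fV])
          moreover have "[ev ?E x = ev ?E (\<lambda>j. ev (\<phi> j) x)] (mod q ^ T)" if "x \<in> S" for x
            by (rule ev_cong_mod) (rule \<phi>(2)[OF that])
          ultimately show ?thesis using \<phi>(1) by (intro exI[of _ "sub \<phi> ?E"]) (auto simp only: ev_sub vars_sub)
        qed
        show "\<bar>f \<gamma> x\<bar> \<le> bx G ^ L * (int K * int G ^ K) ^ L" if x: "x \<in> S" and gG: "\<gamma> \<in> \<Gamma>" for x \<gamma>
        proof -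
          obtain \<gamma>1 k where gk: "\<gamma> = (\<gamma>1, k)" "\<gamma>1 \<in> Gam V L" "k \<le> L" using gG by (auto simp: \<Gamma>_def)
          have "\<bar>mval V x \<gamma>1\<bar> = (\<Prod>i\<in>V. \<bar>x i\<bar> ^ \<gamma>1 i)" by (simp add: mval_def abs_prod power_abs)
          also have "\<dots> \<le> (\<Prod>i\<in>V. bx G ^ \<gamma>1 i)" by (intro prod_mono conjI power_mono state_bound[OF st x]) auto
          also have "\<dots> = bx G ^ sum \<gamma>1 V" by (simp add: power_sum)
          also have "\<dots> \<le> bx G ^ L" using gk(2) bx1[OF G1] by (intro power_increasing) (auto simp: Gam_def)
          finally have 1: "\<bar>mval V x \<gamma>1\<bar> \<le> bx G ^ L" .
          have "\<bar>ev g x\<bar> ^ k * \<bar>ev g' x\<bar> ^ (L - k) \<le> (int K * int G ^ K) ^ k * (int K * int G ^ K) ^ (L - k)"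
            using state_ev[OF st x g] state_ev[OF st x g'] by (intro mult_mono power_mono) auto
          also have "\<dots> = (int K * int G ^ K) ^ L" using gk by (simp add: power_add[symmetric])
          finally show ?thesis using 1 bx1[OF G1] unfolding f_def gk prod.case abs_mult power_abs by (intro mult_mono) auto
        qed
        show "q ^ ((T + card V) choose Suc (card V)) < (int G ^ L) ^ card \<Gamma>"
        proof -
          have "int C1 * int G ^ Suc 1 \<le> int G * int G ^ Suc 1" using True by (intro mult_right_mono) (auto simp: G0_def)
          then have "q \<le> int G ^ 3" using q2 by (simp add: eval_nat_numeral)
          then have "q ^ ((T + t) choose Suc t) \<le> (int G ^ 3) ^ ((T + t) choose Suc t)" using q0 by (intro power_mono) auto
          also have "\<dots> = int G ^ (3 * ((T + t) choose Suc t))" by (simp add: power_mult)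
          also have "\<dots> < int G ^ (L * N)" using L(2) G by (intro power_strict_increasing) (auto simp: N_def T_def)
          finally show ?thesis by (simp add: V cG power_mult)
        qed
        show "int (card \<Gamma>) * (int G ^ L * (bx G ^ L * (int K * int G ^ K) ^ L)) < q ^ T"
        proof -
          have "int (card \<Gamma>) * (int G ^ L * (bx G ^ L * (int K * int G ^ K) ^ L)) = int (N * K ^ L) * int G ^ (L * (1 + (K + k0)))"
            by (simp add: cG bx_def power_mult_distrib power_add power_mult[symmetric] algebra_simps)
          also have "\<dots> < int G * int G ^ (L * (1 + (K + k0)))"
          proof (rule mult_strict_right_mono)
            have "N * K ^ L < G" using True by (simp add: G0_def)
            then show "int (N * K ^ L) < int G" by (simp only: of_nat_less_iff)
          qed (use G in simp)
          also have "\<dots> = int G ^ T" by (simp add: T_def)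
          also have "\<dots> \<le> q ^ T" using q1 by (intro power_mono) auto
          finally show ?thesis .
        qed
      qed (use fV q0 in auto)
      then obtain c where c: "\<exists>\<gamma>\<in>\<Gamma>. c \<gamma> \<noteq> 0" "\<And>\<gamma>. \<bar>c \<gamma>\<bar> \<le> int G ^ L" "\<And>\<gamma>. \<gamma> \<notin> \<Gamma> \<Longrightarrow> c \<gamma> = 0"
         "\<And>x. x \<in> S \<Longrightarrow> (\<Sum>\<gamma>\<in>\<Gamma>. c \<gamma> * f \<gamma> x) = 0" by blast
      define ck where "ck k = (\<lambda>\<gamma>. c (\<gamma>, k))" for k
      have sck: "sup_in V L (ck k)" for k using c(3) by (auto simp: sup_in_def ck_def \<Gamma>_def)
      have ckb: "\<bar>ck k \<gamma>\<bar> \<le> int G ^ L" for k \<gamma> using c(2) by (simp add: ck_def)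
      have cknz: "\<exists>k \<gamma>. ck k \<gamma> \<noteq> 0" using c(1) by (auto simp: ck_def)
      obtain us where us: "set us \<subseteq> V" "length us \<le> L" "\<forall>k. sup_in V 0 (itd us (ck k))" "\<exists>k. itd us (ck k) (\<lambda>_. 0) \<noteq> 0"
        using descent_family[OF fV _ cknz, of L] sck by blast
      have kL: "\<exists>k\<le>L. itd us (ck k) (\<lambda>_. 0) \<noteq> 0"
      proof -
        obtain k where k: "itd us (ck k) (\<lambda>_. 0) \<noteq> 0" using us(4) by blast
        have "k \<le> L"
        proof (rule ccontr)
          assume "\<not> k \<le> L"
          then have "ck k = (\<lambda>_. 0)" using c(3) by (auto simp: ck_def \<Gamma>_def)
          moreover have "itd vs (\<lambda>_. 0) = (\<lambda>_. 0)" for vs by (induction vs) (auto simp: pdc_def)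
          ultimately show False using k by simp
        qed
        then show ?thesis using k by blast
      qed
      define Ws where "Ws = {us. set us \<subseteq> V \<and> length us \<le> L}"
      define \<E> where "\<E> = Qp V L ck g g' ` Ws"
      have fW: "finite Ws" unfolding Ws_def by (rule word_finite[OF fV])
      have "card Ws \<le> W" unfolding Ws_def W_def using Vsub by (intro card_mono word_finite) auto
      then have cE: "card \<E> \<le> W" using card_image_le[OF fW] by (metis \<E>_def order_trans)
      have okE: "okb G (K + Z) E" if "E \<in> \<E>" for E
      proof -
        obtain vs where vs: "vs \<in> Ws" "E = Qp V L ck g g' vs" using \<open>E \<in> \<E>\<close> by (auto simp: \<E>_def)
        have "okb G Z E" unfolding vs(2) Z_def
          by (rule okb_Qp) (use vs G1 g g' fV V K1 sck ckb L in \<open>auto simp: Ws_def\<close>)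
        then show ?thesis using okb_mono G1 by (metis le_add2)
      qed
      define bad where "bad = {x \<in> S. \<exists>E\<in>\<E>. \<exists>k\<in>V. ev E x = 0 \<and> ev (der (\<Theta> k) E) x \<noteq> 0}"
      have stZ: "state G (K + Z) S V \<Theta> \<Delta>" by (rule state_mono[OF st _ G1]) simp
      have cbad: "card bad \<le> C * G ^ AA t"
        unfolding bad_def by (rule C[OF G stZ V]) (use fW cE okE in \<open>auto simp: \<E>_def\<close>)
      \<comment> \<open>Up to the factor \<open>a * a'\<close>, deriving the form for
        \<open>vs\<close> in direction \<open>i\<close> gives \<open>\<Delta>\<close> times the form
        for \<open>vs @ [i]\<close> plus a multiple of the form for \<open>vs\<close> itself. At a
        point that is not bad the derivative vanishes along with the form, so the longer word gives
        0 as well.\<close>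
      have van: "ev (Qp V L ck g g' vs) x = 0" if x: "x \<in> S - bad" and sv: "set vs \<subseteq> V" "length vs \<le> L" for x vs
        using sv
      proof (induction vs rule: rev_induct)
        case Nil
        have "(\<Sum>\<gamma>\<in>\<Gamma>. c \<gamma> * f \<gamma> x) = (\<Sum>k\<le>L. \<Sum>\<gamma>\<in>Gam V L. c (\<gamma>, k) * f (\<gamma>, k) x)"
          unfolding \<Gamma>_def by (subst sum.swap) (simp add: sum.cartesian_product)
        then show ?case using c(4)[of x] x
          by (simp add: ev_Qp[OF fV] pv_def ck_def f_def sum_distrib_right mult.assoc)
      next
        case (snoc i vs)
        have i: "i \<in> V" and vs: "vs \<in> Ws" using snoc.prems by (auto simp: Ws_def)
        have Q0: "ev (Qp V L ck g g' vs) x = 0" using snoc by auto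
        then have "ev (der (\<Theta> i) (Qp V L ck g g' vs)) x = 0"
          using x i vs by (auto simp: bad_def \<E>_def)
        then have D0: "dv (Qp V L ck g g' vs) x (\<lambda>j. ev (\<Theta> i j) x) = 0" by (simp add: ev_der)
        define Dg where "Dg = ev (der (\<Theta> i) g) x"
        define Dg' where "Dg' = ev (der (\<Theta> i) g') x"
        define a where "a = ev g x"
        define a' where "a' = ev g' x"
        have wr: "a' * Dg = a * Dg'" "a \<noteq> 0" "a' \<noteq> 0" using w x i by (auto simp: a_def a'_def Dg_def Dg'_def)
        have dPE: "dv (PE V L (itd vs (ck k))) x (\<lambda>j. ev (\<Theta> i j) x) = ev \<Delta> x * pv V L (itd (vs @ [i]) (ck k)) x" for k
        proof -
          have "sup_in V L (itd vs (ck k))" using sup_in_itd[OF fV sck] vs by (auto simp: Ws_def)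
          then have "dv (PE V L (itd vs (ck k))) x (\<lambda>j. ev (\<Theta> i j) x) = (\<Sum>j\<in>V. pv V L (pdc j (itd vs (ck k))) x * ev (\<Theta> i j) x)"
            by (rule dv_PE[OF fV])
          also have "\<dots> = (\<Sum>j\<in>V. if j = i then ev \<Delta> x * pv V L (pdc j (itd vs (ck k))) x else 0)"
            using st x i by (intro sum.cong refl) (auto simp: state_def tang_def)
          also have "\<dots> = ev \<Delta> x * pv V L (itd (vs @ [i]) (ck k)) x" using fV i by (simp add: itd_snoc)
          finally show ?thesis .
        qed
        \<comment> \<open>The logarithmic derivative of \<open>g ^ k * g' ^ (L - k)\<close> is
          \<open>L\<close> times that of \<open>g'\<close>, whatever \<open>k\<close> is;
          denominators are cleared by \<open>a * a'\<close>.\<close>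
        have pw: "a * a' * (int k * a ^ (k - 1) * Dg * a' ^ (L - k) + a ^ k * (int (L - k) * a' ^ (L - k - 1) * Dg'))
           = a ^ k * a' ^ (L - k) * (int L * (a * Dg'))" if "k \<le> L" for k
        proof -
          have 1: "a * (int k * a ^ (k - 1)) = int k * a ^ k" by (cases k) auto
          have 2: "a' * (int (L - k) * a' ^ (L - k - 1)) = int (L - k) * a' ^ (L - k)" by (cases "L - k") auto
          have "a * a' * (int k * a ^ (k - 1) * Dg * a' ^ (L - k) + a ^ k * (int (L - k) * a' ^ (L - k - 1) * Dg'))
            = (a * (int k * a ^ (k - 1))) * (a' * Dg) * a' ^ (L - k) + a ^ k * (a' * (int (L - k) * a' ^ (L - k - 1))) * (a * Dg')"
            by (simp add: algebra_simps)
          also have "\<dots> = a ^ k * a' ^ (L - k) * ((int k + int (L - k)) * (a * Dg'))"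
            unfolding 1 2 wr(1) by (simp add: algebra_simps)
          finally show ?thesis using that by simp
        qed
        have "a * a' * dv (Qp V L ck g g' vs) x (\<lambda>j. ev (\<Theta> i j) x)
          = (\<Sum>k\<le>L. a * a' * (ev \<Delta> x * pv V L (itd (vs @ [i]) (ck k)) x * (a ^ k * a' ^ (L - k))
             + pv V L (itd vs (ck k)) x * (int k * a ^ (k - 1) * Dg * a' ^ (L - k) + a ^ k * (int (L - k) * a' ^ (L - k - 1) * Dg'))))"
          by (simp add: Qp_def dv_psum interv_sum_list_conv_sum_set_nat atLeast0LessThan lessThan_Suc_atMost dPE ev_PE[OF fV]
              dv_ppow sum_distrib_left Dg_def Dg'_def ev_der a_def a'_def del: upt_Suc)
        also have "\<dots> = (\<Sum>k\<le>L. a * a' * ev \<Delta> x * (pv V L (itd (vs @ [i]) (ck k)) x * (a ^ k * a' ^ (L - k)))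
             + int L * (a * Dg') * (pv V L (itd vs (ck k)) x * (a ^ k * a' ^ (L - k))))"
        proof (intro sum.cong refl)
          fix k assume "k \<in> {..L}"
          then have k: "k \<le> L" by simp
          have "a * a' * (ev \<Delta> x * pv V L (itd (vs @ [i]) (ck k)) x * (a ^ k * a' ^ (L - k))
             + pv V L (itd vs (ck k)) x * (int k * a ^ (k - 1) * Dg * a' ^ (L - k) + a ^ k * (int (L - k) * a' ^ (L - k - 1) * Dg')))
            = a * a' * ev \<Delta> x * (pv V L (itd (vs @ [i]) (ck k)) x * (a ^ k * a' ^ (L - k)))
             + pv V L (itd vs (ck k)) x * (a * a' * (int k * a ^ (k - 1) * Dg * a' ^ (L - k) + a ^ k * (int (L - k) * a' ^ (L - k - 1) * Dg')))"
            by (simp only: distrib_left mult.assoc mult.commute mult.left_commute)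
          then show "a * a' * (ev \<Delta> x * pv V L (itd (vs @ [i]) (ck k)) x * (a ^ k * a' ^ (L - k))
             + pv V L (itd vs (ck k)) x * (int k * a ^ (k - 1) * Dg * a' ^ (L - k) + a ^ k * (int (L - k) * a' ^ (L - k - 1) * Dg')))
            = a * a' * ev \<Delta> x * (pv V L (itd (vs @ [i]) (ck k)) x * (a ^ k * a' ^ (L - k)))
             + int L * (a * Dg') * (pv V L (itd vs (ck k)) x * (a ^ k * a' ^ (L - k)))"
            unfolding pw[OF k] by (simp only: mult.assoc mult.commute mult.left_commute)
        qed
        also have "\<dots> = a * a' * ev \<Delta> x * ev (Qp V L ck g g' (vs @ [i])) x + int L * (a * Dg') * ev (Qp V L ck g g' vs) x"
          by (simp add: sum.distrib ev_Qp[OF fV] sum_distrib_left a_def a'_def)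
        finally have "a * a' * ev \<Delta> x * ev (Qp V L ck g g' (vs @ [i])) x = 0" using D0 Q0 by simp
        moreover have "ev \<Delta> x \<noteq> 0" using st x by (auto simp: state_def)
        ultimately show ?case using wr by simp
      qed
      have "card (S - bad) \<le> L * X"
      proof (rule ratio_values[where e = "\<lambda>k. itd us (ck k) (\<lambda>_. 0)" and g = "ev g" and g' = "ev g'", OF kL])
        show "finite (S - bad)" using state_fin[OF st] by simp
        show "(\<Sum>k\<le>L. itd us (ck k) (\<lambda>_. 0) * (ev g x ^ k * ev g' x ^ (L - k))) = 0" if "x \<in> S - bad" for x
          using van[OF that us(1,2)] us(3) by (simp add: ev_Qp[OF fV] pv_sup0[OF fV])
        show "card S' \<le> X" if "S' \<subseteq> S - bad" "\<forall>x\<in>S'. \<forall>y\<in>S'. ev g x * ev g' y = ev g' x * ev g y" for S'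
          using X that by blast
      qed (use w in auto)
      moreover have "card S \<le> card bad + card (S - bad)"
        using card_Un_le[of bad "S - bad"] by (simp add: bad_def Un_absorb1 Un_Diff_cancel Collect_restrict)
      ultimately have "card S \<le> C * G ^ AA t + L * X" using cbad by linarith
      also have "\<dots> \<le> (C + L + C') * (G ^ AA t + X)" by (simp add: algebra_simps)
      finally show ?thesis .
    qed
  qed
qed

end

section \<open>From constant quotients to constant ratios, and the heights of eliminated
  coefficients\<close>

context count
begin

lemma constants_count:
  assumes dr: "dropP t"
  shows "\<exists>C. \<forall>G\<ge>2. \<forall>S V \<Theta> \<Delta> g g' X. state G K S V \<Theta> \<Delta> \<longrightarrow> card V = t \<longrightarrow> okb G K g \<longrightarrow> okb G K g' \<longrightarrow>
     (\<forall>x\<in>S. ev g x \<noteq> 0 \<and> ev g' x \<noteq> 0 \<and> (\<forall>k\<in>V. ev g' x * ev (der (\<Theta> k) g) x = ev g x * ev (der (\<Theta> k) g') x)) \<longrightarrow>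
     (\<forall>S'. S' \<subseteq> S \<longrightarrow> (\<forall>x\<in>S'. \<forall>y\<in>S'. ev g x * ev g' y = ev g' x * ev g y) \<longrightarrow> card S' \<le> X) \<longrightarrow>
     card S \<le> C * G ^ (2 * (8 * l + 1)) * (G ^ AA t + X)"
proof -
  obtain C1 where C1: "C1 \<ge> 1" and "\<forall>G\<ge>2. \<forall>S V \<Theta> \<Delta> X. state G (Suc K) S V \<Theta> \<Delta> \<longrightarrow>
     (\<forall>F q x0. F \<subseteq> S \<longrightarrow> x0 \<in> F \<longrightarrow> int G ^ 1 \<le> q \<longrightarrow> q \<le> int C1 * int G ^ Suc 1 \<longrightarrow> coprime (ev \<Delta> x0) q \<longrightarrow>
        (\<forall>x\<in>F. \<forall>i. [x i = x0 i] (mod q)) \<longrightarrow> card F \<le> X) \<longrightarrow>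
     card S \<le> (C1 * G ^ Suc 1) ^ Suc (8 * l) * X"
    using residue_split[of "Suc K" 1] by blast
  note sp = this(2)[rule_format]
  obtain C where "\<forall>G\<ge>2. \<forall>S V \<Theta> \<Delta> g g' X q x0. state G (Suc K) S V \<Theta> \<Delta> \<longrightarrow> card V = t \<longrightarrow> okb G (Suc K) g \<longrightarrow> okb G (Suc K) g' \<longrightarrow>
     (\<forall>x\<in>S. ev g x \<noteq> 0 \<and> ev g' x \<noteq> 0 \<and> (\<forall>k\<in>V. ev g' x * ev (der (\<Theta> k) g) x = ev g x * ev (der (\<Theta> k) g') x)) \<longrightarrow>
     (\<forall>S'. S' \<subseteq> S \<longrightarrow> (\<forall>x\<in>S'. \<forall>y\<in>S'. ev g x * ev g' y = ev g' x * ev g y) \<longrightarrow> card S' \<le> X) \<longrightarrow>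
     x0 \<in> S \<longrightarrow> int G ^ 1 \<le> q \<longrightarrow> q \<le> int C1 * int G ^ Suc 1 \<longrightarrow> coprime (ev \<Delta> x0) q \<longrightarrow> (\<forall>x\<in>S. \<forall>i. [x i = x0 i] (mod q)) \<longrightarrow>
     card S \<le> C * (G ^ AA t + X)"
    using constants_fiber[OF dr, of "Suc K", where ?C1.0 = C1] by auto
  note C = this[rule_format]
  show ?thesis
  proof (rule exI[of _ "C1 ^ Suc (8 * l) * C"], intro allI impI)
    fix G S V \<Theta> \<Delta> g g' X
    assume G: "(2::nat) \<le> G" and st: "state G K S V \<Theta> \<Delta>" and V: "card V = t" and g: "okb G K g" "okb G K g'"
      and w: "\<forall>x\<in>S. ev g x \<noteq> 0 \<and> ev g' x \<noteq> 0 \<and> (\<forall>k\<in>V. ev g' x * ev (der (\<Theta> k) g) x = ev g x * ev (der (\<Theta> k) g') x)"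
      and X: "\<forall>S'. S' \<subseteq> S \<longrightarrow> (\<forall>x\<in>S'. \<forall>y\<in>S'. ev g x * ev g' y = ev g' x * ev g y) \<longrightarrow> card S' \<le> X"
    have G1: "G \<ge> 1" using G by simp
    have st': "state G (Suc K) S V \<Theta> \<Delta>" by (rule state_mono[OF st _ G1]) simp
    have g': "okb G (Suc K) g" "okb G (Suc K) g'" using okb_mono[OF g(1) _ G1] okb_mono[OF g(2) _ G1] by auto
    have "card S \<le> (C1 * G ^ Suc 1) ^ Suc (8 * l) * (C * (G ^ AA t + X))"
    proof (rule sp[OF G st'])
      fix F q x0
      assume F: "F \<subseteq> S" "x0 \<in> F" "int G ^ 1 \<le> q" "q \<le> int C1 * int G ^ Suc 1" "coprime (ev \<Delta> x0) q"
        "\<And>x i. x \<in> F \<Longrightarrow> [x i = x0 i] (mod q)"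
      show "card F \<le> C * (G ^ AA t + X)"
        by (rule C[OF G state_subset[OF st' F(1)] V g' _ _ F(2-5)]) (use w X F in auto)
    qed
    also have "(C1 * G ^ Suc 1) ^ Suc (8 * l) = C1 ^ Suc (8 * l) * G ^ (2 * (8 * l + 1))"
    proof -
      have "Suc 1 * Suc (8 * l) = 2 * (8 * l + 1)" by simp
      then show ?thesis by (simp only: power_mult_distrib power_mult[symmetric])
    qed
    finally show "card S \<le> C1 ^ Suc (8 * l) * C * G ^ (2 * (8 * l + 1)) * (G ^ AA t + X)"
      by (simp only: ac_simps)
  qed
qed

text \<open>This is where the large exponent pays. Relative to a reference point \<open>y\<close>
  the ratio of \<open>n\<close> and \<open>n'\<close> is a reduced fraction, and the
  \<open>e\<close>-th powers of its numerator and denominator divide products of two coefficients.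
  Such a product is at most \<open>Z ^ 2 \<le> B ^ e\<close>, so both are at most
  \<open>B\<close>.\<close>

lemma ratio_split:
  fixes n n' a a' :: "'a \<Rightarrow> int" and B :: nat
  assumes S: "finite S" and e: "e \<ge> 1" and Z: "Z ^ 2 \<le> int B ^ e"
    and pos: "\<And>x. x \<in> S \<Longrightarrow> n x > 0 \<and> n' x > 0 \<and> a x \<noteq> 0 \<and> a' x \<noteq> 0 \<and> \<bar>a x\<bar> \<le> Z \<and> \<bar>a' x\<bar> \<le> Z"
    and eq: "\<And>x y. x \<in> S \<Longrightarrow> y \<in> S \<Longrightarrow> (a x * n x ^ e) * (a' y * n' y ^ e) = (a' x * n' x ^ e) * (a y * n y ^ e)"
    and X: "\<And>S'. S' \<subseteq> S \<Longrightarrow> (\<forall>x\<in>S'. \<forall>y\<in>S'. n x * n' y = n' x * n y) \<Longrightarrow> card S' \<le> X"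
  shows "card S \<le> B ^ 2 * X"
proof (cases "S = {}")
  case False
  then obtain y where y: "y \<in> S" by blast
  define N1 where "N1 x = n x * n' y" for x
  define N2 where "N2 x = n' x * n y" for x
  define \<gamma> where "\<gamma> x = gcd (N1 x) (N2 x)" for x
  define \<alpha> where "\<alpha> x = N1 x div \<gamma> x" for x
  define \<beta> where "\<beta> x = N2 x div \<gamma> x" for x
  have N: "N1 x > 0" "N2 x > 0" if "x \<in> S" for x using pos[OF that] pos[OF y] by (auto simp: N1_def N2_def)
  have ab: "N1 x = \<gamma> x * \<alpha> x" "N2 x = \<gamma> x * \<beta> x" for x by (auto simp: \<alpha>_def \<beta>_def \<gamma>_def)
  have cop: "coprime (\<alpha> x) (\<beta> x)" if "x \<in> S" for x
    unfolding \<alpha>_def \<beta>_def \<gamma>_def using N[OF that] by (intro div_gcd_coprime) auto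
  have gpos: "\<gamma> x > 0" if "x \<in> S" for x using N[OF that] by (auto simp: \<gamma>_def)
  have abpos: "\<alpha> x > 0" "\<beta> x > 0" if "x \<in> S" for x using N[OF that] gpos[OF that] ab[of x] by (auto simp: zero_less_mult_iff)
  have bnd: "u \<le> int B" if "u > 0" "u ^ e dvd p * r" "p \<noteq> 0" "r \<noteq> 0" "\<bar>p\<bar> \<le> Z" "\<bar>r\<bar> \<le> Z" for u p r :: int
  proof (rule ccontr)
    assume "\<not> u \<le> int B"
    then have "int B ^ e < u ^ e" using e by (intro power_strict_mono) auto
    moreover have "u ^ e \<le> \<bar>p * r\<bar>" using that by (intro zdvd_imp_le) auto
    moreover have "\<bar>p * r\<bar> \<le> Z ^ 2" unfolding abs_mult power2_eq_square using that by (intro mult_mono) auto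
    ultimately show False using Z by linarith
  qed
  have ab_le: "\<alpha> x \<le> int B" "\<beta> x \<le> int B" if x: "x \<in> S" for x
  proof -
    have "(a x * a' y) * N1 x ^ e = (a' x * a y) * N2 x ^ e"
      using eq[OF x y] by (simp add: N1_def N2_def power_mult_distrib algebra_simps)
    then have "\<gamma> x ^ e * ((a x * a' y) * \<alpha> x ^ e) = \<gamma> x ^ e * ((a' x * a y) * \<beta> x ^ e)"
      unfolding ab power_mult_distrib by (simp add: algebra_simps)
    then have *: "(a x * a' y) * \<alpha> x ^ e = (a' x * a y) * \<beta> x ^ e" using gpos[OF x] by simp
    have c: "coprime (\<alpha> x ^ e) (\<beta> x ^ e)" using cop[OF x] by simp
    have "\<alpha> x ^ e dvd (a' x * a y) * \<beta> x ^ e" using * by (metis dvd_triv_right)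
    then have "\<alpha> x ^ e dvd a' x * a y" using c by (simp add: coprime_dvd_mult_left_iff)
    then show "\<alpha> x \<le> int B" using pos[OF x] pos[OF y] abpos[OF x] by (intro bnd[of _ "a' x" "a y"]) auto
    have "\<beta> x ^ e dvd (a x * a' y) * \<alpha> x ^ e" using * by (metis dvd_triv_right)
    then have "\<beta> x ^ e dvd a x * a' y" using c by (simp add: coprime_dvd_mult_left_iff coprime_commute)
    then show "\<beta> x \<le> int B" using pos[OF x] pos[OF y] abpos[OF x] by (intro bnd[of _ "a x" "a' y"]) auto
  qed
  define lab where "lab x = (nat (\<alpha> x), nat (\<beta> x))" for x
  have "lab ` S \<subseteq> {1..B} \<times> {1..B}"
  proof
    fix z assume "z \<in> lab ` S"
    then obtain x where "x \<in> S" "z = lab x" by blast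
    then show "z \<in> {1..B} \<times> {1..B}" using ab_le[of x] abpos[of x] by (auto simp: lab_def)
  qed
  then have "card S \<le> card ({1..B} \<times> {1..B}) * X"
  proof (rule card_le_labels[OF S finite_cartesian_product[OF finite_atLeastAtMost finite_atLeastAtMost]])
    fix z
    show "card {x \<in> S. lab x = z} \<le> X"
    proof (rule X)
      show "\<forall>x\<in>{x \<in> S. lab x = z}. \<forall>w\<in>{x \<in> S. lab x = z}. n x * n' w = n' x * n w"
      proof (intro ballI)
        fix x w assume "x \<in> {x \<in> S. lab x = z}" "w \<in> {x \<in> S. lab x = z}"
        then have xw: "x \<in> S" "w \<in> S" "lab x = lab w" by auto
        then have "\<alpha> x = \<alpha> w" "\<beta> x = \<beta> w" using abpos[OF xw(1)] abpos[OF xw(2)] by (auto simp: lab_def)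
        then have "N1 x * N2 w = N2 x * N1 w" unfolding ab by (simp add: algebra_simps)
        then have "(n' y * n y) * (n x * n' w) = (n' y * n y) * (n' x * n w)" by (simp add: N1_def N2_def algebra_simps)
        then show "n x * n' w = n' x * n w" using pos[OF y] by simp
      qed
    qed auto
  qed
  then show ?thesis by (simp add: card_cartesian_product power2_eq_square)
qed auto

definition WL :: nat where "WL = 8 * l * (b + k0 * D)"

text \<open>The exponent of \<open>G\<close> in the coefficients after \<open>n\<close>
  eliminations: each new one multiplies two old coefficients, two of the variables \<open>n\<close>
  and one value of a derivation. Doubling at each of \<open>4 * l\<close> steps is the source of
  \<open>2 ^ (4 * l)\<close> in \<open>weight\<close>.\<close>

fun Wt :: "nat \<Rightarrow> nat" where
  "Wt 0 = k0"
| "Wt (Suc n) = 2 * Wt n + 2 * k0 + WL"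

lemma Wt_mono: "n \<le> m \<Longrightarrow> Wt n \<le> Wt m"
  by (induction m) (auto simp: le_Suc_eq)

lemma Wt_le: "2 * Wt (4 * l) \<le> d - 4 * l"
proof -
  have "Wt n + 2 * k0 + WL = 2 ^ n * (3 * k0 + WL)" for n by (induction n) (auto simp: algebra_simps)
  from this[of "4 * l"] show ?thesis using weight unfolding WL_def by linarith
qed

lemma ac_bound:
  "\<exists>C\<ge>1. \<forall>G\<ge>1. \<forall>V \<Lambda> ps s. (\<forall>k\<in>V. \<forall>j. bd (bx G) (\<Lambda> k j) \<le> int K * int G ^ WL \<and> dg (\<Lambda> k j) \<le> K) \<longrightarrow> set ps \<subseteq> V \<times> UNIV \<longrightarrow>
     length ps = n \<longrightarrow> bd (bx G) (ac m d \<Lambda> ps s) \<le> int C * int G ^ Wt n \<and> dg (ac m d \<Lambda> ps s) \<le> C"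
proof (induction n)
  case 0
  show ?case by (rule exI[of _ 1]) (auto simp: bx_def)
next
  case (Suc n)
  then obtain C where C1: "C \<ge> 1" and "\<forall>G\<ge>1. \<forall>V \<Lambda> ps s. (\<forall>k\<in>V. \<forall>j. bd (bx G) (\<Lambda> k j) \<le> int K * int G ^ WL \<and> dg (\<Lambda> k j) \<le> K) \<longrightarrow> set ps \<subseteq> V \<times> UNIV \<longrightarrow>
     length ps = n \<longrightarrow> bd (bx G) (ac m d \<Lambda> ps s) \<le> int C * int G ^ Wt n \<and> dg (ac m d \<Lambda> ps s) \<le> C" by blast
  note C = this(2)[rule_format]
  define C' where "C' = 2 * (C * (C * C * K + d * (C * K))) + (2 * C + K + 5)"
  show ?case
  proof (rule exI[of _ C'], intro conjI allI impI)
    show "1 \<le> C'" by (simp add: C'_def)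
    fix G and V :: "nat set" and \<Lambda> :: "nat \<Rightarrow> nat \<Rightarrow> pexp" and ps :: "(nat \<times> nat) list" and s
    assume G: "(1::nat) \<le> G" and L: "\<forall>k\<in>V. \<forall>j. bd (bx G) (\<Lambda> k j) \<le> int K * int G ^ WL \<and> dg (\<Lambda> k j) \<le> K"
      and ps: "set ps \<subseteq> V \<times> UNIV" "length ps = Suc n"
    then obtain k r qs where q: "ps = (k, r) # qs" "k \<in> V" "set qs \<subseteq> V \<times> UNIV" "length qs = n" by (cases ps) auto
    define M where "M = bx G"
    define B where "B = int C * int G ^ Wt n"
    define LL where "LL = int K * int G ^ WL"
    have M1: "M \<ge> 1" using bx1[OF G] by (simp add: M_def)
    have LL0: "LL \<ge> 0" by (simp add: LL_def)
    have B0: "B \<ge> 0" by (simp add: B_def)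
    have a: "bd M (ac m d \<Lambda> qs t) \<le> B" "dg (ac m d \<Lambda> qs t) \<le> C" for t
      using C[OF G L[rule_format] q(3,4)] by (auto simp: M_def B_def)
    have nn: "bd M E \<ge> 0" for E using bd_nonneg M1 by simp
    have da: "bd M (der (\<Lambda> k) (ac m d \<Lambda> qs t)) \<le> int C * B * LL" for t
    proof -
      have "bd M (der (\<Lambda> k) (ac m d \<Lambda> qs t)) \<le> int (dg (ac m d \<Lambda> qs t)) * bd M (ac m d \<Lambda> qs t) * LL"
        by (rule bd_der) (use M1 LL0 L q(2) in \<open>auto simp: LL_def M_def\<close>)
      also have "\<dots> \<le> int C * B * LL" using a nn LL0 B0 by (intro mult_mono) auto
      finally show ?thesis .
    qed
    have lb: "bd M (\<Lambda> k j) \<le> LL" for j using L q(2) by (auto simp: M_def LL_def)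
    have half: "bd M (ac m d \<Lambda> qs u) * M * (M * bd M (der (\<Lambda> k) (ac m d \<Lambda> qs v)) + int (d - n) * (bd M (ac m d \<Lambda> qs v) * bd M (\<Lambda> k (m + v))))
        \<le> B * M * (M * (int C * B * LL) + int d * (B * LL))" for u v
      using a da lb nn M1 LL0 B0 by (intro mult_mono add_mono mult_left_mono) (auto intro!: add_nonneg_nonneg mult_nonneg_nonneg)
    have "B * M * (M * (int C * B * LL) + int d * (B * LL)) \<le> B * M * (M * (int C * B * LL) + M * (int d * (B * LL)))"
    proof (intro mult_left_mono add_mono order_refl)
      have "0 \<le> int d * (B * LL)" using B0 LL0 by simp
      then have "1 * (int d * (B * LL)) \<le> M * (int d * (B * LL))" using M1 by (intro mult_right_mono)
      then show "int d * (B * LL) \<le> M * (int d * (B * LL))" by simp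
    qed (use B0 M1 in auto)
    also have "\<dots> = int (C * (C * C * K + d * (C * K))) * int G ^ Wt (Suc n)"
      by (simp add: B_def M_def bx_def LL_def power_add power_mult algebra_simps power2_eq_square)
    finally have half': "bd M (ac m d \<Lambda> qs u) * M * (M * bd M (der (\<Lambda> k) (ac m d \<Lambda> qs v)) + int (d - n) * (bd M (ac m d \<Lambda> qs v) * bd M (\<Lambda> k (m + v))))
        \<le> int (C * (C * C * K + d * (C * K))) * int G ^ Wt (Suc n)" for u v using half[of u v] by linarith
    have "bd M (ac m d \<Lambda> ps s) \<le> 2 * (int (C * (C * C * K + d * (C * K))) * int G ^ Wt (Suc n))"
      using half'[of r s] half'[of s r] q(4) by (simp add: q(1))
    also have "\<dots> = int (2 * (C * (C * C * K + d * (C * K)))) * int G ^ Wt (Suc n)" by simp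
    also have "\<dots> \<le> int C' * int G ^ Wt (Suc n)" by (intro mult_right_mono) (auto simp: C'_def)
    finally show "bd (bx G) (ac m d \<Lambda> ps s) \<le> int C' * int G ^ Wt (Suc n)" by (simp add: M_def)
    have dd: "dg (der (\<Lambda> k) (ac m d \<Lambda> qs t)) \<le> C + K" for t
      using dg_der[of "\<Lambda> k" K "ac m d \<Lambda> qs t"] a(2)[of t] L q(2) by (meson add_le_mono order_refl order_trans)
    have dl: "dg (\<Lambda> k j) \<le> K" for j using L q(2) by auto
    have "dg (ac m d \<Lambda> ps s) \<le> 2 * C + K + 5"
      using a(2)[of r] a(2)[of s] dd[of r] dd[of s] dl[of "m + r"] dl[of "m + s"] unfolding q(1) by (auto simp: max_def)
    then show "dg (ac m d \<Lambda> ps s) \<le> C'" by (simp add: C'_def)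
  qed
qed

lemma ac_bound_all:
  "\<exists>C\<ge>1. \<forall>G\<ge>1. \<forall>V \<Lambda> ps s. (\<forall>k\<in>V. \<forall>j. bd (bx G) (\<Lambda> k j) \<le> int K * int G ^ WL \<and> dg (\<Lambda> k j) \<le> K) \<longrightarrow> set ps \<subseteq> V \<times> UNIV \<longrightarrow>
     length ps \<le> n \<longrightarrow> bd (bx G) (ac m d \<Lambda> ps s) \<le> int C * int G ^ Wt n \<and> dg (ac m d \<Lambda> ps s) \<le> C"
proof -
  have "\<forall>i. \<exists>C. C \<ge> 1 \<and> (\<forall>G\<ge>1. \<forall>V \<Lambda> ps s. (\<forall>k\<in>V. \<forall>j. bd (bx G) (\<Lambda> k j) \<le> int K * int G ^ WL \<and> dg (\<Lambda> k j) \<le> K) \<longrightarrow> set ps \<subseteq> V \<times> UNIV \<longrightarrow>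
     length ps = i \<longrightarrow> bd (bx G) (ac m d \<Lambda> ps s) \<le> int C * int G ^ Wt i \<and> dg (ac m d \<Lambda> ps s) \<le> C)"
    by (intro allI ac_bound)
  from choice[OF this] obtain C where C0: "\<forall>i. C i \<ge> 1 \<and> (\<forall>G\<ge>1. \<forall>V \<Lambda> ps s. (\<forall>k\<in>V. \<forall>j. bd (bx G) (\<Lambda> k j) \<le> int K * int G ^ WL \<and> dg (\<Lambda> k j) \<le> K) \<longrightarrow> set ps \<subseteq> V \<times> UNIV \<longrightarrow>
     length ps = i \<longrightarrow> bd (bx G) (ac m d \<Lambda> ps s) \<le> int (C i) * int G ^ Wt i \<and> dg (ac m d \<Lambda> ps s) \<le> C i)"
    by (rule exE)
  note C1 = conjunct1[OF C0[rule_format]] and C = conjunct2[OF spec[OF C0], rule_format]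
  define CC where "CC = (\<Sum>i\<le>n. C i)"
  have le: "C i \<le> CC" if "i \<le> n" for i unfolding CC_def using that by (intro member_le_sum) auto
  show ?thesis
  proof (rule exI[of _ CC], intro conjI allI impI)
    show "1 \<le> CC" using le[of 0] C1[of 0] by simp
    fix G and V :: "nat set" and \<Lambda> :: "nat \<Rightarrow> nat \<Rightarrow> pexp" and ps :: "(nat \<times> nat) list" and s
    assume G: "(1::nat) \<le> G" and L: "\<forall>k\<in>V. \<forall>j. bd (bx G) (\<Lambda> k j) \<le> int K * int G ^ WL \<and> dg (\<Lambda> k j) \<le> K"
      and ps: "set ps \<subseteq> V \<times> UNIV" "length ps \<le> n"
    have *: "bd (bx G) (ac m d \<Lambda> ps s) \<le> int (C (length ps)) * int G ^ Wt (length ps) \<and> dg (ac m d \<Lambda> ps s) \<le> C (length ps)"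
      by (rule C[OF G L[rule_format] ps(1) refl])
    have "int (C (length ps)) * int G ^ Wt (length ps) \<le> int CC * int G ^ Wt n"
      using le[OF ps(2)] Wt_mono[OF ps(2)] G by (intro mult_mono power_increasing) auto
    then show "bd (bx G) (ac m d \<Lambda> ps s) \<le> int CC * int G ^ Wt n" using * by linarith
    show "dg (ac m d \<Lambda> ps s) \<le> CC" using * le[OF ps(2)] by linarith
  qed
qed

end

section \<open>Merging classes of proportional variables\<close>

context count
begin

text \<open>Pointwise proportionality with nonzero factors preserves the conditions that a
  derivative vanishes or that two logarithmic derivatives agree. The exponent \<open>WL\<close>
  depends on the fixed parameters only; the level enters through the factor \<open>K\<close> and the
  degree.\<close>

definition low :: "nat \<Rightarrow> nat \<Rightarrow> (nat \<Rightarrow> int) set \<Rightarrow> nat set \<Rightarrow> (nat \<Rightarrow> nat \<Rightarrow> pexp) \<Rightarrow> (nat \<Rightarrow> nat \<Rightarrow> pexp) \<Rightarrow> bool" where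
  "low G K S V \<Theta> \<Lambda> \<longleftrightarrow> (\<forall>x\<in>S. \<exists>u v. u \<noteq> 0 \<and> v \<noteq> 0 \<and> (\<forall>k\<in>V. \<forall>E. u * ev (der (\<Lambda> k) E) x = v * ev (der (\<Theta> k) E) x)) \<and>
     (\<forall>k\<in>V. \<forall>j. bd (bx G) (\<Lambda> k j) \<le> int K * int G ^ WL \<and> dg (\<Lambda> k j) \<le> K)"

definition ratio_const :: "(nat \<Rightarrow> int) set \<Rightarrow> (nat \<Rightarrow> nat) \<Rightarrow> bool" where
  "ratio_const S cls \<longleftrightarrow> (\<forall>x\<in>S. \<forall>y\<in>S. \<forall>s<4 * l. \<forall>s'<4 * l. cls s = cls s' \<longrightarrow>
     x (4 * l + s) * y (4 * l + s') = x (4 * l + s') * y (4 * l + s))"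

lemma low_subset: "low G K S V \<Theta> \<Lambda> \<Longrightarrow> S' \<subseteq> S \<Longrightarrow> low G K S' V \<Theta> \<Lambda>"
  unfolding low_def by (elim conjE, rule conjI, rule ballI, drule bspec, erule subsetD, assumption+)

lemma ratio_subset: "ratio_const S cls \<Longrightarrow> S' \<subseteq> S \<Longrightarrow> ratio_const S' cls"
  unfolding ratio_const_def by blast

lemma ratio_merge:
  assumes S: "S \<subseteq> SB l d M" and rc: "ratio_const S cls" and r: "r < 4 * l" "r' < 4 * l"
    and eq: "\<forall>x\<in>S. \<forall>y\<in>S. x (4 * l + r) * y (4 * l + r') = x (4 * l + r') * y (4 * l + r)"
  shows "ratio_const S (\<lambda>s. if cls s = cls r' then cls r else cls s)"
  unfolding ratio_const_def
proof (intro ballI allI impI)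
  fix x y s s'
  assume x: "x \<in> S" and y: "y \<in> S" and s: "s < 4 * l" "s' < 4 * l"
    and c: "(if cls s = cls r' then cls r else cls s) = (if cls s' = cls r' then cls r else cls s')"
  define \<rho> where "\<rho> t = real_of_int (x (4 * l + t)) / real_of_int (y (4 * l + t))" for t
  have pos: "y (4 * l + t) > 0" if "t < 4 * l" for t using SB_D(2)[OF subsetD[OF S y] that] by simp
  have iff: "x (4 * l + t) * y (4 * l + t') = x (4 * l + t') * y (4 * l + t) \<longleftrightarrow> \<rho> t = \<rho> t'" if "t < 4 * l" "t' < 4 * l" for t t'
    using pos[OF that(1)] pos[OF that(2)] unfolding \<rho>_def
    by (simp add: frac_eq_eq flip: of_int_mult)
  have cl: "\<rho> t = \<rho> t'" if "t < 4 * l" "t' < 4 * l" "cls t = cls t'" for t t'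
    using rc x y that iff[OF that(1,2)] unfolding ratio_const_def by blast
  have rr: "\<rho> r = \<rho> r'" using eq x y iff[OF r] by blast
  have "\<rho> s = \<rho> s'"
    using c rr cl[OF s] cl[OF s(1) r(2)] cl[OF s(2) r(2)] cl[OF s(1) r(1)] cl[OF s(2) r(1)] by (auto split: if_splits)
  then show "x (4 * l + s) * y (4 * l + s') = x (4 * l + s') * y (4 * l + s)" using iff[OF s] by blast
qed

text \<open>Induction on the number of classes. Apart from exceptional points either the elimination
  goes through, so that all class sums vanish and \<open>terminal_count\<close> applies, or two
  surviving terms of different classes have a quotient with zero derivatives. In the second case the
  quotient takes few values, hence by \<open>ratio_split\<close> so does the ratio of the two
  variables, and on each value the two classes become one.\<close>

lemma merge:
  assumes dr: "dropP t"
  shows "\<exists>C. \<forall>G\<ge>2. \<forall>S V \<Theta> \<Delta> \<Lambda> cls. state G K S V \<Theta> \<Delta> \<longrightarrow> card V = t \<longrightarrow> low G K S V \<Theta> \<Lambda> \<longrightarrow> ratio_const S cls \<longrightarrow>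
     card (cls ` {..<4 * l}) \<le> \<mu> \<longrightarrow> card S \<le> C * G ^ (AA t + \<mu> * c2)"
proof (induction \<mu>)
  case 0
  show ?case
  proof (rule exI[of _ 0], intro allI impI)
    fix G S V \<Theta> \<Delta> \<Lambda> and cls :: "nat \<Rightarrow> nat"
    assume "card (cls ` {..<4 * l}) \<le> 0"
    then have "{..<4 * l} = {}" by simp
    then have "4 * l = 0" by (simp only: lessThan_empty_iff bot_nat_def)
    then show "card S \<le> 0 * G ^ (AA t + 0 * c2)" using l2 by simp
  qed
next
  case (Suc \<mu>)
  obtain Ci where "\<forall>G\<ge>2. \<forall>S V \<Theta> \<Delta> \<Lambda> cls. state G K S V \<Theta> \<Delta> \<longrightarrow> card V = t \<longrightarrow> low G K S V \<Theta> \<Lambda> \<longrightarrow> ratio_const S cls \<longrightarrow>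
     card (cls ` {..<4 * l}) \<le> \<mu> \<longrightarrow> card S \<le> Ci * G ^ (AA t + \<mu> * c2)" using Suc by (rule exE)
  note IH = this[rule_format]
  obtain Ca where Ca: "Ca \<ge> 1 \<and> (\<forall>G\<ge>1. \<forall>V \<Lambda> ps s. (\<forall>k\<in>V. \<forall>j. bd (bx G) (\<Lambda> k j) \<le> int K * int G ^ WL \<and> dg (\<Lambda> k j) \<le> K) \<longrightarrow> set ps \<subseteq> V \<times> UNIV \<longrightarrow>
     length ps \<le> 4 * l \<longrightarrow> bd (bx G) (ac (4 * l) d \<Lambda> ps s) \<le> int Ca * int G ^ Wt (4 * l) \<and> dg (ac (4 * l) d \<Lambda> ps s) \<le> Ca)"
    using ac_bound_all[of K "4 * l" "4 * l"] by (rule exE)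
  note Ca1 = conjunct1[OF Ca] and acb = conjunct2[OF Ca, rule_format]
  define W where "W = Wt (4 * l)"
  define K2 where "K2 = K + 4 * l * Ca + W + k0 * d + Ca + d"
  define PS where "PS V = {ps :: (nat \<times> nat) list. set ps \<subseteq> V \<times> {..<4 * l} \<and> length ps \<le> 4 * l}" for V
  define NP where "NP = card (PS {..<8 * l})"
  have finPS: "finite (PS V)" if "finite V" for V unfolding PS_def using that by (intro word_finite) auto
  obtain Cd where "\<forall>G\<ge>2. \<forall>S V \<Theta> \<Delta> \<E>. state G K2 S V \<Theta> \<Delta> \<longrightarrow> card V = t \<longrightarrow> finite \<E> \<longrightarrow> card \<E> \<le> NP * (4 * l) + NP \<longrightarrow>
     (\<forall>E\<in>\<E>. okb G K2 E) \<longrightarrow> card {x \<in> S. \<exists>E\<in>\<E>. \<exists>k\<in>V. ev E x = 0 \<and> ev (der (\<Theta> k) E) x \<noteq> 0} \<le> Cd * G ^ AA t"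
    using closed_count[OF dr] by (rule exE)
  note Cd = this[rule_format]
  obtain Cc where "\<forall>G\<ge>2. \<forall>S V \<Theta> \<Delta> g g' X. state G K2 S V \<Theta> \<Delta> \<longrightarrow> card V = t \<longrightarrow> okb G K2 g \<longrightarrow> okb G K2 g' \<longrightarrow>
     (\<forall>x\<in>S. ev g x \<noteq> 0 \<and> ev g' x \<noteq> 0 \<and> (\<forall>k\<in>V. ev g' x * ev (der (\<Theta> k) g) x = ev g x * ev (der (\<Theta> k) g') x)) \<longrightarrow>
     (\<forall>S'. S' \<subseteq> S \<longrightarrow> (\<forall>x\<in>S'. \<forall>y\<in>S'. ev g x * ev g' y = ev g' x * ev g y) \<longrightarrow> card S' \<le> X) \<longrightarrow>
     card S \<le> Cc * G ^ (2 * (8 * l + 1)) * (G ^ AA t + X)"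
    using constants_count[OF dr] by (rule exE)
  note Cc = this[rule_format]
  show ?case
  proof (rule exI[of _ "Cd + 3 ^ (4 * l - 2) + NP * (4 * l) * (4 * l) * (Cc * (1 + Ca ^ 4 * Ci))"], intro allI impI)
    fix G S V \<Theta> \<Delta> \<Lambda> and cls :: "nat \<Rightarrow> nat"
    assume G: "(2::nat) \<le> G" and st: "state G K S V \<Theta> \<Delta>" and V: "card V = t" and low: "low G K S V \<Theta> \<Lambda>"
      and rc: "ratio_const S cls" and cls: "card (cls ` {..<4 * l}) \<le> Suc \<mu>"
    let ?m = "4 * l"
    have G1: "G \<ge> 1" using G by simp
    note fV = state_finV[OF st]
    have Vs: "V \<subseteq> {..<8 * l}" and SBs: "S \<subseteq> SB l d (bx G)" using st by (auto simp: state_def)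
    have st2: "state G K2 S V \<Theta> \<Delta>" by (rule state_mono[OF st _ G1]) (simp add: K2_def)
    have Lb: "bd (bx G) (\<Lambda> k j) \<le> int K * int G ^ WL \<and> dg (\<Lambda> k j) \<le> K" if "k \<in> V" for k j using low that by (auto simp: low_def)
    have acB: "bd (bx G) (ac ?m d \<Lambda> ps s) \<le> int Ca * int G ^ W" "dg (ac ?m d \<Lambda> ps s) \<le> Ca" if "ps \<in> PS V" for ps s
    proof -
      have ps: "set ps \<subseteq> V \<times> UNIV" "length ps \<le> ?m" using that by (auto simp: PS_def)
      show "bd (bx G) (ac ?m d \<Lambda> ps s) \<le> int Ca * int G ^ W" "dg (ac ?m d \<Lambda> ps s) \<le> Ca"
        using acb[OF G1 Lb ps] by (simp_all add: W_def)
    qed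
    have Gm: "int G ^ i \<le> int G ^ j" if "i \<le> j" for i j using G that by (intro power_increasing) auto
    have gcB: "bd (bx G) (gc ?m d \<Lambda> ps s) \<le> int Ca * int G ^ (W + k0 * d)" "dg (gc ?m d \<Lambda> ps s) \<le> Ca + d" if "ps \<in> PS V" for ps s
    proof -
      have "bd (bx G) (gc ?m d \<Lambda> ps s) = bd (bx G) (ac ?m d \<Lambda> ps s) * int G ^ (k0 * (d - length ps))"
        by (simp add: gc_def bd_ppow bx_def power_mult)
      also have "\<dots> \<le> (int Ca * int G ^ W) * int G ^ (k0 * d)"
        using acB[OF that] by (intro mult_mono Gm) auto
      finally show "bd (bx G) (gc ?m d \<Lambda> ps s) \<le> int Ca * int G ^ (W + k0 * d)" by (simp add: power_add)
      show "dg (gc ?m d \<Lambda> ps s) \<le> Ca + d" using acB(2)[OF that, of s] by (simp add: gc_def dg_ppow)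
    qed
    have okac: "okb G K2 (ac ?m d \<Lambda> ps s)" if "ps \<in> PS V" for ps s
    proof -
      have "int Ca * int G ^ W \<le> int K2 * int G ^ K2" by (intro mult_mono Gm) (auto simp: K2_def)
      then show ?thesis using acB[OF that, of s] by (simp add: okb_def K2_def)
    qed
    have okgc: "okb G K2 (gc ?m d \<Lambda> ps s)" if "ps \<in> PS V" for ps s
    proof -
      have "int Ca * int G ^ (W + k0 * d) \<le> int K2 * int G ^ K2" by (intro mult_mono Gm) (auto simp: K2_def)
      moreover have "Ca + d \<le> K2" by (simp add: K2_def)
      ultimately show ?thesis using gcB[OF that, of s] unfolding okb_def by linarith
    qed
    have okRR: "okb G K2 (RR ?m d \<Lambda> ps)" if "ps \<in> PS V" for ps
    proof -
      have "bd (bx G) (RR ?m d \<Lambda> ps) = (\<Sum>s<?m. bd (bx G) (gc ?m d \<Lambda> ps s))"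
        by (simp add: RR_def bd_psum interv_sum_list_conv_sum_set_nat atLeast0LessThan)
      also have "\<dots> \<le> (\<Sum>s<?m. int Ca * int G ^ (W + k0 * d))" by (intro sum_mono gcB that)
      also have "\<dots> = int (4 * l * Ca) * int G ^ (W + k0 * d)" by simp
      also have "\<dots> \<le> int K2 * int G ^ K2" by (intro mult_mono Gm) (auto simp: K2_def)
      finally have "bd (bx G) (RR ?m d \<Lambda> ps) \<le> int K2 * int G ^ K2" .
      moreover have "dg (RR ?m d \<Lambda> ps) \<le> Ca + d" unfolding RR_def by (rule dg_psum) (rule gcB(2)[OF that])
      ultimately show ?thesis by (simp add: okb_def K2_def)
    qed
    have cPS: "card (PS V) \<le> NP" unfolding NP_def using Vs by (intro card_mono finPS) (auto simp: PS_def)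
    \<comment> \<open>All coefficients and relations that an elimination can meet. Their number is
      bounded in terms of \<open>l\<close> alone, so a single use of \<open>closed_count\<close>
      covers them.\<close>
    define \<E> where "\<E> = (\<lambda>(ps, s). ac ?m d \<Lambda> ps s) ` (PS V \<times> {..<?m}) \<union> RR ?m d \<Lambda> ` PS V"
    have finE: "finite \<E>" using finPS[OF fV] by (auto simp: \<E>_def)
    have "card \<E> \<le> card (PS V \<times> {..<?m}) + card (PS V)"
      unfolding \<E>_def by (intro order_trans[OF card_Un_le] add_mono card_image_le) (use finPS[OF fV] in auto)
    also have "\<dots> \<le> NP * (4 * l) + NP"
      unfolding card_cartesian_product card_lessThan by (intro add_mono mult_le_mono1 cPS)
    finally have cE: "card \<E> \<le> NP * (4 * l) + NP" .
    define bad where "bad = {x \<in> S. \<exists>E\<in>\<E>. \<exists>k\<in>V. ev E x = 0 \<and> ev (der (\<Theta> k) E) x \<noteq> 0}"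
    have cbad: "card bad \<le> Cd * G ^ AA t" unfolding bad_def
      by (rule Cd[OF G st2 V finE cE]) (use okac okRR in \<open>auto simp: \<E>_def\<close>)
    define good where "good = {x \<in> S. \<forall>c. (\<Sum>s | s < ?m \<and> cls s = c. x s * x (?m + s) ^ d) = 0}"
    have cgood: "card good \<le> 3 ^ (4 * l - 2) * G ^ AA t"
    proof -
      have "card good \<le> nat (2 * bx G + 1) ^ (4 * l - 2)"
        by (rule terminal_count[of l d "bx G" good cls])
          (use l2 d4 bx1[OF G1] SBs rc in \<open>auto simp: good_def ratio_const_def\<close>)
      also have "\<dots> \<le> (3 * G ^ k0) ^ (4 * l - 2)"
        using bx1[OF G1] by (intro power_mono) (auto simp: bx_def nat_le_iff)
      also have "\<dots> = 3 ^ (4 * l - 2) * G ^ (k0 * (4 * l - 2))" by (simp add: power_mult_distrib power_mult)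
      also have "\<dots> \<le> 3 ^ (4 * l - 2) * G ^ AA t" using G by (intro mult_le_mono2 power_increasing) (auto simp: AA_def)
      finally show ?thesis .
    qed
    \<comment> \<open>The points at which \<open>nobeta\<close> fails for \<open>ps\<close>,
      \<open>r\<close>, \<open>r'\<close>: both terms survive and their logarithmic derivatives
      agree.\<close>
    define beta where "beta = (\<lambda>(ps, r, r'). {x \<in> S. cls r \<noteq> cls r' \<and> ev (ac ?m d \<Lambda> ps r) x \<noteq> 0 \<and> ev (ac ?m d \<Lambda> ps r') x \<noteq> 0 \<and>
       (\<forall>k\<in>V. ev (gc ?m d \<Lambda> ps r') x * ev (der (\<Lambda> k) (gc ?m d \<Lambda> ps r)) x =
              ev (gc ?m d \<Lambda> ps r) x * ev (der (\<Lambda> k) (gc ?m d \<Lambda> ps r')) x)})"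
    have cover: "S \<subseteq> bad \<union> good \<union> (\<Union>p\<in>PS V \<times> {..<?m} \<times> {..<?m}. beta p)"
    proof
      fix x assume x: "x \<in> S"
      show "x \<in> bad \<union> good \<union> (\<Union>p\<in>PS V \<times> {..<?m} \<times> {..<?m}. beta p)"
      proof (rule ccontr)
        assume nx: "\<not> ?thesis"
        obtain u v where uv: "u \<noteq> 0" "v \<noteq> 0" "\<forall>k\<in>V. \<forall>E. u * ev (der (\<Lambda> k) E) x = v * ev (der (\<Theta> k) E) x"
          using low x by (auto simp: low_def)
        \<comment> \<open>Exceptional points are counted with \<open>\<Theta>\<close>, for which the
          induction hypothesis is available, whereas the elimination uses \<open>\<Lambda>\<close>;
          proportionality transfers the conclusion.\<close>
        have closed: "ev (der (\<Lambda> k) E) x = 0" if "E \<in> \<E>" "k \<in> V" "ev E x = 0" for E k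
        proof -
          have "ev (der (\<Theta> k) E) x = 0" using nx x that by (auto simp: bad_def)
          then show ?thesis using uv that by (metis mult_eq_0_iff)
        qed
        have "(\<Sum>s | s < ?m \<and> cls s = c. ev (gc ?m d \<Lambda> [] s) x) = 0" for c
        proof (rule elimination[of ?m d x V \<Lambda> cls])
          show "x (?m + s) \<noteq> 0" if "s < ?m" for s using SB_D(2)[OF subsetD[OF SBs x] that] by simp
          show "ev (der (\<Lambda> k) (ac ?m d \<Lambda> ps s)) x = 0"
            if "set ps \<subseteq> V \<times> {..<?m}" "length ps \<le> ?m" "s < ?m" "k \<in> V" "ev (ac ?m d \<Lambda> ps s) x = 0" for ps s k
            by (rule closed) (use that in \<open>auto simp: \<E>_def PS_def\<close>)
          show "ev (der (\<Lambda> k) (RR ?m d \<Lambda> ps)) x = 0"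
            if "set ps \<subseteq> V \<times> {..<?m}" "length ps \<le> ?m" "k \<in> V" "ev (RR ?m d \<Lambda> ps) x = 0" for ps k
            by (rule closed) (use that in \<open>auto simp: \<E>_def PS_def\<close>)
          show "\<exists>k\<in>V. ev (gc ?m d \<Lambda> ps r') x * ev (der (\<Lambda> k) (gc ?m d \<Lambda> ps r)) x \<noteq>
              ev (gc ?m d \<Lambda> ps r) x * ev (der (\<Lambda> k) (gc ?m d \<Lambda> ps r')) x"
            if "set ps \<subseteq> V \<times> {..<?m}" "length ps \<le> ?m" "r < ?m" "r' < ?m" "cls r \<noteq> cls r'"
              "ev (ac ?m d \<Lambda> ps r) x \<noteq> 0" "ev (ac ?m d \<Lambda> ps r') x \<noteq> 0" for ps r r'
          proof -
            have "(ps, r, r') \<in> PS V \<times> {..<?m} \<times> {..<?m}" using that by (auto simp: PS_def)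
            then have "x \<notin> beta (ps, r, r')" using nx by blast
            then show ?thesis using x that by (auto simp: beta_def)
          qed
          have "card {s. s < ?m \<and> ev (ac ?m d \<Lambda> [] s) x \<noteq> 0} \<le> card {..<?m}" by (intro card_mono) auto
          then show "length ([] :: (nat \<times> nat) list) + card {s. s < ?m \<and> ev (ac ?m d \<Lambda> [] s) x \<noteq> 0} \<le> ?m" by simp
          show "ev (RR ?m d \<Lambda> []) x = 0" using SB_D(7)[OF subsetD[OF SBs x]] by (simp add: ev_RR gc_def)
        qed (use d4 in auto)
        then have "x \<in> good" using x by (auto simp: good_def gc_def)
        then show False using nx by blast
      qed
    qed
    have cbeta: "card (beta p) \<le> Cc * (1 + Ca ^ 4 * Ci) * G ^ (AA t + Suc \<mu> * c2)" if p: "p \<in> PS V \<times> {..<?m} \<times> {..<?m}" for p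
    proof -
      obtain ps r r' where pe: "p = (ps, r, r')" "ps \<in> PS V" "r < ?m" "r' < ?m" using p by auto
      define e where "e = d - length ps"
      have len: "length ps \<le> ?m" using pe by (simp add: PS_def)
      have e1: "e \<ge> 1" "2 * W \<le> e" using len d4 Wt_le by (auto simp: e_def W_def)
      have bS: "beta p \<subseteq> S" by (auto simp: beta_def pe)
      \<comment> \<open>The coefficients may be as large as \<open>G ^ W\<close>, but
        \<open>2 * W \<le> e\<close> puts their squares below \<open>B ^ e\<close> with
        \<open>B\<close> linear in \<open>G\<close>. So the ratio costs only \<open>G ^ 2\<close>,
        the summand 2 in \<open>c2\<close>.\<close>
      define B where "B = Ca ^ 2 * G"
      define X where "X = B ^ 2 * (Ci * G ^ (AA t + \<mu> * c2))"
      have "card (beta p) \<le> Cc * G ^ (2 * (8 * l + 1)) * (G ^ AA t + X)"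
      proof (rule Cc[OF G state_subset[OF st2 bS] V okgc[OF pe(2), of r] okgc[OF pe(2), of r']])
        fix x assume xb: "x \<in> beta p"
        then have x: "x \<in> S" using bS by blast
        have n0: "x (?m + s) \<noteq> 0" if "s < ?m" for s using SB_D(2)[OF subsetD[OF SBs x] that] by simp
        obtain u v where uv: "u \<noteq> 0" "v \<noteq> 0" "\<forall>k\<in>V. \<forall>E. u * ev (der (\<Lambda> k) E) x = v * ev (der (\<Theta> k) E) x"
          using low x by (auto simp: low_def)
        show "ev (gc ?m d \<Lambda> ps r) x \<noteq> 0 \<and> ev (gc ?m d \<Lambda> ps r') x \<noteq> 0 \<and>
          (\<forall>k\<in>V. ev (gc ?m d \<Lambda> ps r') x * ev (der (\<Theta> k) (gc ?m d \<Lambda> ps r)) x = ev (gc ?m d \<Lambda> ps r) x * ev (der (\<Theta> k) (gc ?m d \<Lambda> ps r')) x)"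
        proof (intro conjI ballI)
          show "ev (gc ?m d \<Lambda> ps r) x \<noteq> 0" "ev (gc ?m d \<Lambda> ps r') x \<noteq> 0"
            using xb n0[OF pe(3)] n0[OF pe(4)] by (auto simp: beta_def pe gc_def)
          fix k assume k: "k \<in> V"
          have "ev (gc ?m d \<Lambda> ps r') x * ev (der (\<Lambda> k) (gc ?m d \<Lambda> ps r)) x =
              ev (gc ?m d \<Lambda> ps r) x * ev (der (\<Lambda> k) (gc ?m d \<Lambda> ps r')) x" using xb k by (auto simp: beta_def pe)
          then have "ev (gc ?m d \<Lambda> ps r') x * (u * ev (der (\<Lambda> k) (gc ?m d \<Lambda> ps r)) x) =
              ev (gc ?m d \<Lambda> ps r) x * (u * ev (der (\<Lambda> k) (gc ?m d \<Lambda> ps r')) x)" by (metis mult.left_commute)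
          then have "v * (ev (gc ?m d \<Lambda> ps r') x * ev (der (\<Theta> k) (gc ?m d \<Lambda> ps r)) x)
              = v * (ev (gc ?m d \<Lambda> ps r) x * ev (der (\<Theta> k) (gc ?m d \<Lambda> ps r')) x)" using uv(3) k by (simp add: mult.left_commute)
          then show "ev (gc ?m d \<Lambda> ps r') x * ev (der (\<Theta> k) (gc ?m d \<Lambda> ps r)) x = ev (gc ?m d \<Lambda> ps r) x * ev (der (\<Theta> k) (gc ?m d \<Lambda> ps r')) x"
            using uv(2) by simp
        qed
      next
        fix S'
        assume S': "S' \<subseteq> beta p" and "\<And>x y. x \<in> S' \<Longrightarrow> y \<in> S' \<Longrightarrow>
           ev (gc ?m d \<Lambda> ps r) x * ev (gc ?m d \<Lambda> ps r') y = ev (gc ?m d \<Lambda> ps r') x * ev (gc ?m d \<Lambda> ps r) y"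
        note eqg = this(2)
        show "card S' \<le> X"
          unfolding X_def
        proof (rule ratio_split[where n = "\<lambda>x. x (?m + r)" and n' = "\<lambda>x. x (?m + r')" and a = "ev (ac ?m d \<Lambda> ps r)"
              and a' = "ev (ac ?m d \<Lambda> ps r')" and e = e and Z = "int Ca * int G ^ W"])
          show "finite S'" using S' bS state_fin[OF st] by (meson finite_subset)
          show "(int Ca * int G ^ W)\<^sup>2 \<le> int B ^ e"
          proof -
            have "(int Ca ^ 2) ^ 1 \<le> (int Ca ^ 2) ^ e" using Ca1 e1 by (intro power_increasing) auto
            moreover have "int G ^ (2 * W) \<le> int G ^ e" by (rule Gm[OF e1(2)])
            ultimately have "int Ca ^ 2 * int G ^ (2 * W) \<le> (int Ca ^ 2) ^ e * int G ^ e" by (intro mult_mono) auto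
            then show ?thesis by (simp add: B_def power_mult_distrib power_mult[symmetric] mult.commute)
          qed
          fix x assume xS: "x \<in> S'"
          then have x: "x \<in> S" and xb: "x \<in> beta p" using S' bS by auto
          have "\<bar>ev (ac ?m d \<Lambda> ps s) x\<bar> \<le> int Ca * int G ^ W" for s
            using ev_bd[of x "bx G" "ac ?m d \<Lambda> ps s"] state_bound[OF st x] acB(1)[OF pe(2), of s] by (meson order_trans)
          then show "x (?m + r) > 0 \<and> x (?m + r') > 0 \<and> ev (ac ?m d \<Lambda> ps r) x \<noteq> 0 \<and> ev (ac ?m d \<Lambda> ps r') x \<noteq> 0 \<and>
            \<bar>ev (ac ?m d \<Lambda> ps r) x\<bar> \<le> int Ca * int G ^ W \<and> \<bar>ev (ac ?m d \<Lambda> ps r') x\<bar> \<le> int Ca * int G ^ W"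
            using xb SB_D(2)[OF subsetD[OF SBs x] pe(3)] SB_D(2)[OF subsetD[OF SBs x] pe(4)] by (auto simp: beta_def pe)
          fix y assume yS: "y \<in> S'"
          show "(ev (ac ?m d \<Lambda> ps r) x * x (?m + r) ^ e) * (ev (ac ?m d \<Lambda> ps r') y * y (?m + r') ^ e)
             = (ev (ac ?m d \<Lambda> ps r') x * x (?m + r') ^ e) * (ev (ac ?m d \<Lambda> ps r) y * y (?m + r) ^ e)"
            using eqg[OF xS yS] by (simp add: gc_def e_def)
        next
          fix S'' assume S'': "S'' \<subseteq> S'" and eqn: "\<forall>x\<in>S''. \<forall>y\<in>S''. x (?m + r) * y (?m + r') = x (?m + r') * y (?m + r)"
          have S2: "S'' \<subseteq> S" using S'' S' bS by blast
          show "card S'' \<le> Ci * G ^ (AA t + \<mu> * c2)"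
          proof (cases "S'' = {}")
            case False
            then have crr: "cls r \<noteq> cls r'" using S'' S' by (auto simp: beta_def pe)
            define cls' where "cls' = (\<lambda>s. if cls s = cls r' then cls r else cls s)"
            have "cls' ` {..<?m} \<subseteq> cls ` {..<?m} - {cls r'}" using pe crr by (auto simp: cls'_def)
            then have "card (cls' ` {..<?m}) \<le> card (cls ` {..<?m} - {cls r'})" by (intro card_mono) auto
            also have "\<dots> \<le> \<mu>" using cls pe by (simp add: card_Diff_singleton)
            finally have "card (cls' ` {..<?m}) \<le> \<mu>" .
            moreover have "ratio_const S'' cls'" unfolding cls'_def
              by (rule ratio_merge[OF _ ratio_subset[OF rc S2] pe(3,4) eqn]) (use S2 SBs in auto)
            ultimately show ?thesis by (intro IH[OF G state_subset[OF st S2] V low_subset[OF low S2]])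
          qed simp
        qed (use e1 in auto)
      qed
      also have "G ^ AA t + X \<le> (1 + Ca ^ 4 * Ci) * G ^ (AA t + \<mu> * c2 + 2)"
      proof -
        have "G ^ AA t \<le> G ^ (AA t + \<mu> * c2 + 2)" using G by (intro power_increasing) auto
        moreover have "X = Ca ^ 4 * Ci * G ^ (AA t + \<mu> * c2 + 2)"
          by (simp add: X_def B_def power_mult_distrib power_add power_mult[symmetric] algebra_simps power2_eq_square power4_eq_xxxx)
        ultimately show ?thesis by (simp add: algebra_simps)
      qed
      also have "Cc * G ^ (2 * (8 * l + 1)) * ((1 + Ca ^ 4 * Ci) * G ^ (AA t + \<mu> * c2 + 2))
        = Cc * (1 + Ca ^ 4 * Ci) * G ^ (2 * (8 * l + 1) + (AA t + \<mu> * c2 + 2))" by (simp only: power_add ac_simps)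
      also have "2 * (8 * l + 1) + (AA t + \<mu> * c2 + 2) = AA t + Suc \<mu> * c2" by (simp add: c2_def algebra_simps)
      finally show ?thesis by simp
    qed
    have fin: "finite (PS V \<times> {..<?m} \<times> {..<?m})" using finPS[OF fV] by auto
    have cT: "card (PS V \<times> {..<?m} \<times> {..<?m}) \<le> NP * (4 * l) * (4 * l)"
      using cPS by (simp add: card_cartesian_product mult.assoc mult_le_mono1)
    have finS: "finite S" by (rule state_fin[OF st])
    have "card S \<le> card (bad \<union> good \<union> (\<Union>p\<in>PS V \<times> {..<?m} \<times> {..<?m}. beta p))"
      by (rule card_mono[OF _ cover]) (use fin finS in \<open>auto simp: bad_def good_def beta_def\<close>)
    also have "\<dots> \<le> card bad + card good + card (\<Union>p\<in>PS V \<times> {..<?m} \<times> {..<?m}. beta p)"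
      by (intro order_trans[OF card_Un_le] add_mono card_Un_le order_refl)
    also have "card (\<Union>p\<in>PS V \<times> {..<?m} \<times> {..<?m}. beta p) \<le> (\<Sum>p\<in>PS V \<times> {..<?m} \<times> {..<?m}. card (beta p))"
      by (rule card_UN_le[OF fin])
    also have "\<dots> \<le> (\<Sum>p\<in>PS V \<times> {..<?m} \<times> {..<?m}. Cc * (1 + Ca ^ 4 * Ci) * G ^ (AA t + Suc \<mu> * c2))"
      by (intro sum_mono cbeta)
    also have "\<dots> \<le> (NP * (4 * l) * (4 * l)) * (Cc * (1 + Ca ^ 4 * Ci) * G ^ (AA t + Suc \<mu> * c2))"
      unfolding sum_constant of_nat_id by (rule mult_le_mono1[OF cT])
    finally have "card S \<le> Cd * G ^ AA t + 3 ^ (4 * l - 2) * G ^ AA t + (NP * (4 * l) * (4 * l)) * (Cc * (1 + Ca ^ 4 * Ci) * G ^ (AA t + Suc \<mu> * c2))"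
      using cbad cgood by linarith
    moreover have "G ^ AA t \<le> G ^ (AA t + Suc \<mu> * c2)" using G by (intro power_increasing) auto
    then have "Cd * G ^ AA t \<le> Cd * G ^ (AA t + Suc \<mu> * c2)" "3 ^ (4 * l - 2) * G ^ AA t \<le> 3 ^ (4 * l - 2) * G ^ (AA t + Suc \<mu> * c2)"
      by simp_all
    ultimately have "card S \<le> Cd * G ^ (AA t + Suc \<mu> * c2) + 3 ^ (4 * l - 2) * G ^ (AA t + Suc \<mu> * c2)
       + (NP * (4 * l) * (4 * l)) * (Cc * (1 + Ca ^ 4 * Ci) * G ^ (AA t + Suc \<mu> * c2))" by linarith
    also have "\<dots> = (Cd + 3 ^ (4 * l - 2) + NP * (4 * l) * (4 * l) * (Cc * (1 + Ca ^ 4 * Ci))) * G ^ (AA t + Suc \<mu> * c2)"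
      by (simp only: add_mult_distrib mult.assoc)
    finally show "card S \<le> (Cd + 3 ^ (4 * l - 2) + NP * (4 * l) * (4 * l) * (Cc * (1 + Ca ^ 4 * Ci))) * G ^ (AA t + Suc \<mu> * c2)" .
  qed
qed

end

section \<open>Derivations of low height and the induction on the dimension\<close>

context count
begin

text \<open>For every coordinate \<open>j\<close> that is not a parameter the pigeonhole principle
  yields a polynomial in \<open>x j\<close> and the parameters that vanishes on the class, with
  degree \<open>D\<close> and coefficients up to \<open>G ^ b\<close> at every level. Implicit
  differentiation expresses \<open>\<Theta> k j\<close> by its partial derivatives, and clearing
  denominators gives derivations to which \<open>merge\<close> applies.\<close>

lemma low_fiber:
  assumes dr: "dropP t" and t: "t \<le> 8 * l - 5"
  shows "\<exists>C. \<forall>G\<ge>2. \<forall>S V \<Theta> \<Delta> q x0. state G K S V \<Theta> \<Delta> \<longrightarrow> card V = t \<longrightarrow>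
     x0 \<in> S \<longrightarrow> int G ^ k1 \<le> q \<longrightarrow> q \<le> int C1 * int G ^ Suc k1 \<longrightarrow> coprime (ev \<Delta> x0) q \<longrightarrow> (\<forall>x\<in>S. \<forall>i. [x i = x0 i] (mod q)) \<longrightarrow>
     card S \<le> C * G ^ (AA t + 4 * l * c2)"
proof -
  define bn where "bn = (T0 + t) choose Suc t"
  define N where "N = (D + Suc t) choose Suc t"
  have manyN: "Suc k1 * bn < b * N" unfolding bn_def N_def by (rule many[OF t])
  define WP where "WP = b + k0 * D"
  define C2 where "C2 = N * Suc D ^ Suc D"
  define K1 where "K1 = K + C2 + WP + D"
  define Ws where "Ws V = {us :: nat list. set us \<subseteq> V \<and> length us \<le> D}" for V
  define W where "W = card (Ws {..<8 * l})"
  have finWs: "finite (Ws V)" if "finite V" for V unfolding Ws_def by (rule word_finite[OF that])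
  obtain Cd where "\<forall>G\<ge>2. \<forall>S V \<Theta> \<Delta> \<E>. state G K1 S V \<Theta> \<Delta> \<longrightarrow> card V = t \<longrightarrow> finite \<E> \<longrightarrow> card \<E> \<le> 8 * l * W \<longrightarrow>
     (\<forall>E\<in>\<E>. okb G K1 E) \<longrightarrow> card {x \<in> S. \<exists>E\<in>\<E>. \<exists>k\<in>V. ev E x = 0 \<and> ev (der (\<Theta> k) E) x \<noteq> 0} \<le> Cd * G ^ AA t"
    using closed_count[OF dr] by (rule exE)
  note Cd = this[rule_format]
  define K3 where "K3 = K + C2 ^ (8 * l) + 8 * l * D"
  obtain Cm where "\<forall>G\<ge>2. \<forall>S V \<Theta> \<Delta> \<Lambda> cls. state G K3 S V \<Theta> \<Delta> \<longrightarrow> card V = t \<longrightarrow> low G K3 S V \<Theta> \<Lambda> \<longrightarrow> ratio_const S cls \<longrightarrow>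
     card (cls ` {..<4 * l}) \<le> 4 * l \<longrightarrow> card S \<le> Cm * G ^ (AA t + 4 * l * c2)"
    using merge[OF dr] by (rule exE)
  note Cm = this[rule_format]
  define G0 where "G0 = C1 ^ bn + N + 1"
  define C' where "C' = (2 * G0 ^ k0 + 1) ^ (8 * l)"
  have N1: "N \<ge> 1" unfolding N_def by (simp add: Suc_le_eq)
  have "N * Suc D ^ Suc D > 0" using N1 by (intro mult_pos_pos) auto
  then have C21: "C2 \<ge> 1" unfolding C2_def by linarith
  show ?thesis
  proof (rule exI[of _ "Cd + W ^ (8 * l) * Cm + C'"], intro allI impI)
    fix G S V \<Theta> \<Delta> q x0
    assume G: "(2::nat) \<le> G" and st: "state G K S V \<Theta> \<Delta>" and V: "card V = t"
      and x0: "x0 \<in> S" and q1: "int G ^ k1 \<le> q" and q2: "q \<le> int C1 * int G ^ Suc k1" and cop: "coprime (ev \<Delta> x0) q"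
      and cl: "\<forall>x\<in>S. \<forall>i. [x i = x0 i] (mod q)"
    note fV = state_finV[OF st]
    have G1: "G \<ge> 1" using G by simp
    have Gp: "int G ^ k1 > 0" using G by simp
    have q0: "q > 0" using q1 Gp by linarith
    have Vs: "V \<subseteq> {..<8 * l}" using st by (simp add: state_def)
    have Ge: "G ^ (AA t + 4 * l * c2) \<ge> 1" "G ^ AA t \<le> G ^ (AA t + 4 * l * c2)" using G by (auto intro: power_increasing)
    show "card S \<le> (Cd + W ^ (8 * l) * Cm + C') * G ^ (AA t + 4 * l * c2)"
    proof (cases "G \<ge> G0")
      case False
      have "card S \<le> card (SB l d (bx G))" using st SB_finite(1)[of "bx G" l d] bx1[OF G1] by (intro card_mono) (auto simp: state_def)
      also have "\<dots> \<le> nat (2 * bx G + 1) ^ (8 * l)" using SB_finite(2)[of "bx G" l d] bx1[OF G1] by simp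
      also have "\<dots> \<le> C' * 1"
      proof -
        have "int G ^ k0 \<le> int G0 ^ k0" using False by (intro power_mono) auto
        then have "nat (2 * bx G + 1) \<le> 2 * G0 ^ k0 + 1" by (simp add: bx_def nat_le_iff)
        then show ?thesis unfolding C'_def mult_1_right by (intro power_mono) auto
      qed
      also have "\<dots> \<le> (Cd + W ^ (8 * l) * Cm + C') * G ^ (AA t + 4 * l * c2)" using Ge(1) by (intro mult_mono) auto
      finally show ?thesis .
    next
      case True
      obtain \<phi> where \<phi>: "\<And>j. vars (\<phi> j) \<subseteq> V" "\<And>j x. x \<in> S \<Longrightarrow> [x j = ev (\<phi> j) x] (mod q ^ T0)"
      proof -
        have "\<forall>j. \<exists>\<phi>. vars \<phi> \<subseteq> V \<and> (\<forall>x\<in>S. [x j = ev \<phi> x] (mod q ^ T0))"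
        proof
          fix j
          have "hens S V \<Theta> \<Delta>" using st by (simp add: state_def)
          then obtain \<phi> where "vars \<phi> \<subseteq> V" "\<forall>x\<in>S. (\<forall>i. [x i = x0 i] (mod q)) \<longrightarrow> [x j = ev \<phi> x] (mod q ^ T0)"
            using x0 q0 cop unfolding hens_def by blast
          then show "\<exists>\<phi>. vars \<phi> \<subseteq> V \<and> (\<forall>x\<in>S. [x j = ev \<phi> x] (mod q ^ T0))" using cl by blast
        qed
        then show ?thesis using that by metis
      qed
      define J where "J = {..<8 * l} - V"
      have cards: "card (insert j V) = Suc t" if "j \<in> J" for j using that fV V by (auto simp: J_def)
      have "\<forall>j\<in>J. \<exists>c. (\<exists>\<gamma>\<in>Gam (insert j V) D. c \<gamma> \<noteq> 0) \<and> (\<forall>\<gamma>. \<bar>c \<gamma>\<bar> \<le> int G ^ b) \<and> (\<forall>\<gamma>. \<gamma> \<notin> Gam (insert j V) D \<longrightarrow> c \<gamma> = 0) \<and>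
         (\<forall>x\<in>S. (\<Sum>\<gamma>\<in>Gam (insert j V) D. c \<gamma> * mval (insert j V) x \<gamma>) = 0)"
      proof
        fix j assume j: "j \<in> J"
        let ?W = "insert j V"
        have fW: "finite ?W" using fV by simp
        have cG: "card (Gam ?W D) = N" by (simp add: Gam_card[OF fW] cards[OF j] N_def del: card_insert_disjoint)
        show "\<exists>c. (\<exists>\<gamma>\<in>Gam ?W D. c \<gamma> \<noteq> 0) \<and> (\<forall>\<gamma>. \<bar>c \<gamma>\<bar> \<le> int G ^ b) \<and> (\<forall>\<gamma>. \<gamma> \<notin> Gam ?W D \<longrightarrow> c \<gamma> = 0) \<and>
         (\<forall>x\<in>S. (\<Sum>\<gamma>\<in>Gam ?W D. c \<gamma> * mval ?W x \<gamma>) = 0)"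
        proof (rule siegel[of "Gam ?W D" V q "int G ^ b" S x0 "\<lambda>\<gamma> x. mval ?W x \<gamma>" T0 "bx G ^ D"])
          show "1 \<le> int G ^ b" using G by simp
          show "[x i = x0 i] (mod q)" if "x \<in> S" for x i using cl that by blast
          show "\<exists>\<phi>. vars \<phi> \<subseteq> V \<and> (\<forall>x\<in>S. [mval ?W x \<gamma> = ev \<phi> x] (mod q ^ T0))" for \<gamma>
          proof -
            let ?E = "pexp_mono ?W \<gamma>"
            have "mval ?W x \<gamma> = ev ?E x" for x by (simp add: ev_pexp_mono[OF fW])
            moreover have "[ev ?E x = ev ?E (\<lambda>j. ev (\<phi> j) x)] (mod q ^ T0)" if "x \<in> S" for x
              by (rule ev_cong_mod) (rule \<phi>(2)[OF that])
            ultimately show ?thesis using \<phi>(1) by (intro exI[of _ "sub \<phi> ?E"]) (auto simp only: ev_sub vars_sub)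
          qed
          show "\<bar>mval ?W x \<gamma>\<bar> \<le> bx G ^ D" if x: "x \<in> S" and g: "\<gamma> \<in> Gam ?W D" for x \<gamma>
          proof -
            have "\<bar>mval ?W x \<gamma>\<bar> = (\<Prod>i\<in>?W. \<bar>x i\<bar> ^ \<gamma> i)" unfolding mval_def abs_prod power_abs ..
            also have "\<dots> \<le> (\<Prod>i\<in>?W. bx G ^ \<gamma> i)" by (intro prod_mono conjI power_mono state_bound[OF st x]) auto
            also have "\<dots> = bx G ^ sum \<gamma> ?W" by (rule power_sum[symmetric])
            also have "\<dots> \<le> bx G ^ D" using g bx1[OF G1] by (intro power_increasing) (auto simp: Gam_def)
            finally show ?thesis .
          qed
          show "q ^ ((T0 + card V) choose Suc (card V)) < (int G ^ b) ^ card (Gam ?W D)"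
          proof -
            have "q ^ bn \<le> (int C1 * int G ^ Suc k1) ^ bn" using q0 q2 by (intro power_mono) auto
            also have "\<dots> = int (C1 ^ bn) * int G ^ (Suc k1 * bn)" by (simp only: power_mult_distrib power_mult of_nat_power)
            also have "\<dots> < int G * int G ^ (Suc k1 * bn)"
            proof (rule mult_strict_right_mono)
              have "C1 ^ bn < G" using True by (simp add: G0_def)
              then show "int (C1 ^ bn) < int G" by (simp only: of_nat_less_iff)
            qed (use G in simp)
            also have "\<dots> = int G ^ Suc (Suc k1 * bn)" by simp
            also have "\<dots> \<le> int G ^ (b * N)" using manyN G by (intro power_increasing) auto
            finally show ?thesis unfolding cG V bn_def[symmetric] power_mult[symmetric] .
          qed
          show "int (card (Gam ?W D)) * (int G ^ b * bx G ^ D) < q ^ T0"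
          proof -
            have "int (card (Gam ?W D)) * (int G ^ b * bx G ^ D) = int N * int G ^ WP"
              unfolding cG by (simp add: bx_def WP_def power_add power_mult)
            also have "\<dots> < int G * int G ^ WP" using True G by (intro mult_strict_right_mono) (auto simp: G0_def)
            also have "\<dots> = int G ^ Suc WP" by simp
            also have "\<dots> \<le> int G ^ (k1 * T0)" using small G by (intro power_increasing) (auto simp: WP_def)
            also have "\<dots> \<le> q ^ T0" unfolding power_mult using q1 by (intro power_mono) auto
            finally show ?thesis .
          qed
        qed (use fV q0 Gam_finite[OF fW] in auto)
      qed
      from bchoice[OF this] obtain c where c0: "\<forall>j\<in>J. (\<exists>\<gamma>\<in>Gam (insert j V) D. c j \<gamma> \<noteq> 0) \<and> (\<forall>\<gamma>. \<bar>c j \<gamma>\<bar> \<le> int G ^ b) \<and> (\<forall>\<gamma>. \<gamma> \<notin> Gam (insert j V) D \<longrightarrow> c j \<gamma> = 0) \<and>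
         (\<forall>x\<in>S. (\<Sum>\<gamma>\<in>Gam (insert j V) D. c j \<gamma> * mval (insert j V) x \<gamma>) = 0)" by (rule exE)
      have c: "\<And>j. j \<in> J \<Longrightarrow> \<exists>\<gamma>\<in>Gam (insert j V) D. c j \<gamma> \<noteq> 0" "\<And>j \<gamma>. j \<in> J \<Longrightarrow> \<bar>c j \<gamma>\<bar> \<le> int G ^ b"
         "\<And>j \<gamma>. j \<in> J \<Longrightarrow> \<gamma> \<notin> Gam (insert j V) D \<Longrightarrow> c j \<gamma> = 0"
         "\<And>j x. j \<in> J \<Longrightarrow> x \<in> S \<Longrightarrow> (\<Sum>\<gamma>\<in>Gam (insert j V) D. c j \<gamma> * mval (insert j V) x \<gamma>) = 0"
        using c0 by blast+
      define PP where "PP j us = PE (insert j V) D (itd us (c j))" for j us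
      define pp where "pp j us x = pv (insert j V) D (itd us (c j)) x" for j us x
      have fW: "finite (insert j V)" for j using fV by simp
      have evPP: "ev (PP j us) x = pp j us x" for j us x unfolding PP_def pp_def by (rule ev_PE[OF fW])
      have sup: "sup_in (insert j V) D (itd us (c j))" if "j \<in> J" "set us \<subseteq> insert j V" for j us
        by (rule sup_in_itd[OF fW _ that(2)]) (use c(3)[OF that(1)] in \<open>auto simp: sup_in_def\<close>)
      have PPb: "bd (bx G) (PP j us) \<le> int C2 * int G ^ WP" "dg (PP j us) \<le> D"
        if j: "j \<in> J" and us: "set us \<subseteq> insert j V" "length us \<le> Suc D" for j us
      proof -
        have cb: "\<bar>itd us (c j) \<gamma>\<bar> \<le> int (Suc D) ^ Suc D * int G ^ b" for \<gamma>
        proof -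
          have "\<bar>itd us (c j) \<gamma>\<bar> \<le> int D ^ length us * int G ^ b"
            by (rule itd_bound[OF _ fW us(1)]) (use sup[OF j, of "[]"] c(2)[OF j] in auto)
          also have "\<dots> \<le> int (Suc D) ^ length us * int G ^ b" by (intro mult_right_mono power_mono) auto
          also have "\<dots> \<le> int (Suc D) ^ Suc D * int G ^ b" using us(2) by (intro mult_right_mono power_increasing) auto
          finally show ?thesis .
        qed
        have cG: "card (Gam (insert j V) D) = N" unfolding Gam_card[OF fW] cards[OF j] N_def ..
        have "bd (bx G) (PP j us) \<le> int (card (Gam (insert j V) D)) * ((int (Suc D) ^ Suc D * int G ^ b) * bx G ^ D)"
          unfolding PP_def by (rule bd_PE(1)[OF fW bx1[OF G1] cb])
        also have "\<dots> = int C2 * int G ^ WP"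
          unfolding cG C2_def WP_def bx_def by (simp only: power_add power_mult[symmetric] of_nat_mult of_nat_power ac_simps)
        finally show "bd (bx G) (PP j us) \<le> int C2 * int G ^ WP" .
        show "dg (PP j us) \<le> D" unfolding PP_def by (rule bd_PE(2)[OF fW bx1[OF G1] cb])
      qed
      define \<E> where "\<E> = (\<Union>j\<in>J. PP j ` Ws (insert j V))"
      have finJ: "finite J" by (simp add: J_def)
      have finE: "finite \<E>" using finJ finWs[OF fW] by (auto simp: \<E>_def)
      have cW: "card (Ws (insert j V)) \<le> W" if "j \<in> J" for j
        unfolding W_def using that Vs by (intro card_mono finWs) (auto simp: Ws_def J_def)
      have "card \<E> \<le> (\<Sum>j\<in>J. card (PP j ` Ws (insert j V)))" unfolding \<E>_def by (rule card_UN_le[OF finJ])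
      also have "\<dots> \<le> (\<Sum>j\<in>J. W)" by (intro sum_mono order_trans[OF card_image_le[OF finWs[OF fW]]] cW)
      also have "\<dots> \<le> 8 * l * W"
      proof -
        have "card J \<le> card {..<8 * l}" by (intro card_mono) (auto simp: J_def)
        then show ?thesis by simp
      qed
      finally have cE: "card \<E> \<le> 8 * l * W" .
      have okE: "okb G K1 E" if "E \<in> \<E>" for E
      proof -
        obtain j us where ju: "j \<in> J" "us \<in> Ws (insert j V)" "E = PP j us" using \<open>E \<in> \<E>\<close> by (auto simp: \<E>_def)
        have us: "set us \<subseteq> insert j V" "length us \<le> Suc D" using ju(2) by (auto simp: Ws_def)
        have "int C2 * int G ^ WP \<le> int K1 * int G ^ K1" using G by (intro mult_mono power_increasing) (auto simp: K1_def)
        then show ?thesis using PPb[OF ju(1) us] ju(3) by (simp add: okb_def K1_def)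
      qed
      have st1: "state G K1 S V \<Theta> \<Delta>" by (rule state_mono[OF st _ G1]) (simp add: K1_def)
      define bad where "bad = {x \<in> S. \<exists>E\<in>\<E>. \<exists>k\<in>V. ev E x = 0 \<and> ev (der (\<Theta> k) E) x \<noteq> 0}"
      have cbad: "card bad \<le> Cd * G ^ AA t" unfolding bad_def by (rule Cd[OF G st1 V finE cE okE])
      have derPP: "ev (der (\<Theta> k) (PP j us)) x = ev \<Delta> x * pp j (us @ [k]) x + pp j (us @ [j]) x * ev (\<Theta> k j) x"
        if j: "j \<in> J" and us: "set us \<subseteq> insert j V" and k: "k \<in> V" and x: "x \<in> S" for j us k x
      proof -
        have jV: "j \<notin> V" using j by (simp add: J_def)
        have "ev (der (\<Theta> k) (PP j us)) x = (\<Sum>i\<in>insert j V. pp j (us @ [i]) x * ev (\<Theta> k i) x)"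
          unfolding ev_der PP_def pp_def itd_snoc by (rule dv_PE[OF fW sup[OF j us]])
        also have "\<dots> = pp j (us @ [j]) x * ev (\<Theta> k j) x + (\<Sum>i\<in>V. pp j (us @ [i]) x * ev (\<Theta> k i) x)"
          using jV fV by simp
        also have "(\<Sum>i\<in>V. pp j (us @ [i]) x * ev (\<Theta> k i) x) = (\<Sum>i\<in>V. if i = k then ev \<Delta> x * pp j (us @ [i]) x else 0)"
          using st x k by (intro sum.cong refl) (auto simp: state_def tang_def)
        also have "\<dots> = ev \<Delta> x * pp j (us @ [k]) x" using fV k by simp
        finally show ?thesis by simp
      qed
      \<comment> \<open>The descent stops at a derived polynomial that vanishes at \<open>x\<close>
        but has a nonzero partial derivative. At a point that is not bad its derivations vanish too.
        If the partial derivative in \<open>x j\<close> were 0, this would annihilate all partial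
        derivatives in the parameters as well; so \<open>x j\<close> genuinely occurs.\<close>
      have key: "\<exists>us\<in>Ws (insert j V). pp j us x = 0 \<and> pp j (us @ [j]) x \<noteq> 0 \<and> (\<forall>k\<in>V. ev \<Delta> x * pp j (us @ [k]) x + pp j (us @ [j]) x * ev (\<Theta> k j) x = 0)"
        if x: "x \<in> S - bad" and j: "j \<in> J" for x j
      proof -
        have xS: "x \<in> S" using x by simp
        have "\<exists>us i. set us \<subseteq> insert j V \<and> length us \<le> D \<and> i \<in> insert j V \<and> pv (insert j V) D (itd us (c j)) x = 0
          \<and> pv (insert j V) D (itd (us @ [i]) (c j)) x \<noteq> 0"
        proof (rule descent[OF fW])
          show "sup_in (insert j V) D (c j)" using sup[OF j, of "[]"] by simp
          show "\<exists>\<gamma>. c j \<gamma> \<noteq> 0" using c(1)[OF j] by blast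
          show "pv (insert j V) D (c j) x = 0" using c(4)[OF j xS] by (simp only: pv_def)
        qed
        then obtain us i where us: "set us \<subseteq> insert j V" "length us \<le> D" "i \<in> insert j V" "pp j us x = 0" "pp j (us @ [i]) x \<noteq> 0"
          unfolding pp_def by blast
        have uW: "us \<in> Ws (insert j V)" using us by (simp add: Ws_def)
        have D0: "ev \<Delta> x * pp j (us @ [k]) x + pp j (us @ [j]) x * ev (\<Theta> k j) x = 0" if k: "k \<in> V" for k
        proof -
          have "PP j us \<in> \<E>" using j uW by (auto simp: \<E>_def)
          moreover have "ev (PP j us) x = 0" using us(4) by (simp only: evPP)
          ultimately have "ev (der (\<Theta> k) (PP j us)) x = 0" using x k by (auto simp: bad_def)
          then show ?thesis using derPP[OF j us(1) k xS] by simp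
        qed
        have "pp j (us @ [j]) x \<noteq> 0"
        proof
          assume z: "pp j (us @ [j]) x = 0"
          then have iV: "i \<in> V" using us(3,5) by auto
          have "ev \<Delta> x \<noteq> 0" using st xS by (auto simp: state_def)
          then show False using D0[OF iV] z us(5) by simp
        qed
        then show ?thesis using uW us(4) D0 by blast
      qed
      define U where "U x j = (SOME us. us \<in> Ws (insert j V) \<and> pp j us x = 0 \<and> pp j (us @ [j]) x \<noteq> 0 \<and>
          (\<forall>k\<in>V. ev \<Delta> x * pp j (us @ [k]) x + pp j (us @ [j]) x * ev (\<Theta> k j) x = 0))" for x j
      have U: "U x j \<in> Ws (insert j V) \<and> pp j (U x j) x = 0 \<and> pp j (U x j @ [j]) x \<noteq> 0 \<and>
          (\<forall>k\<in>V. ev \<Delta> x * pp j (U x j @ [k]) x + pp j (U x j @ [j]) x * ev (\<Theta> k j) x = 0)"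
        if "x \<in> S - bad" "j \<in> J" for x j
        unfolding U_def by (rule someI_ex) (use key[OF that] in blast)
      \<comment> \<open>The words \<open>U x j\<close> depend on the point. Fixing them for all
        \<open>j\<close> splits the points into a number of parts that does not depend on
        \<open>G\<close>.\<close>
      define LL where "LL = PiE J (\<lambda>j. Ws (insert j V))"
      have "card (S - bad) \<le> card LL * (Cm * G ^ (AA t + 4 * l * c2))"
      proof (rule card_le_labels[where lab = "\<lambda>x. restrict (U x) J"])
        show "finite (S - bad)" using state_fin[OF st] by simp
        show "finite LL" unfolding LL_def by (intro finite_PiE finJ finWs fW)
        show "(\<lambda>x. restrict (U x) J) ` (S - bad) \<subseteq> LL" using U by (auto simp: LL_def)
        fix w assume "w \<in> LL"
        define F where "F = {x \<in> S - bad. restrict (U x) J = w}"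
        have FS: "F \<subseteq> S" by (auto simp: F_def)
        have wU: "w j = U x j" if "x \<in> F" "j \<in> J" for x j using that by (auto simp: F_def)
        have wW: "w j \<in> Ws (insert j V)" if "j \<in> J" for j using \<open>w \<in> LL\<close> that by (auto simp: LL_def)
        have wF: "pp j (w j @ [j]) x \<noteq> 0" "k \<in> V \<Longrightarrow> ev \<Delta> x * pp j (w j @ [k]) x + pp j (w j @ [j]) x * ev (\<Theta> k j) x = 0"
          if "x \<in> F" "j \<in> J" for x j k
          using U[of x j] wU[OF that] that by (auto simp: F_def)
        \<comment> \<open>The common denominator \<open>\<Delta>L\<close> is the product over
          \<open>J\<close> of the derivative of the \<open>i\<close>-th polynomial in its own
          variable \<open>i\<close>. With it, \<open>\<Lambda> k\<close> becomes
          \<open>\<Delta>L\<close> times \<open>\<Theta> k\<close> divided by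
          \<open>\<Delta>\<close>, now as an expression of controlled height.\<close>
        define \<Lambda> where "\<Lambda> k j = (if j = k then pprod (\<lambda>i. PP i (w i @ [i])) (lst J)
            else if j \<in> J then Mul (Con (-1)) (Mul (PP j (w j @ [k])) (pprod (\<lambda>i. PP i (w i @ [i])) (lst (J - {j})))) else Con 0)" for k j
        define \<Delta>L where "\<Delta>L x = (\<Prod>i\<in>J. pp i (w i @ [i]) x)" for x
        have evpr: "ev (pprod (\<lambda>i. PP i (w i @ [i])) (lst A)) x = (\<Prod>i\<in>A. pp i (w i @ [i]) x)" if "A \<subseteq> J" for A x
          using lst[OF finite_subset[OF that finJ]] by (simp add: ev_pprod evPP prod.distinct_set_conv_list[symmetric])
        have scale: "ev \<Delta> x * ev (\<Lambda> k j) x = \<Delta>L x * ev (\<Theta> k j) x" if x: "x \<in> F" and k: "k \<in> V" for x k j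
        proof -
          have xS: "x \<in> S" using x FS by blast
          consider "j = k" | "j \<noteq> k" "j \<in> V" | "j \<in> J" "j \<noteq> k" | "j \<ge> 8 * l" "j \<notin> J" "j \<noteq> k" by (cases "j = k"; cases "j \<in> V"; cases "j < 8 * l") (auto simp: J_def)
          then show ?thesis
          proof cases
            case 1
            then show ?thesis using st xS k by (simp add: \<Lambda>_def evpr \<Delta>L_def state_def tang_def)
          next
            case 2
            then have "j \<notin> J" by (simp add: J_def)
            then show ?thesis using st xS k 2 by (auto simp: \<Lambda>_def state_def tang_def)
          next
            case 3
            have "\<Delta>L x = pp j (w j @ [j]) x * (\<Prod>i\<in>J - {j}. pp i (w i @ [i]) x)" unfolding \<Delta>L_def using finJ 3 by (simp add: prod.remove)
            moreover have "ev (\<Lambda> k j) x = - (pp j (w j @ [k]) x * (\<Prod>i\<in>J - {j}. pp i (w i @ [i]) x))"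
              using 3 by (simp add: \<Lambda>_def evpr evPP)
            moreover have "ev \<Delta> x * pp j (w j @ [k]) x = - (pp j (w j @ [j]) x * ev (\<Theta> k j) x)" using wF(2)[OF x 3(1) k] by linarith
            moreover have "ev \<Delta> x * (- (pp j (w j @ [k]) x * P)) = - ((ev \<Delta> x * pp j (w j @ [k]) x) * P)" for P by simp
            ultimately show ?thesis by simp
          next
            case 4
            then show ?thesis using st xS k by (auto simp: \<Lambda>_def state_def)
          qed
        qed
        have G1i: "int C2 * int G ^ WP \<ge> 1" using C21 G by (simp add: int_one_le_iff_zero_less)
        have wlen: "set (w i @ [i']) \<subseteq> insert i V" "length (w i @ [i']) \<le> Suc D" if "i \<in> J" "i' \<in> insert i V" for i i'
          using wW[OF that(1)] that(2) by (auto simp: Ws_def)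
        have prb: "bd (bx G) (pprod (\<lambda>i. PP i (w i @ [i])) (lst A)) \<le> (int C2 * int G ^ WP) ^ card A"
          "dg (pprod (\<lambda>i. PP i (w i @ [i])) (lst A)) \<le> D * card A" if "A \<subseteq> J" for A
        proof -
          note fA = finite_subset[OF that finJ]
          have "bd (bx G) (pprod (\<lambda>i. PP i (w i @ [i])) (lst A)) = (\<Prod>i\<in>A. bd (bx G) (PP i (w i @ [i])))"
            using lst[OF fA] by (simp add: bd_pprod prod.distinct_set_conv_list[symmetric])
          also have "\<dots> \<le> (\<Prod>i\<in>A. int C2 * int G ^ WP)"
          proof (rule prod_mono)
            fix i assume "i \<in> A"
            then have i: "i \<in> J" using that by blast
            show "0 \<le> bd (bx G) (PP i (w i @ [i])) \<and> bd (bx G) (PP i (w i @ [i])) \<le> int C2 * int G ^ WP"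
              using bd_nonneg[of "bx G"] bx1[OF G1] PPb(1)[OF i wlen[OF i]] by auto
          qed
          finally show "bd (bx G) (pprod (\<lambda>i. PP i (w i @ [i])) (lst A)) \<le> (int C2 * int G ^ WP) ^ card A" by simp
          have "dg (pprod (\<lambda>i. PP i (w i @ [i])) (lst A)) = (\<Sum>i\<in>A. dg (PP i (w i @ [i])))"
            using lst[OF fA] by (simp add: dg_pprod sum_list_distinct_conv_sum_set)
          also have "\<dots> \<le> (\<Sum>i\<in>A. D)"
          proof (rule sum_mono)
            fix i assume "i \<in> A"
            then have i: "i \<in> J" using that by blast
            show "dg (PP i (w i @ [i])) \<le> D" by (rule PPb(2)[OF i wlen[OF i]]) auto
          qed
          finally show "dg (pprod (\<lambda>i. PP i (w i @ [i])) (lst A)) \<le> D * card A" by (simp add: mult.commute)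
        qed
        have cJ: "card J \<le> 8 * l"
        proof -
          have "card J \<le> card {..<8 * l}" by (intro card_mono) (auto simp: J_def)
          then show ?thesis by simp
        qed
        have DJ: "D * card J \<le> K3"
        proof -
          have "D * card J \<le> D * (8 * l)" by (rule mult_le_mono2[OF cJ])
          also have "\<dots> = 8 * l * D" by (rule mult.commute)
          also have "\<dots> \<le> K3" unfolding K3_def by linarith
          finally show ?thesis .
        qed
        \<comment> \<open>The values of \<open>\<Lambda>\<close> are products of at most
          \<open>8 * l\<close> derived polynomials, each of height about
          \<open>G ^ (b + k0 * D)\<close>; this is the origin of \<open>WL\<close>.\<close>
        have big: "(int C2 * int G ^ WP) ^ i \<le> int K3 * int G ^ WL" if "i \<le> 8 * l" for i
        proof -
          have "(int C2 * int G ^ WP) ^ i \<le> (int C2 * int G ^ WP) ^ (8 * l)" using G1i that by (intro power_increasing) auto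
          also have "\<dots> = int (C2 ^ (8 * l)) * int G ^ WL"
            by (simp add: power_mult_distrib WL_def WP_def power_mult[symmetric] mult.commute)
          also have "\<dots> \<le> int K3 * int G ^ WL" by (intro mult_right_mono) (auto simp: K3_def)
          finally show ?thesis .
        qed
        have LamB: "bd (bx G) (\<Lambda> k j) \<le> int K3 * int G ^ WL \<and> dg (\<Lambda> k j) \<le> K3" if k: "k \<in> V" for k j
        proof -
          consider "j = k" | "j \<in> J" "j \<noteq> k" | "j \<noteq> k" "j \<notin> J" by blast
          then show ?thesis
          proof cases
            case 1
            show ?thesis using prb[of J] big[OF cJ] 1 DJ unfolding \<Lambda>_def by auto
          next
            case 2
            have sub: "J - {j} \<subseteq> J" by blast
            have c1: "card J = Suc (card (J - {j}))" using 2 finJ by (simp add: card_Suc_Diff1 del: card_Diff_insert)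
            have p: "bd (bx G) (PP j (w j @ [k])) \<le> int C2 * int G ^ WP" "dg (PP j (w j @ [k])) \<le> D"
              using PPb[OF 2(1) wlen[OF 2(1)]] k by auto
            have "bd (bx G) (\<Lambda> k j) = bd (bx G) (PP j (w j @ [k])) * bd (bx G) (pprod (\<lambda>i. PP i (w i @ [i])) (lst (J - {j})))"
              using 2 by (simp add: \<Lambda>_def)
            also have "\<dots> \<le> (int C2 * int G ^ WP) * (int C2 * int G ^ WP) ^ card (J - {j})"
              using p prb[OF sub] bd_nonneg[of "bx G"] bx1[OF G1] G1i by (intro mult_mono) auto
            also have "\<dots> = (int C2 * int G ^ WP) ^ card J" unfolding c1 by simp
            also have "\<dots> \<le> int K3 * int G ^ WL" by (rule big[OF cJ])
            finally have 1: "bd (bx G) (\<Lambda> k j) \<le> int K3 * int G ^ WL" .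
            have "dg (\<Lambda> k j) \<le> D + D * card (J - {j})" using 2 p prb(2)[OF sub] by (simp add: \<Lambda>_def)
            also have "\<dots> = D * card J" unfolding c1 by simp
            also have "\<dots> \<le> K3" by (rule DJ)
            finally show ?thesis using 1 by blast
          next
            case 3
            then show ?thesis by (simp add: \<Lambda>_def)
          qed
        qed
        have lowF: "low G K3 F V \<Theta> \<Lambda>"
          unfolding low_def
        proof (intro conjI ballI)
          fix x assume x: "x \<in> F"
          show "\<exists>u v. u \<noteq> 0 \<and> v \<noteq> 0 \<and> (\<forall>k\<in>V. \<forall>E. u * ev (der (\<Lambda> k) E) x = v * ev (der (\<Theta> k) E) x)"
          proof (rule exI[of _ "ev \<Delta> x"], rule exI[of _ "\<Delta>L x"], intro conjI ballI allI)
            show "ev \<Delta> x \<noteq> 0" using st x FS by (auto simp: state_def)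
            show "\<Delta>L x \<noteq> 0" using wF(1)[OF x] finJ by (simp add: \<Delta>L_def)
            fix k E assume k: "k \<in> V"
            have "ev \<Delta> x * ev (der (\<Lambda> k) E) x = dv E x (\<lambda>j. ev \<Delta> x * ev (\<Lambda> k j) x)" by (simp only: ev_der dv_scale)
            also have "\<dots> = dv E x (\<lambda>j. \<Delta>L x * ev (\<Theta> k j) x)" by (simp only: scale[OF x k])
            also have "\<dots> = \<Delta>L x * ev (der (\<Theta> k) E) x" by (simp only: ev_der dv_scale)
            finally show "ev \<Delta> x * ev (der (\<Lambda> k) E) x = \<Delta>L x * ev (der (\<Theta> k) E) x" .
          qed
        qed (use LamB in auto)
        have "card F \<le> Cm * G ^ (AA t + 4 * l * c2)"
        proof (rule Cm[OF G _ V lowF, where cls = "\<lambda>s. s"])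
          show "state G K3 F V \<Theta> \<Delta>" by (rule state_mono[OF state_subset[OF st FS] _ G1]) (simp add: K3_def)
          show "ratio_const F (\<lambda>s. s)" by (simp add: ratio_const_def mult.commute)
        qed simp
        then show "card {x \<in> S - bad. restrict (U x) J = w} \<le> Cm * G ^ (AA t + 4 * l * c2)" unfolding F_def .
      qed
      also have "card LL \<le> W ^ (8 * l)"
      proof -
        have "card LL = (\<Prod>j\<in>J. card (Ws (insert j V)))" unfolding LL_def by (rule card_PiE[OF finJ])
        also have "\<dots> \<le> (\<Prod>j\<in>J. W)" by (intro prod_mono conjI cW) auto
        also have "\<dots> = W ^ card J" by simp
        also have "\<dots> \<le> W ^ (8 * l)"
        proof (rule power_increasing)
          show "card J \<le> 8 * l" using card_mono[of "{..<8 * l}" J] by (auto simp: J_def)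
          have "[] \<in> Ws {..<8 * l}" by (simp add: Ws_def)
          then show "1 \<le> W" unfolding W_def using finWs[of "{..<8 * l}"] by (metis One_nat_def Suc_leI card_gt_0_iff empty_iff finite_lessThan)
        qed
        finally show ?thesis .
      qed
      finally have "card (S - bad) \<le> W ^ (8 * l) * (Cm * G ^ (AA t + 4 * l * c2))" by simp
      moreover have "card S \<le> card bad + card (S - bad)"
        using card_Un_le[of bad "S - bad"] by (simp add: bad_def Un_absorb1 Un_Diff_cancel Collect_restrict)
      moreover have "Cd * G ^ AA t \<le> Cd * G ^ (AA t + 4 * l * c2)" using Ge(2) by simp
      ultimately have "card S \<le> Cd * G ^ (AA t + 4 * l * c2) + W ^ (8 * l) * (Cm * G ^ (AA t + 4 * l * c2))"
        using cbad by linarith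
      also have "\<dots> \<le> (Cd + W ^ (8 * l) * Cm + C') * G ^ (AA t + 4 * l * c2)" by (simp add: algebra_simps)
      finally show ?thesis .
    qed
  qed
qed

lemma level_step: assumes dr: "dropP t" and t: "t \<le> 8 * l - 5" shows "Plev t"
  unfolding Plev_def
proof
  fix K
  obtain C1 where C1: "C1 \<ge> 1 \<and> (\<forall>G\<ge>2. \<forall>S V \<Theta> \<Delta> X. state G K S V \<Theta> \<Delta> \<longrightarrow>
     (\<forall>F q x0. F \<subseteq> S \<longrightarrow> x0 \<in> F \<longrightarrow> int G ^ k1 \<le> q \<longrightarrow> q \<le> int C1 * int G ^ Suc k1 \<longrightarrow> coprime (ev \<Delta> x0) q \<longrightarrow>
        (\<forall>x\<in>F. \<forall>i. [x i = x0 i] (mod q)) \<longrightarrow> card F \<le> X) \<longrightarrow>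
     card S \<le> (C1 * G ^ Suc k1) ^ Suc (8 * l) * X)"
    using residue_split[of K k1] by (rule exE)
  note sp = conjunct2[OF C1, rule_format]
  obtain C where "\<forall>G\<ge>2. \<forall>S V \<Theta> \<Delta> q x0. state G K S V \<Theta> \<Delta> \<longrightarrow> card V = t \<longrightarrow>
     x0 \<in> S \<longrightarrow> int G ^ k1 \<le> q \<longrightarrow> q \<le> int C1 * int G ^ Suc k1 \<longrightarrow> coprime (ev \<Delta> x0) q \<longrightarrow> (\<forall>x\<in>S. \<forall>i. [x i = x0 i] (mod q)) \<longrightarrow>
     card S \<le> C * G ^ (AA t + 4 * l * c2)"
    using low_fiber[OF dr t] by (rule exE)
  note C = this[rule_format]
  show "\<exists>C. \<forall>G\<ge>2. \<forall>S V \<Theta> \<Delta>. state G K S V \<Theta> \<Delta> \<longrightarrow> card V = t \<longrightarrow> card S \<le> C * G ^ AA (Suc t)"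
  proof (rule exI[of _ "C1 ^ Suc (8 * l) * C"], intro allI impI)
    fix G S V \<Theta> \<Delta>
    assume G: "(2::nat) \<le> G" and st: "state G K S V \<Theta> \<Delta>" and V: "card V = t"
    have "card S \<le> (C1 * G ^ Suc k1) ^ Suc (8 * l) * (C * G ^ (AA t + 4 * l * c2))"
    proof (rule sp[OF G st])
      fix F q x0
      assume F: "F \<subseteq> S" "x0 \<in> F" "int G ^ k1 \<le> q" "q \<le> int C1 * int G ^ Suc k1" "coprime (ev \<Delta> x0) q"
        "\<And>x i. x \<in> F \<Longrightarrow> [x i = x0 i] (mod q)"
      show "card F \<le> C * G ^ (AA t + 4 * l * c2)"
        by (rule C[OF G state_subset[OF st F(1)] V F(2-5)]) (rule F(6))
    qed
    also have "\<dots> = C1 ^ Suc (8 * l) * C * G ^ (Suc k1 * Suc (8 * l) + (AA t + 4 * l * c2))"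
      by (simp only: power_mult_distrib power_mult[symmetric] power_add ac_simps)
    also have "Suc k1 * Suc (8 * l) + (AA t + 4 * l * c2) = AA (Suc t)" by (simp add: AA_def cc_def)
    finally show "card S \<le> C1 ^ Suc (8 * l) * C * G ^ AA (Suc t)" .
  qed
qed

lemma level: "t \<le> 8 * l - 5 \<Longrightarrow> Plev t"
proof (induction t)
  case 0
  then show ?case using level_step[OF drop_0] by simp
next
  case (Suc t)
  then show ?case using level_step[OF drop_Suc] by simp
qed

end

section \<open>The counting bound\<close>

lemma sum_group_split:
  fixes f :: "nat \<Rightarrow> 'a::comm_monoid_add"
  assumes "l \<ge> 1" "g < 4"
  shows "(\<Sum>s | s < 4 * l \<and> s div l = g. f s) = f (g * l) + (\<Sum>s | s < 4 * l \<and> s div l = g \<and> s \<noteq> g * l. f s)"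
proof -
  have gl: "g * l < 4 * l" "g * l div l = g" using assms by auto
  then have "{s. s < 4 * l \<and> s div l = g} = insert (g * l) {s. s < 4 * l \<and> s div l = g \<and> s \<noteq> g * l}" by auto
  then show ?thesis by simp
qed

section \<open>The initial parameters and the transversality of the equation\<close>

context count
begin

definition piv :: "nat set" where "piv = (\<lambda>g. g * l) ` {..<4}"

text \<open>The first \<open>h\<close> of each group is determined by the others through the group
  sum. These relations are linear, so the initial parametrization is exact, with
  \<open>\<Delta> = 1\<close>, and four coordinates disappear at no cost.\<close>

definition V1 :: "nat set" where "V1 = {..<8 * l} - piv"

definition \<Theta>1 :: "nat \<Rightarrow> nat \<Rightarrow> pexp" where
  "\<Theta>1 k j = Con (if j = k then 1 else if j \<in> piv \<and> k < 4 * l \<and> k div l = j div l then -1 else 0)"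

definition F1 :: pexp where "F1 = psum (\<lambda>s. Mul (Var s) (ppow (Var (4 * l + s)) d)) [0..<4 * l]"

lemma piv_sub: "piv \<subseteq> {..<4 * l}" "card piv = 4" "finite piv"
  using l2 by (auto simp: piv_def card_image inj_on_def)

lemma hens_V1: "hens (SB l d M) V1 \<Theta>1 (Con 1)"
  unfolding hens_def
proof (intro ballI allI impI)
  fix x0 q T j
  let ?P = "\<lambda>\<phi>. vars \<phi> \<subseteq> V1 \<and> (\<forall>x\<in>SB l d M. (\<forall>i. [x i = x0 i] (mod q)) \<longrightarrow> [x j = ev \<phi> x] (mod q ^ T)) \<and>
     (\<forall>k\<in>V1. [ev (Con 1) x0 * dv \<phi> x0 (unit k) = ev (\<Theta>1 k j) x0] (mod q))"
  consider "j \<in> V1" | "j \<in> piv" | "j \<ge> 8 * l" by (cases "j < 8 * l"; cases "j \<in> piv") (auto simp: V1_def)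
  then show "\<exists>\<phi>. ?P \<phi>"
  proof cases
    case 1
    then have "j \<notin> piv" by (simp add: V1_def)
    then have "?P (Var j)" using 1 by (auto simp: unit_def \<Theta>1_def)
    then show ?thesis by blast
  next
    case 2
    then obtain g where g: "j = g * l" "g < 4" by (auto simp: piv_def)
    define R where "R = {s. s < 4 * l \<and> s div l = g \<and> s \<noteq> g * l}"
    have finR: "finite R" by (simp add: R_def)
    define \<phi> where "\<phi> = Mul (Con (-1)) (psum Var (lst R))"
    have RV: "s \<notin> piv" if "s \<in> R" for s
    proof
      assume "s \<in> piv"
      then obtain g' where "s = g' * l" by (auto simp: piv_def)
      then show False using that l2 by (auto simp: R_def)
    qed
    have "vars \<phi> = R" using lst[OF finR] by (simp add: \<phi>_def vars_psum)
    moreover have "R \<subseteq> V1"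
    proof
      fix s assume s: "s \<in> R"
      then have "s < 8 * l" by (simp add: R_def)
      then show "s \<in> V1" using RV[OF s] by (simp add: V1_def)
    qed
    ultimately have "vars \<phi> \<subseteq> V1" by simp
    moreover have "x j = ev \<phi> x" if x: "x \<in> SB l d M" for x
    proof -
      have "x (g * l) + (\<Sum>s\<in>R. x s) = 0"
        using SB_D(6)[OF x g(2)] sum_group_split[of l g x] l2 g(2) by (simp add: R_def)
      then show ?thesis using lst[OF finR] by (simp add: \<phi>_def ev_psum sum_list_distinct_conv_sum_set g)
    qed
    moreover have "dv \<phi> x0 (unit k) = ev (\<Theta>1 k j) x0" if k: "k \<in> V1" for k
    proof -
      have kp: "k \<notin> piv" using k by (simp add: V1_def)
      have "dv \<phi> x0 (unit k) = - (\<Sum>s\<in>R. unit k s)"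
        using lst[OF finR] by (simp add: \<phi>_def dv_psum sum_list_distinct_conv_sum_set)
      also have "\<dots> = - (if k \<in> R then 1 else 0)" using finR by (simp add: unit_def)
      also have "\<dots> = ev (\<Theta>1 k j) x0" using 2 kp g l2 by (auto simp: \<Theta>1_def R_def)
      finally show ?thesis .
    qed
    ultimately have "?P \<phi>" by simp
    then show ?thesis by blast
  next
    case 3
    then have jp: "j \<notin> piv" using piv_sub by auto
    have "x j = 0" if "x \<in> SB l d M" for x using SB_D(1)[OF that 3] .
    then have "[x j = ev (Con 0) x] (mod q ^ T)" if "x \<in> SB l d M" for x unfolding ev.simps SB_D(1)[OF that 3] by simp
    moreover have "dv (Con 0) x0 (unit k) = ev (\<Theta>1 k j) x0" if "k \<in> V1" for k using that 3 jp by (auto simp: \<Theta>1_def V1_def)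
    ultimately have "?P (Con 0)" by simp
    then show ?thesis by blast
  qed
qed

lemma ev_F1: "x \<in> SB l d M \<Longrightarrow> ev F1 x = 0"
  using SB_D(7)[of x l d M] by (simp add: F1_def ev_psum interv_sum_list_conv_sum_set_nat atLeast0LessThan)

text \<open>Moving the second \<open>h\<close> of the first group moves the first \<open>h\<close>
  by the opposite amount, so the derivative is a difference of two \<open>d\<close>-th powers of
  distinct positive numbers. The equation is thus transversal at every solution, and the induction
  starts without exceptional points.\<close>

lemma der_F1: assumes x: "x \<in> SB l d M" shows "ev (der (\<Theta>1 1) F1) x \<noteq> 0"
proof -
  have one: "(1::nat) \<notin> piv" and zero: "0 \<in> piv" using l2 by (auto simp: piv_def)
  have piv0: "j = 0" if "j \<in> piv" "j div l = 0" for j using that l2 by (auto simp: piv_def)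
  have th: "ev (\<Theta>1 1 j) x = (if j = 1 then 1 else if j = 0 then -1 else 0)" for j
    using one zero piv0[of j] l2 by (auto simp: \<Theta>1_def)
  have "ev (der (\<Theta>1 1) F1) x = (\<Sum>s<4 * l. ev (\<Theta>1 1 s) x * x (4 * l + s) ^ d + x s * (int d * x (4 * l + s) ^ (d - 1) * ev (\<Theta>1 1 (4 * l + s)) x))"
    by (simp add: ev_der F1_def dv_psum dv_ppow interv_sum_list_conv_sum_set_nat atLeast0LessThan)
  also have "\<dots> = (\<Sum>s<4 * l. (if s = 1 then x (4 * l + 1) ^ d else 0) + (if s = 0 then - (x (4 * l) ^ d) else 0))"
    using l2 by (intro sum.cong refl) (auto simp: th simp del: One_nat_def)
  also have "\<dots> = x (4 * l + 1) ^ d - x (4 * l) ^ d" using l2 by (simp add: sum.distrib)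
  finally have e: "ev (der (\<Theta>1 1) F1) x = x (4 * l + 1) ^ d - x (4 * l) ^ d" .
  have p: "x (4 * l + 1) \<ge> 1" "x (4 * l + 0) \<ge> 1" using SB_D(2)[OF x, of 1] SB_D(2)[OF x, of 0] l2 by auto
  have ne: "x (4 * l + 1) \<noteq> x (4 * l + 0)" using SB_D(4)[OF x, of 1 0] l2 by auto
  have "x (4 * l + 1) ^ d \<noteq> x (4 * l) ^ d"
  proof
    assume "x (4 * l + 1) ^ d = x (4 * l) ^ d"
    then have "x (4 * l + 1) = x (4 * l)" using power_eq_imp_eq_base[of "x (4 * l + 1)" d "x (4 * l)"] p d4 by simp
    then show False using ne by simp
  qed
  then show ?thesis using e by simp
qed

lemma SB_count: "\<exists>C. \<forall>G\<ge>2. card (SB l d (int G ^ k0)) \<le> C * G ^ AA (8 * l - 4)"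
proof -
  define K where "K = 4 * l + k0 * Suc d + d + 2"
  have "Plev (8 * l - 5)" by (rule level) simp
  moreover have "Suc (8 * l - 5) = 8 * l - 4" using l2 by linarith
  ultimately have "dropP (8 * l - 4)" using drop_Suc[of "8 * l - 5"] by simp
  then obtain C where "\<forall>G\<ge>2. \<forall>S V \<Theta> \<Delta> i E. state G K S V \<Theta> \<Delta> \<longrightarrow> card V = 8 * l - 4 \<longrightarrow> i \<in> V \<longrightarrow> okb G K E \<longrightarrow>
      (\<forall>x\<in>S. ev E x = 0 \<and> ev (der (\<Theta> i) E) x \<noteq> 0) \<longrightarrow> card S \<le> C * G ^ AA (8 * l - 4)"
    unfolding dropP_def by blast
  note C = this[rule_format]
  show ?thesis
  proof (rule exI[of _ C], intro allI impI)
    fix G :: nat assume G: "2 \<le> G"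
    have G1: "G \<ge> 1" using G by simp
    have p8: "piv \<subseteq> {..<8 * l}" using piv_sub(1) by auto
    show "card (SB l d (int G ^ k0)) \<le> C * G ^ AA (8 * l - 4)"
    proof (rule C[OF G, where V = V1 and \<Theta> = \<Theta>1 and \<Delta> = "Con 1" and i = 1 and E = F1])
      have th: "okb G K (\<Theta>1 k j)" for k j unfolding \<Theta>1_def by (rule okb_Con[OF G1]) (auto simp: K_def)
      show "state G K (SB l d (int G ^ k0)) V1 \<Theta>1 (Con 1)"
        unfolding state_def
      proof (intro conjI ballI allI impI)
        show "hens (SB l d (int G ^ k0)) V1 \<Theta>1 (Con 1)" by (rule hens_V1)
        show "tang (SB l d (int G ^ k0)) V1 \<Theta>1 (Con 1)" by (auto simp: tang_def V1_def \<Theta>1_def)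
        show "okb G K (Con 1)" by (rule okb_Con[OF G1]) (simp add: K_def)
        fix x k j assume "k \<in> V1" "8 * l \<le> j"
        then show "ev (\<Theta>1 k j) x = 0" using p8 by (auto simp: \<Theta>1_def V1_def)
      qed (auto simp: bx_def V1_def th)
      show "card V1 = 8 * l - 4" unfolding V1_def using piv_sub p8 by (simp add: card_Diff_subset)
      show "1 \<in> V1" using l2 by (auto simp: V1_def piv_def)
      show "okb G K F1"
      proof -
        have "bd (bx G) F1 = int (4 * l) * int G ^ (k0 * Suc d)"
          by (simp add: F1_def bd_psum bd_ppow interv_sum_list_conv_sum_set_nat bx_def power_mult power_add)
        also have "\<dots> \<le> int K * int G ^ K" using G by (intro mult_mono power_increasing) (auto simp: K_def)
        finally have "bd (bx G) F1 \<le> int K * int G ^ K" .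
        moreover have "dg F1 \<le> K" unfolding F1_def by (rule dg_psum) (simp add: dg_ppow K_def)
        ultimately show ?thesis by (simp add: okb_def)
      qed
    qed (use ev_F1 der_F1 in auto)
  qed
qed

end

section \<open>Numerical verification of the choice of parameters\<close>

lemma numeric_ge:
  fixes l :: nat
  assumes l: "l \<ge> 2"
  shows "2 * (2 ^ (4 * l) * (3 * (6400 * l ^ 3) + 8 * l * (6400 * l ^ 3 * (16 * (40 * l ^ 2) ^ (8 * l - 5)) + 6400 * l ^ 3 * (8 * l * (16 * (40 * l ^ 2) ^ (8 * l - 5)))))) + 4 * l
     \<le> (8 * l) ^ (16 * l)"
proof -
  define X where "X = (40 * l ^ 2) ^ (8 * l - 5)"
  have X1: "X \<ge> 1" using l by (simp add: X_def Suc_le_eq)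
  have l1: "l \<ge> 1" using l by simp
  have p: "l ^ i \<le> l ^ j" if "i \<le> j" for i j using l1 that by (intro power_increasing) auto
  have "3 * (6400 * l ^ 3) + 8 * l * (6400 * l ^ 3 * (16 * X) + 6400 * l ^ 3 * (8 * l * (16 * X)))
     = 19200 * l ^ 3 + 819200 * l ^ 4 * X + 6553600 * l ^ 5 * X"
    by (simp add: algebra_simps power_numeral_reduce)
  also have "\<dots> \<le> 19200 * l ^ 5 * X + 819200 * l ^ 5 * X + 6553600 * l ^ 5 * X"
  proof -
    have "l ^ 3 * 1 \<le> l ^ 5 * X" using X1 p[of 3 5] by (intro mult_le_mono) auto
    moreover have "l ^ 4 * X \<le> l ^ 5 * X" using p[of 4 5] by (intro mult_le_mono) auto
    ultimately show ?thesis unfolding mult.assoc mult_1_right by linarith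
  qed
  also have "\<dots> = 7392000 * l ^ 5 * X" by simp
  finally have A: "3 * (6400 * l ^ 3) + 8 * l * (6400 * l ^ 3 * (16 * X) + 6400 * l ^ 3 * (8 * l * (16 * X))) \<le> 7392000 * l ^ 5 * X" .
  have "2 * (2 ^ (4 * l) * (7392000 * l ^ 5 * X)) + 4 * l \<le> 2 ^ (4 * l) * (14784004 * l ^ 5 * X)"
  proof -
    have "l ^ 1 * 1 \<le> l ^ 5 * X" using X1 p[of 1 5] by (intro mult_le_mono) auto
    then have "1 * l \<le> 2 ^ (4 * l) * (l ^ 5 * X)" by (intro mult_le_mono) auto
    then show ?thesis by (simp add: algebra_simps)
  qed
  also have "\<dots> \<le> (8 * l) ^ (16 * l)"
  proof -
    have e: "16 * l = 2 * (8 * l - 5) + 10" using l by simp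
    have "(8 * l) ^ (16 * l) = (64 * l ^ 2) ^ (8 * l - 5) * (8 * l) ^ 10"
      unfolding e power_add power_mult by (simp add: power_mult_distrib)
    also have "(64 * l ^ 2) ^ (8 * l - 5) * (8 * l) ^ 10 \<ge> (2 ^ (4 * l) * X) * (14784004 * l ^ 5)"
    proof -
      \<comment> \<open>Replacing \<open>40 * l ^ 2\<close> by \<open>64 * l ^ 2\<close>, which is
        what \<open>(8 * l) ^ (16 * l)\<close> offers, gains powers of \<open>8 / 5\<close>. Since
        \<open>(8 / 5) ^ 8 > 16\<close>, they absorb \<open>16 ^ l\<close>; the factor 11 exceeds
        \<open>(8 / 5) ^ 5\<close>, the part missing in the exponent
        \<open>8 * l - 5\<close>.\<close>
      have r: "real (2 ^ (4 * l)) \<le> (8 / 5) ^ (8 * l - 5) * 11"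
      proof -
        have "(2::real) ^ (4 * l) = 16 ^ l" by (simp add: power_mult)
        also have "\<dots> \<le> ((8 / 5) ^ 8) ^ l" by (intro power_mono) (auto simp: power_numeral_reduce)
        also have "\<dots> = (8 / 5) ^ (8 * l)" by (simp add: power_mult)
        also have "\<dots> = (8 / 5) ^ (8 * l - 5) * (8 / 5) ^ 5" using l by (simp flip: power_add)
        also have "\<dots> \<le> (8 / 5) ^ (8 * l - 5) * 11" by (intro mult_left_mono) (auto simp: power_numeral_reduce)
        finally show ?thesis by simp
      qed
      have "real ((2 ^ (4 * l) * X) * (14784004 * l ^ 5)) \<le> ((8 / 5) ^ (8 * l - 5) * 11) * real X * (14784004 * real l ^ 5)"
      proof -
        have "real (2 ^ (4 * l)) * (real X * (14784004 * real l ^ 5)) \<le> ((8 / 5) ^ (8 * l - 5) * 11) * (real X * (14784004 * real l ^ 5))"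
          using r by (rule mult_right_mono) auto
        then show ?thesis by (simp only: of_nat_mult of_nat_power of_nat_numeral mult.assoc)
      qed
      also have "\<dots> = (64 * real l ^ 2) ^ (8 * l - 5) * (162624044 * real l ^ 5)"
      proof -
        have "(8 / 5) ^ (8 * l - 5) * real X = ((8 / 5) * (40 * real l ^ 2)) ^ (8 * l - 5)"
          unfolding X_def of_nat_power of_nat_mult of_nat_numeral by (rule power_mult_distrib[symmetric])
        also have "(8 / 5) * (40 * real l ^ 2) = 64 * real l ^ 2" by simp
        finally have h: "(8 / 5) ^ (8 * l - 5) * real X = (64 * real l ^ 2) ^ (8 * l - 5)" .
        have "((8 / 5) ^ (8 * l - 5) * 11) * real X * (14784004 * real l ^ 5) = ((8 / 5) ^ (8 * l - 5) * real X) * (162624044 * real l ^ 5)"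
          by simp
        then show ?thesis unfolding h .
      qed
      also have "\<dots> \<le> (64 * real l ^ 2) ^ (8 * l - 5) * ((8 * real l) ^ 10)"
      proof (intro mult_left_mono)
        have "real l ^ 5 \<le> real l ^ 10" using l1 by (intro power_increasing) auto
        moreover have "(8 * real l) ^ 10 = 1073741824 * real l ^ 10" by (simp add: power_mult_distrib)
        moreover have "real l ^ 5 \<ge> 0" by simp
        ultimately show "162624044 * real l ^ 5 \<le> (8 * real l) ^ 10" by linarith
      qed auto
      also have "\<dots> = real ((64 * l ^ 2) ^ (8 * l - 5) * (8 * l) ^ 10)" by simp
      finally show ?thesis by linarith
    qed
    finally show ?thesis by (simp add: algebra_simps)
  qed
  finally have "2 * (2 ^ (4 * l) * (7392000 * l ^ 5 * X)) + 4 * l \<le> (8 * l) ^ (16 * l)" .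
  moreover have "2 * (2 ^ (4 * l) * (3 * (6400 * l ^ 3) + 8 * l * (6400 * l ^ 3 * (16 * X) + 6400 * l ^ 3 * (8 * l * (16 * X)))))
     \<le> 2 * (2 ^ (4 * l) * (7392000 * l ^ 5 * X))" using A by simp
  ultimately show ?thesis unfolding X_def[symmetric] by linarith
qed

text \<open>Binomials are compared with powers of exponent \<open>Suc t\<close>, and the common
  factor \<open>(8 * l * D2) ^ Suc t\<close> cancels. Rounding \<open>8 * l + 2\<close> to
  \<open>8 * l\<close> costs at most the square of \<open>exp 1\<close>, hence at most 9; the factor
  16 in \<open>D2\<close> covers this together with the excess of \<open>Suc (160 * l)\<close> over
  \<open>160 * l\<close>. What remains is \<open>16 * a ^ t \<le> D2\<close> with
  \<open>a = 40 * l ^ 2\<close>, which dictates the exponent \<open>8 * l - 5\<close>.\<close>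

lemma numeric_many:
  fixes l t :: nat
  assumes l: "l \<ge> 2" and t: "t \<le> 8 * l - 5"
  defines "D2 \<equiv> 16 * (40 * l ^ 2) ^ (8 * l - 5)"
  shows "Suc (160 * l) * (((40 * l ^ 2) * D2 * (8 * l + 1) + 1 + t) choose Suc t) < (6400 * l ^ 3 * D2) * ((8 * l * D2 + Suc t) choose Suc t)"
proof -
  define a where "a = 40 * l ^ 2"
  have a1: "a \<ge> 1" using l by (simp add: a_def Suc_le_eq)
  have D2: "D2 = 16 * a ^ (8 * l - 5)" by (simp add: D2_def a_def)
  have D21: "D2 \<ge> 1" using a1 by (simp add: D2 Suc_le_eq)
  define T where "T = a * D2 * (8 * l + 1) + 1"
  have T: "T + t \<le> a * D2 * (8 * l + 2)"
  proof -
    have "8 * l \<le> a" using l by (simp add: a_def power2_eq_square)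
    then have "(8 * l) * 1 \<le> a * D2" using D21 by (intro mult_le_mono)
    then show ?thesis using t l by (simp add: T_def algebra_simps)
  qed
  have pw: "(8 * l + 2) ^ Suc t \<le> 9 * (8 * l) ^ Suc t"
  proof -
    have "real ((8 * l + 2) ^ Suc t) = (8 * real l) ^ Suc t * (1 + 1 / (4 * real l)) ^ Suc t"
    proof -
      have "8 * real l * (1 + 1 / (4 * real l)) = real (8 * l + 2)" using l by (simp add: field_simps)
      then show ?thesis by (simp only: of_nat_power power_mult_distrib[symmetric])
    qed
    also have "\<dots> \<le> (8 * real l) ^ Suc t * 9"
    proof (intro mult_left_mono)
      have "(1 + 1 / (4 * real l)) ^ Suc t \<le> exp (1 / (4 * real l)) ^ Suc t"
        by (intro power_mono exp_ge_add_one_self) auto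
      also have "\<dots> = exp (real (Suc t) * (1 / (4 * real l)))" by (rule exp_of_nat_mult[symmetric])
      also have "\<dots> \<le> exp 2"
      proof (subst exp_le_cancel_iff)
        have "real (Suc t) \<le> 8 * real l" using t l by linarith
        then show "real (Suc t) * (1 / (4 * real l)) \<le> 2" using l by (simp add: field_simps)
      qed
      also have "\<dots> = exp 1 * exp 1" by (simp flip: exp_add)
      also have "\<dots> \<le> 3 * 3" using exp_le by (intro mult_mono) auto
      finally show "(1 + 1 / (4 * real l)) ^ Suc t \<le> 9" by simp
    qed auto
    also have "\<dots> = real (9 * (8 * l) ^ Suc t)" by simp
    finally show ?thesis by linarith
  qed
  have "fact (Suc t) * (Suc (160 * l) * ((T + t) choose Suc t)) = Suc (160 * l) * (((T + t) choose Suc t) * fact (Suc t))" by (simp only: ac_simps)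
  also have "\<dots> \<le> Suc (160 * l) * (T + t) ^ Suc t" by (intro mult_le_mono2 binomial_fact_pow)
  also have "\<dots> \<le> Suc (160 * l) * (a * D2 * (8 * l + 2)) ^ Suc t" by (intro mult_le_mono2 power_mono T) simp
  also have "\<dots> = Suc (160 * l) * ((a * D2) ^ Suc t * (8 * l + 2) ^ Suc t)" by (simp only: power_mult_distrib)
  also have "\<dots> \<le> Suc (160 * l) * ((a * D2) ^ Suc t * (9 * (8 * l) ^ Suc t))" by (intro mult_le_mono2 pw)
  also have "\<dots> < (160 * l * a * D2) * (8 * l * D2) ^ Suc t"
  proof -
    have "Suc (160 * l) * 9 < (160 * l) * 16" using l by simp
    then have "Suc (160 * l) * 9 * (a ^ Suc t * (D2 * (8 * l)) ^ Suc t) < (160 * l) * 16 * (a ^ Suc t * (D2 * (8 * l)) ^ Suc t)"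
      using a1 D21 l by (intro mult_strict_right_mono) auto
    also have "\<dots> = (160 * l) * (a * (16 * a ^ t)) * (D2 * (8 * l)) ^ Suc t" by (simp only: power_Suc ac_simps)
    also have "\<dots> \<le> (160 * l) * (a * D2) * (D2 * (8 * l)) ^ Suc t"
    proof -
      have "a ^ t \<le> a ^ (8 * l - 5)" using a1 t by (intro power_increasing)
      then show ?thesis unfolding D2 by (intro mult_le_mono1 mult_le_mono2)
    qed
    finally show ?thesis by (simp only: power_mult_distrib ac_simps)
  qed
  also have "\<dots> \<le> (160 * l * a * D2) * (fact (Suc t) * ((8 * l * D2 + Suc t) choose Suc t))"
    by (intro mult_le_mono2 choose_fact_ge)
  also have "\<dots> = fact (Suc t) * ((6400 * l ^ 3 * D2) * ((8 * l * D2 + Suc t) choose Suc t))"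
    by (simp add: a_def power_numeral_reduce algebra_simps del: fact_Suc binomial_Suc_Suc)
  finally have "Suc (160 * l) * ((T + t) choose Suc t) < (6400 * l ^ 3 * D2) * ((8 * l * D2 + Suc t) choose Suc t)"
    by (metis mult_less_cancel1)
  then show ?thesis by (simp only: T_def a_def ac_simps)
qed

theorem SB_card_bound:
  assumes l: "l \<ge> 2" and d: "d > (8 * l) ^ (16 * l)"
  shows "\<exists>C>0. \<forall>M\<ge>1. real (card (SB l d (int M))) \<le> C * real M powr (4 * real l - 3 / 10)"
proof -
  define D2 where "D2 = 16 * (40 * l ^ 2) ^ (8 * l - 5)"
  define k0 where "k0 = 6400 * l ^ 3"
  \<comment> \<open>Here \<open>160 * l * (40 * l ^ 2) = k0\<close>, so the two sides of
    \<open>small\<close> would be equal without the final summand 1 in the last parameter.\<close>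
  interpret count l d k0 "160 * l" "8 * l * D2" "k0 * D2" "40 * l ^ 2 * D2 * (8 * l + 1) + 1"
  proof
    show "1 \<le> k0" using l by (simp add: k0_def Suc_le_eq)
    show "2 * (2 ^ (4 * l) * (3 * k0 + 8 * l * (k0 * D2 + k0 * (8 * l * D2)))) \<le> d - 4 * l"
      using numeric_ge[OF l] d unfolding k0_def D2_def by linarith
    show "4 * l < d" using numeric_ge[OF l] d by linarith
    show "k0 * D2 + k0 * (8 * l * D2) < 160 * l * (40 * l ^ 2 * D2 * (8 * l + 1) + 1)"
      using l by (simp add: k0_def power_numeral_reduce algebra_simps)
    show "Suc (160 * l) * ((40 * l\<^sup>2 * D2 * (8 * l + 1) + 1 + t) choose Suc t) < k0 * D2 * ((8 * l * D2 + Suc t) choose Suc t)"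
      if "t \<le> 8 * l - 5" for t
      using numeric_many[OF l that] unfolding k0_def D2_def .
  qed (rule l)
  obtain C where C: "\<And>G. G \<ge> 2 \<Longrightarrow> card (SB l d (int G ^ k0)) \<le> C * G ^ AA (8 * l - 4)" using SB_count by blast
  have k01: "k0 \<ge> 1" using l by (simp add: k0_def Suc_le_eq)
  \<comment> \<open>The loss over all dimensions is a cubic in \<open>l\<close> with leading
    coefficient \<open>8 * (1280 + 64) = 10752\<close>, below \<open>17 / 10 * 6400 = 10880\<close>.
    This determines the constant 6400 in \<open>k0\<close>.\<close>
  have AA: "real (AA (8 * l - 4)) \<le> real k0 * (4 * real l - 3 / 10)"
  proof -
    have "real (AA (8 * l - 4)) = (4 * real l - 2) * real k0 + (8 * real l - 4) * real cc"
      using l by (simp add: AA_def of_nat_diff)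
    moreover have "real cc = (160 * real l + 1) * (8 * real l + 1) + 4 * real l * (16 * real l + 4)"
      unfolding cc_def c2_def by (simp add: algebra_simps)
    moreover have "(8 * real l - 4) * ((160 * real l + 1) * (8 * real l + 1) + 4 * real l * (16 * real l + 4)) \<le> 17 / 10 * (6400 * real l ^ 3)"
    proof -
      have l2r: "real l \<ge> 2" using l by simp
      have "real l ^ 2 * 2 \<le> real l ^ 2 * real l" using l2r by (intro mult_left_mono) auto
      then have "real l ^ 2 * 2 \<le> real l ^ 3" by (simp add: power_numeral_reduce)
      moreover have "real l * 2 \<le> real l * real l" using l2r by (intro mult_left_mono) auto
      then have "real l * 2 \<le> real l ^ 2" by (simp add: power2_eq_square)
      moreover have "(8 * real l - 4) * ((160 * real l + 1) * (8 * real l + 1) + 4 * real l * (16 * real l + 4))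
         = 10752 * real l ^ 3 - 3904 * real l ^ 2 - 728 * real l - 4"
        by (simp add: algebra_simps power_numeral_reduce)
      ultimately show ?thesis using l2r by linarith
    qed
    ultimately show ?thesis by (simp add: k0_def algebra_simps)
  qed
  have epos: "4 * real l - 3 / 10 > 0" using l by simp
  define C' where "C' = (real C + 1) * (2 ^ k0) powr (4 * real l - 3 / 10)"
  have "real (card (SB l d (int M))) \<le> C' * real M powr (4 * real l - 3 / 10)" if M: "M \<ge> 1" for M :: nat
  proof -
    define G where "G = (LEAST G. G \<ge> 2 \<and> M \<le> G ^ k0)"
    have "M + 2 \<le> (M + 2) ^ k0" using k01 by (intro self_le_power) auto
    then have G: "G \<ge> 2 \<and> M \<le> G ^ k0" unfolding G_def by (intro LeastI[of "\<lambda>G. G \<ge> 2 \<and> M \<le> G ^ k0" "M + 2"]) auto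
    have GM: "real G ^ k0 \<le> 2 ^ k0 * real M"
    proof (cases "G = 2")
      case False
      then have "\<not> (G - 1 \<ge> 2 \<and> M \<le> (G - 1) ^ k0)" using G not_less_Least[of "G - 1" "\<lambda>G. G \<ge> 2 \<and> M \<le> G ^ k0"] by (fold G_def) auto
      then have "(G - 1) ^ k0 \<le> M" using False G by auto
      have "real G ^ k0 \<le> (2 * real (G - 1)) ^ k0" using G by (intro power_mono) auto
      also have "\<dots> = 2 ^ k0 * real ((G - 1) ^ k0)" by (simp add: power_mult_distrib)
      also have "\<dots> \<le> 2 ^ k0 * real M" using \<open>(G - 1) ^ k0 \<le> M\<close> by (intro mult_left_mono) auto
      finally show ?thesis .
    qed (use M in simp)
    have "SB l d (int M) \<subseteq> SB l d (int G ^ k0)"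
    proof
      fix x assume x: "x \<in> SB l d (int M)"
      have "int M \<le> int G ^ k0" using G by (metis of_nat_le_iff of_nat_power)
      then show "x \<in> SB l d (int G ^ k0)" using x unfolding SB_def by (auto intro: order_trans)
    qed
    then have "card (SB l d (int M)) \<le> card (SB l d (int G ^ k0))" by (intro card_mono SB_finite) auto
    also have "\<dots> \<le> C * G ^ AA (8 * l - 4)" using C G by blast
    finally have "real (card (SB l d (int M))) \<le> real C * real G ^ AA (8 * l - 4)" by (metis of_nat_le_iff of_nat_mult of_nat_power)
    also have "\<dots> \<le> (real C + 1) * real G powr (real (AA (8 * l - 4)))" using G by (simp add: powr_realpow algebra_simps)
    also have "\<dots> \<le> (real C + 1) * real G powr (real k0 * (4 * real l - 3 / 10))"
      using G AA by (intro mult_left_mono powr_mono) auto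
    also have "\<dots> = (real C + 1) * (real G ^ k0) powr (4 * real l - 3 / 10)"
      using G by (simp add: powr_powr[symmetric] powr_realpow)
    also have "\<dots> \<le> (real C + 1) * (2 ^ k0 * real M) powr (4 * real l - 3 / 10)"
      using GM epos by (intro mult_left_mono powr_mono2) auto
    also have "\<dots> = C' * real M powr (4 * real l - 3 / 10)" by (simp add: C'_def powr_mult)
    finally show ?thesis .
  qed
  moreover have "C' > 0" by (simp add: C'_def add_pos_nonneg add.commute)
  ultimately show ?thesis by blast
qed

section \<open>The Fejer kernel\<close>

lemma ee_add: "ee (x + y) = ee x * ee y"
  by (simp add: ee_def cis_mult algebra_simps)

lemma ee_minus: "ee (- x) = cnj (ee x)"
  by (simp add: ee_def cis_cnj)

lemma ee_diff: "ee (x - y) = ee x * cnj (ee y)"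
  using ee_add[of x "- y"] by (simp add: ee_minus)

lemma ee_0 [simp]: "ee 0 = 1"
  by (simp add: ee_def)

lemma norm_ee [simp]: "cmod (ee x) = 1"
  by (simp add: ee_def)

lemma ee_of_int [simp]: "ee (of_int k) = 1"
  by (simp add: ee_def cis_multiple_2pi)

lemma ee_power: "ee (real r * x) = ee x ^ r"
  unfolding ee_def Complex.DeMoivre by (simp add: mult.assoc mult.left_commute)

lemma ee_sum: "finite A \<Longrightarrow> ee (\<Sum>x\<in>A. f x) = (\<Prod>x\<in>A. ee (f x))"
  by (induction A rule: finite_induct) (auto simp: ee_add)

lemma continuous_on_ee: "continuous_on S f \<Longrightarrow> continuous_on S (\<lambda>x. ee (f x))"
  unfolding ee_def cis_conv_exp by (intro continuous_intros)

lemma norm_ee_minus_1: "cmod (ee x - 1) = 2 * \<bar>sin (pi * x)\<bar>"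
proof -
  have "(cmod (ee x - 1))\<^sup>2 = (cos (2 * (pi * x)) - 1)\<^sup>2 + (sin (2 * (pi * x)))\<^sup>2"
    by (simp add: ee_def cmod_def mult.assoc)
  also have "\<dots> = (2 * sin (pi * x))\<^sup>2"
    unfolding cos_double_sin sin_double using sin_cos_squared_add[of "pi * x"] by algebra
  finally have "(cmod (ee x - 1))\<^sup>2 = (2 * sin (pi * x))\<^sup>2" .
  then have "(cmod (ee x - 1))\<^sup>2 = (2 * \<bar>sin (pi * x)\<bar>)\<^sup>2" by (simp add: power_mult_distrib)
  then show ?thesis by (rule power2_eq_imp_eq) auto
qed

lemma sum_roots_of_unity:
  fixes m :: int
  assumes "\<bar>m\<bar> < int P" "m \<noteq> 0"
  shows "(\<Sum>a<P. ee (of_int m * (real a / real P))) = 0"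
proof -
  have P: "P > 0" using assms by simp
  let ?w = "ee (of_int m / real P)"
  have "?w \<noteq> 1"
  proof
    assume "?w = 1"
    then have "sin (pi * (of_int m / real P)) = 0" using norm_ee_minus_1[of "of_int m / real P"] by simp
    then obtain i where "pi * (of_int m / real P) = of_int i * pi" unfolding sin_zero_iff_int2 by blast
    then have "of_int m = of_int i * real P" using P by (simp add: field_simps)
    then have "m = i * int P" by (metis of_int_eq_iff of_int_mult of_int_of_nat_eq)
    then have "int P dvd m" by simp
    then show False using assms by (metis dvd_imp_le_int abs_of_nat not_le)
  qed
  moreover have "?w ^ P = 1" using P ee_power[of P "of_int m / real P"] by simp
  moreover have "(\<Sum>a<P. ee (of_int m * (real a / real P))) = (\<Sum>a<P. ?w ^ a)"
    by (rule sum.cong) (simp_all add: ee_power[symmetric] mult.commute)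
  ultimately show ?thesis by (simp add: geometric_sum)
qed

definition dirich :: "nat \<Rightarrow> real \<Rightarrow> complex" where
  "dirich P \<theta> = (\<Sum>r<P. ee (real r * \<theta>))"

definition fej :: "nat \<Rightarrow> real \<Rightarrow> real" where
  "fej P \<theta> = (cmod (dirich P \<theta>))\<^sup>2 / (real P)\<^sup>2"

lemma fej_nonneg [simp]: "fej P \<theta> \<ge> 0"
  by (simp add: fej_def)

lemma dirich_sin: "cmod (dirich P \<theta>) * \<bar>sin (pi * \<theta>)\<bar> = \<bar>sin (pi * (real P * \<theta>))\<bar>"
proof -
  have "(ee \<theta> - 1) * dirich P \<theta> = ee (real P * \<theta>) - 1"
    unfolding dirich_def ee_power by (rule power_diff_1_eq[symmetric])
  then have "cmod (ee \<theta> - 1) * cmod (dirich P \<theta>) = cmod (ee (real P * \<theta>) - 1)"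
    by (metis norm_mult)
  then show ?thesis by (simp add: norm_ee_minus_1 mult.commute)
qed

lemma dirich_periodic: "dirich P (\<theta> + of_int k) = dirich P \<theta>"
proof -
  have "ee (real r * (\<theta> + of_int k)) = ee (real r * \<theta>)" for r
    using ee_of_int[of "int r * k"] by (simp add: distrib_left ee_add)
  then show ?thesis by (simp add: dirich_def)
qed

lemma fej_periodic: "fej P (\<theta> + of_int k) = fej P \<theta>"
  by (simp add: fej_def dirich_periodic)

lemma dirich_norm_sq: "complex_of_real ((cmod (dirich P \<theta>))\<^sup>2) = (\<Sum>r<P. \<Sum>r'<P. ee (of_int (int r - int r') * \<theta>))"
proof -
  have "ee (of_int (int r - int r') * \<theta>) = ee (real r * \<theta>) * cnj (ee (real r' * \<theta>))" for r r'
    using ee_diff[of "real r * \<theta>" "real r' * \<theta>"] by (simp add: algebra_simps)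
  then show ?thesis
    unfolding complex_norm_square dirich_def by (simp add: sum_product)
qed

text \<open>All frequencies of the kernel are smaller than \<open>P\<close> in absolute value, so
  averaging over the multiples of \<open>1 / P\<close> leaves only the constant term.\<close>

lemma fej_partition:
  assumes P: "P > 0"
  shows "(\<Sum>a<P. fej P (\<theta> - real a / real P)) = 1"
proof -
  have "complex_of_real (\<Sum>a<P. (cmod (dirich P (\<theta> - real a / real P)))\<^sup>2)
      = (\<Sum>a<P. \<Sum>r<P. \<Sum>r'<P. ee (of_int (int r - int r') * (\<theta> - real a / real P)))"
    unfolding of_real_sum dirich_norm_sq ..
  also have "\<dots> = (\<Sum>r<P. \<Sum>a<P. \<Sum>r'<P. ee (of_int (int r - int r') * (\<theta> - real a / real P)))"
    by (rule sum.swap)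
  also have "\<dots> = (\<Sum>r<P. \<Sum>r'<P. \<Sum>a<P. ee (of_int (int r - int r') * (\<theta> - real a / real P)))"
    by (intro sum.cong refl sum.swap)
  also have "\<dots> = (\<Sum>r<P. \<Sum>r'<P. if r' = r then of_nat P else 0)"
  proof (intro sum.cong refl)
    fix r r' assume r: "r \<in> {..<P}" "r' \<in> {..<P}"
    have "(\<Sum>a<P. ee (of_int (int r - int r') * (\<theta> - real a / real P)))
      = (\<Sum>a<P. ee (of_int (int r - int r') * \<theta>) * ee (of_int (int r' - int r) * (real a / real P)))"
      by (intro sum.cong refl) (simp add: ee_add[symmetric] algebra_simps diff_divide_distrib)
    also have "\<dots> = ee (of_int (int r - int r') * \<theta>) * (\<Sum>a<P. ee (of_int (int r' - int r) * (real a / real P)))"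
      by (rule sum_distrib_left[symmetric])
    also have "\<dots> = (if r' = r then of_nat P else 0)"
    proof (cases "r' = r")
      case False
      then have "(\<Sum>a<P. ee (of_int (int r' - int r) * (real a / real P))) = 0"
        using r by (intro sum_roots_of_unity) auto
      then show ?thesis using False by simp
    qed simp
    finally show "(\<Sum>a<P. ee (of_int (int r - int r') * (\<theta> - real a / real P))) = (if r' = r then of_nat P else 0)" .
  qed
  also have "\<dots> = of_nat P * of_nat P" by simp
  finally have "complex_of_real (\<Sum>a<P. (cmod (dirich P (\<theta> - real a / real P)))\<^sup>2) = complex_of_real (real P * real P)"
    by simp
  then have "(\<Sum>a<P. (cmod (dirich P (\<theta> - real a / real P)))\<^sup>2) = real P * real P" by (simp only: of_real_eq_iff)
  then show ?thesis using P unfolding fej_def sum_divide_distrib[symmetric] by (simp add: power2_eq_square)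
qed

lemma fej_partition_int:
  assumes P: "P > 0"
  shows "(\<Sum>a\<in>{c..<c + int P}. fej P (\<theta> - of_int a / real P)) = 1"
proof -
  have "bij_betw (\<lambda>i. c + int i) {..<P} {c..<c + int P}"
    by (rule bij_betwI[where g = "\<lambda>a. nat (a - c)"]) auto
  then have "(\<Sum>a\<in>{c..<c + int P}. fej P (\<theta> - of_int a / real P)) = (\<Sum>i<P. fej P (\<theta> - of_int (c + int i) / real P))"
    by (rule sum.reindex_bij_betw[symmetric])
  also have "\<dots> = (\<Sum>i<P. fej P ((\<theta> - of_int c / real P) - real i / real P))"
    by (simp add: add_divide_distrib diff_diff_eq)
  finally show ?thesis using fej_partition[OF P] by simp
qed

text \<open>The range extends to \<open>3 / 4\<close> because a gap of size at most
  \<open>1 / 2\<close> may still be shifted by the centre of a kernel, by up to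
  \<open>1 / 4\<close>.\<close>

lemma sin_ge_half:
  assumes "\<bar>\<theta>\<bar> \<le> 3 / 4" shows "\<bar>sin (pi * \<theta>)\<bar> \<ge> \<bar>\<theta>\<bar> / 2"
proof -
  have main: "sin (pi * t) \<ge> t / 2" if t: "0 \<le> t" "t \<le> 3 / 4" for t :: real
  proof (cases "t \<le> 1 / 4")
    case True
    have "cos (pi * t) \<ge> 1 / 2" 
      using cos_monotone_0_pi_le[of "pi * t" "pi / 3"] t True by (simp add: cos_60 field_simps)
    moreover have "\<exists>z>0. z < pi * t \<and> sin (pi * t) - sin 0 = (pi * t - 0) * cos z" if "t > 0"
      using that MVT2[of 0 "pi * t" sin cos] by auto
    moreover have "cos z \<ge> 1 / 2" if "0 < z" "z < pi * t" for z
    proof -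
      have "pi * t \<le> pi * 1" using True by (intro mult_left_mono) auto
      then show ?thesis
      using cos_monotone_0_pi_le[of z "pi * t"] that \<open>cos (pi * t) \<ge> 1 / 2\<close> by linarith
    qed
    ultimately have "sin (pi * t) \<ge> pi * t * (1 / 2)" if "t > 0"
      using that by (metis diff_zero mult_left_mono mult_nonneg_nonneg pi_ge_zero sin_zero t(1))
    moreover have "pi * t * (1 / 2) \<ge> 1 * t * (1 / 2)"
      using pi_gt3 t by (intro mult_right_mono) auto
    ultimately show ?thesis using t by (cases "t = 0") (simp, linarith)
  next
    case False
    have "sin (pi * t) = cos (pi * t - pi / 2)" using cos_sin_eq[of "pi / 2 - pi * t"] cos_minus[of "pi * t - pi / 2"] by simp
    also have "\<dots> = cos (pi * \<bar>t - 1 / 2\<bar>)" using cos_minus[of "pi * t - pi / 2"] by (auto simp: abs_if algebra_simps)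
    also have "\<dots> \<ge> cos (pi / 4)" using t False 
      by (intro cos_monotone_0_pi_le) (auto simp: field_simps abs_if)
    finally have "sin (pi * t) \<ge> sqrt 2 / 2" by (simp add: cos_45)
    moreover have "sqrt 2 \<ge> 1" by simp
    ultimately show ?thesis using t by linarith
  qed
  show ?thesis
  proof (cases "\<theta> \<ge> 0")
    case True then show ?thesis using main[of \<theta>] assms by auto
  next
    case False
    have "\<bar>sin (pi * \<theta>)\<bar> = \<bar>sin (pi * (- \<theta>))\<bar>" by simp
    then show ?thesis using main[of "- \<theta>"] False assms by linarith
  qed
qed

lemma fej_decay:
  assumes "\<bar>\<theta>\<bar> \<le> 3 / 4" "\<theta> \<noteq> 0" "P > 0"
  shows "fej P \<theta> \<le> 4 / (real P * \<theta>)\<^sup>2"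
proof -
  have "cmod (dirich P \<theta>) * (\<bar>\<theta>\<bar> / 2) \<le> cmod (dirich P \<theta>) * \<bar>sin (pi * \<theta>)\<bar>"
    using sin_ge_half[OF assms(1)] by (intro mult_left_mono) auto
  also have "\<dots> \<le> 1" unfolding dirich_sin by simp
  finally have "(cmod (dirich P \<theta>) * (\<bar>\<theta>\<bar> / 2))\<^sup>2 \<le> 1\<^sup>2" by (intro power_mono) auto
  then have "(cmod (dirich P \<theta>))\<^sup>2 * \<theta>\<^sup>2 \<le> 4" by (simp add: power_mult_distrib power_divide)
  then have "(cmod (dirich P \<theta>))\<^sup>2 \<le> 4 / \<theta>\<^sup>2" using assms by (simp add: pos_le_divide_eq)
  then have "fej P \<theta> \<le> (4 / \<theta>\<^sup>2) / (real P)\<^sup>2" unfolding fej_def by (rule divide_right_mono) simp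
  then show ?thesis by (simp add: power_mult_distrib mult.commute)
qed

text \<open>A single kernel vanishes at the fractions \<open>k / N\<close> that are not integers.
  The translate by half of that spacing does not, so the sum is strictly positive and can dominate
  errors.\<close>

definition wfej :: "nat \<Rightarrow> real \<Rightarrow> real" where
  "wfej N \<theta> = fej N \<theta> + fej N (\<theta> - 1 / (2 * real N))"

lemma wfej_nonneg: "wfej N \<theta> \<ge> 0"
  by (simp add: wfej_def)

lemma wfej_periodic: "wfej N (\<theta> + of_int k) = wfej N \<theta>"
  using fej_periodic[of N "\<theta> - 1 / (2 * real N)" k] by (simp add: wfej_def fej_periodic algebra_simps)

text \<open>The half-step shift turns the sine in the numerator into a cosine, and the two squares
  add up to 1; the denominators are at most linear in the distance. The constant is
  \<open>20 = 16 * 5 / 4\<close>, from 16 as a bound for the square of \<open>pi\<close> and 5/4 for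
  the quotient of the squares of \<open>\<bar>x\<bar> + 1 / 2\<close> and of
  \<open>sqrt (1 + x\<^sup>2)\<close>.\<close>

lemma wfej_lower:
  assumes N: "N > 0"
  shows "wfej N \<theta> * (20 * (1 + (real N * \<theta>)\<^sup>2)) \<ge> 1"
proof -
  let ?D = "cmod (dirich N \<theta>)" and ?E = "cmod (dirich N (\<theta> - 1 / (2 * real N)))" and ?b = "pi * (\<bar>\<theta>\<bar> + 1 / (2 * real N))"
  have d: "\<bar>sin (pi * (real N * t))\<bar> \<le> cmod (dirich N t) * ?b" if t: "\<bar>t\<bar> \<le> \<bar>\<theta>\<bar> + 1 / (2 * real N)" for t
  proof -
    have "\<bar>sin (pi * t)\<bar> \<le> \<bar>pi * t\<bar>" by (rule abs_sin_x_le_abs_x)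
    also have "\<dots> \<le> ?b" using t by (simp add: abs_mult)
    finally show ?thesis unfolding dirich_sin[symmetric] by (intro mult_left_mono) auto
  qed
  have 1: "\<bar>sin (pi * (real N * \<theta>))\<bar> \<le> ?D * ?b" by (rule d) auto
  have "\<bar>sin (pi * (real N * (\<theta> - 1 / (2 * real N))))\<bar> \<le> ?E * ?b"
    by (rule d) (use N in \<open>auto intro: order.trans[OF abs_triangle_ineq4]\<close>)
  moreover have "pi * (real N * (\<theta> - 1 / (2 * real N))) = pi * (real N * \<theta>) - pi / 2" using N by (simp add: field_simps)
  moreover have "\<bar>sin (pi * (real N * \<theta>) - pi / 2)\<bar> = \<bar>cos (pi * (real N * \<theta>))\<bar>"
    by (simp add: sin_diff)
  ultimately have 2: "\<bar>cos (pi * (real N * \<theta>))\<bar> \<le> ?E * ?b" by simp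
  have "1 = \<bar>sin (pi * (real N * \<theta>))\<bar>\<^sup>2 + \<bar>cos (pi * (real N * \<theta>))\<bar>\<^sup>2" by simp
  also have "\<dots> \<le> (?D * ?b)\<^sup>2 + (?E * ?b)\<^sup>2" by (intro add_mono power_mono 1 2) auto
  also have "\<dots> = wfej N \<theta> * ((real N)\<^sup>2 * ?b\<^sup>2)"
  proof -
    have "(D * b)\<^sup>2 + (E * b)\<^sup>2 = (D\<^sup>2 / n\<^sup>2 + E\<^sup>2 / n\<^sup>2) * (n\<^sup>2 * b\<^sup>2)" if "n \<noteq> 0" for D E b n :: real
      using that by (simp add: field_simps)
    then show ?thesis using N unfolding wfej_def fej_def by simp
  qed
  also have "(real N)\<^sup>2 * ?b\<^sup>2 = pi\<^sup>2 * (\<bar>real N * \<theta>\<bar> + 1 / 2)\<^sup>2"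
    using N by (simp add: power_mult_distrib[symmetric] abs_mult) (simp add: field_simps)
  also have "wfej N \<theta> * \<dots> \<le> wfej N \<theta> * (20 * (1 + (real N * \<theta>)\<^sup>2))"
  proof (rule mult_left_mono[OF _ wfej_nonneg])
    have "pi \<le> 3.2" using pi_approx by simp
    then have "pi\<^sup>2 \<le> 3.2\<^sup>2" by (intro power_mono) auto
    then have p: "pi\<^sup>2 \<le> 16" by (simp add: power2_eq_square)
    have "(\<bar>real N * \<theta>\<bar> + 1 / 2)\<^sup>2 \<le> 5 / 4 * (1 + (real N * \<theta>)\<^sup>2)"
      using zero_le_power2[of "\<bar>real N * \<theta>\<bar> / 2 - 1"] by (simp add: power2_eq_square algebra_simps abs_mult_self_eq)
    then have "pi\<^sup>2 * (\<bar>real N * \<theta>\<bar> + 1 / 2)\<^sup>2 \<le> 16 * (5 / 4 * (1 + (real N * \<theta>)\<^sup>2))"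
      using p by (intro mult_mono) auto
    then show "pi\<^sup>2 * (\<bar>real N * \<theta>\<bar> + 1 / 2)\<^sup>2 \<le> 20 * (1 + (real N * \<theta>)\<^sup>2)" by simp
  qed
  finally show ?thesis .
qed

lemma sum_inverse_squares_tail:
  fixes I :: "int set"
  assumes "finite I" "K \<ge> (1::real)"
  shows "(\<Sum>a\<in>{a\<in>I. \<bar>y - of_int a\<bar> \<ge> K}. 1 / (y - of_int a)\<^sup>2) \<le> 4 / K"
proof -
  have half: "(\<Sum>a\<in>{a\<in>J. of_int a - z \<ge> K}. 1 / (of_int a - z)\<^sup>2) \<le> 2 / K" if J: "finite J" for J :: "int set" and z
  proof (cases "{a\<in>J. of_int a - z \<ge> K} = {}")
    case False
    define c where "c = \<lceil>z + K\<rceil>"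
    define b where "b = Max J"
    have cb: "{a\<in>J. of_int a - z \<ge> K} \<subseteq> {c..b}"
      using J by (auto simp: c_def b_def ceiling_le_iff)
    define n where "n = nat (b - c + 1)"
    have cK: "of_int c - z \<ge> K" unfolding c_def using le_of_int_ceiling[of "z + K"] by linarith
    have "(\<Sum>a\<in>{a\<in>J. of_int a - z \<ge> K}. 1 / (of_int a - z)\<^sup>2) \<le> (\<Sum>a\<in>{c..b}. 1 / (of_int a - z)\<^sup>2)"
      using cb by (intro sum_mono2) auto
    also have "\<dots> = (\<Sum>i<n. 1 / (of_int (c + int i) - z)\<^sup>2)"
      by (rule sum.reindex_bij_witness[where i = "\<lambda>i. c + int i" and j = "\<lambda>a. nat (a - c)"]) (auto simp: n_def)
    also have "\<dots> \<le> (\<Sum>i<n. 2 * (1 / (of_int c - z + real i) - 1 / (of_int c - z + real (Suc i))))"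
    proof (rule sum_mono)
      fix i
      define v where "v = of_int c - z + real i"
      have v: "v \<ge> 1" using cK assms by (simp add: v_def)
      have "v * (v + 1) \<le> 2 * v\<^sup>2" using v by (simp add: power2_eq_square algebra_simps)
      then have "2 * (1 / (2 * v\<^sup>2)) \<le> 2 * (1 / (v * (v + 1)))"
        using v by (intro mult_left_mono divide_left_mono) auto
      also have "1 / (v * (v + 1)) = 1 / v - 1 / (v + 1)" using v by (simp add: field_simps)
      finally have "1 / v\<^sup>2 \<le> 2 * (1 / v - 1 / (v + 1))" by simp
      then show "1 / (of_int (c + int i) - z)\<^sup>2 \<le> 2 * (1 / (of_int c - z + real i) - 1 / (of_int c - z + real (Suc i)))"
        by (simp add: v_def algebra_simps)
    qed
    also have "\<dots> = 2 * (1 / (of_int c - z) - 1 / (of_int c - z + real n))"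
      unfolding sum_distrib_left[symmetric]
      using sum_lessThan_telescope'[of "\<lambda>i. 1 / (of_int c - z + real i)" n] by simp
    also have "\<dots> \<le> 2 * (1 / (of_int c - z))" using cK assms by simp
    also have "\<dots> \<le> 2 * (1 / K)" using cK assms by (intro mult_left_mono divide_left_mono mult_pos_pos) auto
    finally show ?thesis by simp
  next
    case True
    then show ?thesis using assms unfolding True by simp
  qed
  have "(\<Sum>a\<in>{a\<in>I. \<bar>y - of_int a\<bar> \<ge> K}. 1 / (y - of_int a)\<^sup>2)
     \<le> (\<Sum>a\<in>{a\<in>I. of_int a - y \<ge> K} \<union> {a\<in>I. y - of_int a \<ge> K}. 1 / (y - of_int a)\<^sup>2)"
    using assms by (intro sum_mono2) auto
  also have "\<dots> = (\<Sum>a\<in>{a\<in>I. of_int a - y \<ge> K}. 1 / (y - of_int a)\<^sup>2) + (\<Sum>a\<in>{a\<in>I. y - of_int a \<ge> K}. 1 / (y - of_int a)\<^sup>2)"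
    by (rule sum.union_disjoint) (use assms in \<open>simp, simp, force\<close>)
  also have "(\<Sum>a\<in>{a\<in>I. of_int a - y \<ge> K}. 1 / (y - of_int a)\<^sup>2) \<le> 2 / K"
    using half[OF assms(1), of y] by (simp add: power2_commute)
  also have "(\<Sum>a\<in>{a\<in>I. y - of_int a \<ge> K}. 1 / (y - of_int a)\<^sup>2)
    = (\<Sum>a\<in>{a\<in>uminus ` I. of_int a - (- y) \<ge> K}. 1 / (of_int a - (- y))\<^sup>2)"
    by (rule sum.reindex_bij_witness[where i = uminus and j = uminus]) auto
  also have "\<dots> \<le> 2 / K" using half[of "uminus ` I" "- y"] assms by simp
  finally show ?thesis by simp
qed

section \<open>Approximation by Fejer kernels\<close>

lemma unif_cont_cube:
  fixes f :: "real^'n \<Rightarrow> real"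
  assumes "continuous_on UNIV f" "\<epsilon> > 0"
  obtains \<eta> where "0 < \<eta>" "\<eta> \<le> 1"
    "\<And>x y. (\<And>j. \<bar>x $ j\<bar> \<le> R) \<Longrightarrow> (\<And>j. \<bar>y $ j\<bar> \<le> R) \<Longrightarrow> (\<And>j. \<bar>x $ j - y $ j\<bar> \<le> \<eta>) \<Longrightarrow> \<bar>f x - f y\<bar> \<le> \<epsilon>"
proof -
  define K :: "(real^'n) set" where "K = cbox (\<chi> j. - R) (\<chi> j. R)"
  have "uniformly_continuous_on K f"
    using assms(1) unfolding K_def by (intro compact_uniformly_continuous) (auto intro: continuous_on_subset)
  then obtain \<delta> where \<delta>: "\<delta> > 0" "\<And>x y. x \<in> K \<Longrightarrow> y \<in> K \<Longrightarrow> dist y x < \<delta> \<Longrightarrow> dist (f y) (f x) < \<epsilon>"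
    using assms(2) unfolding uniformly_continuous_on_def by metis
  define \<eta> where "\<eta> = min 1 (\<delta> / (2 * real CARD('n)))"
  show ?thesis
  proof (rule that[of \<eta>])
    show "0 < \<eta>" "\<eta> \<le> 1" using \<delta>(1) by (auto simp: \<eta>_def)
    fix x y :: "real^'n"
    assume x: "\<And>j. \<bar>x $ j\<bar> \<le> R" and y: "\<And>j. \<bar>y $ j\<bar> \<le> R" and xy: "\<And>j. \<bar>x $ j - y $ j\<bar> \<le> \<eta>"
    have K: "x \<in> K" "y \<in> K" using x y by (auto simp: K_def mem_box_cart abs_le_iff minus_le_iff)
    have "norm (x - y) \<le> (\<Sum>j\<in>UNIV. \<bar>(x - y) $ j\<bar>)" by (rule norm_le_l1_cart)
    also have "\<dots> \<le> (\<Sum>j\<in>(UNIV::'n set). \<delta> / (2 * real CARD('n)))"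
      using xy by (intro sum_mono) (auto simp: \<eta>_def)
    also have "\<dots> < \<delta>" using \<delta>(1) by simp
    finally have "dist x y < \<delta>" by (simp add: dist_norm)
    then have "dist (f x) (f y) < \<epsilon>" using \<delta>(2) K by blast
    then show "\<bar>f x - f y\<bar> \<le> \<epsilon>" by (simp add: dist_real_def)
  qed
qed

lemma bounded_cube:
  fixes f :: "real^'n \<Rightarrow> real"
  assumes "continuous_on UNIV f" "\<And>x. f x \<noteq> 0 \<Longrightarrow> \<forall>j. \<bar>x $ j\<bar> \<le> R"
  obtains B where "B > 0" "\<And>x. \<bar>f x\<bar> \<le> B"
proof -
  have "compact (f ` cbox (\<chi> j. - R) (\<chi> j. R))"
    using assms(1) by (intro compact_continuous_image) (auto intro: continuous_on_subset)
  then obtain B where B: "\<And>y. y \<in> f ` cbox (\<chi> j. - R) (\<chi> j. R) \<Longrightarrow> norm y \<le> B"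
    using compact_imp_bounded bounded_iff by metis
  have "\<bar>f x\<bar> \<le> \<bar>B\<bar> + 1" for x
  proof (cases "f x = 0")
    case False
    then have "x \<in> cbox (\<chi> j. - R) (\<chi> j. R)" using assms(2) by (auto simp: mem_box_cart abs_le_iff minus_le_iff)
    then have "\<bar>f x\<bar> \<le> B" using B by auto
    then show ?thesis by simp
  qed simp
  then show ?thesis by (intro that[of "\<bar>B\<bar> + 1"]) auto
qed

text \<open>For large \<open>N * \<delta>\<close> every centre is far from \<open>\<delta>\<close>:
  about \<open>R * M\<close> terms of size \<open>1 / (M * x)\<^sup>2\<close> produce the factor
  \<open>1 / M\<close>. For small \<open>N * \<delta>\<close> the partition of unity bounds the sum
  by 1, which the majorant exceeds up to the constant. The factor 1920 is
  \<open>48 * 2 * 20\<close>.\<close>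

lemma fej_box_sum:
  assumes R: "R \<ge> 1" and M: "M \<ge> 1" and N: "N \<ge> 8 * R" and \<delta>: "\<bar>\<delta>\<bar> \<le> 1 / 2"
  defines "s \<equiv> (\<Sum>a\<in>{- int (R * M)..int (R * M)}. fej (M * N) (\<delta> - of_int a / real (M * N)))"
    and "W \<equiv> 1920 * (1 + 4 * (real R)\<^sup>2)"
  shows "s \<le> W * wfej N \<delta>" "\<bar>real N * \<delta>\<bar> > 2 * real R \<Longrightarrow> s \<le> W / real M * wfej N \<delta>"
    "\<bar>real N * \<delta>\<bar> \<le> 2 * real R \<Longrightarrow> 1 \<le> W * wfej N \<delta>"
proof -
  have N0: "N > 0" using N R by simp
  then have P0: "M * N > 0" using M by simp
  define x where "x = real N * \<delta>"
  have w: "1 / (1 + x\<^sup>2) \<le> 20 * wfej N \<delta>"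
    using wfej_lower[OF N0, of \<delta>] by (simp add: x_def divide_le_eq add_pos_nonneg mult_ac)
  show small: "1 \<le> W * wfej N \<delta>" if "\<bar>real N * \<delta>\<bar> \<le> 2 * real R"
  proof -
    have xR: "x\<^sup>2 \<le> 4 * (real R)\<^sup>2" using that power_mono[of "\<bar>x\<bar>" "2 * real R" 2] by (simp add: x_def power_mult_distrib)
    have gen: "20 * (1 + u) \<le> 1920 * (1 + 4 * v)" if "u \<le> 4 * v" "v \<ge> 0" for u v :: real
    proof -
      have "80 * v \<le> 7680 * v" using that by simp
      then show ?thesis using that by (simp add: distrib_left)
    qed
    have "20 * (1 + x\<^sup>2) \<le> W" unfolding W_def by (rule gen[OF xR]) simp
    then have "wfej N \<delta> * (20 * (1 + x\<^sup>2)) \<le> wfej N \<delta> * W"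
      by (rule mult_left_mono) (rule wfej_nonneg)
    then show ?thesis using wfej_lower[OF N0, of \<delta>] by (simp add: x_def mult.commute)
  qed
  show large: "s \<le> W / real M * wfej N \<delta>" if big: "\<bar>real N * \<delta>\<bar> > 2 * real R"
  proof -
    have x1: "x\<^sup>2 \<ge> 1" using that R power_mono[of 1 "\<bar>x\<bar>" 2] by (simp add: x_def)
    have "s \<le> (\<Sum>a\<in>{- int (R * M)..int (R * M)}. 16 / (real M * x)\<^sup>2)"
      unfolding s_def
    proof (rule sum_mono)
      fix a assume a: "a \<in> {- int (R * M)..int (R * M)}"
      then have "\<bar>a\<bar> \<le> int (R * M)" unfolding atLeastAtMost_iff by linarith
      then have a': "\<bar>real_of_int a\<bar> \<le> real R * real M" by (metis of_int_abs of_int_le_iff of_int_of_nat_eq of_nat_mult)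
      have "\<bar>real M * x\<bar> > real M * (2 * real R)" using big M by (simp add: abs_mult x_def)
      then have "\<bar>real M * x\<bar> > 2 * (real R * real M)" by (simp add: mult_ac)
      then have d: "\<bar>real M * x - of_int a\<bar> \<ge> \<bar>real M * x\<bar> / 2" using a' by linarith
      have eq: "real (M * N) * (\<delta> - of_int a / real (M * N)) = real M * x - of_int a"
        using N0 M by (simp add: x_def field_simps)
      have pos: "\<bar>real M * x\<bar> > 0" using M x1 by auto
      have "\<bar>of_int a / real (M * N)\<bar> \<le> real R * real M / real (M * N)"
        unfolding abs_divide abs_of_nat using a' by (rule divide_right_mono) simp
      also have "\<dots> = real R / real N" using M by simp
      also have "\<dots> \<le> 1 / 4" using N N0 by (simp add: divide_le_eq)
      finally have "\<bar>\<delta> - of_int a / real (M * N)\<bar> \<le> 3 / 4" using \<delta> by linarith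
      moreover have "\<delta> - of_int a / real (M * N) \<noteq> 0" using eq d pos by auto
      ultimately have "fej (M * N) (\<delta> - of_int a / real (M * N)) \<le> 4 / (real M * x - of_int a)\<^sup>2"
        using fej_decay[OF _ _ P0] eq by metis
      also have "\<dots> \<le> 4 / (\<bar>real M * x\<bar> / 2)\<^sup>2"
      proof (rule divide_left_mono)
        show "(\<bar>real M * x\<bar> / 2)\<^sup>2 \<le> (real M * x - of_int a)\<^sup>2"
          using power_mono[OF d, of 2] by (simp add: power2_abs)
        then show "0 < (real M * x - of_int a)\<^sup>2 * (\<bar>real M * x\<bar> / 2)\<^sup>2"
          using pos by (smt (verit) half_gt_zero_iff mult_pos_pos zero_less_power)
      qed simp
      also have "\<dots> = 16 / (real M * x)\<^sup>2" by (simp add: power_divide)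
      finally show "fej (M * N) (\<delta> - of_int a / real (M * N)) \<le> 16 / (real M * x)\<^sup>2" .
    qed
    also have "\<dots> = real (2 * R * M + 1) * (16 / (real M * x)\<^sup>2)" by simp
    also have "\<dots> \<le> (3 * real R * real M) * (16 / (real M * x)\<^sup>2)"
    proof (rule mult_right_mono)
      have "1 \<le> R * M" using R M by simp
      then have "2 * R * M + 1 \<le> 3 * R * M" by simp
      then show "real (2 * R * M + 1) \<le> 3 * real R * real M" by (metis of_nat_le_iff of_nat_mult of_nat_numeral)
    qed simp
    also have "\<dots> = 48 * real R / real M * (1 / x\<^sup>2)"
      using M by (simp add: power2_eq_square field_simps)
    also have "\<dots> \<le> 48 * real R / real M * (2 * (1 / (1 + x\<^sup>2)))"
    proof (rule mult_left_mono)
      have "1 / v \<le> 2 * (1 / (1 + v))" if "v \<ge> 1" for v :: real using that by (simp add: field_simps)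
      from this[OF x1] show "1 / x\<^sup>2 \<le> 2 * (1 / (1 + x\<^sup>2))" .
    qed simp
    also have "\<dots> \<le> 48 * real R / real M * (2 * (20 * wfej N \<delta>))"
      by (intro mult_left_mono w) auto
    also have "\<dots> = 1920 * real R / real M * wfej N \<delta>" by simp
    also have "\<dots> \<le> W / real M * wfej N \<delta>"
    proof (intro mult_right_mono wfej_nonneg divide_right_mono)
      have "real R \<le> (real R)\<^sup>2" using R by (simp add: power2_eq_square)
      moreover have "r \<le> 1 + 4 * v" if "r \<le> v" "0 \<le> v" for r v :: real using that by linarith
      ultimately have "real R \<le> 1 + 4 * (real R)\<^sup>2" using zero_le_power2 by blast
      then show "1920 * real R \<le> W" unfolding W_def by (intro mult_left_mono) auto
    qed simp
    finally show ?thesis .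
  qed
  show "s \<le> W * wfej N \<delta>"
  proof (cases "\<bar>real N * \<delta>\<bar> \<le> 2 * real R")
    case True
    have "2 * (R * M) + 1 \<le> M * N"
    proof -
      have "1 \<le> R * M" using R M by simp
      then have "2 * (R * M) + 1 \<le> M * (8 * R)" by (simp add: mult_ac)
      also have "\<dots> \<le> M * N" using N by simp
      finally show ?thesis .
    qed
    then have "{- int (R * M)..int (R * M)} \<subseteq> {- int (R * M)..<- int (R * M) + int (M * N)}"
      by (auto simp del: of_nat_mult)
    then have "s \<le> (\<Sum>a\<in>{- int (R * M)..<- int (R * M) + int (M * N)}. fej (M * N) (\<delta> - of_int a / real (M * N)))"
      unfolding s_def by (intro sum_mono2) auto
    also have "\<dots> = 1" by (rule fej_partition_int[OF P0])
    finally show ?thesis using small[OF True] by simp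
  next
    case False
    have "s \<le> W / real M * wfej N \<delta>" using large False by simp
    also have "\<dots> \<le> W * wfej N \<delta>"
    proof (rule mult_right_mono[OF _ wfej_nonneg])
      have "W / real M \<le> W / 1" using M by (intro divide_left_mono) (auto simp: W_def)
      then show "W / real M \<le> W" by simp
    qed
    finally show ?thesis .
  qed
qed

lemma sum_prod_UNIV:
  fixes g :: "'n::finite \<Rightarrow> 'b \<Rightarrow> 'c::comm_semiring_1"
  assumes "\<And>j. finite (I j)"
  shows "(\<Sum>a\<in>{a. \<forall>j. a j \<in> I j}. \<Prod>j\<in>UNIV. g j (a j)) = (\<Prod>j\<in>UNIV. \<Sum>i\<in>I j. g j i)"
proof -
  have "{a. \<forall>j. a j \<in> I j} = PiE UNIV I" by (auto simp: PiE_def)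
  then show ?thesis using prod_sum_PiE[of UNIV I g] assms by simp
qed

lemma finite_UNIV_Pi:
  assumes "\<And>j::'n::finite. finite (I j)"
  shows "finite {a. \<forall>j. a j \<in> I j}"
proof -
  have "{a. \<forall>j. a j \<in> I j} = PiE UNIV I" by (auto simp: PiE_def)
  then show ?thesis using assms by (simp add: finite_PiE)
qed

text \<open>The summation window of length \<open>P\<close> is centred at
  \<open>P * \<delta>\<close>, which keeps every \<open>\<delta> - i / P\<close> within
  \<open>1 / 2\<close> of 0. There the decay estimate holds without reduction modulo 1.\<close>

lemma fej_tail:
  assumes P0: "P > 0" and \<eta>: "real M * \<eta> \<ge> 1" and M: "M \<ge> 1" and y: "real P * \<delta> = real M * x"
    and c: "c = \<lceil>real P * \<delta> - real P / 2\<rceil>"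
  shows "(\<Sum>i\<in>{c..<c + int P}. (if \<bar>x - of_int i / real M\<bar> \<ge> \<eta> then 1 else 0) * fej P (\<delta> - of_int i / real P)) \<le> 16 / (real M * \<eta>)"
proof -
  have "(\<Sum>i\<in>{c..<c + int P}. (if \<bar>x - of_int i / real M\<bar> \<ge> \<eta> then 1 else 0) * fej P (\<delta> - of_int i / real P))
    \<le> (\<Sum>i\<in>{c..<c + int P}. if \<bar>real M * x - of_int i\<bar> \<ge> real M * \<eta> then 4 * (1 / (real M * x - of_int i)\<^sup>2) else 0)"
  proof (rule sum_mono)
    fix i assume i: "i \<in> {c..<c + int P}"
    have iff: "\<bar>x - of_int i / real M\<bar> \<ge> \<eta> \<longleftrightarrow> \<bar>real M * x - of_int i\<bar> \<ge> real M * \<eta>"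
    proof -
      have "real M * x - of_int i = real M * (x - of_int i / real M)" using M by (simp add: field_simps)
      then show ?thesis using M by (simp add: abs_mult)
    qed
    have "fej P (\<delta> - of_int i / real P) \<le> 4 * (1 / (real M * x - of_int i)\<^sup>2)" if t: "\<bar>real M * x - of_int i\<bar> \<ge> real M * \<eta>"
    proof -
      have c': "of_int c \<ge> real P * \<delta> - real P / 2" "of_int c < real P * \<delta> - real P / 2 + 1"
        unfolding c by linarith+
      have i': "of_int i \<ge> real_of_int c" "of_int i + 1 \<le> real_of_int c + real P"
        using i by simp_all
      have eq: "real P * (\<delta> - of_int i / real P) = real M * x - of_int i"
        using P0 y by (simp add: field_simps)
      have "\<bar>real P * (\<delta> - of_int i / real P)\<bar> \<le> real P / 2" unfolding eq y[symmetric] using c' i' by linarith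
      then have "\<bar>\<delta> - of_int i / real P\<bar> \<le> 3 / 4" using P0 by (simp add: abs_mult)
      moreover have "\<delta> - of_int i / real P \<noteq> 0" using eq t \<eta> by auto
      ultimately show ?thesis using fej_decay[OF _ _ P0] eq by (metis mult_1_right times_divide_eq_right)
    qed
    then show "(if \<bar>x - of_int i / real M\<bar> \<ge> \<eta> then 1 else 0) * fej P (\<delta> - of_int i / real P)
       \<le> (if \<bar>real M * x - of_int i\<bar> \<ge> real M * \<eta> then 4 * (1 / (real M * x - of_int i)\<^sup>2) else 0)"
      unfolding iff by simp
  qed
  also have "\<dots> = 4 * (\<Sum>i\<in>{i\<in>{c..<c + int P}. \<bar>real M * x - of_int i\<bar> \<ge> real M * \<eta>}. 1 / (real M * x - of_int i)\<^sup>2)"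
    unfolding sum_distrib_left by (rule sum.inter_filter[symmetric]) simp
  also have "\<dots> \<le> 4 * (4 / (real M * \<eta>))"
    by (intro mult_left_mono sum_inverse_squares_tail \<eta>) auto
  finally show ?thesis by simp
qed

text \<open>The factor \<open>\<kappa>\<close> near 1 allows a polynomial built for the scale
  \<open>N\<close> to test \<open>f\<close> at neighbouring scales, as needed between members of the
  sparse subsequence. The error is measured by the product of the majorants, so it can be summed
  over all tuples, including those with large gaps.\<close>

lemma fejer_approx:
  fixes f :: "real^'n \<Rightarrow> real"
  assumes cont: "continuous_on UNIV f" and R: "R \<ge> 1" and supp: "\<And>x. f x \<noteq> 0 \<Longrightarrow> \<forall>j. \<bar>x $ j\<bar> \<le> real R"
    and \<epsilon>: "\<epsilon> > 0"
  obtains \<rho> M0 where "\<rho> > 0" "M0 \<ge> 1"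
    "\<And>M N \<kappa> \<delta>. M \<ge> M0 \<Longrightarrow> N \<ge> 8 * R \<Longrightarrow> \<bar>\<kappa> - 1\<bar> \<le> \<rho> \<Longrightarrow> (\<And>j. \<bar>\<delta> j\<bar> \<le> 1 / 2) \<Longrightarrow>
      \<bar>f (\<chi> j. \<kappa> * (real N * \<delta> j)) - (\<Sum>a\<in>{a. \<forall>j. a j \<in> {- int (R * M)..int (R * M)}}.
          f (\<chi> j. of_int (a j) / real M) * (\<Prod>j\<in>UNIV. fej (M * N) (\<delta> j - of_int (a j) / real (M * N))))\<bar>
      \<le> \<epsilon> * (\<Prod>j\<in>UNIV. wfej N (\<delta> j))"
proof -
  obtain B where B: "B > 0" "\<And>x. \<bar>f x\<bar> \<le> B" using bounded_cube[OF cont supp] by metis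
  let ?n = "CARD('n)"
  define W where "W = 1920 * (1 + 4 * (real R)\<^sup>2)"
  have W1: "W \<ge> 1" by (simp add: W_def)
  define \<epsilon>1 where "\<epsilon>1 = \<epsilon> / (4 * W ^ ?n)"
  have Wn: "W ^ ?n \<ge> 1" using W1 by simp
  have \<epsilon>1: "\<epsilon>1 > 0" using \<epsilon> W1 by (simp add: \<epsilon>1_def)
  obtain \<eta> where \<eta>: "0 < \<eta>" "\<eta> \<le> 1" and uc: 
    "\<And>x y. (\<And>j. \<bar>x $ j\<bar> \<le> 4 * real R) \<Longrightarrow> (\<And>j. \<bar>y $ j\<bar> \<le> 4 * real R) \<Longrightarrow> (\<And>j. \<bar>x $ j - y $ j\<bar> \<le> \<eta>) \<Longrightarrow> \<bar>f x - f y\<bar> \<le> \<epsilon>1"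
    using unif_cont_cube[OF cont \<epsilon>1, of "4 * real R"] by metis
  define \<rho> where "\<rho> = \<eta> / (2 * real R)"
  have \<rho>: "\<rho> > 0" "\<rho> \<le> 1 / 2" using \<eta> R by (auto simp: \<rho>_def divide_le_eq)
  \<comment> \<open>The first bound makes the tail estimate applicable, the second keeps the
    contribution of distant centres below half of the error, and the third handles arguments outside
    the cube of side \<open>2 * R\<close>, where only the factor \<open>1 / M\<close> helps.\<close>
  obtain m0 where m0: "real m0 \<ge> max (1 / \<eta>) (max (64 * B * real ?n * W ^ ?n / (\<eta> * \<epsilon>)) (B * W ^ ?n / \<epsilon>))"
    using real_arch_simple by blast
  show ?thesis
  proof (rule that[of \<rho> "Suc m0"])
    fix M N :: nat and \<kappa> :: real and \<delta> :: "'n \<Rightarrow> real"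
    assume MM: "M \<ge> Suc m0" and N: "N \<ge> 8 * R" and \<kappa>: "\<bar>\<kappa> - 1\<bar> \<le> \<rho>" and \<delta>: "\<And>j. \<bar>\<delta> j\<bar> \<le> 1 / 2"
    have M: "M \<ge> 1" using MM by simp
    have N0: "N > 0" using N R by simp
    define P where "P = M * N"
    have P0: "P > 0" using M N0 by (simp add: P_def)
    have Mr: "real M \<ge> 1 / \<eta>" "real M \<ge> 64 * B * real ?n * W ^ ?n / (\<eta> * \<epsilon>)" "real M \<ge> B * W ^ ?n / \<epsilon>"
      using m0 MM by auto
    define x where "x j = real N * \<delta> j" for j
    define F where "F j i = fej P (\<delta> j - of_int i / real P)" for j and i :: int
    have F0: "F j i \<ge> 0" for j i by (simp add: F_def)
    define G where "G = (\<Prod>j\<in>UNIV. wfej N (\<delta> j))"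
    define Box :: "('n \<Rightarrow> int) set" where "Box = {a. \<forall>j. a j \<in> {- int (R * M)..int (R * M)}}"
    define \<phi> where "\<phi> a = f (\<chi> j. of_int (a j) / real M)" for a
    define A where "A = (\<Sum>a\<in>Box. \<phi> a * (\<Prod>j\<in>UNIV. F j (a j)))"
    have fin: "finite Box" unfolding Box_def by (rule finite_UNIV_Pi) simp
    have "\<bar>f (\<chi> j. \<kappa> * x j) - A\<bar> \<le> \<epsilon> * G"
    proof (cases "\<forall>j. \<bar>x j\<bar> \<le> 2 * real R")
      case True
      define c where "c j = \<lceil>real P * \<delta> j - real P / 2\<rceil>" for j
      define I where "I j = {c j..<c j + int P}" for j
      define BI where "BI = {a. \<forall>j. a j \<in> I j}"
      have finI: "finite BI" unfolding BI_def by (rule finite_UNIV_Pi) (simp add: I_def)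
      have Px: "real P * \<delta> j = real M * x j" for j by (simp add: P_def x_def)
      have sub: "Box \<subseteq> BI"
      proof -
        have "{- int (R * M)..int (R * M)} \<subseteq> I j" for j
        proof -
          have "\<bar>real M * x j\<bar> \<le> real M * (2 * real R)" using True by (simp add: abs_mult mult_left_mono)
          then have xb: "\<bar>real P * \<delta> j\<bar> \<le> 2 * real (R * M)" unfolding Px by (simp add: mult_ac)
          have "real P \<ge> 8 * real (R * M)" 
          proof -
            have "8 * (R * M) \<le> P" unfolding P_def using mult_left_mono[OF N, of M] by (simp add: mult_ac)
            then have "real (8 * (R * M)) \<le> real P" by (simp only: of_nat_le_iff)
            then show ?thesis by simp
          qed
          then have "c j \<le> - int (R * M)" unfolding c_def ceiling_le_iff using xb by simp
          moreover have "real_of_int (int (R * M)) < real_of_int (c j + int P)"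
          proof -
            have "real_of_int (c j) \<ge> real P * \<delta> j - real P / 2" unfolding c_def by linarith
            moreover have "real (R * M) > 0" using R M by simp
            moreover have "real_of_int (int (R * M)) = real (R * M)" "real_of_int (c j + int P) = real_of_int (c j) + real P" by simp_all
            ultimately show ?thesis using xb \<open>real P \<ge> 8 * real (R * M)\<close> by linarith
          qed
          then have "int (R * M) < c j + int P" by linarith
          ultimately show ?thesis unfolding I_def by auto
        qed
        then show ?thesis unfolding Box_def BI_def by blast
      qed
      have one: "(\<Sum>a\<in>BI. \<Prod>j\<in>UNIV. F j (a j)) = 1"
      proof -
        have "(\<Sum>a\<in>BI. \<Prod>j\<in>UNIV. F j (a j)) = (\<Prod>j\<in>UNIV. \<Sum>i\<in>I j. F j i)"
          unfolding BI_def by (rule sum_prod_UNIV) (simp add: I_def)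
        also have "\<dots> = 1" unfolding I_def F_def fej_partition_int[OF P0] by simp
        finally show ?thesis .
      qed
      have "A = (\<Sum>a\<in>BI. \<phi> a * (\<Prod>j\<in>UNIV. F j (a j)))"
        unfolding A_def
      proof (rule sum.mono_neutral_left[OF finI sub], rule ballI)
        fix a assume "a \<in> BI - Box"
        then obtain j where "\<not> (- int (R * M) \<le> a j \<and> a j \<le> int (R * M))" by (auto simp: Box_def)
        then have "\<bar>a j\<bar> > int (R * M)" by linarith
        then have "\<bar>real_of_int (a j)\<bar> > real R * real M" by (metis of_int_abs of_int_less_iff of_int_of_nat_eq of_nat_mult)
        then have "\<bar>real_of_int (a j) / real M\<bar> > real R" using M by (simp add: abs_divide pos_less_divide_eq)
        then have "\<phi> a = 0" unfolding \<phi>_def using supp[of "\<chi> j. real_of_int (a j) / real M"] by (metis not_le vec_lambda_beta)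
        then show "\<phi> a * (\<Prod>j\<in>UNIV. F j (a j)) = 0" by simp
      qed
      \<comment> \<open>Since the products of kernels sum to 1 over \<open>BI\<close>, the error is
        an average of the differences between \<open>f\<close> at the point and \<open>f\<close> at
        the centres.\<close>
      then have "f (\<chi> j. \<kappa> * x j) - A = (\<Sum>a\<in>BI. (f (\<chi> j. \<kappa> * x j) - \<phi> a) * (\<Prod>j\<in>UNIV. F j (a j)))"
        unfolding left_diff_distrib sum_subtractf sum_distrib_left[symmetric] one by simp
      then have "\<bar>f (\<chi> j. \<kappa> * x j) - A\<bar> \<le> (\<Sum>a\<in>BI. \<bar>f (\<chi> j. \<kappa> * x j) - \<phi> a\<bar> * (\<Prod>j\<in>UNIV. F j (a j)))"
        using sum_abs[of "\<lambda>a. (f (\<chi> j. \<kappa> * x j) - \<phi> a) * (\<Prod>j\<in>UNIV. F j (a j))" BI]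
        by (simp add: abs_mult abs_prod F0)
      also have "\<dots> \<le> (\<Sum>a\<in>BI. (2 * \<epsilon>1 + 2 * B * (\<Sum>j\<in>UNIV. if \<bar>x j - of_int (a j) / real M\<bar> \<ge> \<eta> then 1 else 0)) * (\<Prod>j\<in>UNIV. F j (a j)))"
      proof (intro sum_mono mult_right_mono prod_nonneg)
        fix a
        show "\<bar>f (\<chi> j. \<kappa> * x j) - \<phi> a\<bar> \<le> 2 * \<epsilon>1 + 2 * B * (\<Sum>j\<in>UNIV. if \<bar>x j - of_int (a j) / real M\<bar> \<ge> \<eta> then 1 else 0)"
        proof (cases "\<forall>j. \<bar>x j - of_int (a j) / real M\<bar> < \<eta>")
          case near: True
          have a1: "\<bar>f (\<chi> j. \<kappa> * x j) - f (\<chi> j. x j)\<bar> \<le> \<epsilon>1"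
          proof (rule uc)
            fix j
            have "\<bar>\<kappa> * x j\<bar> \<le> 2 * (2 * real R)" unfolding abs_mult
              using \<kappa> \<rho> True by (intro mult_mono) auto
            then show "\<bar>(\<chi> j. \<kappa> * x j) $ j\<bar> \<le> 4 * real R" by simp
            have "\<bar>x j\<bar> \<le> 2 * real R" using True by blast
            then show "\<bar>(\<chi> j. x j) $ j\<bar> \<le> 4 * real R" by simp
            have "\<bar>\<kappa> * x j - x j\<bar> = \<bar>\<kappa> - 1\<bar> * \<bar>x j\<bar>" by (simp add: abs_mult[symmetric] algebra_simps)
            also have "\<dots> \<le> \<rho> * (2 * real R)" using \<kappa> True \<rho> by (intro mult_mono) auto
            also have "\<dots> = \<eta>" using R by (simp add: \<rho>_def)
            finally show "\<bar>(\<chi> j. \<kappa> * x j) $ j - (\<chi> j. x j) $ j\<bar> \<le> \<eta>" by simp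
          qed
          have a2: "\<bar>f (\<chi> j. x j) - \<phi> a\<bar> \<le> \<epsilon>1" unfolding \<phi>_def
          proof (rule uc)
            fix j
            have x2: "\<bar>x j\<bar> \<le> 2 * real R" using True by blast
            then show "\<bar>(\<chi> j. x j) $ j\<bar> \<le> 4 * real R" by simp
            have nj: "\<bar>x j - of_int (a j) / real M\<bar> < \<eta>" using near by blast
            then show "\<bar>(\<chi> j. x j) $ j - (\<chi> j. of_int (a j) / real M) $ j\<bar> \<le> \<eta>" by simp
            have "real R \<ge> 1" using R by simp
            then show "\<bar>(\<chi> j. of_int (a j) / real M) $ j\<bar> \<le> 4 * real R" using x2 nj \<eta> unfolding vec_lambda_beta by linarith
          qed
          have "(\<Sum>j\<in>UNIV. if \<bar>x j - of_int (a j) / real M\<bar> \<ge> \<eta> then 1 else (0::real)) \<ge> 0" by (intro sum_nonneg) auto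
          then have "2 * B * (\<Sum>j\<in>UNIV. if \<bar>x j - of_int (a j) / real M\<bar> \<ge> \<eta> then 1 else 0) \<ge> 0" using B by (intro mult_nonneg_nonneg) auto
          then show ?thesis using a1 a2 by linarith
        next
          case False
          then obtain j where j: "\<bar>x j - of_int (a j) / real M\<bar> \<ge> \<eta>" by (auto simp: not_less)
          have "(if \<bar>x j - of_int (a j) / real M\<bar> \<ge> \<eta> then 1 else 0) \<le> (\<Sum>j\<in>UNIV. if \<bar>x j - of_int (a j) / real M\<bar> \<ge> \<eta> then 1 else (0::real))"
            by (rule member_le_sum) auto
          then have "2 * B * 1 \<le> 2 * B * (\<Sum>j\<in>UNIV. if \<bar>x j - of_int (a j) / real M\<bar> \<ge> \<eta> then 1 else 0)"
            using B j by (intro mult_left_mono) auto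
          moreover have "\<bar>f (\<chi> j. \<kappa> * x j) - \<phi> a\<bar> \<le> 2 * B" using B(2)[of "\<chi> j. \<kappa> * x j"] B(2)[of "\<chi> j. of_int (a j) / real M"] unfolding \<phi>_def by linarith
          ultimately show ?thesis using \<epsilon>1 by linarith
        qed
      qed (use F0 in auto)
      also have "\<dots> = 2 * \<epsilon>1 + 2 * B * (\<Sum>j\<in>UNIV. \<Sum>a\<in>BI. (if \<bar>x j - of_int (a j) / real M\<bar> \<ge> \<eta> then 1 else 0) * (\<Prod>j\<in>UNIV. F j (a j)))"
        unfolding distrib_right sum.distrib sum_distrib_left[symmetric] one mult.assoc sum_distrib_right
        by (subst sum.swap) simp
      also have "\<dots> \<le> 2 * \<epsilon>1 + 2 * B * (\<Sum>j\<in>(UNIV::'n set). 16 / (real M * \<eta>))"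
      proof (intro add_left_mono mult_left_mono sum_mono)
        fix j
        define \<iota> where "\<iota> i = (if \<bar>x j - of_int i / real M\<bar> \<ge> \<eta> then 1 else (0::real))" for i :: int
        have "(\<Sum>a\<in>BI. \<iota> (a j) * (\<Prod>k\<in>UNIV. F k (a k))) = (\<Sum>a\<in>BI. \<Prod>k\<in>UNIV. (if k = j then \<iota> (a k) else 1) * F k (a k))"
        proof (rule sum.cong[OF refl])
          fix a
          have "(\<Prod>k\<in>UNIV. if k = j then \<iota> (a k) else 1) = \<iota> (a j)" by simp
          then show "\<iota> (a j) * (\<Prod>k\<in>UNIV. F k (a k)) = (\<Prod>k\<in>UNIV. (if k = j then \<iota> (a k) else 1) * F k (a k))"
            unfolding prod.distrib by simp
        qed
        also have "\<dots> = (\<Prod>k\<in>UNIV. \<Sum>i\<in>I k. (if k = j then \<iota> i else 1) * F k i)"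
          unfolding BI_def by (rule sum_prod_UNIV) (simp add: I_def)
        also have "\<dots> = (\<Prod>k\<in>UNIV. if k = j then (\<Sum>i\<in>I k. \<iota> i * F k i) else 1)"
        proof (rule prod.cong[OF refl])
          fix k
          have "(\<Sum>i\<in>I k. F k i) = 1" unfolding I_def F_def fej_partition_int[OF P0] by simp
          then show "(\<Sum>i\<in>I k. (if k = j then \<iota> i else 1) * F k i) = (if k = j then (\<Sum>i\<in>I k. \<iota> i * F k i) else 1)" by simp
        qed
        also have "\<dots> = (\<Sum>i\<in>I j. \<iota> i * F j i)" by simp
        also have "\<dots> \<le> 16 / (real M * \<eta>)"
          unfolding I_def F_def \<iota>_def
          by (rule fej_tail[OF P0 _ M Px c_def]) (use Mr(1) \<eta> in \<open>simp add: field_simps\<close>)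
        finally show "(\<Sum>a\<in>BI. (if \<bar>x j - of_int (a j) / real M\<bar> \<ge> \<eta> then 1 else 0) * (\<Prod>j\<in>UNIV. F j (a j))) \<le> 16 / (real M * \<eta>)"
          unfolding \<iota>_def .
      qed (use B in auto)
      also have "\<dots> = 2 * \<epsilon>1 + 32 * B * real ?n / (real M * \<eta>)" by simp
      also have "\<dots> \<le> \<epsilon> / (2 * W ^ ?n) + \<epsilon> / (2 * W ^ ?n)"
      proof (rule add_mono)
        show "2 * \<epsilon>1 \<le> \<epsilon> / (2 * W ^ ?n)" by (simp add: \<epsilon>1_def)
        have "64 * B * real ?n * W ^ ?n \<le> real M * (\<eta> * \<epsilon>)" using Mr(2) \<eta> \<epsilon> by (simp add: divide_le_eq)
        then show "32 * B * real ?n / (real M * \<eta>) \<le> \<epsilon> / (2 * W ^ ?n)"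
          using \<eta> M Wn by (simp add: field_simps)
      qed
      also have "\<dots> = \<epsilon> / W ^ ?n" by simp
      also have "\<dots> \<le> \<epsilon> * G"
      proof -
        have "(\<Prod>j\<in>(UNIV::'n set). 1) \<le> (\<Prod>j\<in>(UNIV::'n set). W * wfej N (\<delta> j))"
          using fej_box_sum(3)[OF R M N \<delta>] True by (intro prod_mono) (auto simp: x_def W_def)
        then have "1 \<le> W ^ ?n * G" by (simp add: prod.distrib G_def)
        then have "1 / W ^ ?n \<le> G" using Wn by (simp add: divide_le_eq mult.commute)
        then have "\<epsilon> * (1 / W ^ ?n) \<le> \<epsilon> * G" using \<epsilon> by (intro mult_left_mono) auto
        then show ?thesis by simp
      qed
      finally show ?thesis .
    next
      case False
      then obtain j0 where j0: "\<bar>x j0\<bar> > 2 * real R" by (auto simp: not_le)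
      have "\<kappa> \<ge> 1 / 2" using \<kappa> \<rho> by linarith
      have "1 / 2 * (2 * real R) < \<bar>\<kappa>\<bar> * \<bar>x j0\<bar>"
        using j0 \<open>\<kappa> \<ge> 1 / 2\<close> by (intro mult_le_less_imp_less) auto
      then have "\<not> \<bar>\<kappa> * x j0\<bar> \<le> real R" by (simp add: abs_mult)
      then have f0: "f (\<chi> j. \<kappa> * x j) = 0" using supp[of "\<chi> j. \<kappa> * x j"] by auto
      define s where "s j = (\<Sum>i\<in>{- int (R * M)..int (R * M)}. F j i)" for j
      have s0: "s j \<ge> 0" for j unfolding s_def by (intro sum_nonneg F0)
      have "\<bar>A\<bar> \<le> (\<Sum>a\<in>Box. \<bar>\<phi> a * (\<Prod>j\<in>UNIV. F j (a j))\<bar>)" unfolding A_def by (rule sum_abs)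
      also have "\<dots> \<le> (\<Sum>a\<in>Box. B * (\<Prod>j\<in>UNIV. F j (a j)))"
      proof (rule sum_mono)
        fix a
        have "\<bar>\<phi> a\<bar> \<le> B" by (simp add: \<phi>_def B)
        then show "\<bar>\<phi> a * (\<Prod>j\<in>UNIV. F j (a j))\<bar> \<le> B * (\<Prod>j\<in>UNIV. F j (a j))"
          by (simp add: abs_mult abs_prod F0 mult_right_mono prod_nonneg)
      qed
      also have "\<dots> = B * (\<Prod>j\<in>UNIV. s j)"
        unfolding sum_distrib_left[symmetric] Box_def s_def by (subst sum_prod_UNIV) auto
      also have "\<dots> \<le> B * (\<Prod>j\<in>UNIV. (if j = j0 then 1 / real M else 1) * (W * wfej N (\<delta> j)))"
      proof (intro mult_left_mono prod_mono conjI)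
        fix j
        show "s j \<le> (if j = j0 then 1 / real M else 1) * (W * wfej N (\<delta> j))"
        proof (cases "j = j0")
          case True
          then show ?thesis using fej_box_sum(2)[OF R M N \<delta>, of j0] j0 by (simp add: s_def F_def x_def W_def P_def)
        next
          case False
          then show ?thesis using fej_box_sum(1)[OF R M N \<delta>, of j] by (simp add: s_def F_def x_def W_def P_def)
        qed
      qed (use B s0 in auto)
      also have "\<dots> = B * (1 / real M * (W ^ ?n * G))"
        unfolding prod.distrib by (simp add: G_def)
      also have "\<dots> = B * W ^ ?n / real M * G" by simp
      also have "\<dots> \<le> \<epsilon> * G"
      proof (rule mult_right_mono)
        have "B * W ^ ?n \<le> real M * \<epsilon>" using Mr(3) \<epsilon> by (simp add: divide_le_eq)
        then show "B * W ^ ?n / real M \<le> \<epsilon>" using M by (simp add: divide_le_eq mult.commute)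
        show "G \<ge> 0" unfolding G_def by (intro prod_nonneg) (simp add: wfej_nonneg)
      qed
      finally show ?thesis using f0 by simp
    qed
    then show "\<bar>f (\<chi> j. \<kappa> * (real N * \<delta> j)) - (\<Sum>a\<in>{a. \<forall>j. a j \<in> {- int (R * M)..int (R * M)}}.
          f (\<chi> j. of_int (a j) / real M) * (\<Prod>j\<in>UNIV. fej (M * N) (\<delta> j - of_int (a j) / real (M * N))))\<bar>
      \<le> \<epsilon> * (\<Prod>j\<in>UNIV. wfej N (\<delta> j))"
      unfolding A_def G_def x_def \<phi>_def F_def Box_def P_def .
  qed (use \<rho> in auto)
qed

section \<open>Frequencies and additive energy\<close>

lemma idx_bij: "bij_betw (idx :: 'n::finite \<Rightarrow> nat) UNIV {..<CARD('n)}"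
proof -
  have "\<exists>g. bij_betw g (UNIV :: 'n set) {..<CARD('n)}"
    by (simp add: finite_same_card_bij lessThan_atLeast0)
  then show ?thesis unfolding idx_def by (rule someI_ex)
qed

lemma idx_less: "idx (j :: 'n::finite) < CARD('n)"
  using idx_bij bij_betwE by blast

lemma finite_distinct_tuples: "finite (distinct_tuples l N)"
proof -
  have "distinct_tuples l N \<subseteq> {n. \<forall>i. (i \<in> {..<l} \<longrightarrow> n i \<in> {1..N}) \<and> (i \<notin> {..<l} \<longrightarrow> n i = 0)}"
    by (auto simp: distinct_tuples_def)
  then show ?thesis by (rule finite_subset) (rule finite_set_of_finite_funs; simp)
qed

lemma distinct_tuples_mono: "N \<le> N' \<Longrightarrow> distinct_tuples l N \<subseteq> distinct_tuples l N'"
  by (fastforce simp: distinct_tuples_def)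

lemma card_distinct_tuples: "l \<le> N \<Longrightarrow> card (distinct_tuples l N) = \<Prod>{N - l + 1..N}"
proof -
  assume lN: "l \<le> N"
  have "bij_betw (\<lambda>n. map n [0..<l]) (distinct_tuples l N) {xs. length xs = l \<and> distinct xs \<and> set xs \<subseteq> {1..N}}"
  proof (rule bij_betw_byWitness[where f' = "\<lambda>xs i. if i < l then xs ! i else 0"])
    show "\<forall>n\<in>distinct_tuples l N. (\<lambda>i. if i < l then map n [0..<l] ! i else 0) = n"
      by (auto simp: distinct_tuples_def fun_eq_iff)
    show "\<forall>xs\<in>{xs. length xs = l \<and> distinct xs \<and> set xs \<subseteq> {1..N}}. map (\<lambda>i. if i < l then xs ! i else 0) [0..<l] = xs"
      by (auto intro: nth_equalityI)
    show "(\<lambda>n. map n [0..<l]) ` distinct_tuples l N \<subseteq> {xs. length xs = l \<and> distinct xs \<and> set xs \<subseteq> {1..N}}"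
      by (auto simp: distinct_tuples_def distinct_map lessThan_atLeast0 simp del: atLeastAtMost_iff)
    show "(\<lambda>xs i. if i < l then xs ! i else 0) ` {xs. length xs = l \<and> distinct xs \<and> set xs \<subseteq> {1..N}} \<subseteq> distinct_tuples l N"
      by (auto simp: distinct_tuples_def inj_on_def nth_eq_iff_index_eq simp del: atLeastAtMost_iff)
  qed
  then have "card (distinct_tuples l N) = card {xs. length xs = l \<and> distinct xs \<and> set xs \<subseteq> {1..N}}"
    by (rule bij_betw_same_card)
  also have "\<dots> = \<Prod>{card {1..N} - l + 1..card {1..N}}"
    by (rule card_lists_distinct_length_eq) (use lN in auto)
  finally show ?thesis by simp
qed

lemma card_distinct_tuples_asymp: "(\<lambda>N. real (card (distinct_tuples l N)) / real N ^ l) \<longlonglongrightarrow> 1"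
proof (rule real_tendsto_sandwich)
  show "\<forall>\<^sub>F N in sequentially. (1 - real l / real N) ^ l \<le> real (card (distinct_tuples l N)) / real N ^ l"
    using eventually_ge_at_top[of "Suc l"]
  proof eventually_elim
    case (elim N)
    have "(\<Prod>i\<in>{N - l + 1..N}. real N - real l) \<le> (\<Prod>i\<in>{N - l + 1..N}. real i)"
      using elim by (intro prod_mono) (auto simp: of_nat_diff)
    then have "(real N - real l) ^ l \<le> real (card (distinct_tuples l N))"
      using elim by (simp add: card_distinct_tuples)
    then have "(real N - real l) ^ l / real N ^ l \<le> real (card (distinct_tuples l N)) / real N ^ l"
      by (rule divide_right_mono) simp
    moreover have "1 - real l / real N = (real N - real l) / real N" using elim by (simp add: diff_divide_distrib)
    ultimately show ?case by (simp add: power_divide)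
  qed
  show "\<forall>\<^sub>F N in sequentially. real (card (distinct_tuples l N)) / real N ^ l \<le> 1"
    using eventually_ge_at_top[of "Suc l"]
  proof eventually_elim
    case (elim N)
    have "(\<Prod>i\<in>{N - l + 1..N}. real i) \<le> (\<Prod>i\<in>{N - l + 1..N}. real N)"
      by (intro prod_mono) auto
    then have "real (card (distinct_tuples l N)) \<le> real N ^ l"
      using elim by (simp add: card_distinct_tuples)
    then show ?case using elim by (simp add: divide_le_eq)
  qed
  have "(\<lambda>N. (1 - real l / real N) ^ l) \<longlonglongrightarrow> (1 - 0) ^ l"
    by (intro tendsto_intros lim_const_over_n)
  then show "(\<lambda>N. (1 - real l / real N) ^ l) \<longlonglongrightarrow> 1" by simp
qed simp

definition frq :: "nat \<Rightarrow> ('n::finite \<Rightarrow> int) \<times> (nat \<Rightarrow> nat) \<Rightarrow> int" where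
  "frq d p = (\<Sum>j\<in>UNIV. fst p j * (int (snd p (idx j)) ^ d - int (snd p (idx j + 1)) ^ d))"

text \<open>
  Summation by parts: a frequency vector \<open>k\<close> becomes the coefficients \<open>hh k\<close> of the powers \<open>n\<^sub>i^d\<close>, which sum to zero.
\<close>

definition kk :: "('n::finite \<Rightarrow> int) \<Rightarrow> nat \<Rightarrow> int" where
  "kk k i = (if i < CARD('n) then k (inv_into UNIV idx i) else 0)"

definition kp :: "('n::finite \<Rightarrow> int) \<Rightarrow> nat \<Rightarrow> int" where
  "kp k i = (if i = 0 then 0 else kk k (i - 1))"

definition hh :: "('n::finite \<Rightarrow> int) \<Rightarrow> nat \<Rightarrow> int" where
  "hh k i = kk k i - kp k i"

lemma kk_idx: "kk k (idx j) = k (j :: 'n::finite)"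
proof -
  have "inj (idx :: 'n \<Rightarrow> nat)" using idx_bij bij_betw_imp_inj_on by blast
  then show ?thesis using idx_less[of j] by (simp add: kk_def)
qed

lemma kp_Suc [simp]: "kp k (Suc i) = kk k i" and kp_0 [simp]: "kp k 0 = 0"
  by (simp_all add: kp_def)

lemma hh_sum: "(\<Sum>i<m. hh k i) = kp k m"
  by (induction m) (auto simp: hh_def)

lemma hh_sum_0: "(\<Sum>i<CARD('n) + 1. hh (k :: 'n::finite \<Rightarrow> int) i) = 0"
  unfolding hh_sum by (simp add: kk_def)

lemma hh_inj:
  fixes k k' :: "'n::finite \<Rightarrow> int"
  assumes "\<And>i. i < CARD('n) + 1 \<Longrightarrow> hh k i = hh k' i"
  shows "k = k'"
proof
  fix j :: 'n
  have "(\<Sum>i<Suc (idx j). hh k i) = (\<Sum>i<Suc (idx j). hh k' i)"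
    using assms idx_less[of j] by (intro sum.cong) auto
  then show "k j = k' j" unfolding hh_sum by (simp add: kk_idx)
qed

lemma hh_zero: "hh (\<lambda>_. 0) i = 0"
  by (simp add: hh_def kp_def kk_def)

lemma frq_hh:
  fixes k :: "'n::finite \<Rightarrow> int"
  shows "frq d (k, n) = (\<Sum>i<CARD('n) + 1. hh k i * int (n i) ^ d)"
proof -
  define w where "w i = int (n i) ^ d" for i
  have *: "(\<Sum>i<m. kk k i * (w i - w (Suc i))) = (\<Sum>i<m. hh k i * w i) - kp k m * w m" for m
    by (induction m) (auto simp: hh_def algebra_simps)
  have "frq d (k, n) = (\<Sum>j\<in>(UNIV::'n set). (\<lambda>i. kk k i * (w i - w (Suc i))) (idx j))"
    by (simp add: frq_def kk_idx w_def)
  also have "\<dots> = (\<Sum>i<CARD('n). kk k i * (w i - w (Suc i)))"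
    by (rule sum.reindex_bij_betw[OF idx_bij])
  also have "\<dots> = (\<Sum>i<CARD('n) + 1. hh k i * w i)"
    unfolding * by (simp add: hh_def kk_def)
  finally show ?thesis by (simp add: w_def)
qed

lemma hh_bound:
  fixes k :: "'n::finite \<Rightarrow> int"
  assumes "\<And>j. \<bar>k j\<bar> \<le> K"
  shows "\<bar>hh k i\<bar> \<le> 2 * K"
proof -
  have "0 \<le> K" using assms[of undefined] by linarith
  then have "\<bar>kk k i\<bar> \<le> K" "\<bar>kp k i\<bar> \<le> K" using assms by (auto simp: kk_def kp_def)
  then show ?thesis unfolding hh_def by linarith
qed

definition fpairs :: "nat \<Rightarrow> nat \<Rightarrow> (('n::finite \<Rightarrow> int) \<times> (nat \<Rightarrow> nat)) set" where
  "fpairs K N = {k. (\<forall>j. k j \<in> {- int K..int K}) \<and> k \<noteq> (\<lambda>_. 0)} \<times> distinct_tuples (CARD('n) + 1) N"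

lemma finite_fpairs: "finite (fpairs K N)"
proof -
  have "finite {k :: 'a \<Rightarrow> int. (\<forall>j. k j \<in> {- int K..int K}) \<and> k \<noteq> (\<lambda>_. 0)}"
    by (rule finite_subset[OF _ finite_UNIV_Pi[of "\<lambda>_. {- int K..int K}"]]) auto
  then show ?thesis unfolding fpairs_def by (intro finite_cartesian_product finite_distinct_tuples)
qed

lemma frq_bound:
  fixes p :: "('n::finite \<Rightarrow> int) \<times> (nat \<Rightarrow> nat)"
  assumes "p \<in> fpairs K N"
  shows "\<bar>frq d p\<bar> \<le> int (CARD('n) * K * N ^ d)"
proof -
  have "\<bar>frq d p\<bar> \<le> (\<Sum>j\<in>(UNIV::'n set). \<bar>fst p j * (int (snd p (idx j)) ^ d - int (snd p (idx j + 1)) ^ d)\<bar>)"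
    unfolding frq_def by (rule sum_abs)
  also have "\<dots> \<le> (\<Sum>j\<in>(UNIV::'n set). int K * int N ^ d)"
  proof (rule sum_mono)
    fix j :: 'n
    have n: "snd p i \<le> N" if "i < CARD('n) + 1" for i
      using assms that by (auto simp: fpairs_def distinct_tuples_def)
    have "int (snd p (idx j)) ^ d \<le> int N ^ d" "int (snd p (idx j + 1)) ^ d \<le> int N ^ d"
      using n[of "idx j"] n[of "idx j + 1"] idx_less[of j] by (auto intro!: power_mono)
    moreover have "int (snd p (idx j)) ^ d \<ge> 0" "int (snd p (idx j + 1)) ^ d \<ge> 0" by auto
    ultimately have 1: "\<bar>int (snd p (idx j)) ^ d - int (snd p (idx j + 1)) ^ d\<bar> \<le> int N ^ d" by linarith
    have "fst p j \<in> {- int K..int K}" using assms by (auto simp: fpairs_def)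
    then have "\<bar>fst p j\<bar> \<le> int K" by auto
    then show "\<bar>fst p j * (int (snd p (idx j)) ^ d - int (snd p (idx j + 1)) ^ d)\<bar> \<le> int K * int N ^ d"
      unfolding abs_mult by (intro mult_mono 1) auto
  qed
  also have "\<dots> = int (CARD('n) * K * N ^ d)" by simp
  finally show ?thesis .
qed

lemma sum_blocks:
  fixes F :: "nat \<Rightarrow> nat \<Rightarrow> int"
  assumes "l > 0"
  shows "(\<Sum>s<4 * l. F (s div l) (s mod l)) = (\<Sum>g<4. \<Sum>i<l. F g i)"
proof -
  have "(\<Sum>g<4. \<Sum>i<l. F g i) = (\<Sum>(g, i)\<in>{..<4} \<times> {..<l}. F g i)" by (rule sum.cartesian_product)
  also have "\<dots> = (\<Sum>s<4 * l. F (s div l) (s mod l))"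
  proof (rule sum.reindex_bij_witness[where i = "\<lambda>s. (s div l, s mod l)" and j = "\<lambda>(g, i). g * l + i"])
    fix x assume x: "x \<in> {..<4::nat} \<times> {..<l}"
    obtain g i where gi: "x = (g, i)" "g < 4" "i < l" using x by auto
    have "g * l + i < g * l + l" using gi by simp
    also have "\<dots> = (g + 1) * l" by simp
    also have "\<dots> \<le> 4 * l" using gi by (intro mult_right_mono) auto
    finally show "(case x of (g, i) \<Rightarrow> g * l + i) \<in> {..<4 * l}" using gi by simp
    show "(\<lambda>s. (s div l, s mod l)) (case x of (g, i) \<Rightarrow> g * l + i) = x" using gi assms by simp
    show "F ((case x of (g, i) \<Rightarrow> g * l + i) div l) ((case x of (g, i) \<Rightarrow> g * l + i) mod l) = (case x of (g, i) \<Rightarrow> F g i)"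
      using gi assms by simp
  next
    fix s assume "s \<in> {..<4 * l}"
    then show "(s div l, s mod l) \<in> {..<4} \<times> {..<l}" using assms by (simp add: less_mult_imp_div_less)
    show "(case (s div l, s mod l) of (g, i) \<Rightarrow> g * l + i) = s" by simp
  qed
  finally show ?thesis by simp
qed

lemma sum_one_block:
  fixes F :: "nat \<Rightarrow> int"
  assumes "g < 4" "l > 0"
  shows "(\<Sum>s | s < 4 * l \<and> s div l = g. F s) = (\<Sum>i<l. F (g * l + i))"
proof (rule sum.reindex_bij_witness[where i = "\<lambda>i. g * l + i" and j = "\<lambda>s. s mod l"])
  fix s assume s: "s \<in> {s. s < 4 * l \<and> s div l = g}"
  then show "g * l + s mod l = s" "s mod l \<in> {..<l}" using assms by auto
  then show "F (g * l + s mod l) = F s" by simp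
next
  fix i assume i: "i \<in> {..<l}"
  then show "(g * l + i) mod l = i" by simp
  have "g * l + i < g * l + l" using i by simp
  also have "\<dots> = (g + 1) * l" by simp
  also have "\<dots> \<le> 4 * l" using assms by (intro mult_right_mono) auto
  finally show "g * l + i \<in> {s. s < 4 * l \<and> s div l = g}" using i assms by simp
qed

text \<open>The signs +, -, -, + on the four groups turn the equality of two differences of
  frequencies into the vanishing of one sum. The box has side \<open>2 * K\<close> because a
  coefficient \<open>hh k i\<close> is a difference of two entries of \<open>k\<close>. Partial sums
  of the \<open>hh k i\<close> recover \<open>k\<close>, hence the injectivity and the fact that no
  group of coefficients vanishes entirely.\<close>

lemma card_quadruples_le_SB:
  fixes d K N :: nat
  defines "l \<equiv> CARD('n::finite) + 1"
  assumes N: "N \<le> 2 * K"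
  shows "card {q. fst q \<in> (fpairs K N :: (('n \<Rightarrow> int) \<times> (nat \<Rightarrow> nat)) set) \<times> (fpairs K N :: (('n \<Rightarrow> int) \<times> (nat \<Rightarrow> nat)) set) \<and>
      snd q \<in> (fpairs K N :: (('n \<Rightarrow> int) \<times> (nat \<Rightarrow> nat)) set) \<times> (fpairs K N :: (('n \<Rightarrow> int) \<times> (nat \<Rightarrow> nat)) set) \<and>
      frq d (snd (fst q)) - frq d (fst (fst q)) = frq d (snd (snd q)) - frq d (fst (snd q))} \<le> card (SB l d (int (2 * K)))" (is "card ?A \<le> _")
proof -
  have l: "l > 0" by (simp add: l_def)
  define pq :: "((('n \<Rightarrow> int) \<times> (nat \<Rightarrow> nat)) \<times> (('n \<Rightarrow> int) \<times> (nat \<Rightarrow> nat))) \<times> ((('n \<Rightarrow> int) \<times> (nat \<Rightarrow> nat)) \<times> (('n \<Rightarrow> int) \<times> (nat \<Rightarrow> nat))) \<Rightarrow> nat \<Rightarrow> ('n \<Rightarrow> int) \<times> (nat \<Rightarrow> nat)"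
    where "pq q g = (if g = 0 then fst (fst q) else if g = 1 then snd (fst q) else if g = 2 then fst (snd q) else snd (snd q))" for q g
  define \<sigma> :: "nat \<Rightarrow> int" where "\<sigma> g = (if g = 0 \<or> g = 3 then 1 else - 1)" for g
  define X where "X q s = (if s < 4 * l then \<sigma> (s div l) * hh (fst (pq q (s div l))) (s mod l)
     else if s < 8 * l then int (snd (pq q ((s - 4 * l) div l)) ((s - 4 * l) mod l)) else 0)" for q s
  have pqm: "pq q g \<in> fpairs K N" if "q \<in> ?A" for q g
    using that by (auto simp: pq_def)
  have X1: "X q (g * l + i) = \<sigma> g * hh (fst (pq q g)) i" if "g < 4" "i < l" for q g i
  proof -
    have "g * l + i < (g + 1) * l" using that by simp
    also have "\<dots> \<le> 4 * l" using that by (intro mult_right_mono) auto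
    finally show ?thesis using that by (simp add: X_def)
  qed
  have X2: "X q (4 * l + s) = int (snd (pq q (s div l)) (s mod l))" if "s < 4 * l" for q s
    using that by (simp add: X_def)
  have inj: "inj_on X ?A"
  proof (rule inj_onI)
    fix q q' assume q: "q \<in> ?A" and q': "q' \<in> ?A" and eq: "X q = X q'"
    have "pq q g = pq q' g" if g: "g < 4" for g
    proof (rule prod_eqI)
      show "fst (pq q g) = fst (pq q' g)"
      proof (rule hh_inj)
        fix i assume "i < CARD('n) + 1"
        then have i: "i < l" by (simp add: l_def)
        have "\<sigma> g * hh (fst (pq q g)) i = \<sigma> g * hh (fst (pq q' g)) i" using X1[OF g i] eq by metis
        then show "hh (fst (pq q g)) i = hh (fst (pq q' g)) i" by (auto simp: \<sigma>_def split: if_splits)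
      qed
      show "snd (pq q g) = snd (pq q' g)"
      proof
        fix i
        show "snd (pq q g) i = snd (pq q' g) i"
        proof (cases "i < l")
          case True
          have "g * l + i < (g + 1) * l" using True by simp
          also have "\<dots> \<le> 4 * l" using g by (intro mult_right_mono) auto
          finally have "g * l + i < 4 * l" .
          then have "int (snd (pq q g) i) = int (snd (pq q' g) i)" using X2[of "g * l + i" q] X2[of "g * l + i" q'] True l eq by simp
          then show ?thesis by simp
        next
          case False
          then show ?thesis using pqm[OF q, of g] pqm[OF q', of g] by (auto simp: fpairs_def distinct_tuples_def l_def)
        qed
      qed
    qed
    from this[of 0] this[of 1] this[of 2] this[of 3] show "q = q'"
      by (simp add: pq_def prod_eq_iff)
  qed
  have "X ` ?A \<subseteq> SB l d (int (2 * K))"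
  proof
    fix x assume "x \<in> X ` ?A"
    then obtain q where x: "x = X q" and q: "q \<in> ?A" by (rule imageE)
    have dt: "snd (pq q g) \<in> distinct_tuples l N" for g using pqm[OF q, of g] by (auto simp: fpairs_def l_def)
    have kb: "\<bar>fst (pq q g) j\<bar> \<le> int K" for g j
    proof -
      have "fst (pq q g) j \<in> {- int K..int K}" using pqm[OF q, of g] by (auto simp: fpairs_def)
      then show ?thesis by auto
    qed
    have kn: "fst (pq q g) \<noteq> (\<lambda>_. 0)" for g using pqm[OF q, of g] by (auto simp: fpairs_def)
    show "x \<in> SB l d (int (2 * K))"
      unfolding SB_def mem_Collect_eq
    proof (intro conjI allI impI)
      show "x j = 0" if "8 * l \<le> j" for j using that by (simp add: x X_def)
      fix s assume s: "s < 4 * l"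
      have ml: "s mod l < l" using l by simp
      have nN: "snd (pq q (s div l)) (s mod l) \<in> {1..N}" using dt[of "s div l"] ml by (auto simp: distinct_tuples_def)
      show "\<bar>x s\<bar> \<le> int (2 * K)"
        using hh_bound[of "fst (pq q (s div l))" "int K" "s mod l", OF kb] s by (simp add: x X_def abs_mult \<sigma>_def)
      show "1 \<le> x (4 * l + s)" "x (4 * l + s) \<le> int (2 * K)" using nN N unfolding x X2[OF s] by auto
      fix s' assume s': "s' < 4 * l" "s \<noteq> s'" "s div l = s' div l"
      have "s mod l \<noteq> s' mod l" using s' by (metis div_mult_mod_eq)
      moreover have "inj_on (snd (pq q (s div l))) {..<l}" using dt[of "s div l"] by (auto simp: distinct_tuples_def)
      ultimately have "snd (pq q (s div l)) (s mod l) \<noteq> snd (pq q (s div l)) (s' mod l)" using l by (auto simp: inj_on_def)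
      then show "x (4 * l + s) \<noteq> x (4 * l + s')" unfolding x X2[OF s] X2[OF s'(1)] s'(3)[symmetric] by simp
    next
      fix g :: nat assume g: "g < 4"
      have "\<not> (\<forall>i<l. hh (fst (pq q g)) i = 0)"
      proof
        assume "\<forall>i<l. hh (fst (pq q g)) i = 0"
        then have "fst (pq q g) = (\<lambda>_. 0)" by (intro hh_inj) (simp add: hh_zero l_def)
        then show False using kn by simp
      qed
      then obtain i where i: "i < l" "hh (fst (pq q g)) i \<noteq> 0" by auto
      have "g * l + i < (g + 1) * l" using i by simp
      also have "\<dots> \<le> 4 * l" using g by (intro mult_right_mono) auto
      finally have "g * l + i < 4 * l" .
      moreover have "(g * l + i) div l = g" using i by simp
      moreover have "x (g * l + i) \<noteq> 0" unfolding x X1[OF g i(1)] using i by (simp add: \<sigma>_def)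
      ultimately show "\<exists>s<4 * l. s div l = g \<and> x s \<noteq> 0" by blast
      have "(\<Sum>s | s < 4 * l \<and> s div l = g. x s) = (\<Sum>i<l. x (g * l + i))" by (rule sum_one_block[OF g l])
      also have "\<dots> = (\<Sum>i<l. \<sigma> g * hh (fst (pq q g)) i)" using X1[OF g] by (intro sum.cong) (auto simp: x)
      also have "\<dots> = \<sigma> g * (\<Sum>i<l. hh (fst (pq q g)) i)" by (rule sum_distrib_left[symmetric])
      also have "\<dots> = 0" unfolding l_def hh_sum_0 by simp
      finally show "(\<Sum>s | s < 4 * l \<and> s div l = g. x s) = 0" .
    next
      have "(\<Sum>s<4 * l. x s * x (4 * l + s) ^ d) = (\<Sum>s<4 * l. (\<lambda>g i. \<sigma> g * (hh (fst (pq q g)) i * int (snd (pq q g) i) ^ d)) (s div l) (s mod l))"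
        by (intro sum.cong refl) (simp add: x X_def mult.assoc)
      also have "\<dots> = (\<Sum>g<4. \<Sum>i<l. \<sigma> g * (hh (fst (pq q g)) i * int (snd (pq q g) i) ^ d))"
        by (rule sum_blocks[OF l])
      also have "\<dots> = (\<Sum>g<4. \<sigma> g * frq d (pq q g))"
        unfolding sum_distrib_left[symmetric] l_def frq_hh[symmetric] by simp
      also have "\<dots> = 0" using q by (auto simp: numeral_eq_Suc \<sigma>_def pq_def)
      finally show "(\<Sum>s<4 * l. x s * x (4 * l + s) ^ d) = 0" .
    qed
  qed
  then show ?thesis by (rule card_inj_on_le[OF inj _ SB_finite(1)]) simp
qed

section \<open>Riemann sums\<close>

lemma lattice_cell:
  fixes a :: "'n::finite \<Rightarrow> int"
  assumes M: "M > 0"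
  defines "C \<equiv> {x :: real^'n. \<forall>j. \<lfloor>real M * x $ j\<rfloor> = a j}"
  shows "C \<in> fmeasurable lborel" "measure lborel C = (1 / real M) ^ CARD('n)"
proof -
  define l :: "real^'n" where "l = (\<chi> j. of_int (a j) / real M)"
  define u :: "real^'n" where "u = (\<chi> j. (of_int (a j) + 1) / real M)"
  have C: "C = (\<Inter>j. {x. x $ j \<ge> l $ j} \<inter> {x. x $ j < u $ j})"
    using M by (auto simp: C_def l_def u_def floor_eq_iff field_simps)
  have "C \<in> sets borel" unfolding C
    by (intro sets.finite_INT sets.Int borel_closed borel_open closed_halfspace_component_ge_cart open_halfspace_component_lt_cart) auto
  then have sC: "C \<in> sets lborel" by simp
  have sub: "box l u \<subseteq> C" "C \<subseteq> cbox l u" unfolding C by (auto simp: mem_box_cart less_eq_real_def)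
  show fC: "C \<in> fmeasurable lborel"
    by (rule fmeasurableI2[OF fmeasurable_cbox sub(2) sC])
  have lu: "l $ j \<le> u $ j" for j using M by (simp add: l_def u_def divide_right_mono)
  then have "l \<in> cbox l u" by (simp add: mem_box_cart)
  then have ne: "cbox l u \<noteq> {}" by blast
  have "measure lborel (cbox l u) = (\<Prod>j\<in>UNIV. u $ j - l $ j)" by (rule content_cbox_cart[OF ne])
  also have "\<dots> = (\<Prod>j\<in>(UNIV::'n set). 1 / real M)"
    by (intro prod.cong refl) (simp add: u_def l_def diff_divide_distrib[symmetric])
  finally have cb: "measure lborel (cbox l u) = (1 / real M) ^ CARD('n)" by simp
  have "measure lborel (box l u) = measure lborel (cbox l u)"
    by (simp add: measure_lborel_box_eq measure_lborel_cbox_eq)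
  moreover have "measure lborel (box l u) \<le> measure lborel C"
    by (rule measure_mono_fmeasurable[OF sub(1) _ fC]) simp
  moreover have "measure lborel C \<le> measure lborel (cbox l u)"
    by (rule measure_mono_fmeasurable[OF sub(2) sC fmeasurable_cbox])
  ultimately show "measure lborel C = (1 / real M) ^ CARD('n)" using cb by linarith
qed

text \<open>The sum is the integral of the step function that evaluates \<open>f\<close> at the
  lower corner of the lattice cell of \<open>x\<close>. Dominated convergence applies, with a
  multiple of the indicator of a cube larger by 1 in each direction.\<close>

lemma riemann_sum_lattice:
  fixes f :: "real^'n \<Rightarrow> real"
  assumes cont: "continuous_on UNIV f" and supp: "\<And>x. f x \<noteq> 0 \<Longrightarrow> \<forall>j. \<bar>x $ j\<bar> \<le> real R"
  shows "(\<lambda>M. (\<Sum>a\<in>{a. \<forall>j. a j \<in> {- int (R * M)..int (R * M)}}. f (\<chi> j. of_int (a j) / real M)) * (1 / real M) ^ CARD('n))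
      \<longlonglongrightarrow> integral UNIV f"
    and "f integrable_on UNIV"
proof -
  obtain B where B: "B > 0" "\<And>x. \<bar>f x\<bar> \<le> B" using bounded_cube[OF cont supp] by metis
  define Box :: "nat \<Rightarrow> ('n \<Rightarrow> int) set" where "Box M = {a. \<forall>j. a j \<in> {- int (R * M)..int (R * M)}}" for M
  define C :: "nat \<Rightarrow> ('n \<Rightarrow> int) \<Rightarrow> (real^'n) set" where "C M a = {x. \<forall>j. \<lfloor>real M * x $ j\<rfloor> = a j}" for M a
  define s where "s M x = (\<Sum>a\<in>Box (Suc M). f (\<chi> j. of_int (a j) / real (Suc M)) * indicator (C (Suc M) a) x)" for M x
  have fin: "finite (Box M)" for M unfolding Box_def by (rule finite_UNIV_Pi) simp
  have Cm: "C (Suc M) a \<in> fmeasurable lborel" "measure lborel (C (Suc M) a) = (1 / real (Suc M)) ^ CARD('n)" for M a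
    unfolding C_def by (rule lattice_cell; simp)+
  have seq: "s M x = f (\<chi> j. of_int \<lfloor>real (Suc M) * x $ j\<rfloor> / real (Suc M))" for M x
  proof -
    define b where "b j = \<lfloor>real (Suc M) * x $ j\<rfloor>" for j
    have ind: "indicator (C (Suc M) a) x = (if a = b then 1 else (0::real))" for a
    proof -
      have "x \<in> C (Suc M) a \<longleftrightarrow> a = b" unfolding C_def mem_Collect_eq b_def by (metis ext)
      then show ?thesis by (simp add: indicator_def)
    qed
    have "s M x = (if b \<in> Box (Suc M) then f (\<chi> j. of_int (b j) / real (Suc M)) else 0)"
      unfolding s_def ind using fin by (simp add: if_distrib[of "\<lambda>t. _ * t"] sum.delta cong: if_cong)
    moreover have "f (\<chi> j. of_int (b j) / real (Suc M)) = 0" if "b \<notin> Box (Suc M)"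
    proof -
      obtain j where "\<not> (- int (R * Suc M) \<le> b j \<and> b j \<le> int (R * Suc M))" using \<open>b \<notin> Box (Suc M)\<close> by (auto simp: Box_def simp del: of_nat_mult of_nat_Suc mult_Suc_right)
      then have "\<bar>b j\<bar> > int (R * Suc M)" by linarith
      then have "\<bar>real_of_int (b j)\<bar> > real R * real (Suc M)" by (metis of_int_abs of_int_less_iff of_int_of_nat_eq of_nat_mult)
      then have "\<bar>real_of_int (b j) / real (Suc M)\<bar> > real R" by (simp add: abs_divide pos_less_divide_eq)
      then show ?thesis using supp[of "\<chi> j. real_of_int (b j) / real (Suc M)"] by (metis not_le vec_lambda_beta)
    qed
    ultimately show ?thesis by (auto simp: b_def)
  qed
  have ints: "integrable lborel (s M)" for M unfolding s_def
    using Cm by (intro Bochner_Integration.integrable_sum integrable_mult_right integrable_real_indicator) (auto simp: fmeasurable_def)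
  have Is: "integral\<^sup>L lborel (s M) = (\<Sum>a\<in>Box (Suc M). f (\<chi> j. of_int (a j) / real (Suc M))) * (1 / real (Suc M)) ^ CARD('n)" for M
  proof -
    have "integral\<^sup>L lborel (s M) = (\<Sum>a\<in>Box (Suc M). f (\<chi> j. of_int (a j) / real (Suc M)) * measure lborel (C (Suc M) a))"
      unfolding s_def using Cm by (subst Bochner_Integration.integral_sum) (auto simp: fmeasurable_def intro!: integrable_mult_right integrable_real_indicator)
    then show ?thesis unfolding Cm(2) sum_distrib_right .
  qed
  have fl: "\<bar>of_int \<lfloor>real (Suc M) * y\<rfloor> / real (Suc M) - y\<bar> \<le> 1 / real (Suc M)" for M and y :: real
  proof -
    have "\<bar>of_int \<lfloor>real (Suc M) * y\<rfloor> - real (Suc M) * y\<bar> \<le> 1" by linarith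
    then have "\<bar>of_int \<lfloor>real (Suc M) * y\<rfloor> - real (Suc M) * y\<bar> / real (Suc M) \<le> 1 / real (Suc M)" by (intro divide_right_mono) auto
    moreover have "of_int \<lfloor>real (Suc M) * y\<rfloor> / real (Suc M) - y = (of_int \<lfloor>real (Suc M) * y\<rfloor> - real (Suc M) * y) / real (Suc M)"
      by (simp add: diff_divide_distrib)
    ultimately show ?thesis by (metis abs_divide abs_of_nat)
  qed
  have ptw: "(\<lambda>M. s M x) \<longlonglongrightarrow> f x" for x
  proof -
    have "(\<lambda>M. of_int \<lfloor>real (Suc M) * y\<rfloor> / real (Suc M)) \<longlonglongrightarrow> y" for y
    proof -
      have "(\<lambda>M. of_int \<lfloor>real (Suc M) * y\<rfloor> / real (Suc M) - y) \<longlonglongrightarrow> 0"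
        by (rule Lim_null_comparison[OF _ LIMSEQ_Suc[OF lim_1_over_n]]) (use fl in auto)
      then show ?thesis by (simp only: LIM_zero_iff)
    qed
    then have "(\<lambda>M. \<chi> j. of_int \<lfloor>real (Suc M) * x $ j\<rfloor> / real (Suc M)) \<longlonglongrightarrow> (\<chi> j. x $ j)"
      by (intro tendsto_vec_lambda)
    then have "(\<lambda>M. \<chi> j. of_int \<lfloor>real (Suc M) * x $ j\<rfloor> / real (Suc M)) \<longlonglongrightarrow> x" by simp
    moreover have "isCont f x" using cont by (simp add: continuous_on_eq_continuous_at)
    ultimately show ?thesis unfolding seq by (rule isCont_tendsto_compose[rotated])
  qed
  define K :: "(real^'n) set" where "K = cbox (\<chi> j. - real R - 1) (\<chi> j. real R + 1)"
  have dom: "norm (s M x) \<le> B * indicator K x" for M x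
  proof (cases "s M x = 0")
    case False
    have "\<bar>x $ j\<bar> \<le> real R + 1" for j
    proof -
      have "\<bar>of_int \<lfloor>real (Suc M) * x $ j\<rfloor> / real (Suc M)\<bar> \<le> real R"
        using supp[OF False[unfolded seq]] by simp
      moreover have "1 / real (Suc M) \<le> 1" by simp
      ultimately show ?thesis using fl[of M "x $ j"] by linarith
    qed
    then have "x \<in> K" unfolding K_def mem_box_cart by (auto simp: abs_le_iff) (smt (verit))
    then show ?thesis using B(2) seq by simp
  qed (use B in simp)
  have intK: "integrable lborel (\<lambda>x. B * indicator K x)"
    unfolding K_def using fmeasurable_cbox by (intro integrable_mult_right integrable_real_indicator) (auto simp: fmeasurable_def)
  have fm: "f \<in> borel_measurable lborel" using cont by (simp add: borel_measurable_continuous_onI)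
  have sm: "s M \<in> borel_measurable lborel" for M using ints by blast
  have intf: "integrable lborel f"
    by (rule integrable_dominated_convergence[where s = s and w = "\<lambda>x. B * indicator K x"]) (use fm sm intK ptw dom in auto)
  have lim: "(\<lambda>M. integral\<^sup>L lborel (s M)) \<longlonglongrightarrow> integral\<^sup>L lborel f"
    by (rule integral_dominated_convergence[where w = "\<lambda>x. B * indicator K x"]) (use fm sm intK ptw dom in auto)
  have hi: "(f has_integral integral\<^sup>L lborel f) UNIV" by (rule has_integral_integral_lborel[OF intf])
  then show "f integrable_on UNIV" by blast
  have "integral UNIV f = integral\<^sup>L lborel f" using hi by (rule integral_unique)
  with lim have "(\<lambda>M. (\<Sum>a\<in>Box (Suc M). f (\<chi> j. of_int (a j) / real (Suc M))) * (1 / real (Suc M)) ^ CARD('n)) \<longlonglongrightarrow> integral UNIV f"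
    unfolding Is by simp
  then show "(\<lambda>M. (\<Sum>a\<in>{a. \<forall>j. a j \<in> {- int (R * M)..int (R * M)}}. f (\<chi> j. of_int (a j) / real M)) * (1 / real M) ^ CARD('n))
      \<longlonglongrightarrow> integral UNIV f"
    unfolding Box_def by (rule LIMSEQ_imp_Suc)
qed

section \<open>The second moment\<close>

lemma sum_image_card:
  fixes h :: "'b \<Rightarrow> 'c::comm_semiring_1"
  assumes "finite Z"
  shows "(\<Sum>z\<in>Z. h (v z)) = (\<Sum>w\<in>v ` Z. of_nat (card {z\<in>Z. v z = w}) * h w)"
proof -
  have "(\<Sum>z\<in>Z. h (v z)) = (\<Sum>w\<in>v ` Z. \<Sum>z\<in>{z\<in>Z. v z = w}. h (v z))"
    by (rule sum.image_gen[OF assms])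
  also have "\<dots> = (\<Sum>w\<in>v ` Z. \<Sum>z\<in>{z\<in>Z. v z = w}. h w)" by (intro sum.cong) auto
  finally show ?thesis by simp
qed

text \<open>The sum is grouped by the values \<open>w\<close> of \<open>v\<close>, and
  Cauchy-Schwarz separates the multiplicities from \<open>g\<close>. The sum of the squared
  multiplicities counts the coincidences.\<close>

lemma sum_le_additive_energy:
  fixes g :: "'b \<Rightarrow> real"
  assumes Z: "finite Z"
  shows "(\<Sum>z\<in>Z. g (v z)) \<le> sqrt (real (card {q. fst q \<in> Z \<and> snd q \<in> Z \<and> v (fst q) = v (snd q)})) * sqrt (\<Sum>w\<in>v ` Z. (g w)\<^sup>2)"
proof -
  define r where "r w = real (card {z\<in>Z. v z = w})" for w
  have 1: "(\<Sum>z\<in>Z. g (v z)) = (\<Sum>w\<in>v ` Z. r w * g w)" unfolding r_def by (rule sum_image_card[OF Z])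
  have "{q. fst q \<in> Z \<and> snd q \<in> Z \<and> v (fst q) = v (snd q)} = Sigma Z (\<lambda>z. {z'\<in>Z. v z' = v z})" by auto
  then have "real (card {q. fst q \<in> Z \<and> snd q \<in> Z \<and> v (fst q) = v (snd q)}) = (\<Sum>z\<in>Z. r (v z))"
    using Z by (simp add: card_SigmaI r_def)
  also have "\<dots> = (\<Sum>w\<in>v ` Z. r w * r w)" unfolding r_def by (rule sum_image_card[OF Z])
  finally have 2: "real (card {q. fst q \<in> Z \<and> snd q \<in> Z \<and> v (fst q) = v (snd q)}) = (\<Sum>w\<in>v ` Z. (r w)\<^sup>2)"
    by (simp add: power2_eq_square)
  have "(\<Sum>w\<in>v ` Z. r w * g w)\<^sup>2 \<le> (\<Sum>w\<in>v ` Z. (r w)\<^sup>2) * (\<Sum>w\<in>v ` Z. (g w)\<^sup>2)"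
    by (rule Cauchy_Schwarz_ineq_sum)
  then have "(\<Sum>w\<in>v ` Z. r w * g w) \<le> sqrt ((\<Sum>w\<in>v ` Z. (r w)\<^sup>2) * (\<Sum>w\<in>v ` Z. (g w)\<^sup>2))"
    by (rule real_le_rsqrt)
  then show ?thesis unfolding 1 2 real_sqrt_mult .
qed

lemma ee_xseq:
  "ee (of_int r * (xseq d \<alpha> a - xseq d \<alpha> b)) = ee (\<alpha> * of_int (r * (int a ^ d - int b ^ d)))"
proof -
  have "of_int r * (xseq d \<alpha> a - xseq d \<alpha> b)
     = \<alpha> * of_int (r * (int a ^ d - int b ^ d)) + of_int (r * (\<lfloor>\<alpha> * real b ^ d\<rfloor> - \<lfloor>\<alpha> * real a ^ d\<rfloor>))"
    by (simp add: xseq_def frac_def algebra_simps)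
  then show ?thesis by (simp only: ee_add ee_of_int mult_1_right)
qed

definition tpol :: "nat \<Rightarrow> (int \<Rightarrow> complex) \<Rightarrow> real \<Rightarrow> complex" where
  "tpol K t \<theta> = (\<Sum>r\<in>{- int K..int K}. t r * ee (of_int r * \<theta>))"

definition gap :: "nat \<Rightarrow> real \<Rightarrow> (nat \<Rightarrow> nat) \<Rightarrow> 'n::finite \<Rightarrow> real" where
  "gap d \<alpha> n j = xseq d \<alpha> (n (idx j)) - xseq d \<alpha> (n (idx j + 1))"

text \<open>The frequencies are integers, so the reduction modulo 1 in \<open>xseq\<close>
  disappears. The zero vector gives the main term; the other vectors, paired with the tuples, form
  \<open>fpairs\<close>.\<close>

lemma tpol_correlation:
  fixes t :: "'n::finite \<Rightarrow> int \<Rightarrow> complex"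
  shows "(\<Sum>n\<in>distinct_tuples (CARD('n) + 1) N. \<Prod>j\<in>UNIV. tpol K (t j) (gap d \<alpha> n j))
    = of_nat (card (distinct_tuples (CARD('n) + 1) N)) * (\<Prod>j\<in>UNIV. t j 0)
      + (\<Sum>p\<in>fpairs K N. (\<Prod>j\<in>UNIV. t j (fst p j)) * ee (\<alpha> * of_int (frq d p)))"
proof -
  let ?D = "distinct_tuples (CARD('n) + 1) N"
  define B :: "('n \<Rightarrow> int) set" where "B = {k. \<forall>j. k j \<in> {- int K..int K}}"
  have fB: "finite B" unfolding B_def by (rule finite_UNIV_Pi) simp
  define c where "c k = (\<Prod>j\<in>UNIV. t j (k j))" for k
  have "(\<Prod>j\<in>UNIV. tpol K (t j) (gap d \<alpha> n j)) = (\<Sum>k\<in>B. c k * ee (\<alpha> * of_int (frq d (k, n))))" for n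
  proof -
    have "(\<Prod>j\<in>UNIV. tpol K (t j) (gap d \<alpha> n j)) = (\<Sum>k\<in>B. \<Prod>j\<in>UNIV. t j (k j) * ee (of_int (k j) * gap d \<alpha> n j))"
      unfolding tpol_def B_def by (rule sum_prod_UNIV[symmetric]) simp
    also have "\<dots> = (\<Sum>k\<in>B. c k * ee (\<alpha> * of_int (frq d (k, n))))"
      unfolding prod.distrib c_def gap_def ee_xseq
      by (simp add: ee_sum[symmetric] sum_distrib_left[symmetric] frq_def)
    finally show ?thesis .
  qed
  then have "(\<Sum>n\<in>?D. \<Prod>j\<in>UNIV. tpol K (t j) (gap d \<alpha> n j)) = (\<Sum>n\<in>?D. \<Sum>k\<in>B. c k * ee (\<alpha> * of_int (frq d (k, n))))"
    by simp
  also have "\<dots> = (\<Sum>k\<in>B. \<Sum>n\<in>?D. c k * ee (\<alpha> * of_int (frq d (k, n))))" by (rule sum.swap)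
  also have "\<dots> = (\<Sum>n\<in>?D. c (\<lambda>_. 0) * ee (\<alpha> * of_int (frq d ((\<lambda>_. 0) :: 'n \<Rightarrow> int, n))))
       + (\<Sum>k\<in>B - {\<lambda>_. 0}. \<Sum>n\<in>?D. c k * ee (\<alpha> * of_int (frq d (k, n))))"
    by (rule sum.remove[OF fB]) (simp add: B_def)
  also have "(\<Sum>n\<in>?D. c (\<lambda>_. 0) * ee (\<alpha> * of_int (frq d ((\<lambda>_. 0) :: 'n \<Rightarrow> int, n)))) = of_nat (card ?D) * (\<Prod>j\<in>UNIV. t j 0)"
    by (simp add: frq_def c_def)
  also have "(\<Sum>k\<in>B - {\<lambda>_. 0}. \<Sum>n\<in>?D. c k * ee (\<alpha> * of_int (frq d (k, n)))) = (\<Sum>p\<in>fpairs K N. c (fst p) * ee (\<alpha> * of_int (frq d p)))"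
  proof -
    have "fpairs K N = (B - {\<lambda>_. 0}) \<times> ?D" by (auto simp: fpairs_def B_def)
    then show ?thesis by (simp add: sum.cartesian_product case_prod_unfold)
  qed
  finally show ?thesis unfolding c_def .
qed

text \<open>By monotone convergence the sum of the \<open>u i\<close> has a finite integral, so it
  is finite almost everywhere and its terms tend to 0.\<close>

lemma AE_tendsto_zero_of_summable_integrals:
  fixes u :: "nat \<Rightarrow> 'a \<Rightarrow> real"
  assumes u: "\<And>i. integrable M (u i)" "\<And>i x. u i x \<ge> 0" and b: "\<And>i. integral\<^sup>L M (u i) \<le> c i" "summable c"
  shows "AE x in M. (\<lambda>i. u i x) \<longlonglongrightarrow> 0"
proof -
  have c0: "c i \<ge> 0" for i
  proof -
    have "0 \<le> integral\<^sup>L M (u i)" using u(2) by (intro integral_nonneg_AE) auto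
    then show ?thesis using b(1)[of i] by linarith
  qed
  have m [measurable]: "u i \<in> borel_measurable M" for i using u(1) by blast
  have "(\<integral>\<^sup>+x. (\<Sum>i. ennreal (u i x)) \<partial>M) = (\<Sum>i. \<integral>\<^sup>+x. ennreal (u i x) \<partial>M)"
    by (rule nn_integral_suminf) simp
  also have "\<dots> \<le> (\<Sum>i. ennreal (c i))"
  proof (rule suminf_le)
    fix i
    have "(\<integral>\<^sup>+x. ennreal (u i x) \<partial>M) = ennreal (integral\<^sup>L M (u i))"
      using u by (intro nn_integral_eq_integral) auto
    then show "(\<integral>\<^sup>+x. ennreal (u i x) \<partial>M) \<le> ennreal (c i)" using b(1) by (simp add: ennreal_leI)
  qed auto
  also have "\<dots> < \<top>" using suminf_ennreal2[OF c0 b(2)] by (simp add: ennreal_less_top)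
  finally have "(\<integral>\<^sup>+x. (\<Sum>i. ennreal (u i x)) \<partial>M) \<noteq> \<infinity>" by auto
  then have "AE x in M. (\<Sum>i. ennreal (u i x)) \<noteq> \<infinity>"
    by (intro nn_integral_PInf_AE) auto
  then show ?thesis
  proof eventually_elim
    case (elim x)
    then have "summable (\<lambda>i. u i x)" using u(2) by (intro summable_suminf_not_top) auto
    then show ?case by (rule summable_LIMSEQ_zero)
  qed
qed

locale energy_measure =
  fixes M :: "real measure"
  assumes sets_M: "sets M = sets borel" and fin_M: "finite_measure M" and null_M: "emeasure M (- {0..1}) = 0"
    and energy: "\<And>s::real. 0 < s \<Longrightarrow> s < 1 \<Longrightarrow>
           (\<lambda>u::int. (cmod (fourier_meas M (of_int u)))\<^sup>2 * \<bar>real_of_int u\<bar> powr (s - 1)) summable_on (UNIV - {0})"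
begin

abbreviation mh :: "int \<Rightarrow> real" where "mh u \<equiv> cmod (fourier_meas M (of_int u))"

lemma cont_measurable: "continuous_on UNIV (f :: real \<Rightarrow> 'b::topological_space) \<Longrightarrow> f \<in> borel_measurable M"
  unfolding measurable_cong_sets[OF sets_M refl] by (rule borel_measurable_continuous_onI)

lemma integrable_bounded_cont:
  fixes f :: "real \<Rightarrow> 'b::{banach, second_countable_topology}"
  assumes "continuous_on UNIV f" "\<And>x. norm (f x) \<le> B"
  shows "integrable M f"
  using assms by (intro finite_measure.integrable_const_bound[OF fin_M, of _ B] cont_measurable) auto

lemma integral_ee: "(LINT \<alpha>|M. ee (- of_int u * \<alpha>)) = fourier_meas M (of_int u)"
proof -
  have "- {0..1} \<in> null_sets M" using null_M sets_M by (intro null_setsI) auto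
  then have ae: "AE x in M. x \<in> {0..1}" using AE_not_in by fastforce
  have m: "(\<lambda>\<alpha>. ee (- of_int u * \<alpha>)) \<in> borel_measurable M"
    by (intro cont_measurable continuous_on_ee continuous_intros)
  show ?thesis unfolding fourier_meas_def set_lebesgue_integral_def
  proof (rule integral_cong_AE)
    show "(\<lambda>x. indicat_real {0..1} x *\<^sub>R ee (- real_of_int u * x)) \<in> borel_measurable M"
      using m sets_M by (intro borel_measurable_scaleR borel_measurable_indicator) auto
  qed (use m ae in auto)
qed

lemma second_moment_le:
  fixes c :: "'p \<Rightarrow> complex" and u :: "'p \<Rightarrow> int"
  assumes Q: "finite Q" and c: "\<And>p. p \<in> Q \<Longrightarrow> cmod (c p) \<le> b" and b: "b \<ge> 0"
  shows "integrable M (\<lambda>\<alpha>. (cmod (\<Sum>p\<in>Q. c p * ee (\<alpha> * of_int (u p))))\<^sup>2)"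
    "(LINT \<alpha>|M. (cmod (\<Sum>p\<in>Q. c p * ee (\<alpha> * of_int (u p))))\<^sup>2) \<le> b\<^sup>2 * (\<Sum>z\<in>Q \<times> Q. mh (u (snd z) - u (fst z)))"
proof -
  define S where "S \<alpha> = (\<Sum>p\<in>Q. c p * ee (\<alpha> * of_int (u p)))" for \<alpha>
  have eq: "complex_of_real ((cmod (S \<alpha>))\<^sup>2) = (\<Sum>z\<in>Q \<times> Q. c (fst z) * cnj (c (snd z)) * ee (- of_int (u (snd z) - u (fst z)) * \<alpha>))" for \<alpha>
  proof -
    have "complex_of_real ((cmod (S \<alpha>))\<^sup>2) = S \<alpha> * cnj (S \<alpha>)" by (rule complex_norm_square)
    also have "\<dots> = (\<Sum>p\<in>Q. \<Sum>p'\<in>Q. (c p * ee (\<alpha> * of_int (u p))) * (cnj (c p') * cnj (ee (\<alpha> * of_int (u p')))))"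
      unfolding S_def by (simp add: sum_product)
    also have "\<dots> = (\<Sum>p\<in>Q. \<Sum>p'\<in>Q. c p * cnj (c p') * ee (- of_int (u p' - u p) * \<alpha>))"
    proof (intro sum.cong refl)
      fix p p'
      have "ee (- of_int (u p' - u p) * \<alpha>) = ee (\<alpha> * of_int (u p)) * cnj (ee (\<alpha> * of_int (u p')))"
        unfolding ee_diff[symmetric] by (simp add: algebra_simps)
      then show "(c p * ee (\<alpha> * of_int (u p))) * (cnj (c p') * cnj (ee (\<alpha> * of_int (u p')))) = c p * cnj (c p') * ee (- of_int (u p' - u p) * \<alpha>)"
        by simp
    qed
    finally show ?thesis by (simp add: sum.cartesian_product case_prod_unfold)
  qed
  have int1: "integrable M (\<lambda>\<alpha>. ee (- of_int w * \<alpha>))" for w :: int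
    by (rule integrable_bounded_cont[where B = 1]) (auto intro!: continuous_on_ee continuous_intros)
  have "integrable M (\<lambda>\<alpha>. complex_of_real ((cmod (S \<alpha>))\<^sup>2))"
    unfolding eq by (intro Bochner_Integration.integrable_sum integrable_mult_right int1)
  then show "integrable M (\<lambda>\<alpha>. (cmod (\<Sum>p\<in>Q. c p * ee (\<alpha> * of_int (u p))))\<^sup>2)"
    unfolding S_def[symmetric] by (simp only: complex_of_real_integrable_eq)
  have "complex_of_real (LINT \<alpha>|M. (cmod (S \<alpha>))\<^sup>2) = (LINT \<alpha>|M. complex_of_real ((cmod (S \<alpha>))\<^sup>2))"
    by (rule integral_complex_of_real[symmetric])
  also have "\<dots> = (\<Sum>z\<in>Q \<times> Q. LINT \<alpha>|M. c (fst z) * cnj (c (snd z)) * ee (- of_int (u (snd z) - u (fst z)) * \<alpha>))"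
    unfolding eq by (rule Bochner_Integration.integral_sum) (intro integrable_mult_right int1)
  also have "\<dots> = (\<Sum>z\<in>Q \<times> Q. c (fst z) * cnj (c (snd z)) * fourier_meas M (of_int (u (snd z) - u (fst z))))"
    by (simp only: integral_mult_right_zero integral_ee)
  finally have "cmod (complex_of_real (LINT \<alpha>|M. (cmod (S \<alpha>))\<^sup>2)) = cmod (\<Sum>z\<in>Q \<times> Q. c (fst z) * cnj (c (snd z)) * fourier_meas M (of_int (u (snd z) - u (fst z))))"
    by simp
  also have "\<dots> \<le> (\<Sum>z\<in>Q \<times> Q. cmod (c (fst z) * cnj (c (snd z)) * fourier_meas M (of_int (u (snd z) - u (fst z)))))"
    by (rule norm_sum)
  also have "\<dots> \<le> (\<Sum>z\<in>Q \<times> Q. b\<^sup>2 * mh (u (snd z) - u (fst z)))"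
  proof (rule sum_mono)
    fix z assume z: "z \<in> Q \<times> Q"
    have "cmod (c (fst z)) * cmod (c (snd z)) \<le> b * b" using z b by (intro mult_mono c) auto
    then show "cmod (c (fst z) * cnj (c (snd z)) * fourier_meas M (of_int (u (snd z) - u (fst z)))) \<le> b\<^sup>2 * mh (u (snd z) - u (fst z))"
      by (simp add: norm_mult power2_eq_square mult_right_mono)
  qed
  finally show "(LINT \<alpha>|M. (cmod (\<Sum>p\<in>Q. c p * ee (\<alpha> * of_int (u p))))\<^sup>2) \<le> b\<^sup>2 * (\<Sum>z\<in>Q \<times> Q. mh (u (snd z) - u (fst z)))"
    unfolding S_def[symmetric] sum_distrib_left by simp
qed

text \<open>The energy hypothesis at \<open>s = 1 - e\<close>: on frequencies up to \<open>X\<close>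
  the weight is at least \<open>X powr (- e)\<close>. The frequency 0 carries no weight and is
  treated separately.\<close>

lemma energy_bound:
  assumes e: "0 < e" "e < 1"
  obtains E where "E \<ge> 0" "\<And>X V. finite V \<Longrightarrow> X \<ge> 1 \<Longrightarrow> (\<And>w. w \<in> V \<Longrightarrow> \<bar>real_of_int w\<bar> \<le> X) \<Longrightarrow>
    (\<Sum>w\<in>V. (mh w)\<^sup>2) \<le> (mh 0)\<^sup>2 + E * X powr e"
proof -
  define g where "g w = (mh w)\<^sup>2 * \<bar>real_of_int w\<bar> powr (- e)" for w
  have sm: "g summable_on (UNIV - {0})" using energy[of "1 - e"] e unfolding g_def by simp
  have g0: "g w \<ge> 0" for w by (simp add: g_def)
  show ?thesis
  proof (rule that[of "infsum g (UNIV - {0})"])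
    show "infsum g (UNIV - {0}) \<ge> 0" by (intro infsum_nonneg g0)
    fix X :: real and V :: "int set"
    assume V: "finite V" and X: "X \<ge> 1" and w: "\<And>w. w \<in> V \<Longrightarrow> \<bar>real_of_int w\<bar> \<le> X"
    have "(\<Sum>w\<in>V. (mh w)\<^sup>2) \<le> (\<Sum>w\<in>insert 0 (V - {0}). (mh w)\<^sup>2)"
      using V by (intro sum_mono2) auto
    also have "\<dots> = (mh 0)\<^sup>2 + (\<Sum>w\<in>V - {0}. (mh w)\<^sup>2)" using V by (subst sum.insert) auto
    also have "(\<Sum>w\<in>V - {0}. (mh w)\<^sup>2) \<le> (\<Sum>w\<in>V - {0}. g w * X powr e)"
    proof (rule sum_mono)
      fix v assume v: "v \<in> V - {0}"
      have "(mh v)\<^sup>2 = g v * \<bar>real_of_int v\<bar> powr e" using v by (simp add: g_def powr_minus field_simps)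
      also have "\<dots> \<le> g v * X powr e" using v w e by (intro mult_left_mono g0 powr_mono2) auto
      finally show "(mh v)\<^sup>2 \<le> g v * X powr e" .
    qed
    also have "\<dots> = (\<Sum>w\<in>V - {0}. g w) * X powr e" by (rule sum_distrib_right[symmetric])
    also have "\<dots> \<le> infsum g (UNIV - {0}) * X powr e"
      using V g0 by (intro mult_right_mono finite_sum_le_infsum[OF sm]) auto
    finally show "(\<Sum>w\<in>V. (mh w)\<^sup>2) \<le> (mh 0)\<^sup>2 + infsum g (UNIV - {0}) * X powr e" by simp
  qed
qed

lemma variance_bound:
  fixes t :: "nat \<Rightarrow> 'n::finite \<Rightarrow> int \<Rightarrow> complex"
  assumes d: "real d > (8 * real (CARD('n) + 1)) ^ (16 * (CARD('n) + 1))" and L: "L \<ge> 1"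
    and t: "\<And>N j r. N \<ge> 1 \<Longrightarrow> cmod (t N j r) \<le> Ct / real N"
  shows "\<exists>C. \<forall>N\<ge>1.
    integrable M (\<lambda>\<alpha>. (cmod (\<Sum>p\<in>fpairs (L * N) N. ((\<Prod>j\<in>UNIV. t N j (fst p j)) / of_nat N) * ee (\<alpha> * of_int (frq d p))))\<^sup>2) \<and>
    (LINT \<alpha>|M. (cmod (\<Sum>p\<in>fpairs (L * N) N. ((\<Prod>j\<in>UNIV. t N j (fst p j)) / of_nat N) * ee (\<alpha> * of_int (frq d p))))\<^sup>2) \<le> C * real N powr (- 1 / 8)"
proof -
  define n where "n = CARD('n)"
  define l where "l = n + 1"
  have n1: "n \<ge> 1" by (simp add: n_def Suc_leI)
  have Ct: "Ct \<ge> 0" using t[of 1 undefined 0] norm_ge_zero[of "t 1 undefined 0"] by linarith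
  have "real ((8 * l) ^ (16 * l)) < real d" using d by (simp add: l_def n_def)
  then have dl: "d > (8 * l) ^ (16 * l)" by linarith
  have l2: "l \<ge> 2" using n1 by (simp add: l_def)
  obtain C0 where C0: "C0 > 0" "\<forall>Q\<ge>1. real (card (SB l d (int Q))) \<le> C0 * real Q powr (4 * real l - 3 / 10)"
    using SB_card_bound[OF l2 dl] by (elim exE conjE)
  \<comment> \<open>Frequencies are of order at most \<open>N ^ (d + 1)\<close>, so this choice
    limits the energy factor to \<open>N powr (1 / 20)\<close>.\<close>
  define e where "e = 1 / (20 * (real d + 1))"
  have e: "0 < e" "e < 1" by (auto simp: e_def)
  obtain E where E: "E \<ge> 0" "\<And>X V. finite V \<Longrightarrow> X \<ge> 1 \<Longrightarrow> (\<And>w. w \<in> V \<Longrightarrow> \<bar>real_of_int w\<bar> \<le> X) \<Longrightarrow>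
    (\<Sum>w\<in>V. (mh w)\<^sup>2) \<le> (mh 0)\<^sup>2 + E * X powr e"
    using energy_bound[OF e] by metis
  define ex where "ex = 4 * real l - 3 / 10"
  define C1 where "C1 = C0 * real (2 * L) powr ex"
  define C2 where "C2 = (mh 0)\<^sup>2 + E * real (2 * n * L) powr e"
  have C12: "C1 \<ge> 0" "C2 \<ge> 0" using C0(1) E(1) by (auto simp: C1_def C2_def)
  define C where "C = Ct ^ (2 * n) * (sqrt C1 * sqrt C2)"
  show ?thesis
  proof (rule exI[of _ C], intro allI impI conjI)
    fix N :: nat assume N: "N \<ge> 1"
    define Q :: "(('n \<Rightarrow> int) \<times> (nat \<Rightarrow> nat)) set" where "Q = fpairs (L * N) N"
    define c where "c p = (\<Prod>j\<in>UNIV. t N j (fst p j)) / of_nat N" for p :: "('n \<Rightarrow> int) \<times> (nat \<Rightarrow> nat)"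
    define b where "b = (Ct / real N) ^ n / real N"
    have b0: "b \<ge> 0" using Ct by (simp add: b_def)
    have cb: "cmod (c p) \<le> b" for p
    proof -
      have "cmod (\<Prod>j\<in>UNIV. t N j (fst p j)) \<le> (\<Prod>j\<in>(UNIV::'n set). Ct / real N)"
        unfolding prod_norm[symmetric] using t[OF N] by (intro prod_mono) auto
      then show ?thesis using N unfolding c_def b_def n_def by (simp add: norm_divide divide_right_mono)
    qed
    have fQ: "finite Q" unfolding Q_def by (rule finite_fpairs)
    note sm = second_moment_le[where u = "frq d", OF fQ cb b0]
    show "integrable M (\<lambda>\<alpha>. (cmod (\<Sum>p\<in>fpairs (L * N) N. ((\<Prod>j\<in>UNIV. t N j (fst p j)) / of_nat N) * ee (\<alpha> * of_int (frq d p))))\<^sup>2)"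
      using sm(1) unfolding Q_def c_def .
    define v where "v z = frq d (snd z) - frq d (fst z)" for z :: "(('n \<Rightarrow> int) \<times> (nat \<Rightarrow> nat)) \<times> (('n \<Rightarrow> int) \<times> (nat \<Rightarrow> nat))"
    have "(LINT \<alpha>|M. (cmod (\<Sum>p\<in>Q. c p * ee (\<alpha> * of_int (frq d p))))\<^sup>2) \<le> b\<^sup>2 * (\<Sum>z\<in>Q \<times> Q. mh (v z))"
      using sm(2) unfolding v_def .
    also have "\<dots> \<le> b\<^sup>2 * (sqrt (real (card {q. fst q \<in> Q \<times> Q \<and> snd q \<in> Q \<times> Q \<and> v (fst q) = v (snd q)})) * sqrt (\<Sum>w\<in>v ` (Q \<times> Q). (mh w)\<^sup>2))"
      using fQ by (intro mult_left_mono sum_le_additive_energy) auto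
    also have "\<dots> \<le> b\<^sup>2 * (sqrt (C1 * real N powr ex) * sqrt (C2 * real N powr (1 / 20)))"
    proof (intro mult_left_mono mult_mono real_sqrt_le_mono)
      have "1 * N \<le> 2 * (L * N)" using L by (simp add: mult_le_mono)
      then have "card {q. fst q \<in> Q \<times> Q \<and> snd q \<in> Q \<times> Q \<and> v (fst q) = v (snd q)} \<le> card (SB l d (int (2 * (L * N))))"
        using card_quadruples_le_SB[where 'n = 'n and N = N and K = "L * N" and d = d] unfolding Q_def v_def l_def n_def by simp
      then have "real (card {q. fst q \<in> Q \<times> Q \<and> snd q \<in> Q \<times> Q \<and> v (fst q) = v (snd q)}) \<le> real (card (SB l d (int (2 * (L * N)))))"
        by (rule of_nat_mono)
      also have "\<dots> \<le> C0 * real (2 * (L * N)) powr ex"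
      proof -
        have "2 * (L * N) \<ge> 1" using L N by (simp add: Suc_leI)
        then show ?thesis using C0(2) unfolding ex_def by blast
      qed
      also have "\<dots> = C1 * real N powr ex"
      proof -
        have "real (2 * (L * N)) = real (2 * L) * real N" by simp
        then show ?thesis by (simp only: powr_mult of_nat_0_le_iff C1_def mult.assoc)
      qed
      finally show "real (card {q. fst q \<in> Q \<times> Q \<and> snd q \<in> Q \<times> Q \<and> v (fst q) = v (snd q)}) \<le> C1 * real N powr ex" .
      define X where "X = real (2 * n * L) * real N ^ (d + 1)"
      have X1: "X \<ge> 1"
      proof -
        have "2 * n * L * N ^ (d + 1) \<ge> 1" using n1 L N by (simp add: Suc_leI)
        then have "real (2 * n * L * N ^ (d + 1)) \<ge> 1" by linarith
        then show ?thesis unfolding X_def by (simp only: of_nat_mult of_nat_power)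
      qed
      have "\<bar>real_of_int w\<bar> \<le> X" if "w \<in> v ` (Q \<times> Q)" for w
      proof -
        obtain p p' where p: "p \<in> Q" "p' \<in> Q" "w = frq d p' - frq d p" using \<open>w \<in> v ` (Q \<times> Q)\<close> by (auto simp: v_def)
        have "\<bar>w\<bar> \<le> int (n * (L * N) * N ^ d) + int (n * (L * N) * N ^ d)"
          using frq_bound[of p "L * N" N d] frq_bound[of p' "L * N" N d] p unfolding Q_def n_def by linarith
        also have "\<dots> = int (2 * n * L * N ^ (d + 1))" by simp
        finally have "real_of_int \<bar>w\<bar> \<le> real_of_int (int (2 * n * L * N ^ (d + 1)))" by (simp only: of_int_le_iff)
        then show ?thesis by (simp add: X_def)
      qed
      then have "(\<Sum>w\<in>v ` (Q \<times> Q). (mh w)\<^sup>2) \<le> (mh 0)\<^sup>2 + E * X powr e"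
        using fQ X1 by (intro E(2)) auto
      also have "X powr e = real (2 * n * L) powr e * real N powr (1 / 20)"
      proof -
        have "X powr e = real (2 * n * L) powr e * (real N ^ (d + 1)) powr e" unfolding X_def by (rule powr_mult)
        also have "(real N ^ (d + 1)) powr e = (real N powr real (d + 1)) powr e" using N powr_realpow[of "real N" "d + 1"] by (simp only: of_nat_0_less_iff)
        also have "\<dots> = real N powr (real (d + 1) * e)" by (rule powr_powr)
        also have "real (d + 1) * e = 1 / 20" by (simp add: e_def field_simps)
        finally show ?thesis .
      qed
      also have "(mh 0)\<^sup>2 + E * (real (2 * n * L) powr e * real N powr (1 / 20)) \<le> C2 * real N powr (1 / 20)"
      proof -
        have "1 \<le> real N powr (1 / 20)" using N by (intro ge_one_powr_ge_zero) auto
        then have "(mh 0)\<^sup>2 * 1 \<le> (mh 0)\<^sup>2 * real N powr (1 / 20)" by (intro mult_left_mono) auto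
        then show ?thesis by (simp add: C2_def distrib_right mult.assoc)
      qed
      finally show "(\<Sum>w\<in>v ` (Q \<times> Q). (mh w)\<^sup>2) \<le> C2 * real N powr (1 / 20)" .
    qed (use C12 in \<open>auto intro!: sum_nonneg mult_nonneg_nonneg\<close>)
    also have "\<dots> = C * real N powr (- 1 / 8)"
    proof -
      have N0: "real N > 0" using N by simp
      have sq: "sqrt (real N powr y) = real N powr (y / 2)" for y
      proof -
        have "real N powr y = (real N powr (y / 2))\<^sup>2" by (simp add: powr_power[symmetric] power2_eq_square powr_add[symmetric])
        then show ?thesis by simp
      qed
      have "b\<^sup>2 = Ct ^ (2 * n) * (real N powr (- real (2 * n + 2)))"
      proof -
        have "b = Ct ^ n / real N ^ (n + 1)" by (simp add: b_def power_divide)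
        then have "b\<^sup>2 = (Ct ^ n)\<^sup>2 / (real N ^ (n + 1))\<^sup>2" by (simp add: power_divide)
        also have "\<dots> = Ct ^ (2 * n) / real N ^ (2 * n + 2)"
          using power_even_eq[of Ct n] power_even_eq[of "real N" "n + 1"] by simp
        also have "real N ^ (2 * n + 2) = real N powr real (2 * n + 2)" using N0 by (rule powr_realpow[symmetric])
        finally show ?thesis by (simp only: powr_minus divide_inverse)
      qed
      then have "b\<^sup>2 * (sqrt (C1 * real N powr ex) * sqrt (C2 * real N powr (1 / 20)))
        = C * (real N powr (- real (2 * n + 2)) * (real N powr (ex / 2) * real N powr (1 / 20 / 2)))"
        unfolding real_sqrt_mult sq C_def by (simp only: mult_ac)
      also have "\<dots> = C * real N powr (- real (2 * n + 2) + (ex / 2 + 1 / 20 / 2))"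
        by (simp only: powr_add)
      \<comment> \<open>With \<open>l = n + 1\<close>, half of \<open>ex\<close> is
        \<open>2 * n + 2 - 3 / 20\<close>: the normalization cancels against the trivial solutions,
        and \<open>- 3 / 20 + 1 / 40 = - 1 / 8\<close> remains.\<close>
      also have "- real (2 * n + 2) + (ex / 2 + 1 / 20 / 2) = - 1 / 8" by (simp add: ex_def l_def field_simps)
      finally show ?thesis .
    qed
    finally show "(LINT \<alpha>|M. (cmod (\<Sum>p\<in>fpairs (L * N) N. ((\<Prod>j\<in>UNIV. t N j (fst p j)) / of_nat N) * ee (\<alpha> * of_int (frq d p))))\<^sup>2) \<le> C * real N powr (- 1 / 8)"
      unfolding Q_def c_def .
  qed
qed

lemma AE_tpol_correlation:
  fixes t :: "nat \<Rightarrow> 'n::finite \<Rightarrow> int \<Rightarrow> complex"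
  assumes d: "real d > (8 * real (CARD('n) + 1)) ^ (16 * (CARD('n) + 1))" and L: "L \<ge> 1"
    and t: "\<And>N j r. N \<ge> 1 \<Longrightarrow> cmod (t N j r) \<le> Ct / real N"
    and t0: "\<And>N j. N \<ge> 1 \<Longrightarrow> t N j 0 = of_real (\<tau> / real N)"
  shows "AE \<alpha> in M. (\<lambda>i. (\<Sum>n\<in>distinct_tuples (CARD('n) + 1) (Suc i ^ 16). \<Prod>j\<in>UNIV. tpol (L * Suc i ^ 16) (t (Suc i ^ 16) j) (gap d \<alpha> n j)) / of_nat (Suc i ^ 16))
      \<longlonglongrightarrow> complex_of_real (\<tau> ^ CARD('n))"
proof -
  define ns where "ns i = Suc i ^ 16" for i :: nat
  have ns: "ns i \<ge> 1" for i unfolding ns_def by (rule one_le_power) simp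
  define Er where "Er N \<alpha> = (\<Sum>p\<in>fpairs (L * N) N. ((\<Prod>j\<in>UNIV. t N j (fst p j)) / of_nat N) * ee (\<alpha> * of_int (frq d p)))" for N \<alpha>
  obtain C where "\<forall>N\<ge>1. integrable M (\<lambda>\<alpha>. (cmod (Er N \<alpha>))\<^sup>2) \<and> (LINT \<alpha>|M. (cmod (Er N \<alpha>))\<^sup>2) \<le> C * real N powr (- 1 / 8)"
    using variance_bound[where t = t, OF d L t, folded Er_def] by (rule exE)
  note C = this[rule_format, THEN conjunct1] this[rule_format, THEN conjunct2]
  have "AE \<alpha> in M. (\<lambda>i. (cmod (Er (ns i) \<alpha>))\<^sup>2) \<longlonglongrightarrow> 0"
  proof (rule AE_tendsto_zero_of_summable_integrals)
    show "integrable M (\<lambda>\<alpha>. (cmod (Er (ns i) \<alpha>))\<^sup>2)" for i using C(1) ns by blast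
    show "(LINT \<alpha>|M. (cmod (Er (ns i) \<alpha>))\<^sup>2) \<le> C * (1 / real (Suc i) ^ 2)" for i
    proof -
      have "real (ns i) powr (- 1 / 8) = (real (Suc i) powr 16) powr (- 1 / 8)"
        unfolding ns_def by (simp add: powr_numeral)
      also have "\<dots> = real (Suc i) powr (- 2)" unfolding powr_powr by simp
      also have "\<dots> = 1 / real (Suc i) ^ 2" by (simp add: powr_minus powr_numeral divide_inverse)
      finally show ?thesis using C(2)[OF ns[of i]] by simp
    qed
    show "summable (\<lambda>i. C * (1 / real (Suc i) ^ 2))"
      using inverse_power_summable[of 2, where 'a = real] summable_Suc_iff[of "\<lambda>i. inverse (real i ^ 2)"]
      by (intro summable_mult) (simp add: divide_inverse)
  qed simp
  then show ?thesis
  proof eventually_elim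
    case (elim \<alpha>)
    have "(\<lambda>i. sqrt ((cmod (Er (ns i) \<alpha>))\<^sup>2)) \<longlonglongrightarrow> sqrt 0" by (rule tendsto_real_sqrt[OF elim])
    then have E0: "(\<lambda>i. Er (ns i) \<alpha>) \<longlonglongrightarrow> 0" by (simp add: tendsto_norm_zero_iff)
    have nsl: "filterlim ns sequentially sequentially"
    proof (rule filterlim_at_top_mono[OF filterlim_Suc])
      show "\<forall>\<^sub>F i in sequentially. Suc i \<le> ns i"
        unfolding ns_def by (intro always_eventually allI self_le_power) auto
    qed
    have "(\<lambda>i. real (card (distinct_tuples (CARD('n) + 1) (ns i))) / real (ns i) ^ (CARD('n) + 1) * \<tau> ^ CARD('n)) \<longlonglongrightarrow> 1 * \<tau> ^ CARD('n)"
      by (intro tendsto_mult tendsto_const filterlim_compose[OF card_distinct_tuples_asymp nsl])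
    then have m: "(\<lambda>i. complex_of_real (real (card (distinct_tuples (CARD('n) + 1) (ns i))) / real (ns i) ^ (CARD('n) + 1) * \<tau> ^ CARD('n))) \<longlonglongrightarrow> complex_of_real (\<tau> ^ CARD('n))"
      by (intro tendsto_of_real) simp
    have "(\<Sum>n\<in>distinct_tuples (CARD('n) + 1) N. \<Prod>j\<in>UNIV. tpol (L * N) (t N j) (gap d \<alpha> n j)) / of_nat N
      = complex_of_real (real (card (distinct_tuples (CARD('n) + 1) N)) / real N ^ (CARD('n) + 1) * \<tau> ^ CARD('n)) + Er N \<alpha>" if N: "N \<ge> 1" for N
    proof -
      have "Er N \<alpha> = (\<Sum>p\<in>fpairs (L * N) N. (\<Prod>j\<in>UNIV. t N j (fst p j)) * ee (\<alpha> * of_int (frq d p))) / of_nat N"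
        unfolding Er_def sum_divide_distrib by simp
      moreover have "of_nat (card (distinct_tuples (CARD('n) + 1) N)) * (\<Prod>j\<in>(UNIV::'n set). t N j 0) / of_nat N
        = complex_of_real (real (card (distinct_tuples (CARD('n) + 1) N)) / real N ^ (CARD('n) + 1) * \<tau> ^ CARD('n))"
        using N by (simp add: t0 power_divide)
      ultimately show ?thesis unfolding tpol_correlation by (simp only: add_divide_distrib)
    qed
    then have "(\<Sum>n\<in>distinct_tuples (CARD('n) + 1) (ns i). \<Prod>j\<in>UNIV. tpol (L * ns i) (t (ns i) j) (gap d \<alpha> n j)) / of_nat (ns i)
      = complex_of_real (real (card (distinct_tuples (CARD('n) + 1) (ns i))) / real (ns i) ^ (CARD('n) + 1) * \<tau> ^ CARD('n)) + Er (ns i) \<alpha>" for i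
      using ns by blast
    then show ?case using tendsto_add[OF m E0] unfolding ns_def by simp
  qed
qed

end

section \<open>Poissonian correlations\<close>

text \<open>The Fourier coefficients of the Fejer kernel, equal to
  \<open>(P - \<bar>r\<bar>) / P\<^sup>2\<close> for \<open>\<bar>r\<bar> \<le> P\<close>. The form
  as a number of representations comes directly from squaring the Dirichlet sum.\<close>

definition fcf :: "nat \<Rightarrow> int \<Rightarrow> real" where
  "fcf P r = real (card {z \<in> {..<P} \<times> {..<P}. int (fst z) - int (snd z) = r}) / (real P)\<^sup>2"

lemma fcf_le: assumes "P > 0" shows "0 \<le> fcf P r" "fcf P r \<le> 1 / real P"
proof -
  have "card {z \<in> {..<P} \<times> {..<P}. int (fst z) - int (snd z) = r} \<le> card {..<P}"
    by (rule card_inj_on_le[where f = fst]) (auto simp: inj_on_def)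
  then have "fcf P r \<le> real P / (real P)\<^sup>2" unfolding fcf_def by (intro divide_right_mono) auto
  then show "fcf P r \<le> 1 / real P" using assms by (simp add: power2_eq_square)
  show "0 \<le> fcf P r" by (simp add: fcf_def)
qed

lemma fcf_0: assumes "P > 0" shows "fcf P 0 = 1 / real P"
proof -
  have "{z \<in> {..<P} \<times> {..<P}. int (fst z) - int (snd z) = 0} = (\<lambda>i. (i, i)) ` {..<P}" by auto
  then have "card {z \<in> {..<P} \<times> {..<P}. int (fst z) - int (snd z) = 0} = P"
    by (simp add: card_image inj_on_def)
  then show ?thesis using assms by (simp add: fcf_def power2_eq_square)
qed

lemma fej_tpol:
  assumes P: "P > 0"
  shows "complex_of_real (fej P (\<theta> - b)) = tpol P (\<lambda>r. of_real (fcf P r) * ee (- (of_int r * b))) \<theta>"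
proof -
  let ?Z = "{..<P} \<times> {..<P}" and ?v = "\<lambda>z::nat \<times> nat. int (fst z) - int (snd z)"
  have "complex_of_real ((cmod (dirich P (\<theta> - b)))\<^sup>2) = (\<Sum>z\<in>?Z. ee (of_int (?v z) * (\<theta> - b)))"
    unfolding dirich_norm_sq by (simp add: sum.cartesian_product case_prod_unfold)
  also have "\<dots> = (\<Sum>w\<in>?v ` ?Z. of_nat (card {z\<in>?Z. ?v z = w}) * ee (of_int w * (\<theta> - b)))"
    by (rule sum_image_card) simp
  also have "\<dots> = (\<Sum>w\<in>{- int P..int P}. of_nat (card {z\<in>?Z. ?v z = w}) * ee (of_int w * (\<theta> - b)))"
  proof (rule sum.mono_neutral_left)
    show "?v ` ?Z \<subseteq> {- int P..int P}" by auto
    show "\<forall>w\<in>{- int P..int P} - ?v ` ?Z. of_nat (card {z\<in>?Z. ?v z = w}) * ee (of_int w * (\<theta> - b)) = 0"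
    proof
      fix w assume w: "w \<in> {- int P..int P} - ?v ` ?Z"
      then have "{z\<in>?Z. ?v z = w} = {}" by blast
      then show "of_nat (card {z\<in>?Z. ?v z = w}) * ee (of_int w * (\<theta> - b)) = 0" by (simp only: card.empty of_nat_0 mult_zero_left)
    qed
  qed simp
  finally have "complex_of_real (fej P (\<theta> - b)) = (\<Sum>w\<in>{- int P..int P}. of_nat (card {z\<in>?Z. ?v z = w}) * ee (of_int w * (\<theta> - b))) / (of_nat P)\<^sup>2"
    unfolding fej_def by simp
  also have "\<dots> = tpol P (\<lambda>r. of_real (fcf P r) * ee (- (of_int r * b))) \<theta>"
    unfolding tpol_def sum_divide_distrib
  proof (intro sum.cong refl)
    fix w
    have "ee (of_int w * (\<theta> - b)) = ee (- (of_int w * b)) * ee (of_int w * \<theta>)"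
      unfolding ee_add[symmetric] by (simp add: algebra_simps)
    then show "of_nat (card {z\<in>?Z. ?v z = w}) * ee (of_int w * (\<theta> - b)) / (of_nat P)\<^sup>2
      = of_real (fcf P w) * ee (- (of_int w * b)) * ee (of_int w * \<theta>)"
      unfolding fcf_def by simp
  qed
  finally show ?thesis .
qed

definition Psi :: "nat \<Rightarrow> ('n::finite \<Rightarrow> int) \<Rightarrow> nat \<Rightarrow> ('n \<Rightarrow> real) \<Rightarrow> real" where
  "Psi M a N \<delta> = (\<Prod>j\<in>UNIV. fej (M * N) (\<delta> j - of_int (a j) / real (M * N)))"

definition Wprod :: "nat \<Rightarrow> ('n::finite \<Rightarrow> real) \<Rightarrow> real" where
  "Wprod N \<delta> = (\<Prod>j\<in>UNIV. wfej N (\<delta> j))"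

definition ctr :: "nat \<Rightarrow> real \<Rightarrow> nat \<Rightarrow> (('n::finite \<Rightarrow> real) \<Rightarrow> real) \<Rightarrow> real" where
  "ctr d \<alpha> N h = (\<Sum>n\<in>distinct_tuples (CARD('n) + 1) N. h (gap d \<alpha> n)) / real N"

text \<open>Countably many limits along one subsequence, so they hold simultaneously almost
  everywhere. The last limit is a power of 2 because \<open>wfej N\<close> is a sum of two kernels,
  each with constant term \<open>1 / N\<close>.\<close>

definition poisson_good :: "nat \<Rightarrow> real \<Rightarrow> 'n::finite itself \<Rightarrow> bool" where
  "poisson_good d \<alpha> _ \<longleftrightarrow>
    (\<forall>M. \<forall>a :: 'n \<Rightarrow> int. M \<ge> 1 \<longrightarrow> (\<lambda>i. ctr d \<alpha> (Suc i ^ 16) (Psi M a (Suc i ^ 16))) \<longlonglongrightarrow> (1 / real M) ^ CARD('n)) \<and>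
    (\<lambda>i. ctr d \<alpha> (Suc i ^ 16) (Wprod (Suc i ^ 16) :: ('n \<Rightarrow> real) \<Rightarrow> real)) \<longlonglongrightarrow> 2 ^ CARD('n)"

lemma (in energy_measure) AE_poisson_good:
  assumes d: "real d > (8 * real (CARD('n::finite) + 1)) ^ (16 * (CARD('n) + 1))"
  shows "AE \<alpha> in M. poisson_good d \<alpha> TYPE('n)"
proof -
  have psi: "AE \<alpha> in M. (\<lambda>i. ctr d \<alpha> (Suc i ^ 16) (Psi m a (Suc i ^ 16))) \<longlonglongrightarrow> (1 / real m) ^ CARD('n)" if m: "m \<ge> 1" for m and a :: "'n \<Rightarrow> int"
  proof -
    define t where "t N j r = complex_of_real (fcf (m * N) r) * ee (- (of_int r * (of_int (a j) / real (m * N))))" for N j r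
    have P: "m * N > 0" if "N \<ge> 1" for N using m that by simp
    have "AE \<alpha> in M. (\<lambda>i. (\<Sum>n\<in>distinct_tuples (CARD('n) + 1) (Suc i ^ 16). \<Prod>j\<in>UNIV. tpol (m * Suc i ^ 16) (t (Suc i ^ 16) j) (gap d \<alpha> n j)) / of_nat (Suc i ^ 16))
      \<longlonglongrightarrow> complex_of_real ((1 / real m) ^ CARD('n))"
    proof (rule AE_tpol_correlation[OF d m, where Ct = 1])
      fix N :: nat and j :: 'n assume N: "N \<ge> 1"
      show "t N j 0 = of_real ((1 / real m) / real N)" using fcf_0[OF P[OF N]] by (simp add: t_def)
      fix r
      have "cmod (t N j r) \<le> 1 / real (m * N)" using fcf_le[OF P[OF N], of r] by (simp add: t_def norm_mult)
      also have "\<dots> \<le> 1 / real N" using m N by (intro divide_left_mono) auto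
      finally show "cmod (t N j r) \<le> 1 / real N" .
    qed
    then show ?thesis
    proof eventually_elim
      case (elim \<alpha>)
      have "(\<Prod>j\<in>UNIV. tpol (m * N) (t N j) (gap d \<alpha> n j)) = complex_of_real (Psi m a N (gap d \<alpha> n))" if "N \<ge> 1" for N n
        unfolding t_def Psi_def of_real_prod using fej_tpol[OF P[OF that]] by simp
      then have eqN: "(\<Sum>n\<in>distinct_tuples (CARD('n) + 1) N. \<Prod>j\<in>UNIV. tpol (m * N) (t N j) (gap d \<alpha> n j)) / of_nat N
         = complex_of_real (ctr d \<alpha> N (Psi m a N))" if "N \<ge> 1" for N
        using that by (simp add: ctr_def)
      have one: "1 \<le> Suc i ^ 16" for i by (rule one_le_power) simp
      have "(\<lambda>i. complex_of_real (ctr d \<alpha> (Suc i ^ 16) (Psi m a (Suc i ^ 16)))) \<longlonglongrightarrow> complex_of_real ((1 / real m) ^ CARD('n))"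
        using elim unfolding eqN[OF one] .
      then show ?case by (simp only: tendsto_of_real_iff)
    qed
  qed
  have wt: "AE \<alpha> in M. (\<lambda>i. ctr d \<alpha> (Suc i ^ 16) (Wprod (Suc i ^ 16) :: ('n \<Rightarrow> real) \<Rightarrow> real)) \<longlonglongrightarrow> 2 ^ CARD('n)"
  proof -
    define t :: "nat \<Rightarrow> 'n \<Rightarrow> int \<Rightarrow> complex" where
      "t N j r = complex_of_real (fcf N r) * ee (- (of_int r * 0)) + complex_of_real (fcf N r) * ee (- (of_int r * (1 / (2 * real N))))" for N j r
    have P: "N > 0" if "N \<ge> 1" for N :: nat using that by simp
    have "AE \<alpha> in M. (\<lambda>i. (\<Sum>n\<in>distinct_tuples (CARD('n) + 1) (Suc i ^ 16). \<Prod>j\<in>UNIV. tpol (1 * Suc i ^ 16) (t (Suc i ^ 16) j) (gap d \<alpha> n j)) / of_nat (Suc i ^ 16))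
      \<longlonglongrightarrow> complex_of_real (2 ^ CARD('n))"
    proof (rule AE_tpol_correlation[OF d order_refl, where Ct = 2])
      fix N :: nat and j :: 'n assume N: "N \<ge> 1"
      show "t N j 0 = of_real (2 / real N)" using fcf_0[OF P[OF N]] by (simp add: t_def)
      fix r
      have "cmod (t N j r) \<le> cmod (complex_of_real (fcf N r) * ee (- (of_int r * 0))) + cmod (complex_of_real (fcf N r) * ee (- (of_int r * (1 / (2 * real N)))))"
        unfolding t_def by (rule norm_triangle_ineq)
      also have "\<dots> = fcf N r + fcf N r" using fcf_le(1)[OF P[OF N], of r] by (simp add: norm_mult)
      also have "\<dots> \<le> 2 / real N" using fcf_le(2)[OF P[OF N], of r] by simp
      finally show "cmod (t N j r) \<le> 2 / real N" .
    qed
    then show ?thesis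
    proof eventually_elim
      case (elim \<alpha>)
      have tp: "tpol N (t N j) \<theta> = complex_of_real (wfej N \<theta>)" if "N \<ge> 1" for N \<theta> j
      proof -
        have "tpol N (t N j) \<theta> = tpol N (\<lambda>r. complex_of_real (fcf N r) * ee (- (of_int r * 0))) \<theta>
          + tpol N (\<lambda>r. complex_of_real (fcf N r) * ee (- (of_int r * (1 / (2 * real N))))) \<theta>"
          unfolding tpol_def t_def distrib_right sum.distrib ..
        then show ?thesis unfolding fej_tpol[OF P[OF that], symmetric] by (simp add: wfej_def)
      qed
      have eqN: "(\<Sum>n\<in>distinct_tuples (CARD('n) + 1) N. \<Prod>j\<in>UNIV. tpol (1 * N) (t N j) (gap d \<alpha> n j)) / of_nat N
         = complex_of_real (ctr d \<alpha> N (Wprod N :: ('n \<Rightarrow> real) \<Rightarrow> real))" if "N \<ge> 1" for N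
        using tp[OF that] by (simp add: ctr_def Wprod_def)
      have one: "1 \<le> Suc i ^ 16" for i by (rule one_le_power) simp
      have "(\<lambda>i. complex_of_real (ctr d \<alpha> (Suc i ^ 16) (Wprod (Suc i ^ 16) :: ('n \<Rightarrow> real) \<Rightarrow> real))) \<longlonglongrightarrow> complex_of_real (2 ^ CARD('n))"
        using elim unfolding eqN[OF one] .
      then show ?case by (simp only: tendsto_of_real_iff)
    qed
  qed
  have "AE \<alpha> in M. \<forall>m. \<forall>a :: 'n \<Rightarrow> int. m \<ge> 1 \<longrightarrow> (\<lambda>i. ctr d \<alpha> (Suc i ^ 16) (Psi m a (Suc i ^ 16))) \<longlonglongrightarrow> (1 / real m) ^ CARD('n)"
    unfolding AE_all_countable
  proof (intro allI)
    fix m :: nat and a :: "'n \<Rightarrow> int"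
    show "AE \<alpha> in M. m \<ge> 1 \<longrightarrow> (\<lambda>i. ctr d \<alpha> (Suc i ^ 16) (Psi m a (Suc i ^ 16))) \<longlonglongrightarrow> (1 / real m) ^ CARD('n)"
      using psi[of m a] by (cases "m \<ge> 1") auto
  qed
  with wt show ?thesis unfolding poisson_good_def by eventually_elim blast
qed

section \<open>From trigonometric polynomials on a subsequence to test functions and all
  \<open>N\<close>\<close>

definition cgap :: "nat \<Rightarrow> real \<Rightarrow> (nat \<Rightarrow> nat) \<Rightarrow> 'n::finite \<Rightarrow> real" where
  "cgap d \<alpha> n j = gap d \<alpha> n j - of_int (round (gap d \<alpha> n j))"

lemma cgap_le: "\<bar>cgap d \<alpha> n j\<bar> \<le> 1 / 2"
  using of_int_round_abs_le[of "gap d \<alpha> n j"] by (simp add: cgap_def abs_minus_commute)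

lemma Psi_cgap: "Psi M a N (cgap d \<alpha> n :: 'n::finite \<Rightarrow> real) = Psi M a N (gap d \<alpha> n)"
proof -
  have "fej P (cgap d \<alpha> n j - b) = fej P (gap d \<alpha> n j - b)" for P b and j :: 'n
    using fej_periodic[of P "gap d \<alpha> n j - b" "- round (gap d \<alpha> n j)"] by (simp add: cgap_def algebra_simps)
  then show ?thesis by (simp add: Psi_def)
qed

lemma Wprod_cgap: "Wprod N (cgap d \<alpha> n :: 'n::finite \<Rightarrow> real) = Wprod N (gap d \<alpha> n :: 'n \<Rightarrow> real)"
proof -
  have "wfej N (cgap d \<alpha> n j) = wfej N (gap d \<alpha> n j)" for j :: 'n
    using wfej_periodic[of N "gap d \<alpha> n j" "- round (gap d \<alpha> n j)"] by (simp add: cgap_def algebra_simps)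
  then show ?thesis by (simp add: Wprod_def)
qed

text \<open>For \<open>N > 2 * R\<close> a nonzero summand forces every shifted gap to be less than
  \<open>1 / 2\<close> in absolute value. So only the shift by the nearest integers can contribute,
  and the infinite sum has one term.\<close>

lemma corr_eq:
  fixes f :: "real^'n \<Rightarrow> real"
  assumes supp: "\<And>x. f x \<noteq> 0 \<Longrightarrow> \<forall>j. \<bar>x $ j\<bar> \<le> real R" and N: "N > 2 * R"
  shows "corr d \<alpha> N f = (\<Sum>n\<in>distinct_tuples (CARD('n) + 1) N. f (\<chi> j. real N * cgap d \<alpha> n j)) / real N"
proof -
  have "(\<Sum>\<^sub>\<infinity>k::int^'n. f (\<chi> j. real N * (xseq d \<alpha> (n (idx j)) - xseq d \<alpha> (n (idx j + 1)) + of_int (k $ j))))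
    = f (\<chi> j. real N * cgap d \<alpha> n j)" for n
  proof -
    define F where "F k = f (\<chi> j. real N * (gap d \<alpha> n j + of_int (k $ j)))" for k :: "int^'n"
    define k0 :: "int^'n" where "k0 = (\<chi> j. - round (gap d \<alpha> n j))"
    have F0: "F k = 0" if "k \<noteq> k0" for k
    proof (rule ccontr)
      assume "F k \<noteq> 0"
      then have b: "\<bar>real N * (gap d \<alpha> n j + of_int (k $ j))\<bar> \<le> real R" for j
        using supp[of "\<chi> j. real N * (gap d \<alpha> n j + of_int (k $ j))"] by (simp add: F_def)
      have "k $ j = k0 $ j" for j
      proof -
        have "real N * \<bar>gap d \<alpha> n j + of_int (k $ j)\<bar> \<le> real R" using b[of j] by (simp add: abs_mult)
        also have "real R < real N * (1 / 2)" using N by simp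
        finally have "\<bar>gap d \<alpha> n j + of_int (k $ j)\<bar> < 1 / 2" using N by (simp only: mult_less_cancel_left_pos of_nat_0_less_iff) 
        then have "gap d \<alpha> n j - 1 / 2 < of_int (- (k $ j))" "of_int (- (k $ j)) \<le> gap d \<alpha> n j + 1 / 2"
          unfolding of_int_minus by linarith+
        then have "round (gap d \<alpha> n j) = - (k $ j)" by (rule round_unique)
        then show ?thesis by (simp add: k0_def)
      qed
      then have "k = k0" by (simp add: vec_eq_iff)
      then show False using that by simp
    qed
    have "infsum F UNIV = infsum F {k0}"
      by (rule infsum_cong_neutral) (auto simp: F0)
    also have "\<dots> = F k0" by simp
    finally have "infsum F UNIV = F k0" .
    then show ?thesis unfolding F_def gap_def k0_def cgap_def by simp
  qed
  then show ?thesis unfolding corr_def by simp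
qed

text \<open>For nonnegative \<open>f\<close> the sum over tuples increases with the range of the
  tuples, so it lies between the sums over the two neighbouring 16th powers. In these the argument
  still carries the factor \<open>N\<close>, which is a factor \<open>\<kappa>\<close> near 1 times
  the 16th power; this is the freedom provided by \<open>fejer_approx\<close>.\<close>

lemma corr_tendsto_nonneg:
  fixes f :: "real^'n \<Rightarrow> real"
  assumes good: "poisson_good d \<alpha> TYPE('n)" and cont: "continuous_on UNIV f" and f0: "\<And>x. f x \<ge> 0"
    and R: "R \<ge> 1" and supp: "\<And>x. f x \<noteq> 0 \<Longrightarrow> \<forall>j. \<bar>x $ j\<bar> \<le> real R"
  shows "(\<lambda>N. corr d \<alpha> N f) \<longlonglongrightarrow> integral UNIV f"
proof (rule tendstoI)
  fix e :: real assume e: "e > 0"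
  let ?n = "CARD('n)"
  \<comment> \<open>The majorants average to \<open>2 ^ CARD('n)\<close>. Of the three further
    multiples of \<open>\<epsilon>\<close> one is for the Riemann sum, one for the convergence along
    the subsequence, and one is spare.\<close>
  define \<epsilon> where "\<epsilon> = e / (2 ^ ?n + 3)"
  have n2: "(2::real) ^ ?n + 3 > 0" by (rule add_nonneg_pos) auto
  have \<epsilon>: "\<epsilon> > 0" using e n2 by (simp add: \<epsilon>_def)
  have "\<epsilon> * (2 ^ ?n + 3) = e" using n2 by (simp add: \<epsilon>_def)
  then have \<epsilon>e: "\<epsilon> * 2 ^ ?n + 3 * \<epsilon> = e" by (simp add: algebra_simps)
  obtain \<rho> M0 where \<rho>: "\<rho> > 0" and M0: "M0 \<ge> 1" and approx:
    "\<And>M N \<kappa> \<delta>. M \<ge> M0 \<Longrightarrow> N \<ge> 8 * R \<Longrightarrow> \<bar>\<kappa> - 1\<bar> \<le> \<rho> \<Longrightarrow> (\<And>j. \<bar>\<delta> j\<bar> \<le> 1 / 2) \<Longrightarrow>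
      \<bar>f (\<chi> j. \<kappa> * (real N * \<delta> j)) - (\<Sum>a\<in>{a. \<forall>j. a j \<in> {- int (R * M)..int (R * M)}}.
          f (\<chi> j. of_int (a j) / real M) * (\<Prod>j\<in>UNIV. fej (M * N) (\<delta> j - of_int (a j) / real (M * N))))\<bar>
      \<le> \<epsilon> * (\<Prod>j\<in>UNIV. wfej N (\<delta> j))"
  proof (rule fejer_approx[OF cont R supp \<epsilon>])
    fix \<rho> M0
    assume "\<rho> > 0" "M0 \<ge> 1" "\<And>M N \<kappa> \<delta>. M \<ge> M0 \<Longrightarrow> N \<ge> 8 * R \<Longrightarrow> \<bar>\<kappa> - 1\<bar> \<le> \<rho> \<Longrightarrow> (\<And>j. \<bar>\<delta> j\<bar> \<le> 1 / 2) \<Longrightarrow>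
      \<bar>f (\<chi> j. \<kappa> * (real N * \<delta> j)) - (\<Sum>a\<in>{a. \<forall>j. a j \<in> {- int (R * M)..int (R * M)}}.
          f (\<chi> j. of_int (a j) / real M) * (\<Prod>j\<in>UNIV. fej (M * N) (\<delta> j - of_int (a j) / real (M * N))))\<bar>
      \<le> \<epsilon> * (\<Prod>j\<in>UNIV. wfej N (\<delta> j))"
    then show thesis by (rule that)
  qed
  have "\<forall>\<^sub>F M in sequentially. dist ((\<Sum>a\<in>{a. \<forall>j. a j \<in> {- int (R * M)..int (R * M)}}. f (\<chi> j. of_int (a j) / real M)) * (1 / real M) ^ ?n) (integral UNIV f) < \<epsilon>"
    by (rule tendstoD[OF riemann_sum_lattice(1)[OF cont supp] \<epsilon>])
  then obtain M1 where M1: "\<And>M. M \<ge> M1 \<Longrightarrow> dist ((\<Sum>a\<in>{a. \<forall>j. a j \<in> {- int (R * M)..int (R * M)}}. f (\<chi> j. of_int (a j) / real M)) * (1 / real M) ^ ?n) (integral UNIV f) < \<epsilon>"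
    unfolding eventually_sequentially by auto
  define M where "M = max M0 M1"
  have M: "M \<ge> 1" "M \<ge> M0" "M \<ge> M1" using M0 by (auto simp: M_def)
  define Box :: "('n \<Rightarrow> int) set" where "Box = {a. \<forall>j. a j \<in> {- int (R * M)..int (R * M)}}"
  define \<phi> where "\<phi> a = f (\<chi> j. of_int (a j) / real M)" for a
  define Rm where "Rm = (\<Sum>a\<in>Box. \<phi> a) * (1 / real M) ^ ?n"
  have Rm: "\<bar>Rm - integral UNIV f\<bar> < \<epsilon>" using M1[OF M(3)] unfolding Rm_def Box_def \<phi>_def dist_real_def .
  define A where "A N \<delta> = (\<Sum>a\<in>Box. \<phi> a * Psi M a N \<delta>)" for N \<delta>
  have ap: "\<bar>f (\<chi> j. \<kappa> * (real N * cgap d \<alpha> n j)) - A N (gap d \<alpha> n)\<bar> \<le> \<epsilon> * Wprod N (gap d \<alpha> n :: 'n \<Rightarrow> real)"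
    if "N \<ge> 8 * R" "\<bar>\<kappa> - 1\<bar> \<le> \<rho>" for N \<kappa> n
    using approx[OF M(2) that, of "cgap d \<alpha> n"] cgap_le unfolding A_def Box_def \<phi>_def Psi_cgap[symmetric] Wprod_cgap[symmetric]
    unfolding Psi_def Wprod_def by blast
  define ns where "ns i = Suc i ^ 16" for i :: nat
  have ns1: "ns i \<ge> 1" for i unfolding ns_def by (rule one_le_power) simp
  have nsm: "ns i \<le> ns k" if "i \<le> k" for i k unfolding ns_def using that by (intro power_mono) auto
  have nsS: "ns i \<ge> Suc i" for i unfolding ns_def by (rule self_le_power) auto
  have cA: "ctr d \<alpha> N (A N) = (\<Sum>a\<in>Box. \<phi> a * ctr d \<alpha> N (Psi M a N))" for N
    unfolding ctr_def A_def by (subst sum.swap) (simp add: sum_distrib_left sum_divide_distrib)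
  have limA: "(\<lambda>i. ctr d \<alpha> (ns i) (A (ns i))) \<longlonglongrightarrow> Rm"
  proof -
    have "(\<lambda>i. ctr d \<alpha> (ns i) (Psi M a (ns i))) \<longlonglongrightarrow> (1 / real M) ^ ?n" for a :: "'n \<Rightarrow> int"
      using good M(1) unfolding poisson_good_def ns_def by blast
    then have "(\<lambda>i. \<Sum>a\<in>Box. \<phi> a * ctr d \<alpha> (ns i) (Psi M a (ns i))) \<longlonglongrightarrow> (\<Sum>a\<in>Box. \<phi> a * (1 / real M) ^ ?n)"
      by (intro tendsto_sum tendsto_mult tendsto_const)
    then show ?thesis unfolding cA Rm_def sum_distrib_right .
  qed
  have limW: "(\<lambda>i. ctr d \<alpha> (ns i) (Wprod (ns i) :: ('n \<Rightarrow> real) \<Rightarrow> real)) \<longlonglongrightarrow> 2 ^ ?n"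
    using good unfolding poisson_good_def ns_def by blast
  define U where "U i = ctr d \<alpha> (ns i) (A (ns i)) + \<epsilon> * ctr d \<alpha> (ns i) (Wprod (ns i) :: ('n \<Rightarrow> real) \<Rightarrow> real)" for i
  define V where "V i = ctr d \<alpha> (ns i) (A (ns i)) - \<epsilon> * ctr d \<alpha> (ns i) (Wprod (ns i) :: ('n \<Rightarrow> real) \<Rightarrow> real)" for i
  have limU: "U \<longlonglongrightarrow> Rm + \<epsilon> * 2 ^ ?n" unfolding U_def by (intro tendsto_intros limA limW)
  have limV: "V \<longlonglongrightarrow> Rm - \<epsilon> * 2 ^ ?n" unfolding V_def by (intro tendsto_intros limA limW)
  have sumU: "(\<Sum>n\<in>distinct_tuples (?n + 1) (ns i). A (ns i) (gap d \<alpha> n) + \<epsilon> * Wprod (ns i) (gap d \<alpha> n :: 'n \<Rightarrow> real)) = real (ns i) * U i"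
    and sumV: "(\<Sum>n\<in>distinct_tuples (?n + 1) (ns i). A (ns i) (gap d \<alpha> n) - \<epsilon> * Wprod (ns i) (gap d \<alpha> n :: 'n \<Rightarrow> real)) = real (ns i) * V i" for i
    using ns1[of i] unfolding U_def V_def ctr_def sum.distrib sum_subtractf sum_distrib_left[symmetric]
    by (simp_all add: field_simps)
  define iN where "iN N = (LEAST i. N < ns (Suc i))" for N
  have iN1: "N < ns (Suc (iN N))" for N unfolding iN_def
    by (rule LeastI[of _ N]) (use nsS[of "Suc N"] in simp)
  have iN0: "ns (iN N) \<le> N" if "N \<ge> 1" for N
  proof (cases "iN N")
    case 0 then show ?thesis using that by (simp add: ns_def)
  next
    case (Suc k)
    then have "\<not> N < ns (Suc k)" using not_less_Least[of k "\<lambda>i. N < ns (Suc i)"] by (simp add: iN_def)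
    then show ?thesis using Suc by simp
  qed
  have iNlim: "filterlim iN sequentially sequentially"
    unfolding filterlim_at_top
  proof
    fix k
    show "\<forall>\<^sub>F N in sequentially. k \<le> iN N"
      using eventually_ge_at_top[of "ns k"]
    proof eventually_elim
      case (elim N)
      show ?case
      proof (rule ccontr)
        assume "\<not> k \<le> iN N"
        then have "ns (Suc (iN N)) \<le> ns k" by (intro nsm) simp
        then show False using iN1[of N] elim by simp
      qed
    qed
  qed
  \<comment> \<open>The quotient of consecutive 16th powers tends to 1; this is why limits along so
    sparse a subsequence determine the full limit.\<close>
  define rr where "rr i = real (ns (Suc i)) / real (ns i)" for i
  have rrlim: "rr \<longlonglongrightarrow> 1"
  proof -
    have "(\<lambda>i. (1 + 1 / real (Suc i)) ^ 16) \<longlonglongrightarrow> (1 + 0) ^ 16"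
      by (intro tendsto_intros LIMSEQ_Suc[OF lim_1_over_n])
    moreover have "rr = (\<lambda>i. (1 + 1 / real (Suc i)) ^ 16)"
    proof (rule ext)
      fix i
      have "1 + 1 / real (Suc i) = real (Suc (Suc i)) / real (Suc i)" by (simp add: field_simps)
      then show "rr i = (1 + 1 / real (Suc i)) ^ 16" unfolding rr_def ns_def of_nat_power by (simp only: power_divide)
    qed
    ultimately show ?thesis by (simp only: add_0_right power_one)
  qed
  have rrN: "(\<lambda>N. rr (iN N)) \<longlonglongrightarrow> 1" by (rule filterlim_compose[OF rrlim iNlim])
  define q0 where "q0 N = real N / real (ns (iN N))" for N
  define q1 where "q1 N = real (ns (Suc (iN N))) / real N" for N
  have q0b: "1 \<le> q0 N" "q0 N \<le> rr (iN N)" and q1b: "1 \<le> q1 N" "q1 N \<le> rr (iN N)" if N: "N \<ge> 1" for N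
  proof -
    have p: "real (ns (iN N)) > 0" using ns1[of "iN N"] by simp
    have a: "real (ns (iN N)) \<le> real N" using iN0[OF N] by simp
    have b: "real N \<le> real (ns (Suc (iN N)))" using iN1[of N] by simp
    show "1 \<le> q0 N" using p a by (simp add: q0_def)
    show "q0 N \<le> rr (iN N)" unfolding q0_def rr_def using b by (intro divide_right_mono) auto
    show "1 \<le> q1 N" using N b by (simp add: q1_def)
    show "q1 N \<le> rr (iN N)" unfolding q1_def rr_def using p a by (intro divide_left_mono mult_pos_pos) auto
  qed
  have q0l: "q0 \<longlonglongrightarrow> 1"
  proof (rule real_tendsto_sandwich[OF _ _ tendsto_const rrN])
    show "\<forall>\<^sub>F N in sequentially. 1 \<le> q0 N" by (rule eventually_sequentiallyI[of 1]) (rule q0b)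
    show "\<forall>\<^sub>F N in sequentially. q0 N \<le> rr (iN N)" by (rule eventually_sequentiallyI[of 1]) (rule q0b)
  qed
  have q1l: "q1 \<longlonglongrightarrow> 1"
  proof (rule real_tendsto_sandwich[OF _ _ tendsto_const rrN])
    show "\<forall>\<^sub>F N in sequentially. 1 \<le> q1 N" by (rule eventually_sequentiallyI[of 1]) (rule q1b)
    show "\<forall>\<^sub>F N in sequentially. q1 N \<le> rr (iN N)" by (rule eventually_sequentiallyI[of 1]) (rule q1b)
  qed
  have Up: "(\<lambda>N. q1 N * U (Suc (iN N))) \<longlonglongrightarrow> 1 * (Rm + \<epsilon> * 2 ^ ?n)"
    by (intro tendsto_mult q1l filterlim_compose[OF LIMSEQ_Suc[OF limU] iNlim])
  have Lo: "(\<lambda>N. inverse (q0 N) * V (iN N)) \<longlonglongrightarrow> inverse 1 * (Rm - \<epsilon> * 2 ^ ?n)"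
    by (intro tendsto_mult tendsto_inverse q0l filterlim_compose[OF limV iNlim]) simp
  have iq1l: "(\<lambda>N. inverse (q1 N)) \<longlonglongrightarrow> inverse 1" by (intro tendsto_inverse q1l) simp
  have E1: "\<forall>\<^sub>F N in sequentially. dist (q1 N * U (Suc (iN N))) (1 * (Rm + \<epsilon> * 2 ^ ?n)) < \<epsilon>" by (rule tendstoD[OF Up \<epsilon>])
  have E2: "\<forall>\<^sub>F N in sequentially. dist (inverse (q0 N) * V (iN N)) (inverse 1 * (Rm - \<epsilon> * 2 ^ ?n)) < \<epsilon>" by (rule tendstoD[OF Lo \<epsilon>])
  have E3: "\<forall>\<^sub>F N in sequentially. dist (q0 N) 1 < \<rho>" by (rule tendstoD[OF q0l \<rho>])
  have E4: "\<forall>\<^sub>F N in sequentially. dist (inverse (q1 N)) (inverse 1) < \<rho>" by (rule tendstoD[OF iq1l \<rho>])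
  have E5: "\<forall>\<^sub>F N in sequentially. ns (8 * R) \<le> N" by (rule eventually_ge_at_top)
  from E1 E2 E3 E4 E5 show "\<forall>\<^sub>F N in sequentially. dist (corr d \<alpha> N f) (integral UNIV f) < e"
  proof eventually_elim
    case (elim N)
    have N1: "N \<ge> 1" using elim(5) ns1[of "8 * R"] by linarith
    have k: "8 * R \<le> iN N"
    proof (rule ccontr)
      assume "\<not> 8 * R \<le> iN N"
      then have "ns (Suc (iN N)) \<le> ns (8 * R)" by (intro nsm) simp
      then show False using iN1[of N] elim(5) by simp
    qed
    have big0: "ns (iN N) \<ge> 8 * R" using k nsS[of "iN N"] by linarith
    have big1: "ns (Suc (iN N)) \<ge> 8 * R" using k nsS[of "Suc (iN N)"] by linarith
    have NR: "N > 2 * R" using iN0[OF N1] big0 R by linarith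
    have N0: "real N > 0" using N1 by simp
    define D where "D K = distinct_tuples (?n + 1) K" for K
    define Y where "Y n = f (\<chi> j. real N * cgap d \<alpha> n j)" for n
    have c: "corr d \<alpha> N f = (\<Sum>n\<in>D N. Y n) / real N" unfolding D_def Y_def by (rule corr_eq[OF supp NR])
    have "(\<Sum>n\<in>D N. Y n) \<le> (\<Sum>n\<in>D (ns (Suc (iN N))). Y n)"
      unfolding D_def Y_def using iN1[of N] f0 by (intro sum_mono2 finite_distinct_tuples distinct_tuples_mono) auto
    also have "\<dots> \<le> (\<Sum>n\<in>D (ns (Suc (iN N))). A (ns (Suc (iN N))) (gap d \<alpha> n) + \<epsilon> * Wprod (ns (Suc (iN N))) (gap d \<alpha> n :: 'n \<Rightarrow> real))"
    proof (rule sum_mono)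
      fix n
      have \<kappa>: "\<bar>inverse (q1 N) - 1\<bar> \<le> \<rho>" using elim(4) by (simp add: dist_real_def)
      have eqx: "inverse (q1 N) * (real (ns (Suc (iN N))) * x) = real N * x" for x
        using ns1[of "Suc (iN N)"] by (simp add: q1_def)
      have "\<bar>Y n - A (ns (Suc (iN N))) (gap d \<alpha> n)\<bar> \<le> \<epsilon> * Wprod (ns (Suc (iN N))) (gap d \<alpha> n :: 'n \<Rightarrow> real)"
        using ap[OF big1 \<kappa>, of n] unfolding Y_def eqx .
      then show "Y n \<le> A (ns (Suc (iN N))) (gap d \<alpha> n) + \<epsilon> * Wprod (ns (Suc (iN N))) (gap d \<alpha> n :: 'n \<Rightarrow> real)" by linarith
    qed
    also have "\<dots> = real (ns (Suc (iN N))) * U (Suc (iN N))" unfolding D_def by (rule sumU)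
    finally have "corr d \<alpha> N f \<le> real (ns (Suc (iN N))) * U (Suc (iN N)) / real N"
      unfolding c by (rule divide_right_mono) simp
    then have hi: "corr d \<alpha> N f \<le> q1 N * U (Suc (iN N))" by (simp add: q1_def)
    have "real (ns (iN N)) * V (iN N) = (\<Sum>n\<in>D (ns (iN N)). A (ns (iN N)) (gap d \<alpha> n) - \<epsilon> * Wprod (ns (iN N)) (gap d \<alpha> n :: 'n \<Rightarrow> real))"
      unfolding D_def by (rule sumV[symmetric])
    also have "\<dots> \<le> (\<Sum>n\<in>D (ns (iN N)). Y n)"
    proof (rule sum_mono)
      fix n
      have \<kappa>: "\<bar>q0 N - 1\<bar> \<le> \<rho>" using elim(3) by (simp add: dist_real_def)
      have eqx: "q0 N * (real (ns (iN N)) * x) = real N * x" for x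
        using ns1[of "iN N"] by (simp add: q0_def)
      have "\<bar>Y n - A (ns (iN N)) (gap d \<alpha> n)\<bar> \<le> \<epsilon> * Wprod (ns (iN N)) (gap d \<alpha> n :: 'n \<Rightarrow> real)"
        using ap[OF big0 \<kappa>, of n] unfolding Y_def eqx .
      then show "A (ns (iN N)) (gap d \<alpha> n) - \<epsilon> * Wprod (ns (iN N)) (gap d \<alpha> n :: 'n \<Rightarrow> real) \<le> Y n" by linarith
    qed
    also have "\<dots> \<le> (\<Sum>n\<in>D N. Y n)"
      unfolding D_def Y_def using iN0[OF N1] f0 by (intro sum_mono2 finite_distinct_tuples distinct_tuples_mono) auto
    finally have "real (ns (iN N)) * V (iN N) / real N \<le> corr d \<alpha> N f"
      unfolding c by (rule divide_right_mono) simp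
    then have lo: "inverse (q0 N) * V (iN N) \<le> corr d \<alpha> N f" by (simp add: q0_def)
    have "q1 N * U (Suc (iN N)) < Rm + \<epsilon> * 2 ^ ?n + \<epsilon>" using elim(1) by (simp add: dist_real_def abs_less_iff)
    moreover have "inverse (q0 N) * V (iN N) > Rm - \<epsilon> * 2 ^ ?n - \<epsilon>" using elim(2) by (simp add: dist_real_def abs_less_iff)
    ultimately have "\<bar>corr d \<alpha> N f - integral UNIV f\<bar> < \<epsilon> * 2 ^ ?n + 3 * \<epsilon>" using hi lo Rm \<epsilon> by linarith
    then show ?case unfolding \<epsilon>e dist_real_def .
  qed
qed

text \<open>The positive and negative parts of \<open>f\<close> are continuous with the same bound
  on the support, as the nonnegative case asks. For large \<open>N\<close> the correlation is a
  finite sum and therefore additive in \<open>f\<close>.\<close>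

lemma corr_tendsto:
  fixes f :: "real^'n \<Rightarrow> real"
  assumes good: "poisson_good d \<alpha> TYPE('n)" and cont: "continuous_on UNIV f"
    and R: "R \<ge> 1" and supp: "\<And>x. f x \<noteq> 0 \<Longrightarrow> \<forall>j. \<bar>x $ j\<bar> \<le> real R"
  shows "(\<lambda>N. corr d \<alpha> N f) \<longlonglongrightarrow> integral UNIV f"
proof -
  define g where "g x = max (f x) 0" for x
  define h where "h x = max (- f x) 0" for x
  have c: "continuous_on UNIV g" "continuous_on UNIV h" unfolding g_def h_def by (intro continuous_intros cont)+
  have s: "\<forall>j. \<bar>x $ j\<bar> \<le> real R" if "g x \<noteq> 0 \<or> h x \<noteq> 0" for x
    using that by (intro supp) (auto simp: g_def h_def)
  have sg: "\<And>x. g x \<noteq> 0 \<Longrightarrow> \<forall>j. \<bar>x $ j\<bar> \<le> real R" and sh: "\<And>x. h x \<noteq> 0 \<Longrightarrow> \<forall>j. \<bar>x $ j\<bar> \<le> real R" using s by blast+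
  have fgh: "f x = g x - h x" for x by (auto simp: g_def h_def max_def)
  have "(\<lambda>N. corr d \<alpha> N g - corr d \<alpha> N h) \<longlonglongrightarrow> integral UNIV g - integral UNIV h"
    by (intro tendsto_diff corr_tendsto_nonneg[OF good _ _ R] c sg sh) (auto simp: g_def h_def)
  moreover have "integral UNIV g - integral UNIV h = integral UNIV f"
    using integral_diff[OF riemann_sum_lattice(2)[OF c(1) sg] riemann_sum_lattice(2)[OF c(2) sh]] by (simp add: fgh[symmetric])
  moreover have "\<forall>\<^sub>F N in sequentially. corr d \<alpha> N g - corr d \<alpha> N h = corr d \<alpha> N f"
    using eventually_gt_at_top[of "2 * R"]
  proof eventually_elim
    case (elim N)
    define S where "S u = (\<Sum>n\<in>distinct_tuples (CARD('n) + 1) N. u (\<chi> j. real N * cgap d \<alpha> n j)) / real N" for u :: "real^'n \<Rightarrow> real"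
    have "corr d \<alpha> N g = S g" unfolding S_def by (rule corr_eq[OF sg elim])
    moreover have "corr d \<alpha> N h = S h" unfolding S_def by (rule corr_eq[OF sh elim])
    moreover have "corr d \<alpha> N f = S f" unfolding S_def by (rule corr_eq[OF supp elim])
    moreover have "S f = S g - S h" by (simp add: S_def fgh sum_subtractf diff_divide_distrib)
    ultimately show ?case by simp
  qed
  ultimately show ?thesis using Lim_transform_eventually by force
qed

lemma poisson_good_imp:
  assumes "poisson_good d \<alpha> TYPE('n::finite)"
  shows "poissonian_corr d \<alpha> TYPE('n)"
  unfolding poissonian_corr_def
proof (intro allI impI)
  fix f :: "real^'n \<Rightarrow> real" assume f: "Cc_infty f"
  have "Ck 0 f" using f unfolding Cc_infty_def smooth_fun_def by blast
  then have cont: "continuous_on UNIV f" by simp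
  have "bounded (closure {x. f x \<noteq> 0})" using f unfolding Cc_infty_def by (blast intro: compact_imp_bounded)
  then obtain B where B: "\<And>x. x \<in> closure {x. f x \<noteq> 0} \<Longrightarrow> norm x \<le> B" unfolding bounded_iff by blast
  obtain R where R: "real R \<ge> B" using real_arch_simple by blast
  show "(\<lambda>N. corr d \<alpha> N f) \<longlonglongrightarrow> integral UNIV f"
  proof (rule corr_tendsto[OF assms cont, of "Suc R"])
    fix x assume "f x \<noteq> 0"
    then have xB: "norm x \<le> B" using closure_subset[of "{x. f x \<noteq> 0}"] by (intro B) auto
    show "\<forall>j. \<bar>x $ j\<bar> \<le> real (Suc R)"
    proof
      fix j
      show "\<bar>x $ j\<bar> \<le> real (Suc R)" using R xB component_le_norm_cart[of x j] by simp
    qed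
  qed simp
qed

theorem theorem1p3:
  fixes M :: "real measure" and d :: nat
  defines "l \<equiv> CARD('n::finite) + 1"
  assumes "real d > (8 * real l) ^ (16 * l)"
    and "sets M = sets borel" and "finite_measure M"
    and "emeasure M (- {0..1}) = 0"
    and "\<And>s::real. 0 < s \<Longrightarrow> s < 1 \<Longrightarrow>
           (\<lambda>u::int. (cmod (fourier_meas M (of_int u)))\<^sup>2 * \<bar>real_of_int u\<bar> powr (s - 1))
             summable_on (UNIV - {0})"
  shows "AE \<alpha> in M. poissonian_corr d \<alpha> TYPE('n)"
proof -
  interpret energy_measure M using assms(3-6) by (rule energy_measure.intro)
  have "AE \<alpha> in M. poisson_good d \<alpha> TYPE('n)" using assms(2) unfolding l_def by (rule AE_poisson_good)
  then show ?thesis by eventually_elim (rule poisson_good_imp)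
qed

end
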